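(* Let $\mathcal{A}$ be an essentially small additive category, $K$ an algebraically closed field, and $S$ a functor in $\mathcal{F}(\mathcal{A};K)$. Assume that the abelian groups $\mathcal{A}(x,y)$ are finite for all objects $x$ and $y$ of $\mathcal{A}$. Then $S$ is simple if and only if there exists, for every prime number $p$, a simple functor $S_p$ in $\mathcal{F}({}_{(p)}\mathcal{A};K)$, with all but finitely many of the $S_p$ equal to the constant functor $K$, such that $$S\simeq\bigotimes_p\pi_p^*S_p$$ (the tensor product being indexed by the set of prime numbers $p$). Moreover, in such a tensor decomposition the $S_p$ are uniquely determined up to isomorphism.
   Context: $\mathcal{F}(\mathcal{C};K)$ denotes the category of functors from $\mathcal{C}$ to $K$-vector spaces. For a finite abelian group $V$ and a prime $p$, ${}_{(p)}V$ is the $p$-primary component of $V$. The category ${}_{(p)}\mathcal{A}$ has the same objects as $\mathcal{A}$, and morphism groups $({}_{(p)}\mathcal{A})(x,y)={}_{(p)}(\mathcal{A}(x,y))$, with composition induced by that of $\mathcal{A}$ (identities being the $p$-primary components of the identities). The functor $\pi_p:\mathcal{A}\to{}_{(p)}\mathcal{A}$ is the identity on objects and sends a morphism to its $p$-primary component; $\pi_p^*S_p=S_p\circ\pi_p$. Tensor products are over $K$ and pointwise; by convention all factors of an infinite tensor product are equal to $K$ except finitely many. *)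

theory Defs
  imports "HOL-Algebra.Algebra"
begin

section \<open>Additive categories\<close>

text \<open>
  Hom-sets need not be disjoint, so composition and identities carry their objects:
  \<open>Cmp A x y z g f\<close> is the composite of \<open>f : x \<rightarrow> y\<close> and \<open>g : y \<rightarrow> z\<close>. The abelian groups
  \<open>Hom A x y\<close> are written multiplicatively, as everywhere in \<^theory>\<open>HOL-Algebra.Group\<close>; in
  particular \<open>\<one>\<^bsub>Hom A x y\<^esub>\<close> is the zero morphism. The objects form a set, i.e. the categories
  are small; an essentially small category is meant up to equivalence.
\<close>

record ('o, 'm) preadditive_data =
  Ob :: "'o set"
  Hom :: "'o \<Rightarrow> 'o \<Rightarrow> 'm monoid"
  Cmp :: "'o \<Rightarrow> 'o \<Rightarrow> 'o \<Rightarrow> 'm \<Rightarrow> 'm \<Rightarrow> 'm"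
  Idn :: "'o \<Rightarrow> 'm"

abbreviation Mor :: "('o, 'm) preadditive_data \<Rightarrow> 'o \<Rightarrow> 'o \<Rightarrow> 'm set" where
  "Mor A x y \<equiv> carrier (Hom A x y)"

locale preadditive_category =
  fixes A :: "('o, 'm) preadditive_data"
  assumes Hom_comm_group: "\<lbrakk>x \<in> Ob A; y \<in> Ob A\<rbrakk> \<Longrightarrow> comm_group (Hom A x y)"
    and Cmp_closed: "\<lbrakk>x \<in> Ob A; y \<in> Ob A; z \<in> Ob A; f \<in> Mor A x y; g \<in> Mor A y z\<rbrakk>
      \<Longrightarrow> Cmp A x y z g f \<in> Mor A x z"
    and Cmp_assoc: "\<lbrakk>w \<in> Ob A; x \<in> Ob A; y \<in> Ob A; z \<in> Ob A;
        f \<in> Mor A w x; g \<in> Mor A x y; h \<in> Mor A y z\<rbrakk>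
      \<Longrightarrow> Cmp A w x z (Cmp A x y z h g) f = Cmp A w y z h (Cmp A w x y g f)"
    and Idn_closed: "x \<in> Ob A \<Longrightarrow> Idn A x \<in> Mor A x x"
    and Cmp_Idn_left: "\<lbrakk>x \<in> Ob A; y \<in> Ob A; f \<in> Mor A x y\<rbrakk> \<Longrightarrow> Cmp A x y y (Idn A y) f = f"
    and Cmp_Idn_right: "\<lbrakk>x \<in> Ob A; y \<in> Ob A; f \<in> Mor A x y\<rbrakk> \<Longrightarrow> Cmp A x x y f (Idn A x) = f"
    and Cmp_add_left: "\<lbrakk>x \<in> Ob A; y \<in> Ob A; z \<in> Ob A;
        f \<in> Mor A x y; g \<in> Mor A y z; h \<in> Mor A y z\<rbrakk>
      \<Longrightarrow> Cmp A x y z (g \<otimes>\<^bsub>Hom A y z\<^esub> h) f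
        = Cmp A x y z g f \<otimes>\<^bsub>Hom A x z\<^esub> Cmp A x y z h f"
    and Cmp_add_right: "\<lbrakk>x \<in> Ob A; y \<in> Ob A; z \<in> Ob A;
        f \<in> Mor A x y; g \<in> Mor A x y; h \<in> Mor A y z\<rbrakk>
      \<Longrightarrow> Cmp A x y z h (f \<otimes>\<^bsub>Hom A x y\<^esub> g)
        = Cmp A x y z h f \<otimes>\<^bsub>Hom A x z\<^esub> Cmp A x y z h g"

definition is_zero_object :: "('o, 'm) preadditive_data \<Rightarrow> 'o \<Rightarrow> bool" where
  "is_zero_object A z \<longleftrightarrow> z \<in> Ob A \<and>
    (\<forall>x\<in>Ob A. (\<exists>f. Mor A x z = {f}) \<and> (\<exists>f. Mor A z x = {f}))"

definition is_biproduct ::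
    "('o, 'm) preadditive_data \<Rightarrow> 'o \<Rightarrow> 'o \<Rightarrow> 'o \<Rightarrow> 'm \<Rightarrow> 'm \<Rightarrow> 'm \<Rightarrow> 'm \<Rightarrow> bool" where
  "is_biproduct A x y s i j p q \<longleftrightarrow> s \<in> Ob A \<and>
    i \<in> Mor A x s \<and> j \<in> Mor A y s \<and> p \<in> Mor A s x \<and> q \<in> Mor A s y \<and>
    Cmp A x s x p i = Idn A x \<and> Cmp A y s y q j = Idn A y \<and>
    Cmp A y s x p j = \<one>\<^bsub>Hom A y x\<^esub> \<and> Cmp A x s y q i = \<one>\<^bsub>Hom A x y\<^esub> \<and>
    Cmp A s x s i p \<otimes>\<^bsub>Hom A s s\<^esub> Cmp A s y s j q = Idn A s"

locale additive_category = preadditive_category +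
  assumes ex_zero_object: "\<exists>z. is_zero_object A z"
    and ex_biproduct: "\<lbrakk>x \<in> Ob A; y \<in> Ob A\<rbrakk> \<Longrightarrow> \<exists>s i j p q. is_biproduct A x y s i j p q"


section \<open>Functors to vector spaces\<close>

text \<open>
  A vector space over the field \<open>K\<close> is a \<open>K\<close>-module in the sense of
  \<^theory>\<open>HOL-Algebra.Module\<close>; the fields \<open>mult\<close> and \<open>one\<close> of the module record play no role.
  The maps \<open>farr F x y f\<close> are only relevant on the carrier of \<open>fobj F x\<close>.
\<close>

definition linear_map :: "'k ring \<Rightarrow> ('k, 'v) module \<Rightarrow> ('k, 'w) module \<Rightarrow> ('v \<Rightarrow> 'w) \<Rightarrow> bool" where
  "linear_map K V W h \<longleftrightarrow> h \<in> carrier V \<rightarrow> carrier W \<and>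
    (\<forall>v\<in>carrier V. \<forall>w\<in>carrier V. h (v \<oplus>\<^bsub>V\<^esub> w) = h v \<oplus>\<^bsub>W\<^esub> h w) \<and>
    (\<forall>a\<in>carrier K. \<forall>v\<in>carrier V. h (a \<odot>\<^bsub>V\<^esub> v) = a \<odot>\<^bsub>W\<^esub> h v)"

record ('o, 'm, 'k, 'v) vect_functor_data =
  fobj :: "'o \<Rightarrow> ('k, 'v) module"
  farr :: "'o \<Rightarrow> 'o \<Rightarrow> 'm \<Rightarrow> 'v \<Rightarrow> 'v"

text \<open>Functors are not required to be additive.\<close>

locale vect_functor =
  fixes A :: "('o, 'm) preadditive_data" and K :: "'k ring"
    and F :: "('o, 'm, 'k, 'v) vect_functor_data"
  assumes fobj_module: "x \<in> Ob A \<Longrightarrow> module K (fobj F x)"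
    and farr_linear: "\<lbrakk>x \<in> Ob A; y \<in> Ob A; f \<in> Mor A x y\<rbrakk>
      \<Longrightarrow> linear_map K (fobj F x) (fobj F y) (farr F x y f)"
    and farr_Idn: "\<lbrakk>x \<in> Ob A; v \<in> carrier (fobj F x)\<rbrakk> \<Longrightarrow> farr F x x (Idn A x) v = v"
    and farr_Cmp: "\<lbrakk>x \<in> Ob A; y \<in> Ob A; z \<in> Ob A; f \<in> Mor A x y; g \<in> Mor A y z;
        v \<in> carrier (fobj F x)\<rbrakk>
      \<Longrightarrow> farr F x z (Cmp A x y z g f) v = farr F y z g (farr F x y f v)"

definition functor_iso ::
    "('o, 'm) preadditive_data \<Rightarrow> 'k ring \<Rightarrow> ('o, 'm, 'k, 'v) vect_functor_data
      \<Rightarrow> ('o, 'm, 'k, 'w) vect_functor_data \<Rightarrow> bool" where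
  "functor_iso A K F G \<longleftrightarrow> (\<exists>\<eta> :: 'o \<Rightarrow> 'v \<Rightarrow> 'w.
    (\<forall>x\<in>Ob A. linear_map K (fobj F x) (fobj G x) (\<eta> x) \<and>
       bij_betw (\<eta> x) (carrier (fobj F x)) (carrier (fobj G x))) \<and>
    (\<forall>x\<in>Ob A. \<forall>y\<in>Ob A. \<forall>f\<in>Mor A x y. \<forall>v\<in>carrier (fobj F x).
       \<eta> y (farr F x y f v) = farr G x y f (\<eta> x v)))"

definition is_subfunctor ::
    "('o, 'm) preadditive_data \<Rightarrow> 'k ring \<Rightarrow> ('o \<Rightarrow> 'v set)
      \<Rightarrow> ('o, 'm, 'k, 'v) vect_functor_data \<Rightarrow> bool" where
  "is_subfunctor A K T F \<longleftrightarrow> (\<forall>x\<in>Ob A. submodule (T x) K (fobj F x)) \<and>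
    (\<forall>x\<in>Ob A. \<forall>y\<in>Ob A. \<forall>f\<in>Mor A x y. farr F x y f ` T x \<subseteq> T y)"

definition simple_functor ::
    "('o, 'm) preadditive_data \<Rightarrow> 'k ring \<Rightarrow> ('o, 'm, 'k, 'v) vect_functor_data \<Rightarrow> bool" where
  "simple_functor A K F \<longleftrightarrow> vect_functor A K F \<and>
    (\<exists>x\<in>Ob A. carrier (fobj F x) \<noteq> {\<zero>\<^bsub>fobj F x\<^esub>}) \<and>
    (\<forall>T. is_subfunctor A K T F \<longrightarrow>
       (\<forall>x\<in>Ob A. T x = {\<zero>\<^bsub>fobj F x\<^esub>}) \<or> (\<forall>x\<in>Ob A. T x = carrier (fobj F x)))"

definition field_module :: "'k ring \<Rightarrow> ('k, 'k) module" where
  "field_module K = \<lparr>carrier = carrier K, monoid.mult = monoid.mult K, monoid.one = monoid.one K,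
     ring.zero = ring.zero K, ring.add = ring.add K, module.smult = monoid.mult K\<rparr>"

definition const_functor :: "'k ring \<Rightarrow> ('o, 'm, 'k, 'k) vect_functor_data" where
  "const_functor K = \<lparr>fobj = (\<lambda>x. field_module K), farr = (\<lambda>x y f v. v)\<rparr>"

record ('o, 'm, 'q, 'n) functor_data =
  on_obj :: "'o \<Rightarrow> 'q"
  on_arr :: "'o \<Rightarrow> 'o \<Rightarrow> 'm \<Rightarrow> 'n"

definition precompose ::
    "('o, 'm, 'q, 'n) functor_data \<Rightarrow> ('q, 'n, 'k, 'v) vect_functor_data
      \<Rightarrow> ('o, 'm, 'k, 'v) vect_functor_data" where
  "precompose P F = \<lparr>fobj = (\<lambda>x. fobj F (on_obj P x)),
     farr = (\<lambda>x y f. farr F (on_obj P x) (on_obj P y) (on_arr P x y f))\<rparr>"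


section \<open>Primary components\<close>

definition primary_part :: "nat \<Rightarrow> 'a monoid \<Rightarrow> 'a set" where
  "primary_part p G = {v \<in> carrier G. \<exists>n::nat. v [^]\<^bsub>G\<^esub> (p ^ n) = \<one>\<^bsub>G\<^esub>}"

text \<open>
  The projection of a finite abelian group onto its \<open>p\<close>-primary part along the sum of the
  primary parts for the other primes.
\<close>

definition primary_component :: "nat \<Rightarrow> 'a monoid \<Rightarrow> 'a \<Rightarrow> 'a" where
  "primary_component p G v = (THE u. u \<in> primary_part p G \<and>
     (\<exists>w \<in> generate G (\<Union>q\<in>{q. Factorial_Ring.prime q \<and> q \<noteq> p}. primary_part q G). v = u \<otimes>\<^bsub>G\<^esub> w))"

definition primary_category :: "nat \<Rightarrow> ('o, 'm) preadditive_data \<Rightarrow> ('o, 'm) preadditive_data" where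
  "primary_category p A = \<lparr>Ob = Ob A,
     Hom = (\<lambda>x y. (Hom A x y)\<lparr>carrier := primary_part p (Hom A x y)\<rparr>),
     Cmp = Cmp A,
     Idn = (\<lambda>x. primary_component p (Hom A x x) (Idn A x))\<rparr>"

definition primary_projection :: "nat \<Rightarrow> ('o, 'm) preadditive_data \<Rightarrow> ('o, 'm, 'o, 'm) functor_data" where
  "primary_projection p A = \<lparr>on_obj = (\<lambda>x. x),
     on_arr = (\<lambda>x y f. primary_component p (Hom A x y) f)\<rparr>"


section \<open>Tensor products of families of vector spaces\<close>

text \<open>
  The tensor product of \<open>V i\<close>, \<open>i \<in> I\<close>, is the free vector space on the product of the sets
  \<open>carrier (V i)\<close> modulo the multilinearity relations. Elements of the free vector space on \<open>B\<close>
  are finitely supported functions vanishing outside \<open>B\<close>.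
\<close>

definition free_module :: "'k ring \<Rightarrow> 'b set \<Rightarrow> ('k, 'b \<Rightarrow> 'k) module" where
  "free_module K B = \<lparr>carrier = {c. (\<forall>b. c b \<in> carrier K) \<and>
       finite {b. c b \<noteq> \<zero>\<^bsub>K\<^esub>} \<and> {b. c b \<noteq> \<zero>\<^bsub>K\<^esub>} \<subseteq> B},
     monoid.mult = undefined, monoid.one = undefined,
     ring.zero = (\<lambda>b. \<zero>\<^bsub>K\<^esub>), ring.add = (\<lambda>c d b. c b \<oplus>\<^bsub>K\<^esub> d b),
     module.smult = (\<lambda>a c b. a \<otimes>\<^bsub>K\<^esub> c b)\<rparr>"

definition free_gen :: "'k ring \<Rightarrow> 'b \<Rightarrow> 'b \<Rightarrow> 'k" where
  "free_gen K b = (\<lambda>b'. if b' = b then \<one>\<^bsub>K\<^esub> else \<zero>\<^bsub>K\<^esub>)"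

text \<open>The linear extension of a map \<open>h\<close> between bases.\<close>

definition free_map :: "'k ring \<Rightarrow> ('b \<Rightarrow> 'c) \<Rightarrow> ('b \<Rightarrow> 'k) \<Rightarrow> 'c \<Rightarrow> 'k" where
  "free_map K h c = (\<lambda>b'. \<Oplus>\<^bsub>K\<^esub>b \<in> {b. c b \<noteq> \<zero>\<^bsub>K\<^esub> \<and> h b = b'}. c b)"

definition submodule_span :: "'k ring \<Rightarrow> ('k, 'v) module \<Rightarrow> 'v set \<Rightarrow> 'v set" where
  "submodule_span K M E = \<Inter>{N. submodule N K M \<and> E \<subseteq> N}"

text \<open>
  In the next two definitions the sets under the union all coincide when \<open>Q\<close> is a coset; the union
  only avoids the choice of a representative.
\<close>

definition quotient_module :: "('k, 'v) module \<Rightarrow> 'v set \<Rightarrow> ('k, 'v set) module" where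
  "quotient_module M N = \<lparr>carrier = a_rcosets\<^bsub>M\<^esub> N,
     monoid.mult = undefined, monoid.one = undefined,
     ring.zero = N, ring.add = set_add M,
     module.smult = (\<lambda>a Q. \<Union>v\<in>Q. N +>\<^bsub>M\<^esub> (a \<odot>\<^bsub>M\<^esub> v))\<rparr>"

definition quotient_map :: "('k, 'w) module \<Rightarrow> 'w set \<Rightarrow> ('v \<Rightarrow> 'w) \<Rightarrow> 'v set \<Rightarrow> 'w set" where
  "quotient_map M N h Q = (\<Union>v\<in>Q. N +>\<^bsub>M\<^esub> h v)"

definition product_set :: "'i set \<Rightarrow> ('i \<Rightarrow> ('k, 'v) module) \<Rightarrow> ('i \<Rightarrow> 'v) set" where
  "product_set I V = (\<Pi>\<^sub>E i\<in>I. carrier (V i))"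

definition multilinear_relations ::
    "'k ring \<Rightarrow> 'i set \<Rightarrow> ('i \<Rightarrow> ('k, 'v) module) \<Rightarrow> (('i \<Rightarrow> 'v) \<Rightarrow> 'k) set" where
  "multilinear_relations K I V = (let M = free_module K (product_set I V) in
     {free_gen K (b(i := v \<oplus>\<^bsub>V i\<^esub> w))
        \<ominus>\<^bsub>M\<^esub> (free_gen K (b(i := v)) \<oplus>\<^bsub>M\<^esub> free_gen K (b(i := w))) | b i v w.
        b \<in> product_set I V \<and> i \<in> I \<and> v \<in> carrier (V i) \<and> w \<in> carrier (V i)} \<union>
     {free_gen K (b(i := a \<odot>\<^bsub>V i\<^esub> v)) \<ominus>\<^bsub>M\<^esub> (a \<odot>\<^bsub>M\<^esub> free_gen K (b(i := v))) | b i a v.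
        b \<in> product_set I V \<and> i \<in> I \<and> a \<in> carrier K \<and> v \<in> carrier (V i)})"

definition tensor_kernel ::
    "'k ring \<Rightarrow> 'i set \<Rightarrow> ('i \<Rightarrow> ('k, 'v) module) \<Rightarrow> (('i \<Rightarrow> 'v) \<Rightarrow> 'k) set" where
  "tensor_kernel K I V =
     submodule_span K (free_module K (product_set I V)) (multilinear_relations K I V)"

definition tensor_module ::
    "'k ring \<Rightarrow> 'i set \<Rightarrow> ('i \<Rightarrow> ('k, 'v) module) \<Rightarrow> ('k, (('i \<Rightarrow> 'v) \<Rightarrow> 'k) set) module" where
  "tensor_module K I V = quotient_module (free_module K (product_set I V)) (tensor_kernel K I V)"

text \<open>The map induced by linear maps \<open>h i\<close> from \<open>V i\<close> to \<open>W i\<close>; the source \<open>V\<close> does not enter.\<close>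

definition tensor_map ::
    "'k ring \<Rightarrow> 'i set \<Rightarrow> ('i \<Rightarrow> ('k, 'w) module) \<Rightarrow> ('i \<Rightarrow> 'v \<Rightarrow> 'w)
      \<Rightarrow> (('i \<Rightarrow> 'v) \<Rightarrow> 'k) set \<Rightarrow> (('i \<Rightarrow> 'w) \<Rightarrow> 'k) set" where
  "tensor_map K I W h =
     quotient_map (free_module K (product_set I W)) (tensor_kernel K I W)
       (free_map K (\<lambda>b. \<lambda>i\<in>I. h i (b i)))"

definition tensor_functor ::
    "'k ring \<Rightarrow> 'i set \<Rightarrow> ('i \<Rightarrow> ('o, 'm, 'k, 'v) vect_functor_data)
      \<Rightarrow> ('o, 'm, 'k, (('i \<Rightarrow> 'v) \<Rightarrow> 'k) set) vect_functor_data" where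
  "tensor_functor K I F = \<lparr>fobj = (\<lambda>x. tensor_module K I (\<lambda>i. fobj (F i) x)),
     farr = (\<lambda>x y f. tensor_map K I (\<lambda>i. fobj (F i) y) (\<lambda>i. farr (F i) x y f))\<rparr>"


section \<open>Primary tensor decompositions\<close>

definition nonconstant_primes ::
    "('o, 'm) preadditive_data \<Rightarrow> 'k ring \<Rightarrow> (nat \<Rightarrow> ('o, 'm, 'k, 'v) vect_functor_data) \<Rightarrow> nat set" where
  "nonconstant_primes A K S =
     {p. Factorial_Ring.prime p \<and> \<not> functor_iso (primary_category p A) K (S p) (const_functor K)}"

text \<open>
  The tensor product over all primes \<open>p\<close> of the functors \<open>S p\<close> precomposed with the \<open>p\<close>-th
  projection, when almost all \<open>S p\<close> are the constant functor \<open>K\<close>: these are neutral for the tensor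
  product over \<open>K\<close> and are omitted, leaving a finite tensor product. Being the constant functor is
  understood up to isomorphism, because the underlying sets of the spaces \<open>fobj (S p) x\<close> lie in an
  arbitrary type \<open>'v\<close>.
\<close>

definition prime_tensor ::
    "('o, 'm) preadditive_data \<Rightarrow> 'k ring \<Rightarrow> (nat \<Rightarrow> ('o, 'm, 'k, 'v) vect_functor_data)
      \<Rightarrow> ('o, 'm, 'k, ((nat \<Rightarrow> 'v) \<Rightarrow> 'k) set) vect_functor_data" where
  "prime_tensor A K S = tensor_functor K (nonconstant_primes A K S)
     (\<lambda>p. precompose (primary_projection p A) (S p))"

definition primary_tensor_decomposition ::
    "('o, 'm) preadditive_data \<Rightarrow> 'k ring \<Rightarrow> ('o, 'm, 'k, 'u) vect_functor_data
      \<Rightarrow> (nat \<Rightarrow> ('o, 'm, 'k, 'v) vect_functor_data) \<Rightarrow> bool" where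
  "primary_tensor_decomposition A K F S \<longleftrightarrow>
     (\<forall>p. Factorial_Ring.prime p \<longrightarrow> simple_functor (primary_category p A) K (S p)) \<and>
     finite (nonconstant_primes A K S) \<and>
     functor_iso A K F (prime_tensor A K S)"

end

theory Submission
  imports Defs "HOL-Number_Theory.Cong"
begin

text \<open>
  Composition respects the decomposition of the finite groups of morphisms into primary components,
  so for each object \<open>x\<close> the multiplicative monoid \<open>End x\<close> is the product of its \<open>p\<close>-primary parts, and
  the monoid algebra \<open>K[End x]\<close> is the tensor product of the monoid algebras of these parts. Over an
  algebraically closed field the simple modules over a tensor product of finite-dimensional algebras
  are the tensor products of simple modules over the factors, in a unique way; and a simple functor is
  determined by its value at any one object where it does not vanish. The theorem is the combination
  of these two facts. Biproducts provide an object at which finitely many given functors are all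
  non-zero, and room to extend a module over the \<open>p\<close>-primary part of \<open>End x\<close> to a functor.

  Algebras are replaced by sets of operators: \<open>ops A K F x y\<close> consists of the linear combinations of
  the maps \<open>F x \<rightarrow> F y\<close> induced by morphisms. Schur's lemma (\<open>schur\<close>) and Jacobson's density argument
  (\<open>density\<close>) show that for simple \<open>F\<close> these contain all maps of rank one (\<open>burnside\<close>). This makes
  a tensor product of simple functors simple (\<open>T_simple\<close>): a product of functionals is
  non-zero on a given non-zero tensor \<open>t\<close>, and the tensor product of the maps of rank one built from
  these functionals takes \<open>t\<close> to an arbitrary pure tensor.

  Isomorphisms of simple functors come from Goursat's lemma (\<open>goursat_iso\<close>): a subfunctor of
  \<open>F \<times> G\<close> generated by a pair of vectors is the graph of an isomorphism as soon as it is proper, and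
  this can be tested at a single object (\<open>simple_iso_of_generators\<close>).

  For uniqueness (\<open>factor_iso\<close>), \<open>S p\<close> embeds into the tensor product by means of pure vectors
  at the other primes, and the tensor product is projected to \<open>S' p\<close> by means of functionals at the
  other primes. For existence, some \<open>u\<close> in \<open>S x\<close> generates a simple module over the \<open>p\<close>-primary part
  of \<open>End x\<close> for all primes \<open>p\<close> simultaneously (\<open>ex_irreducible_vector\<close>); this module extends to a
  simple functor on the \<open>p\<close>-primary category (\<open>factor_simple\<close>); and the matrix coefficient of \<open>S\<close>
  at \<open>u\<close> is the product of the matrix coefficients of these functors (\<open>ex_projection_all\<close>), which by
  Goursat's lemma identifies \<open>S\<close> with their tensor product.
\<close>

section \<open>Linear algebra with lists of vectors\<close>

text \<open>
  Lists of vectors suffice for the linear algebra below: linear independence occurs only as a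
  condition \<open>v \<notin> lspan K V vs\<close> in inductions on \<open>vs\<close>.
\<close>

primrec lspan :: "'k ring \<Rightarrow> ('k, 'v) module \<Rightarrow> 'v list \<Rightarrow> 'v set" where
  "lspan K V [] = {\<zero>\<^bsub>V\<^esub>}"
| "lspan K V (v # vs) = {a \<odot>\<^bsub>V\<^esub> v \<oplus>\<^bsub>V\<^esub> s | a s. a \<in> carrier K \<and> s \<in> lspan K V vs}"

locale vspace = K?: field K + V?: module K V
  for K :: "'k ring" and V :: "('k, 'v) module"
begin

lemma submodule_closedI:
  assumes "N \<subseteq> carrier V" "\<zero>\<^bsub>V\<^esub> \<in> N"
    and "\<And>a b. a \<in> N \<Longrightarrow> b \<in> N \<Longrightarrow> a \<oplus>\<^bsub>V\<^esub> b \<in> N"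
    and "\<And>c a. c \<in> carrier K \<Longrightarrow> a \<in> N \<Longrightarrow> c \<odot>\<^bsub>V\<^esub> a \<in> N"
  shows "submodule N K V"
proof (rule submoduleI)
  fix a assume "a \<in> N"
  then have "\<ominus>\<^bsub>V\<^esub> a = (\<ominus>\<^bsub>K\<^esub> \<one>\<^bsub>K\<^esub>) \<odot>\<^bsub>V\<^esub> a" using assms(1) smult_l_minus[of "\<one>\<^bsub>K\<^esub>" a] by auto
  then show "\<ominus>\<^bsub>V\<^esub> a \<in> N" using assms(4) \<open>a \<in> N\<close> by simp
qed (use assms in auto)

lemma submodule_zero: "submodule N K V \<Longrightarrow> \<zero>\<^bsub>V\<^esub> \<in> N"
  using submodule.axioms(1) subgroup.one_closed by fastforce

lemma inv_nonzero:
  assumes "a \<in> carrier K" "a \<noteq> \<zero>\<^bsub>K\<^esub>"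
  shows "inv\<^bsub>K\<^esub> a \<in> carrier K" "inv\<^bsub>K\<^esub> a \<otimes>\<^bsub>K\<^esub> a = \<one>\<^bsub>K\<^esub>"
proof -
  have "a \<in> Units K" using assms K.field_Units by blast
  then show "inv\<^bsub>K\<^esub> a \<in> carrier K" "inv\<^bsub>K\<^esub> a \<otimes>\<^bsub>K\<^esub> a = \<one>\<^bsub>K\<^esub>"
    by (rule K.Units_inv_closed, rule K.Units_l_inv)
qed

lemma smult_cancel:
  assumes "a \<in> carrier K" "a \<noteq> \<zero>\<^bsub>K\<^esub>" "v \<in> carrier V"
  shows "inv\<^bsub>K\<^esub> a \<odot>\<^bsub>V\<^esub> (a \<odot>\<^bsub>V\<^esub> v) = v"
  using assms inv_nonzero[OF assms(1,2)] by (simp add: smult_assoc1[symmetric])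

lemma smult_eq_zero:
  assumes "a \<in> carrier K" "v \<in> carrier V" "a \<odot>\<^bsub>V\<^esub> v = \<zero>\<^bsub>V\<^esub>"
  shows "a = \<zero>\<^bsub>K\<^esub> \<or> v = \<zero>\<^bsub>V\<^esub>"
proof (rule ccontr)
  assume n: "\<not> ?thesis"
  then have "v = inv\<^bsub>K\<^esub> a \<odot>\<^bsub>V\<^esub> \<zero>\<^bsub>V\<^esub>" using smult_cancel[of a v] assms by simp
  then show False using n inv_nonzero(1)[of a] assms(1) by simp
qed

lemma lspan_submodule: "set vs \<subseteq> carrier V \<Longrightarrow> submodule (lspan K V vs) K V"
proof (induction vs)
  case Nil
  show ?case by (rule submodule_closedI) auto
next
  case (Cons v vs)
  then have S: "submodule (lspan K V vs) K V" and v: "v \<in> carrier V" by auto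
  note c = submoduleE(1)[OF S]
  show ?case
  proof (rule submodule_closedI)
    show "lspan K V (v # vs) \<subseteq> carrier V" using c v by auto
    have "\<zero>\<^bsub>V\<^esub> = \<zero>\<^bsub>K\<^esub> \<odot>\<^bsub>V\<^esub> v \<oplus>\<^bsub>V\<^esub> \<zero>\<^bsub>V\<^esub>" using v by simp
    then show "\<zero>\<^bsub>V\<^esub> \<in> lspan K V (v # vs)" using submodule_zero[OF S] by force
  next
    fix a b assume "a \<in> lspan K V (v # vs)" "b \<in> lspan K V (v # vs)"
    then obtain k s l t where *: "k \<in> carrier K" "l \<in> carrier K" "s \<in> lspan K V vs" "t \<in> lspan K V vs"
      "a = k \<odot>\<^bsub>V\<^esub> v \<oplus>\<^bsub>V\<^esub> s" "b = l \<odot>\<^bsub>V\<^esub> v \<oplus>\<^bsub>V\<^esub> t" by auto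
    have "s \<in> carrier V" "t \<in> carrier V" using * c by auto
    then have "a \<oplus>\<^bsub>V\<^esub> b = (k \<oplus>\<^bsub>K\<^esub> l) \<odot>\<^bsub>V\<^esub> v \<oplus>\<^bsub>V\<^esub> (s \<oplus>\<^bsub>V\<^esub> t)"
      using * v by (simp add: smult_l_distr M.a_ac)
    then show "a \<oplus>\<^bsub>V\<^esub> b \<in> lspan K V (v # vs)"
      using * submoduleE(5)[OF S] by auto
  next
    fix r a assume r: "r \<in> carrier K" and "a \<in> lspan K V (v # vs)"
    then obtain k s where *: "k \<in> carrier K" "s \<in> lspan K V vs" "a = k \<odot>\<^bsub>V\<^esub> v \<oplus>\<^bsub>V\<^esub> s" by auto
    have "s \<in> carrier V" using * c by auto
    then have "r \<odot>\<^bsub>V\<^esub> a = (r \<otimes>\<^bsub>K\<^esub> k) \<odot>\<^bsub>V\<^esub> v \<oplus>\<^bsub>V\<^esub> (r \<odot>\<^bsub>V\<^esub> s)"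
      using * v r by (simp add: smult_r_distr smult_assoc1)
    then show "r \<odot>\<^bsub>V\<^esub> a \<in> lspan K V (v # vs)"
      using * r submoduleE(4)[OF S] by auto
  qed
qed

lemma lspan_carrier: "set vs \<subseteq> carrier V \<Longrightarrow> lspan K V vs \<subseteq> carrier V"
  using lspan_submodule submoduleE(1) by blast

lemma lspan_incl: "set vs \<subseteq> carrier V \<Longrightarrow> set vs \<subseteq> lspan K V vs"
proof (induction vs)
  case (Cons v vs)
  then have S: "submodule (lspan K V vs) K V" and v: "v \<in> carrier V"
    using lspan_submodule by auto
  have "\<one>\<^bsub>K\<^esub> \<odot>\<^bsub>V\<^esub> v \<oplus>\<^bsub>V\<^esub> \<zero>\<^bsub>V\<^esub> \<in> lspan K V (v # vs)" using submodule_zero[OF S] by auto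
  then have "v \<in> lspan K V (v # vs)" using v by simp
  moreover have "s \<in> lspan K V (v # vs)" if s: "s \<in> lspan K V vs" for s
  proof -
    have "\<zero>\<^bsub>K\<^esub> \<odot>\<^bsub>V\<^esub> v \<oplus>\<^bsub>V\<^esub> s \<in> lspan K V (v # vs)" using s by auto
    then show ?thesis using v s submoduleE(1)[OF S] by (simp add: subset_iff)
  qed
  ultimately show ?case using Cons by (auto simp del: lspan.simps)
qed simp

lemma lspan_least:
  assumes "submodule N K V" "set vs \<subseteq> N"
  shows "lspan K V vs \<subseteq> N"
  using assms(2)
proof (induction vs)
  case Nil
  then show ?case using submodule_zero[OF assms(1)] by simp
next
  case (Cons v vs)
  then show ?case using submoduleE(4,5)[OF assms(1)] by auto
qed

lemma lspan_mono: "set vs \<subseteq> set ws \<Longrightarrow> set ws \<subseteq> carrier V \<Longrightarrow> lspan K V vs \<subseteq> lspan K V ws"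
  using lspan_least[OF lspan_submodule] lspan_incl by (meson order_trans)

text \<open>
  The exchange argument: eliminating the first vector \<open>u\<close> of the spanning list with the first
  \<open>w j\<close> that involves \<open>u\<close> leaves a sequence of one vector less in the span of the other vectors.
\<close>

lemma exchange:
  "set us \<subseteq> carrier V \<Longrightarrow> (\<And>i. i \<le> length us \<Longrightarrow> w i \<in> lspan K V us) \<Longrightarrow>
     \<exists>n\<le>length us. w n \<in> lspan K V (map w [0..<n])"
proof (induction us arbitrary: w)
  case Nil
  then show ?case by auto
next
  case (Cons u us)
  have u: "u \<in> carrier V" and us: "set us \<subseteq> carrier V" using Cons.prems by auto
  have S: "submodule (lspan K V us) K V" using lspan_submodule us by blast
  note SC = submoduleE(1)[OF S]
  have "\<forall>i\<in>{..Suc (length us)}. \<exists>c s. c \<in> carrier K \<and> s \<in> lspan K V us \<and> w i = c \<odot>\<^bsub>V\<^esub> u \<oplus>\<^bsub>V\<^esub> s"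
    using Cons.prems(2) by auto
  then obtain c s where cs: "\<And>i. i \<le> Suc (length us) \<Longrightarrow> c i \<in> carrier K"
    "\<And>i. i \<le> Suc (length us) \<Longrightarrow> s i \<in> lspan K V us"
    "\<And>i. i \<le> Suc (length us) \<Longrightarrow> w i = c i \<odot>\<^bsub>V\<^esub> u \<oplus>\<^bsub>V\<^esub> s i"
    by (metis atMost_iff)
  have sC: "\<And>i. i \<le> Suc (length us) \<Longrightarrow> s i \<in> carrier V" using cs SC by auto
  have wC: "\<And>i. i \<le> Suc (length us) \<Longrightarrow> w i \<in> carrier V" using cs sC u by simp
  show ?case
  proof (cases "\<forall>i\<le>length us. c i = \<zero>\<^bsub>K\<^esub>")
    case True
    then have "w i \<in> lspan K V us" if "i \<le> length us" for i
      using cs(2,3)[of i] that sC[of i] u by simp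
    then obtain n where "n \<le> length us" "w n \<in> lspan K V (map w [0..<n])"
      using Cons.IH[OF us, of w] by blast
    then show ?thesis by (intro exI[of _ n]) simp
  next
    case False
    define j where "j = (LEAST i. c i \<noteq> \<zero>\<^bsub>K\<^esub>)"
    have cj: "c j \<noteq> \<zero>\<^bsub>K\<^esub>" and jle: "j \<le> length us"
      using False unfolding j_def by (metis (mono_tags, lifting) LeastI, metis (mono_tags, lifting) Least_le order_trans)
    have jlt: "c i = \<zero>\<^bsub>K\<^esub>" if "i < j" for i using that not_less_Least unfolding j_def by blast
    define d where "d i = c i \<otimes>\<^bsub>K\<^esub> inv\<^bsub>K\<^esub> (c j)" for i
    have cju: "c j \<in> Units K" using K.field_Units cj cs(1) jle by auto
    have d: "d i \<in> carrier K" "d i \<otimes>\<^bsub>K\<^esub> c j = c i" if "i \<le> Suc (length us)" for i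
      using that cju cs(1) jle by (auto simp: d_def K.m_assoc)
    define w' where "w' i = (if i < j then w i else w (Suc i) \<oplus>\<^bsub>V\<^esub> (\<ominus>\<^bsub>K\<^esub> d (Suc i)) \<odot>\<^bsub>V\<^esub> w j)" for i
    have "w' i \<in> lspan K V us" if i: "i \<le> length us" for i
    proof (cases "i < j")
      case True
      then show ?thesis using jlt[of i] cs(2,3)[of i] i sC[of i] u by (simp add: w'_def)
    next
      case False
      have C: "c (Suc i) \<in> carrier K" "s (Suc i) \<in> carrier V" "s j \<in> carrier V" "c j \<in> carrier K" "d (Suc i) \<in> carrier K"
        using cs(1) sC d i jle by auto
      have "(\<ominus>\<^bsub>K\<^esub> d (Suc i)) \<odot>\<^bsub>V\<^esub> w j = (\<ominus>\<^bsub>K\<^esub> d (Suc i) \<otimes>\<^bsub>K\<^esub> c j) \<odot>\<^bsub>V\<^esub> u \<oplus>\<^bsub>V\<^esub> (\<ominus>\<^bsub>K\<^esub> d (Suc i)) \<odot>\<^bsub>V\<^esub> s j"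
        using cs(3)[of j] jle C u by (simp add: smult_r_distr smult_assoc1)
      also have "\<ominus>\<^bsub>K\<^esub> d (Suc i) \<otimes>\<^bsub>K\<^esub> c j = \<ominus>\<^bsub>K\<^esub> c (Suc i)"
        using d(2)[of "Suc i"] i C by (simp add: K.l_minus)
      finally have "w' i = (c (Suc i) \<odot>\<^bsub>V\<^esub> u \<oplus>\<^bsub>V\<^esub> s (Suc i)) \<oplus>\<^bsub>V\<^esub>
          ((\<ominus>\<^bsub>K\<^esub> c (Suc i)) \<odot>\<^bsub>V\<^esub> u \<oplus>\<^bsub>V\<^esub> (\<ominus>\<^bsub>K\<^esub> d (Suc i)) \<odot>\<^bsub>V\<^esub> s j)"
        using False cs(3)[of "Suc i"] i by (simp add: w'_def)
      also have "\<dots> = (c (Suc i) \<odot>\<^bsub>V\<^esub> u \<oplus>\<^bsub>V\<^esub> (\<ominus>\<^bsub>K\<^esub> c (Suc i)) \<odot>\<^bsub>V\<^esub> u) \<oplus>\<^bsub>V\<^esub> (s (Suc i) \<oplus>\<^bsub>V\<^esub> (\<ominus>\<^bsub>K\<^esub> d (Suc i)) \<odot>\<^bsub>V\<^esub> s j)"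
        using C u by (simp add: M.a_ac)
      also have "c (Suc i) \<odot>\<^bsub>V\<^esub> u \<oplus>\<^bsub>V\<^esub> (\<ominus>\<^bsub>K\<^esub> c (Suc i)) \<odot>\<^bsub>V\<^esub> u = \<zero>\<^bsub>V\<^esub>"
        using C u by (simp add: smult_l_minus M.r_neg)
      finally have "w' i = s (Suc i) \<oplus>\<^bsub>V\<^esub> (\<ominus>\<^bsub>K\<^esub> d (Suc i)) \<odot>\<^bsub>V\<^esub> s j" using C by simp
      then show ?thesis using submoduleE(4,5)[OF S] cs(2) C i jle by simp
    qed
    then obtain n where n: "n \<le> length us" "w' n \<in> lspan K V (map w' [0..<n])"
      using Cons.IH[OF us, of w'] by blast
    show ?thesis
    proof (cases "n < j")
      case True
      then have eq: "map w' [0..<n] = map w [0..<n]" "w' n = w n" by (auto simp: w'_def)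
      have "w n \<in> lspan K V (map w [0..<n])" using n(2) unfolding eq .
      then show ?thesis using n(1) by (intro exI[of _ n]) simp
    next
      case False
      let ?L = "lspan K V (map w [0..<Suc n])"
      have WC: "set (map w [0..<Suc n]) \<subseteq> carrier V" using wC n(1) by auto
      then have L: "submodule ?L K V" by (rule lspan_submodule)
      have inL: "w i \<in> ?L" if "i \<le> n" for i
        using lspan_incl[OF WC] that by (auto simp: less_Suc_eq_le image_subset_iff simp del: upt_Suc)
      have "w' i \<in> ?L" if "i < n" for i
        unfolding w'_def using inL[of i] inL[of "Suc i"] inL[of j] that False d(1)[of "Suc i"] n(1) submoduleE(4,5)[OF L]
        by auto
      then have "lspan K V (map w' [0..<n]) \<subseteq> ?L" by (intro lspan_least[OF L]) auto
      then have w'n: "w' n \<in> ?L" using n by auto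
      have D: "d (Suc n) \<in> carrier K" "w (Suc n) \<in> carrier V" "w j \<in> carrier V" using d n(1) wC jle by auto
      have "w' n \<oplus>\<^bsub>V\<^esub> d (Suc n) \<odot>\<^bsub>V\<^esub> w j = w (Suc n)"
        using False D by (simp add: w'_def smult_l_minus M.a_assoc M.l_neg)
      then have "w (Suc n) \<in> ?L"
        using w'n inL[of j] False D submoduleE(4,5)[OF L] by (metis not_less)
      then show ?thesis using n(1) by (intro exI[of _ "Suc n"]) auto
    qed
  qed
qed

end

lemma linear_mapD:
  assumes "linear_map K V W h"
  shows "v \<in> carrier V \<Longrightarrow> h v \<in> carrier W"
    and "v \<in> carrier V \<Longrightarrow> w \<in> carrier V \<Longrightarrow> h (v \<oplus>\<^bsub>V\<^esub> w) = h v \<oplus>\<^bsub>W\<^esub> h w"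
    and "a \<in> carrier K \<Longrightarrow> v \<in> carrier V \<Longrightarrow> h (a \<odot>\<^bsub>V\<^esub> v) = a \<odot>\<^bsub>W\<^esub> h v"
  using assms unfolding linear_map_def by auto

lemma linear_mapI:
  assumes "\<And>v. v \<in> carrier V \<Longrightarrow> h v \<in> carrier W"
    and "\<And>v w. v \<in> carrier V \<Longrightarrow> w \<in> carrier V \<Longrightarrow> h (v \<oplus>\<^bsub>V\<^esub> w) = h v \<oplus>\<^bsub>W\<^esub> h w"
    and "\<And>a v. a \<in> carrier K \<Longrightarrow> v \<in> carrier V \<Longrightarrow> h (a \<odot>\<^bsub>V\<^esub> v) = a \<odot>\<^bsub>W\<^esub> h v"
  shows "linear_map K V W h"
  using assms unfolding linear_map_def by auto

lemma linear_map_zero: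
  assumes "module K V" "module K W" "linear_map K V W h"
  shows "h \<zero>\<^bsub>V\<^esub> = \<zero>\<^bsub>W\<^esub>"
proof -
  interpret V: module K V by fact
  interpret W: module K W by fact
  have "h (\<zero>\<^bsub>K\<^esub> \<odot>\<^bsub>V\<^esub> \<zero>\<^bsub>V\<^esub>) = \<zero>\<^bsub>K\<^esub> \<odot>\<^bsub>W\<^esub> h \<zero>\<^bsub>V\<^esub>"
    by (rule linear_mapD(3)[OF assms(3)]) auto
  then show ?thesis using linear_mapD(1)[OF assms(3)] by simp
qed

lemma linear_map_minus:
  assumes "module K V" "module K W" "linear_map K V W h" "v \<in> carrier V" "w \<in> carrier V"
  shows "h (v \<ominus>\<^bsub>V\<^esub> w) = h v \<ominus>\<^bsub>W\<^esub> h w"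
proof -
  interpret V: module K V by fact
  interpret W: module K W by fact
  have n: "\<ominus>\<^bsub>V\<^esub> w = (\<ominus>\<^bsub>K\<^esub> \<one>\<^bsub>K\<^esub>) \<odot>\<^bsub>V\<^esub> w" using assms V.smult_l_minus[of "\<one>\<^bsub>K\<^esub>" w] by auto
  have "h w \<in> carrier W" using linear_mapD(1)[OF assms(3)] assms by simp
  then have n': "\<ominus>\<^bsub>W\<^esub> h w = (\<ominus>\<^bsub>K\<^esub> \<one>\<^bsub>K\<^esub>) \<odot>\<^bsub>W\<^esub> h w" using W.smult_l_minus[of "\<one>\<^bsub>K\<^esub>" "h w"] by auto
  show ?thesis unfolding a_minus_def n n' using assms linear_mapD[OF assms(3)] by simp
qed

lemma linear_map_comp:
  "linear_map K U V g \<Longrightarrow> linear_map K V W h \<Longrightarrow> linear_map K U W (\<lambda>v. h (g v))"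
  unfolding linear_map_def by (auto simp: Pi_def)

context vspace
begin

text \<open>
  With \<open>w n = \<phi>\<^sup>n v\<close> and \<open>n\<close> minimal such that \<open>w n\<close> lies in the span of the earlier ones, dividing
  the resulting monic polynomial by \<open>X - c\<close> for a root \<open>c\<close> yields an eigenvector, which is non-zero
  by the minimality of \<open>n\<close>.
\<close>

lemma eigenvector:
  assumes ac: "algebraically_closed K"
    and lin: "linear_map K V V \<phi>"
    and us: "set us \<subseteq> carrier V" "carrier V = lspan K V us"
    and v: "v \<in> carrier V" "v \<noteq> \<zero>\<^bsub>V\<^esub>"
  shows "\<exists>c\<in>carrier K. \<exists>u\<in>carrier V. u \<noteq> \<zero>\<^bsub>V\<^esub> \<and> \<phi> u = c \<odot>\<^bsub>V\<^esub> u"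
proof -
  interpret ac: algebraically_closed K by fact
  note L = linear_mapD[OF lin]
  define w where "w n = (\<phi> ^^ n) v" for n
  have wC [simp]: "w n \<in> carrier V" for n
    by (induction n) (auto simp: w_def v L)
  have wS: "\<phi> (w n) = w (Suc n)" for n by (simp add: w_def)
  have w0: "w 0 = v" by (simp add: w_def)
  define U where "U n = lspan K V (map w (rev [0..<n]))" for n
  have UL: "U n = lspan K V (map w [0..<n])" for n
    unfolding U_def by (intro equalityI lspan_mono) auto
  have Usub: "submodule (U n) K V" for n unfolding U_def by (rule lspan_submodule) auto
  have inU: "w i \<in> U n" if "i < n" for i n
    using lspan_incl[of "map w (rev [0..<n])"] that unfolding U_def by (auto simp: image_subset_iff)
  have U_mono: "U m \<subseteq> U n" if "m \<le> n" for m n unfolding U_def using that by (intro lspan_mono) auto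
  have UC: "U n \<subseteq> carrier V" for n using Usub submoduleE(1) by blast
  have USuc: "U (Suc n) = {a \<odot>\<^bsub>V\<^esub> w n \<oplus>\<^bsub>V\<^esub> s | a s. a \<in> carrier K \<and> s \<in> U n}" for n
    unfolding U_def by simp
  define n where "n = (LEAST n. w n \<in> U n)"
  have "\<exists>n\<le>length us. w n \<in> lspan K V (map w [0..<n])"
    by (rule exchange[OF us(1)]) (simp add: us(2)[symmetric])
  then have "\<exists>n. w n \<in> U n" unfolding UL by blast
  then have n: "w n \<in> U n" unfolding n_def by (rule LeastI_ex)
  have n_min: "w m \<notin> U m" if "m < n" for m using that not_less_Least unfolding n_def by blast
  have "n \<noteq> 0"
  proof
    assume "n = 0"
    then show False using n w0 v by (simp add: U_def)
  qed
  then obtain m where m: "n = Suc m" using not0_implies_Suc by blast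

  \<comment> \<open>Horner form of \<open>P(\<phi>) v\<close>, coefficients listed from the leading one.\<close>
  define P where "P = rec_list \<zero>\<^bsub>V\<^esub> (\<lambda>c cs s. c \<odot>\<^bsub>V\<^esub> w (length cs) \<oplus>\<^bsub>V\<^esub> s)"
  have P: "P [] = \<zero>\<^bsub>V\<^esub>" "P (c # cs) = c \<odot>\<^bsub>V\<^esub> w (length cs) \<oplus>\<^bsub>V\<^esub> P cs" for c cs
    by (simp_all add: P_def)
  have PC: "set cs \<subseteq> carrier K \<Longrightarrow> P cs \<in> carrier V" for cs
    by (induction cs) (auto simp: P)
  have surj: "x \<in> U k \<Longrightarrow> \<exists>cs. length cs = k \<and> set cs \<subseteq> carrier K \<and> P cs = x" for x k
  proof (induction k arbitrary: x)
    case 0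
    then show ?case by (auto simp: U_def P)
  next
    case (Suc k)
    then obtain a s where as: "a \<in> carrier K" "s \<in> U k" "x = a \<odot>\<^bsub>V\<^esub> w k \<oplus>\<^bsub>V\<^esub> s"
      unfolding USuc by auto
    then obtain cs where "length cs = k" "set cs \<subseteq> carrier K" "P cs = s" using Suc.IH by blast
    then show ?case using as by (intro exI[of _ "a # cs"]) (auto simp: P)
  qed
  have "\<exists>cs. length cs = n \<and> set cs \<subseteq> carrier K \<and> P cs = \<ominus>\<^bsub>V\<^esub> w n"
    using surj n submoduleE(3)[OF Usub] by blast
  then obtain cs where cs: "length cs = n" "set cs \<subseteq> carrier K" "P cs = \<ominus>\<^bsub>V\<^esub> w n" by blast
  define p where "p = \<one>\<^bsub>K\<^esub> # cs"
  have Pp: "P p = \<zero>\<^bsub>V\<^esub>" using cs by (simp add: p_def P M.r_neg)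
  have pol: "p \<in> carrier (poly_ring K)"
    using cs by (auto simp: p_def univ_poly_def polynomial_def)
  have "size (K.roots p) = degree p" using ac.roots_over_carrier[OF pol] by (simp add: K.splitted_def)
  then have "K.roots p \<noteq> {#}" using cs m by (auto simp: p_def)
  then obtain c where "c \<in># K.roots p" by auto
  then have c: "c \<in> carrier K" "K.eval p c = \<zero>\<^bsub>K\<^esub>"
    using K.roots_mem_iff_is_root[OF pol] by (auto simp: K.is_root_def)

  \<comment> \<open>\<open>D = \<phi> - c\<close>; modulo the image of \<open>D\<close>, applying \<open>\<phi>\<close> is multiplication by \<open>c\<close>.\<close>
  define D where "D x = \<phi> x \<oplus>\<^bsub>V\<^esub> (\<ominus>\<^bsub>K\<^esub> c) \<odot>\<^bsub>V\<^esub> x" for x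
  have Dlin: "D (x \<oplus>\<^bsub>V\<^esub> y) = D x \<oplus>\<^bsub>V\<^esub> D y" "D (a \<odot>\<^bsub>V\<^esub> x) = a \<odot>\<^bsub>V\<^esub> D x" "D x \<in> carrier V"
    if "x \<in> carrier V" "y \<in> carrier V" "a \<in> carrier K" for x y a
  proof -
    show "D x \<in> carrier V" using that c L by (simp add: D_def)
    show "D (x \<oplus>\<^bsub>V\<^esub> y) = D x \<oplus>\<^bsub>V\<^esub> D y"
      using that c L by (simp add: D_def smult_r_distr M.a_ac)
    show "D (a \<odot>\<^bsub>V\<^esub> x) = a \<odot>\<^bsub>V\<^esub> D x"
      using that c L by (simp add: D_def smult_r_distr smult_assoc1[symmetric] K.m_comm)
  qed
  have D_add: "D x \<oplus>\<^bsub>V\<^esub> c \<odot>\<^bsub>V\<^esub> x = \<phi> x" if "x \<in> carrier V" for x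
    using that c L by (simp add: D_def smult_l_minus M.a_assoc M.l_neg)
  have power: "\<exists>g\<in>U k. w (Suc k) = D (w k \<oplus>\<^bsub>V\<^esub> g) \<oplus>\<^bsub>V\<^esub> c [^]\<^bsub>K\<^esub> Suc k \<odot>\<^bsub>V\<^esub> v" for k
  proof (induction k)
    case 0
    show ?case using D_add[of v] w0 wS[of 0] c v by (intro bexI[of _ "\<zero>\<^bsub>V\<^esub>"]) (auto simp: U_def)
  next
    case (Suc k)
    then obtain g where g: "g \<in> U k" "w (Suc k) = D (w k \<oplus>\<^bsub>V\<^esub> g) \<oplus>\<^bsub>V\<^esub> c [^]\<^bsub>K\<^esub> Suc k \<odot>\<^bsub>V\<^esub> v" by blast
    have gC: "g \<in> carrier V" using g UC by auto
    define g' where "g' = c \<odot>\<^bsub>V\<^esub> (w k \<oplus>\<^bsub>V\<^esub> g)"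
    have g': "g' \<in> U (Suc k)" unfolding g'_def
      using inU[of k "Suc k"] g U_mono[of k "Suc k"] c submoduleE(4,5)[OF Usub] by auto
    have "w (Suc (Suc k)) = D (w (Suc k)) \<oplus>\<^bsub>V\<^esub> c \<odot>\<^bsub>V\<^esub> w (Suc k)" by (simp add: D_add wS)
    also have "c \<odot>\<^bsub>V\<^esub> w (Suc k) = D g' \<oplus>\<^bsub>V\<^esub> (c \<otimes>\<^bsub>K\<^esub> c [^]\<^bsub>K\<^esub> Suc k) \<odot>\<^bsub>V\<^esub> v"
      unfolding g(2) g'_def using c gC v Dlin(3)[of "w k \<oplus>\<^bsub>V\<^esub> g" v c]
      by (simp add: Dlin smult_r_distr smult_assoc1)
    also have "D (w (Suc k)) \<oplus>\<^bsub>V\<^esub> (D g' \<oplus>\<^bsub>V\<^esub> (c \<otimes>\<^bsub>K\<^esub> c [^]\<^bsub>K\<^esub> Suc k) \<odot>\<^bsub>V\<^esub> v)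
        = D (w (Suc k) \<oplus>\<^bsub>V\<^esub> g') \<oplus>\<^bsub>V\<^esub> c [^]\<^bsub>K\<^esub> Suc (Suc k) \<odot>\<^bsub>V\<^esub> v"
      using c v gC Dlin(3)[of g' v c] Dlin(3)[of "w (Suc k)" v c]
      by (simp add: Dlin g'_def M.a_assoc K.m_comm)
    finally show ?case using g' by blast
  qed
  have rest: "set ds \<subseteq> carrier K \<Longrightarrow> length ds \<le> Suc k \<Longrightarrow>
      \<exists>g\<in>U k. P ds = D g \<oplus>\<^bsub>V\<^esub> K.eval ds c \<odot>\<^bsub>V\<^esub> v" for ds k
  proof (induction ds)
    case Nil
    have "D \<zero>\<^bsub>V\<^esub> = \<zero>\<^bsub>V\<^esub>" using c linear_map_zero[OF module_axioms module_axioms lin] by (simp add: D_def)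
    then show ?case using submodule_zero[OF Usub] v by (intro bexI[of _ "\<zero>\<^bsub>V\<^esub>"]) (auto simp: P)
  next
    case (Cons a ds)
    then obtain g where g: "g \<in> U k" "P ds = D g \<oplus>\<^bsub>V\<^esub> K.eval ds c \<odot>\<^bsub>V\<^esub> v" by auto
    have gC: "g \<in> carrier V" using g UC by auto
    have a: "a \<in> carrier K" and ds: "set ds \<subseteq> carrier K" and l: "length ds \<le> k" using Cons.prems by auto
    have e: "K.eval ds c \<in> carrier K" using K.eval_in_carrier[OF ds] c by auto
    obtain h where h: "h \<in> U k" "w (length ds) = D h \<oplus>\<^bsub>V\<^esub> c [^]\<^bsub>K\<^esub> length ds \<odot>\<^bsub>V\<^esub> v"
    proof (cases "length ds")
      case 0
      have "D \<zero>\<^bsub>V\<^esub> = \<zero>\<^bsub>V\<^esub>" using c linear_map_zero[OF module_axioms module_axioms lin] by (simp add: D_def)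
      then show ?thesis using that[of "\<zero>\<^bsub>V\<^esub>"] 0 submodule_zero[OF Usub] v w0 by simp
    next
      case (Suc l')
      obtain g where "g \<in> U l'" "w (Suc l') = D (w l' \<oplus>\<^bsub>V\<^esub> g) \<oplus>\<^bsub>V\<^esub> c [^]\<^bsub>K\<^esub> Suc l' \<odot>\<^bsub>V\<^esub> v"
        using power by blast
      then show ?thesis using that[of "w l' \<oplus>\<^bsub>V\<^esub> g"] Suc l inU[of l' k] U_mono[of l' k] submoduleE(5)[OF Usub]
        by auto
    qed
    have hC: "h \<in> carrier V" using h UC by auto
    have "P (a # ds) = a \<odot>\<^bsub>V\<^esub> (D h \<oplus>\<^bsub>V\<^esub> c [^]\<^bsub>K\<^esub> length ds \<odot>\<^bsub>V\<^esub> v) \<oplus>\<^bsub>V\<^esub> (D g \<oplus>\<^bsub>V\<^esub> K.eval ds c \<odot>\<^bsub>V\<^esub> v)"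
      unfolding P g(2) h(2) ..
    also have "\<dots> = D (a \<odot>\<^bsub>V\<^esub> h \<oplus>\<^bsub>V\<^esub> g) \<oplus>\<^bsub>V\<^esub> (a \<otimes>\<^bsub>K\<^esub> c [^]\<^bsub>K\<^esub> length ds \<oplus>\<^bsub>K\<^esub> K.eval ds c) \<odot>\<^bsub>V\<^esub> v"
      using a c e v hC gC Dlin(3)[of h h c] Dlin(3)[of g g c]
      by (simp add: Dlin smult_r_distr smult_l_distr smult_assoc1 M.a_ac)
    finally show ?case using h g a submoduleE(4,5)[OF Usub] by (intro bexI[of _ "a \<odot>\<^bsub>V\<^esub> h \<oplus>\<^bsub>V\<^esub> g"]) auto
  qed
  obtain g where g: "g \<in> U m" "w n = D (w m \<oplus>\<^bsub>V\<^esub> g) \<oplus>\<^bsub>V\<^esub> c [^]\<^bsub>K\<^esub> n \<odot>\<^bsub>V\<^esub> v"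
    using power[of m] m by blast
  obtain h where h: "h \<in> U m" "P cs = D h \<oplus>\<^bsub>V\<^esub> K.eval cs c \<odot>\<^bsub>V\<^esub> v"
    using rest[of cs m] cs m by auto
  have hC: "h \<in> carrier V" "g \<in> carrier V" using h g UC by auto
  define u where "u = w m \<oplus>\<^bsub>V\<^esub> (g \<oplus>\<^bsub>V\<^esub> h)"
  have uC: "u \<in> carrier V" using hC by (simp add: u_def)
  have e: "K.eval cs c \<in> carrier K" using K.eval_in_carrier cs c by auto
  have "K.eval p c = c [^]\<^bsub>K\<^esub> n \<oplus>\<^bsub>K\<^esub> K.eval cs c" using c cs by (simp add: p_def)
  then have pc: "c [^]\<^bsub>K\<^esub> n \<oplus>\<^bsub>K\<^esub> K.eval cs c = \<zero>\<^bsub>K\<^esub>" using c by simp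
  have "\<zero>\<^bsub>V\<^esub> = w n \<oplus>\<^bsub>V\<^esub> P cs" using Pp cs by (simp add: p_def P)
  also have "\<dots> = (D (w m \<oplus>\<^bsub>V\<^esub> g) \<oplus>\<^bsub>V\<^esub> c [^]\<^bsub>K\<^esub> n \<odot>\<^bsub>V\<^esub> v) \<oplus>\<^bsub>V\<^esub> (D h \<oplus>\<^bsub>V\<^esub> K.eval cs c \<odot>\<^bsub>V\<^esub> v)"
    using g(2) h(2) by simp
  also have "\<dots> = D u \<oplus>\<^bsub>V\<^esub> (c [^]\<^bsub>K\<^esub> n \<oplus>\<^bsub>K\<^esub> K.eval cs c) \<odot>\<^bsub>V\<^esub> v"
    using hC c v e Dlin(3)[of g g c] Dlin(3)[of h h c] Dlin(3)[of "w m" "w m" c]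
    by (simp add: Dlin u_def smult_l_distr M.a_ac)
  finally have "D u = \<zero>\<^bsub>V\<^esub>" using pc v uC Dlin(3)[OF uC uC c(1)] by simp
  then have "\<phi> u = c \<odot>\<^bsub>V\<^esub> u" using D_add[OF uC] c uC by simp
  moreover have "u \<noteq> \<zero>\<^bsub>V\<^esub>"
  proof
    assume "u = \<zero>\<^bsub>V\<^esub>"
    then have "\<ominus>\<^bsub>V\<^esub> (g \<oplus>\<^bsub>V\<^esub> h) = w m"
      unfolding u_def using hC by (intro M.minus_equality) auto
    moreover have "\<ominus>\<^bsub>V\<^esub> (g \<oplus>\<^bsub>V\<^esub> h) \<in> U m" using g h submoduleE(3,5)[OF Usub] by simp
    ultimately have "w m \<in> U m" by simp
    then show False using n_min m by blast
  qed
  ultimately show ?thesis using c uC by blast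
qed

definition sum_rank_one :: "(('v \<Rightarrow> 'k) \<times> 'v) list \<Rightarrow> 'v \<Rightarrow> 'v" where
  "sum_rank_one L v = foldr (\<lambda>(l, e) s. l v \<odot>\<^bsub>V\<^esub> e \<oplus>\<^bsub>V\<^esub> s) L \<zero>\<^bsub>V\<^esub>"

end

lemma field_module_simps [simp]:
  "carrier (field_module K) = carrier K" "\<zero>\<^bsub>field_module K\<^esub> = \<zero>\<^bsub>K\<^esub>"
  "a \<oplus>\<^bsub>field_module K\<^esub> b = a \<oplus>\<^bsub>K\<^esub> b" "a \<odot>\<^bsub>field_module K\<^esub> b = a \<otimes>\<^bsub>K\<^esub> b"
  by (simp_all add: field_module_def)

lemma field_module_module:
  fixes K :: "'k ring"
  assumes "cring K"
  shows "module K (field_module K)"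
proof -
  interpret cring K by fact
  show ?thesis
  proof (rule moduleI)
    show "abelian_group (field_module K)"
    proof (rule abelian_groupI)
      show "\<exists>y\<in>carrier (field_module K). y \<oplus>\<^bsub>field_module K\<^esub> x = \<zero>\<^bsub>field_module K\<^esub>"
        if "x \<in> carrier (field_module K)" for x
        using that by (intro bexI[of _ "\<ominus>\<^bsub>K\<^esub> x"]) (auto simp: l_neg)
    qed (auto simp: a_ac)
  qed (auto simp: l_distr r_distr m_assoc assms)
qed

context vspace
begin

lemma lspan_Cons_unique:
  assumes vs: "set vs \<subseteq> carrier V" and v: "v \<in> carrier V" "v \<notin> lspan K V vs"
    and a: "a \<in> carrier K" "s \<in> lspan K V vs" and b: "b \<in> carrier K" "t \<in> lspan K V vs"
    and eq: "a \<odot>\<^bsub>V\<^esub> v \<oplus>\<^bsub>V\<^esub> s = b \<odot>\<^bsub>V\<^esub> v \<oplus>\<^bsub>V\<^esub> t"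
  shows "a = b" "s = t"
proof -
  note S = lspan_submodule[OF vs]
  have C: "s \<in> carrier V" "t \<in> carrier V" using a b lspan_carrier[OF vs] by auto
  have "(a \<ominus>\<^bsub>K\<^esub> b) \<odot>\<^bsub>V\<^esub> v = a \<odot>\<^bsub>V\<^esub> v \<oplus>\<^bsub>V\<^esub> \<ominus>\<^bsub>V\<^esub> (b \<odot>\<^bsub>V\<^esub> v)"
    using a b v by (simp add: a_minus_def smult_l_distr smult_l_minus)
  also have "a \<odot>\<^bsub>V\<^esub> v = (b \<odot>\<^bsub>V\<^esub> v \<oplus>\<^bsub>V\<^esub> t) \<oplus>\<^bsub>V\<^esub> \<ominus>\<^bsub>V\<^esub> s"
    unfolding eq[symmetric] using C a v by (simp add: M.a_assoc M.r_neg)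
  also have "(b \<odot>\<^bsub>V\<^esub> v \<oplus>\<^bsub>V\<^esub> t) \<oplus>\<^bsub>V\<^esub> \<ominus>\<^bsub>V\<^esub> s \<oplus>\<^bsub>V\<^esub> \<ominus>\<^bsub>V\<^esub> (b \<odot>\<^bsub>V\<^esub> v)
      = (b \<odot>\<^bsub>V\<^esub> v \<oplus>\<^bsub>V\<^esub> \<ominus>\<^bsub>V\<^esub> (b \<odot>\<^bsub>V\<^esub> v)) \<oplus>\<^bsub>V\<^esub> (t \<oplus>\<^bsub>V\<^esub> \<ominus>\<^bsub>V\<^esub> s)"
    using C b v by (simp add: M.a_ac)
  also have "\<dots> = t \<oplus>\<^bsub>V\<^esub> \<ominus>\<^bsub>V\<^esub> s" using C b v by (simp add: M.r_neg)
  finally have *: "(a \<ominus>\<^bsub>K\<^esub> b) \<odot>\<^bsub>V\<^esub> v \<in> lspan K V vs"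
    using a b submoduleE(3,5)[OF S] by simp
  show "a = b"
  proof (rule ccontr)
    assume "a \<noteq> b"
    then have nz: "a \<ominus>\<^bsub>K\<^esub> b \<noteq> \<zero>\<^bsub>K\<^esub>" using a b K.r_right_minus_eq by blast
    have "inv\<^bsub>K\<^esub> (a \<ominus>\<^bsub>K\<^esub> b) \<odot>\<^bsub>V\<^esub> ((a \<ominus>\<^bsub>K\<^esub> b) \<odot>\<^bsub>V\<^esub> v) \<in> lspan K V vs"
      using inv_nonzero(1)[OF _ nz] a b * submoduleE(4)[OF S] by simp
    then show False using smult_cancel[OF _ nz] a b v by simp
  qed
  then show "s = t" using eq C a v by simp
qed

text \<open>
  If \<open>v\<close> is not in the span of \<open>vs\<close>, then the coefficient of \<open>v\<close> is a functional on the span of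
  \<open>v # vs\<close>, and the functionals for \<open>vs\<close> extend by ignoring that coefficient.
\<close>

lemma dual_basis_aux:
  "set vs \<subseteq> carrier V \<Longrightarrow> \<exists>L. (\<forall>(l, e)\<in>set L. linear_map K (V\<lparr>carrier := lspan K V vs\<rparr>) (field_module K) l \<and> e \<in> carrier V)
     \<and> (\<forall>v\<in>lspan K V vs. sum_rank_one L v = v)"
proof (induction vs)
  case Nil
  show ?case by (rule exI[of _ "[]"]) (simp add: sum_rank_one_def)
next
  case (Cons v vs)
  let ?U = "lspan K V vs" and ?U' = "lspan K V (v # vs)"
  have v: "v \<in> carrier V" and vs: "set vs \<subseteq> carrier V" using Cons.prems by auto
  note S = lspan_submodule[OF vs]
  obtain L where L: "\<And>l e. (l, e) \<in> set L \<Longrightarrow> linear_map K (V\<lparr>carrier := ?U\<rparr>) (field_module K) l"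
    "\<And>l e. (l, e) \<in> set L \<Longrightarrow> e \<in> carrier V" "\<And>v. v \<in> ?U \<Longrightarrow> sum_rank_one L v = v"
    using Cons.IH[OF vs] by fast
  show ?case
  proof (cases "v \<in> ?U")
    case True
    have "?U' \<subseteq> ?U" using lspan_least[OF S, of "v # vs"] lspan_incl[OF vs] True by auto
    moreover have "?U \<subseteq> ?U'" using Cons.prems by (intro lspan_mono) auto
    ultimately have "?U' = ?U" by blast
    then show ?thesis using L by (intro exI[of _ L]) (auto simp del: lspan.simps)
  next
    case False
    note uniq = lspan_Cons_unique[OF vs v False]
    define co where "co x = (SOME a. a \<in> carrier K \<and> (\<exists>s\<in>?U. x = a \<odot>\<^bsub>V\<^esub> v \<oplus>\<^bsub>V\<^esub> s))" for x
    define r where "r x = (SOME s. s \<in> ?U \<and> x = co x \<odot>\<^bsub>V\<^esub> v \<oplus>\<^bsub>V\<^esub> s)" for x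
    have cr: "co x \<in> carrier K \<and> r x \<in> ?U \<and> x = co x \<odot>\<^bsub>V\<^esub> v \<oplus>\<^bsub>V\<^esub> r x" if "x \<in> ?U'" for x
    proof -
      have "\<exists>a. a \<in> carrier K \<and> (\<exists>s\<in>?U. x = a \<odot>\<^bsub>V\<^esub> v \<oplus>\<^bsub>V\<^esub> s)" using that by auto
      then have c: "co x \<in> carrier K \<and> (\<exists>s\<in>?U. x = co x \<odot>\<^bsub>V\<^esub> v \<oplus>\<^bsub>V\<^esub> s)"
        unfolding co_def by (rule someI_ex)
      then have "\<exists>s. s \<in> ?U \<and> x = co x \<odot>\<^bsub>V\<^esub> v \<oplus>\<^bsub>V\<^esub> s" by blast
      then have "r x \<in> ?U \<and> x = co x \<odot>\<^bsub>V\<^esub> v \<oplus>\<^bsub>V\<^esub> r x" unfolding r_def by (rule someI_ex)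
      then show ?thesis using c by blast
    qed
    have eqs: "co (a \<odot>\<^bsub>V\<^esub> v \<oplus>\<^bsub>V\<^esub> s) = a \<and> r (a \<odot>\<^bsub>V\<^esub> v \<oplus>\<^bsub>V\<^esub> s) = s" if "a \<in> carrier K" "s \<in> ?U" for a s
    proof -
      have "a \<odot>\<^bsub>V\<^esub> v \<oplus>\<^bsub>V\<^esub> s \<in> ?U'" using that by auto
      from cr[OF this] show ?thesis using uniq that by metis
    qed
    have UC: "\<And>s. s \<in> ?U \<Longrightarrow> s \<in> carrier V" using lspan_carrier[OF vs] by auto
    have crC: "co x \<in> carrier K" "r x \<in> carrier V" "r x \<in> ?U" if "x \<in> ?U'" for x
      using cr[OF that] UC by blast+
    have add: "co (x \<oplus>\<^bsub>V\<^esub> y) = co x \<oplus>\<^bsub>K\<^esub> co y \<and> r (x \<oplus>\<^bsub>V\<^esub> y) = r x \<oplus>\<^bsub>V\<^esub> r y"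
      if "x \<in> ?U'" "y \<in> ?U'" for x y
    proof -
      have "x \<oplus>\<^bsub>V\<^esub> y = (co x \<odot>\<^bsub>V\<^esub> v \<oplus>\<^bsub>V\<^esub> r x) \<oplus>\<^bsub>V\<^esub> (co y \<odot>\<^bsub>V\<^esub> v \<oplus>\<^bsub>V\<^esub> r y)" using cr that by metis
      also have "\<dots> = (co x \<oplus>\<^bsub>K\<^esub> co y) \<odot>\<^bsub>V\<^esub> v \<oplus>\<^bsub>V\<^esub> (r x \<oplus>\<^bsub>V\<^esub> r y)"
        using crC[OF that(1)] crC[OF that(2)] v by (simp add: smult_l_distr M.a_ac)
      finally show ?thesis
        using eqs[of "co x \<oplus>\<^bsub>K\<^esub> co y" "r x \<oplus>\<^bsub>V\<^esub> r y"] crC[OF that(1)] crC[OF that(2)] submoduleE(5)[OF S] by simp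
    qed
    have scale: "co (c \<odot>\<^bsub>V\<^esub> x) = c \<otimes>\<^bsub>K\<^esub> co x \<and> r (c \<odot>\<^bsub>V\<^esub> x) = c \<odot>\<^bsub>V\<^esub> r x"
      if "x \<in> ?U'" "c \<in> carrier K" for x c
    proof -
      have "c \<odot>\<^bsub>V\<^esub> x = c \<odot>\<^bsub>V\<^esub> (co x \<odot>\<^bsub>V\<^esub> v \<oplus>\<^bsub>V\<^esub> r x)" using cr that by metis
      also have "\<dots> = (c \<otimes>\<^bsub>K\<^esub> co x) \<odot>\<^bsub>V\<^esub> v \<oplus>\<^bsub>V\<^esub> c \<odot>\<^bsub>V\<^esub> r x"
        using crC[OF that(1)] that(2) v by (simp add: smult_r_distr smult_assoc1)
      finally show ?thesis
        using eqs[of "c \<otimes>\<^bsub>K\<^esub> co x" "c \<odot>\<^bsub>V\<^esub> r x"] crC[OF that(1)] that(2) submoduleE(4)[OF S] by simp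
    qed
    define L' where "L' = (co, v) # map (\<lambda>(l, e). (\<lambda>x. l (r x), e)) L"
    have "linear_map K (V\<lparr>carrier := ?U'\<rparr>) (field_module K) co"
      by (rule linear_mapI) (use crC add scale in \<open>simp_all del: lspan.simps\<close>)
    moreover have "linear_map K (V\<lparr>carrier := ?U'\<rparr>) (V\<lparr>carrier := ?U\<rparr>) r"
      by (rule linear_mapI) (use crC add scale in \<open>simp_all del: lspan.simps\<close>)
    ultimately have "linear_map K (V\<lparr>carrier := ?U'\<rparr>) (field_module K) l \<and> e \<in> carrier V" if "(l, e) \<in> set L'" for l e
      using that L(1,2) v linear_map_comp unfolding L'_def by fastforce
    moreover have "sum_rank_one L' x = x" if "x \<in> ?U'" for x
    proof -
      have "sum_rank_one (map (\<lambda>(l, e). (\<lambda>x. l (r x), e)) L) x = sum_rank_one L (r x)" for L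
        by (induction L) (auto simp: sum_rank_one_def)
      then show ?thesis using cr[OF that] L(3)[of "r x"] by (simp add: L'_def sum_rank_one_def)
    qed
    ultimately show ?thesis by (intro exI[of _ L']) blast
  qed
qed

lemma dual_basis:
  assumes "set vs \<subseteq> carrier V" "carrier V = lspan K V vs"
  obtains L where "\<And>l e. (l, e) \<in> set L \<Longrightarrow> linear_map K V (field_module K) l \<and> e \<in> carrier V"
    "\<And>v. v \<in> carrier V \<Longrightarrow> sum_rank_one L v = v"
proof -
  have "V\<lparr>carrier := lspan K V vs\<rparr> = V" using assms(2) by simp
  then show ?thesis using dual_basis_aux[OF assms(1)] assms(2) that by fastforce
qed

end

section \<open>Quotients, free modules and tensor products\<close>

locale quotient_by_submodule = module K M
  for K :: "'k ring" and M :: "('k, 'v) module" +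
  fixes N :: "'v set"
  assumes sub: "submodule N K M"
begin

sublocale N: abelian_subgroup N M
proof (rule abelian_subgroupI3)
  show "additive_subgroup N M"
    using sub unfolding additive_subgroup_def submodule_def by blast
qed unfold_locales

abbreviation q :: "'v \<Rightarrow> 'v set" where "q v \<equiv> N +>\<^bsub>M\<^esub> v"

lemma N_closed: "x \<in> N \<Longrightarrow> y \<in> N \<Longrightarrow> x \<oplus>\<^bsub>M\<^esub> y \<in> N" "c \<in> carrier K \<Longrightarrow> x \<in> N \<Longrightarrow> c \<odot>\<^bsub>M\<^esub> x \<in> N" "x \<in> N \<Longrightarrow> x \<in> carrier M"
  using submoduleE[OF sub] by auto

lemma q_self: "v \<in> carrier M \<Longrightarrow> v \<in> q v"
  by (rule N.a_rcos_self)

lemma mem_q: "v \<in> carrier M \<Longrightarrow> w \<in> q v \<longleftrightarrow> w \<in> carrier M \<and> q w = q v"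
  using N.a_elemrcos_carrier N.a_rcos_self a_repr_independence[OF _ _ N.a_subgroup] by metis

lemma q_eq_iff:
  assumes "v \<in> carrier M" "w \<in> carrier M"
  shows "q v = q w \<longleftrightarrow> v \<ominus>\<^bsub>M\<^esub> w \<in> N"
  using mem_q[OF assms(2), of v] N.a_rcos_module[OF assms(2,1)] assms by (simp add: a_minus_def)

lemma q_add: "v \<in> carrier M \<Longrightarrow> w \<in> carrier M \<Longrightarrow> q v \<oplus>\<^bsub>quotient_module M N\<^esub> q w = q (v \<oplus>\<^bsub>M\<^esub> w)"
  by (simp add: quotient_module_def N.a_rcos_sum)

lemma q_smult:
  assumes "c \<in> carrier K" "v \<in> carrier M"
  shows "c \<odot>\<^bsub>quotient_module M N\<^esub> q v = q (c \<odot>\<^bsub>M\<^esub> v)"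
proof -
  have "q (c \<odot>\<^bsub>M\<^esub> w) = q (c \<odot>\<^bsub>M\<^esub> v)" if "w \<in> q v" for w
  proof -
    have w: "w \<in> carrier M" "q w = q v" using that mem_q[OF assms(2)] by auto
    then have w: "w \<in> carrier M" "w \<ominus>\<^bsub>M\<^esub> v \<in> N" using q_eq_iff[of w v] assms by auto
    have "c \<odot>\<^bsub>M\<^esub> w \<ominus>\<^bsub>M\<^esub> c \<odot>\<^bsub>M\<^esub> v = c \<odot>\<^bsub>M\<^esub> (w \<ominus>\<^bsub>M\<^esub> v)"
      using w assms by (simp add: a_minus_def smult_r_distr smult_r_minus)
    then show ?thesis using q_eq_iff[of "c \<odot>\<^bsub>M\<^esub> w" "c \<odot>\<^bsub>M\<^esub> v"] w assms N_closed(2)[of c "w \<ominus>\<^bsub>M\<^esub> v"] by simp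
  qed
  then have "(\<Union>w\<in>q v. q (c \<odot>\<^bsub>M\<^esub> w)) = q (c \<odot>\<^bsub>M\<^esub> v)" using q_self[OF assms(2)] by blast
  then show ?thesis by (simp add: quotient_module_def)
qed

lemma q_closed: "v \<in> carrier M \<Longrightarrow> q v \<in> carrier (quotient_module M N)"
  by (auto simp: quotient_module_def A_RCOSETS_def')

lemma q_cases: "Q \<in> carrier (quotient_module M N) \<Longrightarrow> \<exists>v\<in>carrier M. Q = q v"
  by (auto simp: quotient_module_def A_RCOSETS_def')

lemma q_zero: "\<zero>\<^bsub>quotient_module M N\<^esub> = q \<zero>\<^bsub>M\<^esub>"
  using N.a_subset by (simp add: quotient_module_def)

lemma quotient_module_module: "module K (quotient_module M N)"
proof (rule moduleI)
  show "cring K" by unfold_locales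
  show "abelian_group (quotient_module M N)"
  proof (rule abelian_groupI)
    fix x assume "x \<in> carrier (quotient_module M N)"
    then obtain v where "v \<in> carrier M" "x = q v" using q_cases by blast
    then show "\<exists>y\<in>carrier (quotient_module M N). y \<oplus>\<^bsub>quotient_module M N\<^esub> x = \<zero>\<^bsub>quotient_module M N\<^esub>"
      by (intro bexI[of _ "q (\<ominus>\<^bsub>M\<^esub> v)"]) (auto simp: q_add q_zero q_closed M.l_neg)
  qed (auto dest!: q_cases simp: q_add q_zero M.a_ac q_closed)
qed (auto dest!: q_cases simp: q_add q_smult smult_l_distr smult_r_distr smult_assoc1 q_closed)

lemma q_linear: "linear_map K M (quotient_module M N) q"
  by (rule linear_mapI) (auto simp: q_closed q_add q_smult)

text \<open>A linear map that vanishes on \<open>N\<close> is constant on the cosets of \<open>N\<close>.\<close>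

lemma kills_coset:
  assumes W: "module K W" and h: "linear_map K M W h" and N: "\<And>n. n \<in> N \<Longrightarrow> h n = \<zero>\<^bsub>W\<^esub>"
    and v: "v \<in> carrier M" "w \<in> q v"
  shows "h w = h v"
proof -
  interpret W: module K W by fact
  have "w \<in> carrier M" "q w = q v" using v mem_q[of v] by auto
  then have w: "w \<in> carrier M" "w \<ominus>\<^bsub>M\<^esub> v \<in> N" using q_eq_iff[of w v] v by auto
  have "h w \<ominus>\<^bsub>W\<^esub> h v = \<zero>\<^bsub>W\<^esub>"
    using linear_map_minus[OF module_axioms W h w(1) v(1)] N[OF w(2)] by simp
  then have "\<ominus>\<^bsub>W\<^esub> (\<ominus>\<^bsub>W\<^esub> h v) = h w"
    using linear_mapD(1)[OF h] w v by (intro W.M.minus_equality) (auto simp: a_minus_def)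
  then show ?thesis using linear_mapD(1)[OF h] v by simp
qed

lemma induced_linear:
  assumes W: "module K W" and h: "linear_map K M W h"
    and L: "\<And>v. v \<in> carrier M \<Longrightarrow> L (q v) = h v"
  shows "linear_map K (quotient_module M N) W L"
  by (rule linear_mapI) (auto dest!: q_cases simp: L q_add q_smult linear_mapD[OF h])

end

locale free_mod = field K for K :: "'k ring" and B :: "'b set"
begin

abbreviation "F \<equiv> free_module K B"

lemma free_carrier: "c \<in> carrier F \<longleftrightarrow> (\<forall>b. c b \<in> carrier K) \<and> finite {b. c b \<noteq> \<zero>\<^bsub>K\<^esub>} \<and> {b. c b \<noteq> \<zero>\<^bsub>K\<^esub>} \<subseteq> B"
  by (simp add: free_module_def)

lemma free_ops:
  "c \<oplus>\<^bsub>F\<^esub> d = (\<lambda>b. c b \<oplus>\<^bsub>K\<^esub> d b)" "a \<odot>\<^bsub>F\<^esub> c = (\<lambda>b. a \<otimes>\<^bsub>K\<^esub> c b)" "\<zero>\<^bsub>F\<^esub> = (\<lambda>b. \<zero>\<^bsub>K\<^esub>)"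
  by (simp_all add: free_module_def)

lemma free_add_closed:
  assumes "c \<in> carrier F" "d \<in> carrier F"
  shows "(\<lambda>b. c b \<oplus>\<^bsub>K\<^esub> d b) \<in> carrier F"
proof -
  have "{b. c b \<oplus>\<^bsub>K\<^esub> d b \<noteq> \<zero>\<^bsub>K\<^esub>} \<subseteq> {b. c b \<noteq> \<zero>\<^bsub>K\<^esub>} \<union> {b. d b \<noteq> \<zero>\<^bsub>K\<^esub>}" by auto
  moreover have "finite ({b. c b \<noteq> \<zero>\<^bsub>K\<^esub>} \<union> {b. d b \<noteq> \<zero>\<^bsub>K\<^esub>})"
    "{b. c b \<noteq> \<zero>\<^bsub>K\<^esub>} \<union> {b. d b \<noteq> \<zero>\<^bsub>K\<^esub>} \<subseteq> B" using assms by (simp_all add: free_carrier)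
  ultimately show ?thesis using assms unfolding free_carrier by (meson add.m_closed finite_subset order_trans)
qed

lemma free_smult_closed:
  assumes "a \<in> carrier K" "c \<in> carrier F"
  shows "(\<lambda>b. a \<otimes>\<^bsub>K\<^esub> c b) \<in> carrier F"
proof -
  have "{b. a \<otimes>\<^bsub>K\<^esub> c b \<noteq> \<zero>\<^bsub>K\<^esub>} \<subseteq> {b. c b \<noteq> \<zero>\<^bsub>K\<^esub>}" using assms by auto
  then show ?thesis using assms unfolding free_carrier by (meson m_closed finite_subset order_trans)
qed

lemma free_module_module: "module K F"
proof (rule moduleI)
  show "cring K" by unfold_locales
  show "abelian_group F"
  proof (rule abelian_groupI)
    fix x assume x: "x \<in> carrier F"
    then have "(\<lambda>b. \<ominus>\<^bsub>K\<^esub> \<one>\<^bsub>K\<^esub> \<otimes>\<^bsub>K\<^esub> x b) \<in> carrier F" by (intro free_smult_closed) auto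
    moreover have "\<ominus>\<^bsub>K\<^esub> \<one>\<^bsub>K\<^esub> \<otimes>\<^bsub>K\<^esub> x b \<oplus>\<^bsub>K\<^esub> x b = \<zero>\<^bsub>K\<^esub>" for b
      using x by (simp add: free_carrier l_minus l_neg)
    ultimately show "\<exists>y\<in>carrier F. y \<oplus>\<^bsub>F\<^esub> x = \<zero>\<^bsub>F\<^esub>" unfolding free_ops by (intro bexI) auto
  qed (auto simp: free_ops free_add_closed, auto simp: free_carrier a_ac)
qed (auto simp: free_ops free_smult_closed, auto simp: free_carrier l_distr r_distr m_assoc)

sublocale M: module K F by (rule free_module_module)

lemma free_gen_carrier: "b \<in> B \<Longrightarrow> free_gen K b \<in> carrier F"
  by (auto simp: free_carrier free_gen_def)

lemma free_submodule_all:
  assumes N: "submodule N K F" and gen: "\<And>b. b \<in> B \<Longrightarrow> free_gen K b \<in> N"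
  shows "N = carrier F"
proof
  show "N \<subseteq> carrier F" by (rule M.submoduleE(1)[OF N])
  have "c \<in> N" if "c \<in> carrier F" for c
    using that
  proof (induction "card {b. c b \<noteq> \<zero>\<^bsub>K\<^esub>}" arbitrary: c)
    case 0
    then have "{b. c b \<noteq> \<zero>\<^bsub>K\<^esub>} = {}" by (simp add: free_carrier)
    then have "c = \<zero>\<^bsub>F\<^esub>" by (auto simp: free_ops)
    moreover have "\<zero>\<^bsub>F\<^esub> \<in> N" using N submodule.axioms(1) subgroup.one_closed by fastforce
    ultimately show ?case by simp
  next
    case (Suc n)
    then obtain b where b: "c b \<noteq> \<zero>\<^bsub>K\<^esub>" by (metis (mono_tags) card.empty empty_Collect_eq nat.distinct(1))
    define d where "d = c(b := \<zero>\<^bsub>K\<^esub>)"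
    have supp: "{x. d x \<noteq> \<zero>\<^bsub>K\<^esub>} = {x. c x \<noteq> \<zero>\<^bsub>K\<^esub>} - {b}" by (auto simp: d_def)
    have "d \<in> carrier F" using Suc.prems unfolding free_carrier supp by (auto simp: d_def)
    moreover have "card {x. d x \<noteq> \<zero>\<^bsub>K\<^esub>} = n"
      using Suc.hyps(2) Suc.prems b unfolding supp free_carrier by simp
    ultimately have dN: "d \<in> N" using Suc.hyps(1) by blast
    have cb: "c b \<in> carrier K" "b \<in> B" using Suc.prems b by (auto simp: free_carrier)
    have "c = c b \<odot>\<^bsub>F\<^esub> free_gen K b \<oplus>\<^bsub>F\<^esub> d"
      using Suc.prems by (auto simp: free_ops free_gen_def d_def free_carrier fun_eq_iff)
    then show ?case using dN gen[OF cb(2)] cb(1) M.submoduleE(4,5)[OF N] by metis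
  qed
  then show "carrier F \<subseteq> N" by blast
qed

definition free_lift :: "('k, 'w) module \<Rightarrow> ('b \<Rightarrow> 'w) \<Rightarrow> ('b \<Rightarrow> 'k) \<Rightarrow> 'w" where
  "free_lift W f c = (\<Oplus>\<^bsub>W\<^esub>b\<in>{b. c b \<noteq> \<zero>\<^bsub>K\<^esub>}. c b \<odot>\<^bsub>W\<^esub> f b)"

lemma free_lift:
  assumes W: "module K W" and f: "\<And>b. b \<in> B \<Longrightarrow> f b \<in> carrier W"
  shows "linear_map K F W (free_lift W f)" "b \<in> B \<Longrightarrow> free_lift W f (free_gen K b) = f b"
proof -
  interpret W: module K W by fact
  have super: "free_lift W f c = (\<Oplus>\<^bsub>W\<^esub>b\<in>Z. c b \<odot>\<^bsub>W\<^esub> f b)"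
    if "c \<in> carrier F" "finite Z" "{b. c b \<noteq> \<zero>\<^bsub>K\<^esub>} \<subseteq> Z" "Z \<subseteq> B" for c Z
    unfolding free_lift_def
    by (rule W.M.add.finprod_mono_neutral_cong_left) (use that f in \<open>auto simp: free_carrier subset_iff\<close>)
  show "linear_map K F W (free_lift W f)"
  proof (rule linear_mapI)
    fix c assume c: "c \<in> carrier F"
    then show "free_lift W f c \<in> carrier W"
      unfolding free_lift_def by (intro W.M.finsum_closed) (auto simp: free_carrier intro!: f)
    fix d assume d: "d \<in> carrier F"
    let ?Z = "{b. c b \<noteq> \<zero>\<^bsub>K\<^esub>} \<union> {b. d b \<noteq> \<zero>\<^bsub>K\<^esub>}"
    have Z: "finite ?Z" "?Z \<subseteq> B" using c d by (auto simp: free_carrier)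
    have cd: "c b \<in> carrier K" "d b \<in> carrier K" for b using c d by (auto simp: free_carrier)
    have "free_lift W f (c \<oplus>\<^bsub>F\<^esub> d) = (\<Oplus>\<^bsub>W\<^esub>b\<in>?Z. (c b \<oplus>\<^bsub>K\<^esub> d b) \<odot>\<^bsub>W\<^esub> f b)"
      unfolding free_ops by (rule super) (use c d Z free_add_closed in auto)
    also have "\<dots> = (\<Oplus>\<^bsub>W\<^esub>b\<in>?Z. c b \<odot>\<^bsub>W\<^esub> f b \<oplus>\<^bsub>W\<^esub> d b \<odot>\<^bsub>W\<^esub> f b)"
      by (rule W.M.finsum_cong') (use Z f cd in \<open>auto simp: W.smult_l_distr subset_iff\<close>)
    also have "\<dots> = free_lift W f c \<oplus>\<^bsub>W\<^esub> free_lift W f d"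
      unfolding super[OF c Z(1) _ Z(2), simplified] super[OF d Z(1) _ Z(2), simplified]
      by (rule W.M.finsum_addf) (use Z f cd in auto)
    finally show "free_lift W f (c \<oplus>\<^bsub>F\<^esub> d) = free_lift W f c \<oplus>\<^bsub>W\<^esub> free_lift W f d" .
  next
    fix a c assume a: "a \<in> carrier K" and c: "c \<in> carrier F"
    let ?Z = "{b. c b \<noteq> \<zero>\<^bsub>K\<^esub>}"
    have Z: "finite ?Z" "?Z \<subseteq> B" using c by (auto simp: free_carrier)
    have cd: "c b \<in> carrier K" for b using c by (auto simp: free_carrier)
    have "free_lift W f (a \<odot>\<^bsub>F\<^esub> c) = (\<Oplus>\<^bsub>W\<^esub>b\<in>?Z. (a \<otimes>\<^bsub>K\<^esub> c b) \<odot>\<^bsub>W\<^esub> f b)"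
      unfolding free_ops by (rule super) (use a c Z free_smult_closed in auto)
    also have "\<dots> = (\<Oplus>\<^bsub>W\<^esub>b\<in>?Z. a \<odot>\<^bsub>W\<^esub> (c b \<odot>\<^bsub>W\<^esub> f b))"
      by (rule W.M.finsum_cong') (use Z f cd a in \<open>auto simp: W.smult_assoc1 subset_iff\<close>)
    also have "\<dots> = a \<odot>\<^bsub>W\<^esub> free_lift W f c"
      unfolding free_lift_def by (rule W.finsum_smult_ldistr[symmetric]) (use Z f cd a in auto)
    finally show "free_lift W f (a \<odot>\<^bsub>F\<^esub> c) = a \<odot>\<^bsub>W\<^esub> free_lift W f c" .
  qed
  show "free_lift W f (free_gen K b) = f b" if "b \<in> B"
  proof -
    have "{x. free_gen K b x \<noteq> \<zero>\<^bsub>K\<^esub>} = {b}" by (auto simp: free_gen_def)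
    then show ?thesis using f[OF that] by (simp add: free_lift_def free_gen_def)
  qed
qed

lemma free_map:
  assumes h: "\<And>b. b \<in> B \<Longrightarrow> h b \<in> C"
  shows "linear_map K F (free_module K C) (free_map K h)" "b \<in> B \<Longrightarrow> free_map K h (free_gen K b) = free_gen K (h b)"
proof -
  interpret C: free_mod K C by unfold_locales
  have super: "free_map K h c b' = (\<Oplus>\<^bsub>K\<^esub>b\<in>Z. if h b = b' then c b else \<zero>\<^bsub>K\<^esub>)"
    if "c \<in> carrier F" "finite Z" "{b. c b \<noteq> \<zero>\<^bsub>K\<^esub>} \<subseteq> Z" for c Z b'
    unfolding free_map_def
    by (rule add.finprod_mono_neutral_cong_left) (use that in \<open>auto simp: free_carrier subset_iff\<close>)
  show "linear_map K F (free_module K C) (free_map K h)"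
  proof (rule linear_mapI)
    fix c assume c: "c \<in> carrier F"
    have "{b'. free_map K h c b' \<noteq> \<zero>\<^bsub>K\<^esub>} \<subseteq> h ` {b. c b \<noteq> \<zero>\<^bsub>K\<^esub>}"
    proof (rule subsetI, rule ccontr)
      fix b' assume b': "b' \<in> {b'. free_map K h c b' \<noteq> \<zero>\<^bsub>K\<^esub>}" "b' \<notin> h ` {b. c b \<noteq> \<zero>\<^bsub>K\<^esub>}"
      then have "{b. c b \<noteq> \<zero>\<^bsub>K\<^esub> \<and> h b = b'} = {}" by auto
      then show False using b'(1) by (simp only: free_map_def finsum_empty mem_Collect_eq simp_thms)
    qed
    moreover have "h ` {b. c b \<noteq> \<zero>\<^bsub>K\<^esub>} \<subseteq> C" "finite (h ` {b. c b \<noteq> \<zero>\<^bsub>K\<^esub>})" using c h by (auto simp: free_carrier)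
    moreover have "free_map K h c b' \<in> carrier K" for b'
      unfolding free_map_def using c by (intro finsum_closed) (auto simp: free_carrier)
    ultimately show "free_map K h c \<in> carrier (free_module K C)"
      unfolding C.free_carrier by (meson finite_subset order_trans)
    fix d assume d: "d \<in> carrier F"
    let ?Z = "{b. c b \<noteq> \<zero>\<^bsub>K\<^esub>} \<union> {b. d b \<noteq> \<zero>\<^bsub>K\<^esub>}"
    have Z: "finite ?Z" "?Z \<subseteq> B" using c d by (auto simp: free_carrier)
    have cd: "c b \<in> carrier K" "d b \<in> carrier K" for b using c d by (auto simp: free_carrier)
    show "free_map K h (c \<oplus>\<^bsub>F\<^esub> d) = free_map K h c \<oplus>\<^bsub>free_module K C\<^esub> free_map K h d"
    proof
      fix b'
      have "free_map K h (c \<oplus>\<^bsub>F\<^esub> d) b' = (\<Oplus>\<^bsub>K\<^esub>b\<in>?Z. if h b = b' then c b \<oplus>\<^bsub>K\<^esub> d b else \<zero>\<^bsub>K\<^esub>)"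
        unfolding free_ops by (rule super) (use c d Z free_add_closed in auto)
      also have "\<dots> = (\<Oplus>\<^bsub>K\<^esub>b\<in>?Z. (if h b = b' then c b else \<zero>\<^bsub>K\<^esub>) \<oplus>\<^bsub>K\<^esub> (if h b = b' then d b else \<zero>\<^bsub>K\<^esub>))"
        by (rule finsum_cong') (use cd in auto)
      also have "\<dots> = free_map K h c b' \<oplus>\<^bsub>K\<^esub> free_map K h d b'"
        unfolding super[OF c Z(1), simplified] super[OF d Z(1), simplified]
        by (rule finsum_addf) (use cd in auto)
      finally show "free_map K h (c \<oplus>\<^bsub>F\<^esub> d) b' = (free_map K h c \<oplus>\<^bsub>free_module K C\<^esub> free_map K h d) b'"
        by (simp add: C.free_ops)
    qed
  next
    fix a c assume a: "a \<in> carrier K" and c: "c \<in> carrier F"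
    let ?Z = "{b. c b \<noteq> \<zero>\<^bsub>K\<^esub>}"
    have Z: "finite ?Z" "?Z \<subseteq> B" using c by (auto simp: free_carrier)
    have cd: "c b \<in> carrier K" for b using c by (auto simp: free_carrier)
    show "free_map K h (a \<odot>\<^bsub>F\<^esub> c) = a \<odot>\<^bsub>free_module K C\<^esub> free_map K h c"
    proof
      fix b'
      have "free_map K h (a \<odot>\<^bsub>F\<^esub> c) b' = (\<Oplus>\<^bsub>K\<^esub>b\<in>?Z. if h b = b' then a \<otimes>\<^bsub>K\<^esub> c b else \<zero>\<^bsub>K\<^esub>)"
        unfolding free_ops by (rule super) (use a c Z free_smult_closed in auto)
      also have "\<dots> = (\<Oplus>\<^bsub>K\<^esub>b\<in>?Z. a \<otimes>\<^bsub>K\<^esub> (if h b = b' then c b else \<zero>\<^bsub>K\<^esub>))"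
        by (rule finsum_cong') (use cd a in auto)
      also have "\<dots> = a \<otimes>\<^bsub>K\<^esub> free_map K h c b'"
        unfolding super[OF c Z(1) order_refl] by (rule finsum_rdistr[symmetric]) (use Z a cd in auto)
      finally show "free_map K h (a \<odot>\<^bsub>F\<^esub> c) b' = (a \<odot>\<^bsub>free_module K C\<^esub> free_map K h c) b'"
        by (simp add: C.free_ops)
    qed
  qed
  show "free_map K h (free_gen K b) = free_gen K (h b)" if "b \<in> B"
  proof
    fix b'
    have "{x. free_gen K b x \<noteq> \<zero>\<^bsub>K\<^esub> \<and> h x = b'} = (if h b = b' then {b} else {})"
      by (auto simp: free_gen_def)
    then show "free_map K h (free_gen K b) b' = free_gen K (h b) b'"
      by (auto simp: free_map_def free_gen_def)
  qed
qed

end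

definition multilinear :: "'k ring \<Rightarrow> 'i set \<Rightarrow> ('i \<Rightarrow> ('k, 'v) module) \<Rightarrow> ('k, 'w) module \<Rightarrow> (('i \<Rightarrow> 'v) \<Rightarrow> 'w) \<Rightarrow> bool" where
  "multilinear K I V W f \<longleftrightarrow> (\<forall>b\<in>product_set I V. f b \<in> carrier W \<and> (\<forall>i\<in>I.
     (\<forall>v\<in>carrier (V i). \<forall>w\<in>carrier (V i). f (b(i := v \<oplus>\<^bsub>V i\<^esub> w)) = f (b(i := v)) \<oplus>\<^bsub>W\<^esub> f (b(i := w))) \<and>
     (\<forall>a\<in>carrier K. \<forall>v\<in>carrier (V i). f (b(i := a \<odot>\<^bsub>V i\<^esub> v)) = a \<odot>\<^bsub>W\<^esub> f (b(i := v)))))"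

definition pure_tensor :: "'k ring \<Rightarrow> 'i set \<Rightarrow> ('i \<Rightarrow> ('k, 'v) module) \<Rightarrow> ('i \<Rightarrow> 'v) \<Rightarrow> (('i \<Rightarrow> 'v) \<Rightarrow> 'k) set" where
  "pure_tensor K I V b = tensor_kernel K I V +>\<^bsub>free_module K (product_set I V)\<^esub> free_gen K b"

locale tensor_product = field K for K :: "'k ring" +
  fixes I :: "'i set" and V :: "'i \<Rightarrow> ('k, 'v) module"
  assumes V_module: "i \<in> I \<Longrightarrow> module K (V i)"
begin

abbreviation "B \<equiv> product_set I V"
abbreviation "T \<equiv> tensor_module K I V"
abbreviation "pure \<equiv> pure_tensor K I V"

sublocale F: free_mod K B by unfold_locales

lemma upd_mem: "b \<in> B \<Longrightarrow> i \<in> I \<Longrightarrow> v \<in> carrier (V i) \<Longrightarrow> b(i := v) \<in> B"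
  by (auto simp: product_set_def PiE_def extensional_def Pi_def)

lemma mem: "b \<in> B \<Longrightarrow> i \<in> I \<Longrightarrow> b i \<in> carrier (V i)"
  by (auto simp: product_set_def)

lemma relations_carrier: "multilinear_relations K I V \<subseteq> carrier F.F"
proof -
  have V: "v \<oplus>\<^bsub>V i\<^esub> w \<in> carrier (V i)" if "i \<in> I" "v \<in> carrier (V i)" "w \<in> carrier (V i)" for i v w
  proof -
    interpret module K "V i" using V_module that by blast
    show ?thesis using that by auto
  qed
  have V': "a \<odot>\<^bsub>V i\<^esub> v \<in> carrier (V i)" if "i \<in> I" "v \<in> carrier (V i)" "a \<in> carrier K" for i v a
  proof -
    interpret module K "V i" using V_module that by blast
    show ?thesis using that by auto
  qed
  show ?thesis
    unfolding multilinear_relations_def Let_def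
    by (auto simp: V V' F.free_gen_carrier upd_mem simp del: fun_upd_apply intro!: F.M.M.minus_closed)
qed

lemma kernel_submodule: "submodule (tensor_kernel K I V) K F.F"
proof (rule vspace.submodule_closedI)
  show "vspace K F.F" by unfold_locales
  have "carrier F.F \<in> {N. submodule N K F.F \<and> multilinear_relations K I V \<subseteq> N}"
    using F.M.carrier_is_submodule relations_carrier by auto
  then show "tensor_kernel K I V \<subseteq> carrier F.F" unfolding tensor_kernel_def submodule_span_def by (rule Inter_lower)
  show "\<zero>\<^bsub>F.F\<^esub> \<in> tensor_kernel K I V"
    unfolding tensor_kernel_def submodule_span_def using submodule.axioms(1) subgroup.one_closed by fastforce
qed (auto simp: tensor_kernel_def submodule_span_def F.M.submoduleE(4,5))

sublocale Q: quotient_by_submodule K F.F "tensor_kernel K I V"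
  by (intro quotient_by_submodule.intro quotient_by_submodule_axioms.intro F.M.module_axioms kernel_submodule)

lemma relations_in_kernel: "multilinear_relations K I V \<subseteq> tensor_kernel K I V"
  unfolding tensor_kernel_def submodule_span_def by auto

lemma tensor_module_module: "module K T"
  unfolding tensor_module_def by (rule Q.quotient_module_module)

lemma pure_closed: "b \<in> B \<Longrightarrow> pure b \<in> carrier T"
  unfolding tensor_module_def pure_tensor_def by (intro Q.q_closed F.free_gen_carrier)

lemma pure_multilinear: "multilinear K I V T pure"
proof -
  note q = Q.q_closed Q.q_add Q.q_smult F.free_gen_carrier
  have "pure (b(i := v \<oplus>\<^bsub>V i\<^esub> w)) = pure (b(i := v)) \<oplus>\<^bsub>T\<^esub> pure (b(i := w))"
    if "b \<in> B" "i \<in> I" "v \<in> carrier (V i)" "w \<in> carrier (V i)" for b i v w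
  proof -
    interpret Vi: module K "V i" using V_module that by blast
    have "free_gen K (b(i := v \<oplus>\<^bsub>V i\<^esub> w))
        \<ominus>\<^bsub>F.F\<^esub> (free_gen K (b(i := v)) \<oplus>\<^bsub>F.F\<^esub> free_gen K (b(i := w))) \<in> multilinear_relations K I V"
      unfolding multilinear_relations_def Let_def using that by blast
    then show ?thesis unfolding tensor_module_def pure_tensor_def using that relations_in_kernel
      by (subst Q.q_add) (auto simp: q upd_mem Q.q_eq_iff)
  qed
  moreover have "pure (b(i := a \<odot>\<^bsub>V i\<^esub> v)) = a \<odot>\<^bsub>T\<^esub> pure (b(i := v))"
    if "b \<in> B" "i \<in> I" "v \<in> carrier (V i)" "a \<in> carrier K" for b i v a
  proof -
    interpret Vi: module K "V i" using V_module that by blast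
    have "free_gen K (b(i := a \<odot>\<^bsub>V i\<^esub> v)) \<ominus>\<^bsub>F.F\<^esub> (a \<odot>\<^bsub>F.F\<^esub> free_gen K (b(i := v))) \<in> multilinear_relations K I V"
      unfolding multilinear_relations_def Let_def using that by blast
    then show ?thesis unfolding tensor_module_def pure_tensor_def using that relations_in_kernel
      by (subst Q.q_smult) (auto simp: q upd_mem Q.q_eq_iff)
  qed
  ultimately show ?thesis unfolding multilinear_def using pure_closed by blast
qed

text \<open>
  The universal property, stated on the free module: both kinds of relations are mapped to zero by
  a linear map that is multilinear on generators.
\<close>

lemma kills_kernel:
  assumes W: "module K W" and h: "linear_map K F.F W h"
    and f: "multilinear K I V W f" and gen: "\<And>b. b \<in> B \<Longrightarrow> h (free_gen K b) = f b"
    and c: "c \<in> tensor_kernel K I V"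
  shows "h c = \<zero>\<^bsub>W\<^esub>"
proof -
  interpret W: module K W by fact
  let ?N = "{c \<in> carrier F.F. h c = \<zero>\<^bsub>W\<^esub>}"
  note [simp] = linear_mapD[OF h] linear_map_zero[OF F.M.module_axioms W h] linear_map_minus[OF F.M.module_axioms W h]
  have "submodule ?N K F.F"
  proof (rule vspace.submodule_closedI)
    show "vspace K F.F" by unfold_locales
  qed auto
  moreover have "multilinear_relations K I V \<subseteq> ?N"
  proof
    fix r assume r: "r \<in> multilinear_relations K I V"
    then have rC: "r \<in> carrier F.F" using relations_carrier by blast
    consider (add) b i v w where "b \<in> B" "i \<in> I" "v \<in> carrier (V i)" "w \<in> carrier (V i)"
        "r = free_gen K (b(i := v \<oplus>\<^bsub>V i\<^esub> w)) \<ominus>\<^bsub>F.F\<^esub> (free_gen K (b(i := v)) \<oplus>\<^bsub>F.F\<^esub> free_gen K (b(i := w)))"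
      | (smult) b i a v where "b \<in> B" "i \<in> I" "a \<in> carrier K" "v \<in> carrier (V i)"
        "r = free_gen K (b(i := a \<odot>\<^bsub>V i\<^esub> v)) \<ominus>\<^bsub>F.F\<^esub> (a \<odot>\<^bsub>F.F\<^esub> free_gen K (b(i := v)))"
      using r unfolding multilinear_relations_def Let_def by blast
    then have "h r = \<zero>\<^bsub>W\<^esub>"
    proof cases
      case add
      interpret Vi: module K "V i" using V_module add by blast
      note u = upd_mem[OF add(1,2)]
      have "f (b(i := v)) \<in> carrier W" "f (b(i := w)) \<in> carrier W" using f u add unfolding multilinear_def by auto
      moreover have "f (b(i := v \<oplus>\<^bsub>V i\<^esub> w)) = f (b(i := v)) \<oplus>\<^bsub>W\<^esub> f (b(i := w))"
        using f add unfolding multilinear_def by blast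
      moreover have "h r = f (b(i := v \<oplus>\<^bsub>V i\<^esub> w)) \<ominus>\<^bsub>W\<^esub> (f (b(i := v)) \<oplus>\<^bsub>W\<^esub> f (b(i := w)))"
        using add u by (simp add: F.free_gen_carrier gen)
      ultimately show ?thesis by (simp add: a_minus_def W.M.r_neg)
    next
      case smult
      interpret Vi: module K "V i" using V_module smult by blast
      note u = upd_mem[OF smult(1,2)]
      have "f (b(i := v)) \<in> carrier W" using f u smult unfolding multilinear_def by auto
      moreover have "f (b(i := a \<odot>\<^bsub>V i\<^esub> v)) = a \<odot>\<^bsub>W\<^esub> f (b(i := v))"
        using f smult unfolding multilinear_def by blast
      moreover have "h r = f (b(i := a \<odot>\<^bsub>V i\<^esub> v)) \<ominus>\<^bsub>W\<^esub> a \<odot>\<^bsub>W\<^esub> f (b(i := v))"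
        using smult u by (simp add: F.free_gen_carrier gen)
      ultimately show ?thesis using smult by (simp add: a_minus_def W.M.r_neg)
    qed
    then show "r \<in> ?N" using rC by simp
  qed
  ultimately have "tensor_kernel K I V \<subseteq> ?N" unfolding tensor_kernel_def submodule_span_def by auto
  then show ?thesis using c by auto
qed

lemma tensor_lift:
  assumes W: "module K W" and f: "multilinear K I V W f"
  obtains L where "linear_map K T W L" "\<And>b. b \<in> B \<Longrightarrow> L (pure b) = f b"
proof -
  let ?h = "F.free_lift W f"
  have h: "linear_map K F.F W ?h" "\<And>b. b \<in> B \<Longrightarrow> ?h (free_gen K b) = f b"
    using F.free_lift[OF W] f unfolding multilinear_def by auto
  define L where "L Q = ?h (SOME c. c \<in> Q)" for Q
  have L: "L (Q.q c) = ?h c" if "c \<in> carrier F.F" for c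
  proof -
    have "(SOME x. x \<in> Q.q c) \<in> Q.q c" using Q.q_self[OF that] by (rule someI[of "\<lambda>x. x \<in> Q.q c"])
    then show ?thesis unfolding L_def
      using Q.kills_coset[OF W h(1) kills_kernel[OF W h(1) f h(2)] that] by blast
  qed
  show ?thesis
  proof
    show "linear_map K T W L" unfolding tensor_module_def by (rule Q.induced_linear[OF W h(1) L])
    show "L (pure b) = f b" if "b \<in> B" for b
      unfolding pure_tensor_def using L F.free_gen_carrier that h(2) by simp
  qed
qed

text \<open>
  Identities between linear maps on a tensor product are checked on pure tensors, because these
  generate.
\<close>

lemma tensor_submodule_all:
  assumes N: "submodule N K T" and pure: "\<And>b. b \<in> B \<Longrightarrow> pure b \<in> N"
  shows "N = carrier T"
proof
  interpret T: module K T by (rule tensor_module_module)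
  show "N \<subseteq> carrier T" by (rule T.submoduleE(1)[OF N])
  have "submodule {c \<in> carrier F.F. Q.q c \<in> N} K F.F"
  proof (rule vspace.submodule_closedI)
    show "vspace K F.F" by unfold_locales
    have "\<zero>\<^bsub>T\<^esub> \<in> N" using N submodule.axioms(1) subgroup.one_closed by fastforce
    then show "\<zero>\<^bsub>F.F\<^esub> \<in> {c \<in> carrier F.F. Q.q c \<in> N}" by (simp add: tensor_module_def Q.q_zero)
  next
    fix a b assume "a \<in> {c \<in> carrier F.F. Q.q c \<in> N}" "b \<in> {c \<in> carrier F.F. Q.q c \<in> N}"
    then show "a \<oplus>\<^bsub>F.F\<^esub> b \<in> {c \<in> carrier F.F. Q.q c \<in> N}"
      using T.submoduleE(5)[OF N, of "Q.q a" "Q.q b"] by (simp add: tensor_module_def Q.q_add)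
  next
    fix k a assume "k \<in> carrier K" "a \<in> {c \<in> carrier F.F. Q.q c \<in> N}"
    then show "k \<odot>\<^bsub>F.F\<^esub> a \<in> {c \<in> carrier F.F. Q.q c \<in> N}"
      using T.submoduleE(4)[OF N, of k "Q.q a"] by (simp add: tensor_module_def Q.q_smult)
  qed auto
  then have "{c \<in> carrier F.F. Q.q c \<in> N} = carrier F.F"
    using pure by (intro F.free_submodule_all) (auto simp: pure_tensor_def F.free_gen_carrier)
  then show "carrier T \<subseteq> N"
    using Q.q_cases unfolding tensor_module_def by auto
qed

lemma tensor_linear_eqI:
  assumes W: "module K W" and h: "linear_map K T W h" and g: "linear_map K T W g"
    and eq: "\<And>b. b \<in> B \<Longrightarrow> h (pure b) = g (pure b)" and t: "t \<in> carrier T"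
  shows "h t = g t"
proof -
  interpret W: module K W by fact
  interpret T: module K T by (rule tensor_module_module)
  note [simp] = linear_mapD[OF h] linear_mapD[OF g] linear_map_zero[OF T.module_axioms W h] linear_map_zero[OF T.module_axioms W g]
  have "submodule {c \<in> carrier T. h c = g c} K T"
  proof (rule vspace.submodule_closedI)
    show "vspace K T" by unfold_locales
  qed auto
  from tensor_submodule_all[OF this] show ?thesis using eq t pure_closed by auto
qed

end

definition tensor_arg :: "'i set \<Rightarrow> ('i \<Rightarrow> 'v \<Rightarrow> 'w) \<Rightarrow> ('i \<Rightarrow> 'v) \<Rightarrow> 'i \<Rightarrow> 'w" where
  "tensor_arg I h b = (\<lambda>i\<in>I. h i (b i))"

lemma tensor_map:
  assumes "tensor_product K I V" "tensor_product K I W"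
    and h: "\<And>i. i \<in> I \<Longrightarrow> linear_map K (V i) (W i) (h i)"
  shows "linear_map K (tensor_module K I V) (tensor_module K I W) (tensor_map K I W h)"
    and "b \<in> product_set I V \<Longrightarrow> tensor_map K I W h (pure_tensor K I V b) = pure_tensor K I W (tensor_arg I h b)"
    and "b \<in> product_set I V \<Longrightarrow> tensor_arg I h b \<in> product_set I W"
proof -
  interpret V: tensor_product K I V by fact
  interpret W: tensor_product K I W by fact
  have arg: "tensor_arg I h b \<in> W.B" if "b \<in> V.B" for b
    using that linear_mapD(1)[OF h] by (auto simp: tensor_arg_def product_set_def PiE_def Pi_def)
  have fm: "free_map K (tensor_arg I h) (free_gen K b) = free_gen K (tensor_arg I h b)" if "b \<in> V.B" for b
    by (rule V.F.free_map(2)[where C = W.B]) (use arg that in auto)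
  have fm1: "linear_map K V.F.F W.F.F (free_map K (tensor_arg I h))"
    by (rule V.F.free_map(1)) (rule arg)
  define g where "g c = W.Q.q (free_map K (tensor_arg I h) c)" for c
  have g: "linear_map K V.F.F W.T g"
    unfolding g_def tensor_module_def by (rule linear_map_comp[OF fm1 W.Q.q_linear])
  have gen: "g (free_gen K b) = W.pure (tensor_arg I h b)" if "b \<in> V.B" for b
    using fm[OF that] by (simp add: g_def pure_tensor_def)
  have upd: "tensor_arg I h (b(i := v)) = (tensor_arg I h b)(i := h i v)" if "i \<in> I" for b i v
    using that by (auto simp: tensor_arg_def fun_eq_iff)
  have "multilinear K I V W.T (\<lambda>b. W.pure (tensor_arg I h b))"
    using W.pure_multilinear linear_mapD[OF h] arg unfolding multilinear_def by (simp add: upd)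
  note kills = V.kills_kernel[OF W.tensor_module_module g this gen]
  have eq: "tensor_map K I W h (V.Q.q c) = g c" if "c \<in> carrier V.F.F" for c
  proof -
    have "g d = g c" if "d \<in> V.Q.q c" for d
      by (rule V.Q.kills_coset[OF W.tensor_module_module g kills \<open>c \<in> carrier V.F.F\<close> that])
    then have "(\<Union>d\<in>V.Q.q c. g d) = g c" using V.Q.q_self[OF that] by blast
    then show ?thesis unfolding tensor_map_def quotient_map_def g_def tensor_arg_def[abs_def] .
  qed
  show "linear_map K V.T W.T (tensor_map K I W h)"
    unfolding tensor_module_def[of K I V] by (rule V.Q.induced_linear[OF W.tensor_module_module g eq])
  show "tensor_map K I W h (V.pure b) = W.pure (tensor_arg I h b)" if "b \<in> V.B"
    using eq[of "free_gen K b"] V.F.free_gen_carrier that gen by (simp add: pure_tensor_def)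
  show "tensor_arg I h b \<in> W.B" if "b \<in> V.B" by (rule arg[OF that])
qed

lemma linear_map_sum:
  assumes "module K W" "linear_map K V W g" "linear_map K V W h"
  shows "linear_map K V W (\<lambda>v. g v \<oplus>\<^bsub>W\<^esub> h v)"
proof -
  interpret W: module K W by fact
  note [simp] = linear_mapD[OF assms(2)] linear_mapD[OF assms(3)]
  show ?thesis by (rule linear_mapI) (auto simp: W.smult_r_distr W.M.a_ac)
qed

lemma linear_map_scale:
  assumes "module K W" "linear_map K V W h" "c \<in> carrier K"
  shows "linear_map K V W (\<lambda>v. c \<odot>\<^bsub>W\<^esub> h v)"
proof -
  interpret W: module K W by fact
  note [simp] = linear_mapD[OF assms(2)]
  show ?thesis
    by (rule linear_mapI) (use assms(3) in \<open>auto simp: W.smult_r_distr W.smult_assoc1[symmetric] W.R.m_comm\<close>)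
qed

lemma linear_map_rank_one:
  assumes "module K W" "linear_map K V (field_module K) l" "w \<in> carrier W"
  shows "linear_map K V W (\<lambda>v. l v \<odot>\<^bsub>W\<^esub> w)"
proof -
  interpret W: module K W by fact
  note [simp] = linear_mapD[OF assms(2), simplified]
  show ?thesis by (rule linear_mapI) (use assms(3) in \<open>auto simp: W.smult_l_distr W.smult_assoc1\<close>)
qed

lemma linear_map_id: "linear_map K V V (\<lambda>v. v)"
  by (auto simp: linear_map_def)

lemma tensor_map_cong:
  assumes V: "tensor_product K I V" and W: "tensor_product K I W"
    and h: "\<And>i. i \<in> I \<Longrightarrow> linear_map K (V i) (W i) (h i)"
    and eq: "\<And>i v. i \<in> I \<Longrightarrow> v \<in> carrier (V i) \<Longrightarrow> g i v = h i v"
    and t: "t \<in> carrier (tensor_module K I V)"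
  shows "tensor_map K I W g t = tensor_map K I W h t"
proof -
  interpret V: tensor_product K I V by fact
  interpret W: tensor_product K I W by fact
  have g: "linear_map K (V i) (W i) (g i)" if i: "i \<in> I" for i
  proof -
    interpret Vi: module K "V i" using V.V_module i by blast
    show ?thesis by (rule linear_mapI) (use i in \<open>auto simp: eq linear_mapD[OF h[OF i]]\<close>)
  qed
  note G = tensor_map[OF V W, of g, OF g] and H = tensor_map[OF V W, of h, OF h]
  show ?thesis
  proof (rule V.tensor_linear_eqI[OF W.tensor_module_module G(1) H(1) _ t])
    fix b assume b: "b \<in> V.B"
    have "tensor_arg I g b = tensor_arg I h b"
      unfolding tensor_arg_def by (rule restrict_ext) (use b V.mem eq in auto)
    then show "tensor_map K I W g (V.pure b) = tensor_map K I W h (V.pure b)"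
      using G(2) H(2) b by simp
  qed
qed

lemma tensor_map_id:
  assumes V: "tensor_product K I V"
    and eq: "\<And>i v. i \<in> I \<Longrightarrow> v \<in> carrier (V i) \<Longrightarrow> h i v = v"
    and t: "t \<in> carrier (tensor_module K I V)"
  shows "tensor_map K I V h t = t"
proof -
  interpret V: tensor_product K I V by fact
  have h: "linear_map K (V i) (V i) (h i)" if i: "i \<in> I" for i
  proof -
    interpret Vi: module K "V i" using V.V_module i by blast
    show ?thesis by (rule linear_mapI) (use i in \<open>auto simp: eq\<close>)
  qed
  note H = tensor_map[OF V V, of h, OF h]
  show ?thesis
  proof (rule V.tensor_linear_eqI[OF V.tensor_module_module H(1) linear_map_id _ t])
    fix b assume b: "b \<in> V.B"
    have "tensor_arg I h b = restrict b I"
      unfolding tensor_arg_def by (rule restrict_ext) (use b V.mem eq in auto)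
    also have "\<dots> = b" using b by (simp add: product_set_def PiE_restrict)
    finally show "tensor_map K I V h (V.pure b) = V.pure b"
      using H(2) b by simp
  qed
qed

lemma tensor_map_comp:
  assumes U: "tensor_product K I U" and V: "tensor_product K I V" and W: "tensor_product K I W"
    and g: "\<And>i. i \<in> I \<Longrightarrow> linear_map K (U i) (V i) (g i)"
    and h: "\<And>i. i \<in> I \<Longrightarrow> linear_map K (V i) (W i) (h i)"
    and t: "t \<in> carrier (tensor_module K I U)"
  shows "tensor_map K I W (\<lambda>i v. h i (g i v)) t = tensor_map K I W h (tensor_map K I V g t)"
proof -
  interpret U: tensor_product K I U by fact
  interpret V: tensor_product K I V by fact
  interpret W: tensor_product K I W by fact
  note G = tensor_map[OF U V, of g, OF g] and H = tensor_map[OF V W, of h, OF h]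
    and GH = tensor_map[OF U W, of "\<lambda>i v. h i (g i v)", OF linear_map_comp[OF g h]]
  show ?thesis
  proof (rule U.tensor_linear_eqI[OF W.tensor_module_module GH(1) linear_map_comp[OF G(1) H(1)] _ t])
    fix b assume b: "b \<in> U.B"
    have "tensor_arg I (\<lambda>i v. h i (g i v)) b = tensor_arg I h (tensor_arg I g b)"
      by (auto simp: tensor_arg_def)
    then show "tensor_map K I W (\<lambda>i v. h i (g i v)) (U.pure b) = tensor_map K I W h (tensor_map K I V g (U.pure b))"
      using G(2,3) H(2) GH(2) b by simp
  qed simp_all
qed

text \<open>
  The tensor product of linear maps is multilinear in these maps.
\<close>

lemma tensor_map_upd:
  assumes V: "tensor_product K I V" and W: "tensor_product K I W"
    and h: "\<And>i. i \<in> I \<Longrightarrow> i \<noteq> j \<Longrightarrow> linear_map K (V i) (W i) (h i)"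
    and j: "j \<in> I" and f: "linear_map K (V j) (W j) f"
    and t: "t \<in> carrier (tensor_module K I V)"
  shows tensor_map_upd_closed: "tensor_map K I W (h(j := f)) t \<in> carrier (tensor_module K I W)"
    and tensor_map_upd_add: "linear_map K (V j) (W j) g \<Longrightarrow> tensor_map K I W (h(j := \<lambda>v. f v \<oplus>\<^bsub>W j\<^esub> g v)) t =
      tensor_map K I W (h(j := f)) t \<oplus>\<^bsub>tensor_module K I W\<^esub> tensor_map K I W (h(j := g)) t"
    and tensor_map_upd_smult: "c \<in> carrier K \<Longrightarrow> tensor_map K I W (h(j := \<lambda>v. c \<odot>\<^bsub>W j\<^esub> f v)) t =
      c \<odot>\<^bsub>tensor_module K I W\<^esub> tensor_map K I W (h(j := f)) t"
proof -
  interpret V: tensor_product K I V by fact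
  interpret W: tensor_product K I W by fact
  interpret Wj: module K "W j" using W.V_module j by blast
  have L: "linear_map K (V i) (W i) ((h(j := k)) i)" if "i \<in> I" "linear_map K (V j) (W j) k" for i k
    using h that by auto
  note M = tensor_map[OF V W, of "h(j := k)" for k, OF L]
  have arg: "tensor_arg I (h(j := k)) b = (tensor_arg I h b)(j := k (b j))" for k b
    using j by (auto simp: tensor_arg_def)
  have argmem: "(tensor_arg I h b)(j := w) \<in> W.B" if "b \<in> V.B" "w \<in> carrier (W j)" for b w
  proof -
    have "h i (b i) \<in> carrier (W i)" if "i \<in> I" "i \<noteq> j" for i
      using linear_mapD(1)[OF h[OF that] V.mem[OF \<open>b \<in> V.B\<close> that(1)]] .
    then show ?thesis unfolding product_set_def using that j by (intro PiE_I) (auto simp: tensor_arg_def)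
  qed
  show "tensor_map K I W (h(j := f)) t \<in> carrier W.T" by (rule linear_mapD(1)[OF M(1)[OF _ f] t]) auto
  show "tensor_map K I W (h(j := \<lambda>v. f v \<oplus>\<^bsub>W j\<^esub> g v)) t =
      tensor_map K I W (h(j := f)) t \<oplus>\<^bsub>W.T\<^esub> tensor_map K I W (h(j := g)) t"
    if g: "linear_map K (V j) (W j) g"
  proof (rule V.tensor_linear_eqI[OF W.tensor_module_module _ _ _ t])
    note fg = linear_map_sum[OF Wj.module_axioms f g]
    show "linear_map K V.T W.T (tensor_map K I W (h(j := \<lambda>v. f v \<oplus>\<^bsub>W j\<^esub> g v)))" by (rule M(1)[OF _ fg])
    show "linear_map K V.T W.T (\<lambda>t. tensor_map K I W (h(j := f)) t \<oplus>\<^bsub>W.T\<^esub> tensor_map K I W (h(j := g)) t)"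
      by (rule linear_map_sum[OF W.tensor_module_module M(1)[OF _ f] M(1)[OF _ g]])
    fix b assume b: "b \<in> V.B"
    have c: "f (b j) \<in> carrier (W j)" "g (b j) \<in> carrier (W j)"
      using linear_mapD(1)[OF f] linear_mapD(1)[OF g] V.mem[OF b j] by auto
    have "W.pure ((tensor_arg I h b)(j := f (b j), j := f (b j) \<oplus>\<^bsub>W j\<^esub> g (b j))) =
        W.pure ((tensor_arg I h b)(j := f (b j), j := f (b j))) \<oplus>\<^bsub>W.T\<^esub> W.pure ((tensor_arg I h b)(j := f (b j), j := g (b j)))"
      using W.pure_multilinear argmem[OF b c(1)] c j unfolding multilinear_def by blast
    then show "tensor_map K I W (h(j := \<lambda>v. f v \<oplus>\<^bsub>W j\<^esub> g v)) (V.pure b) =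
        tensor_map K I W (h(j := f)) (V.pure b) \<oplus>\<^bsub>W.T\<^esub> tensor_map K I W (h(j := g)) (V.pure b)"
      using M(2)[OF _ f b] M(2)[OF _ g b] M(2)[OF _ fg b] by (simp add: arg)
  qed
  show "tensor_map K I W (h(j := \<lambda>v. c \<odot>\<^bsub>W j\<^esub> f v)) t = c \<odot>\<^bsub>W.T\<^esub> tensor_map K I W (h(j := f)) t"
    if c: "c \<in> carrier K"
  proof (rule V.tensor_linear_eqI[OF W.tensor_module_module _ _ _ t])
    note cf = linear_map_scale[OF Wj.module_axioms f c]
    show "linear_map K V.T W.T (tensor_map K I W (h(j := \<lambda>v. c \<odot>\<^bsub>W j\<^esub> f v)))" by (rule M(1)[OF _ cf])
    show "linear_map K V.T W.T (\<lambda>t. c \<odot>\<^bsub>W.T\<^esub> tensor_map K I W (h(j := f)) t)"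
      by (rule linear_map_scale[OF W.tensor_module_module M(1)[OF _ f] c])
    fix b assume b: "b \<in> V.B"
    have fb: "f (b j) \<in> carrier (W j)" using linear_mapD(1)[OF f] V.mem[OF b j] by auto
    have "W.pure ((tensor_arg I h b)(j := f (b j), j := c \<odot>\<^bsub>W j\<^esub> f (b j))) =
        c \<odot>\<^bsub>W.T\<^esub> W.pure ((tensor_arg I h b)(j := f (b j), j := f (b j)))"
      using W.pure_multilinear argmem[OF b fb] fb c j unfolding multilinear_def by blast
    then show "tensor_map K I W (h(j := \<lambda>v. c \<odot>\<^bsub>W j\<^esub> f v)) (V.pure b) = c \<odot>\<^bsub>W.T\<^esub> tensor_map K I W (h(j := f)) (V.pure b)"
      using M(2)[OF _ f b] M(2)[OF _ cf b] by (simp add: arg)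
  qed
qed

context tensor_product
begin

lemma finprod_upd:
  assumes "finite J" "\<And>i. i \<in> J \<Longrightarrow> c i \<in> carrier K" "j \<in> J" "a \<in> carrier K"
  shows "(\<Otimes>\<^bsub>K\<^esub>i\<in>J. if i = j then a else c i) = a \<otimes>\<^bsub>K\<^esub> (\<Otimes>\<^bsub>K\<^esub>i\<in>J - {j}. c i)"
proof -
  have "(\<Otimes>\<^bsub>K\<^esub>i\<in>insert j (J - {j}). if i = j then a else c i) =
      a \<otimes>\<^bsub>K\<^esub> (\<Otimes>\<^bsub>K\<^esub>i\<in>J - {j}. if i = j then a else c i)"
    using assms by (subst finprod_insert) auto
  also have "(\<Otimes>\<^bsub>K\<^esub>i\<in>J - {j}. if i = j then a else c i) = (\<Otimes>\<^bsub>K\<^esub>i\<in>J - {j}. c i)"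
    by (rule finprod_cong') (use assms in auto)
  finally show ?thesis using assms by (simp add: insert_absorb)
qed

lemma functional_upd:
  assumes J: "finite J" "J \<subseteq> I" and l: "\<And>i. i \<in> J \<Longrightarrow> linear_map K (V i) (field_module K) (l i)"
    and b: "b \<in> B" and j: "j \<in> J" and v: "v \<in> carrier (V j)"
  shows "(\<Otimes>\<^bsub>K\<^esub>i\<in>J. l i ((b(j := v)) i)) = l j v \<otimes>\<^bsub>K\<^esub> (\<Otimes>\<^bsub>K\<^esub>i\<in>J - {j}. l i (b i))"
proof -
  have c: "l i (b i) \<in> carrier K" if "i \<in> J" for i using linear_mapD(1)[OF l[OF that]] mem b that J by auto
  have c': "l j v \<in> carrier K" using linear_mapD(1)[OF l[OF j]] v by auto
  have "(\<Otimes>\<^bsub>K\<^esub>i\<in>J. l i ((b(j := v)) i)) = (\<Otimes>\<^bsub>K\<^esub>i\<in>J. if i = j then l j v else l i (b i))"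
    by (rule finprod_cong') (use c c' in auto)
  then show ?thesis using finprod_upd[OF J(1) c j c'] by simp
qed

lemma functional_closed:
  assumes "J \<subseteq> I" "\<And>i. i \<in> J \<Longrightarrow> linear_map K (V i) (field_module K) (l i)" "b \<in> B"
  shows "(\<Otimes>\<^bsub>K\<^esub>i\<in>J. l i (b i)) \<in> carrier K"
  using assms linear_mapD(1)[OF assms(2)] mem by (intro finprod_closed) (auto simp: subset_iff)

lemma multilinear_functional:
  assumes fin: "finite I" and l: "\<And>i. i \<in> I \<Longrightarrow> linear_map K (V i) (field_module K) (l i)"
  shows "multilinear K I V (field_module K) (\<lambda>b. \<Otimes>\<^bsub>K\<^esub>i\<in>I. l i (b i))"
  unfolding multilinear_def
proof (intro ballI conjI)
  fix b assume b: "b \<in> B"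
  show "(\<Otimes>\<^bsub>K\<^esub>i\<in>I. l i (b i)) \<in> carrier (field_module K)" using functional_closed[OF _ l b] by simp
  fix j assume j: "j \<in> I"
  interpret Vj: module K "V j" using V_module j by blast
  note u = functional_upd[OF fin order_refl l b j] and lj = linear_mapD[OF l[OF j], simplified]
  have c: "(\<Otimes>\<^bsub>K\<^esub>i\<in>I - {j}. l i (b i)) \<in> carrier K" using functional_closed[OF _ l b] by blast
  fix v assume v: "v \<in> carrier (V j)"
  show "(\<Otimes>\<^bsub>K\<^esub>i\<in>I. l i ((b(j := v \<oplus>\<^bsub>V j\<^esub> w)) i)) =
      (\<Otimes>\<^bsub>K\<^esub>i\<in>I. l i ((b(j := v)) i)) \<oplus>\<^bsub>field_module K\<^esub> (\<Otimes>\<^bsub>K\<^esub>i\<in>I. l i ((b(j := w)) i))"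
    if w: "w \<in> carrier (V j)" for w
    using v w c by (simp only: u Vj.M.a_closed lj field_module_simps l_distr)
next
  fix b j a v assume b: "b \<in> B" and j: "j \<in> I" and a: "a \<in> carrier K" and v: "v \<in> carrier (V j)"
  interpret Vj: module K "V j" using V_module j by blast
  note u = functional_upd[OF fin order_refl l b j] and lj = linear_mapD[OF l[OF j], simplified]
  have c: "(\<Otimes>\<^bsub>K\<^esub>i\<in>I - {j}. l i (b i)) \<in> carrier K" using functional_closed[OF _ l b] by blast
  show "(\<Otimes>\<^bsub>K\<^esub>i\<in>I. l i ((b(j := a \<odot>\<^bsub>V j\<^esub> v)) i)) = a \<odot>\<^bsub>field_module K\<^esub> (\<Otimes>\<^bsub>K\<^esub>i\<in>I. l i ((b(j := v)) i))"
    using v a c by (simp only: u Vj.smult_closed lj field_module_simps m_assoc)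
qed

text \<open>
  Contraction of all factors except the one at \<open>p\<close>.
\<close>

lemma multilinear_contraction:
  assumes fin: "finite I" and l: "\<And>i. i \<in> I \<Longrightarrow> linear_map K (V i) (field_module K) (l i)" and p: "p \<in> I"
  shows "multilinear K I V (V p) (\<lambda>b. (\<Otimes>\<^bsub>K\<^esub>i\<in>I - {p}. l i (b i)) \<odot>\<^bsub>V p\<^esub> b p)"
proof -
  interpret Vp: module K "V p" using V_module p by blast
  have l': "\<And>i. i \<in> I - {p} \<Longrightarrow> linear_map K (V i) (field_module K) (l i)" using l by blast
  have fin': "finite (I - {p})" using fin by simp
  have c: "(\<Otimes>\<^bsub>K\<^esub>i\<in>J. l i (b i)) \<in> carrier K" if "b \<in> B" "J \<subseteq> I" for b J
    using functional_closed[OF that(2) _ that(1)] l that(2) by blast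
  have same: "(\<Otimes>\<^bsub>K\<^esub>i\<in>I - {p}. l i ((b(p := v)) i)) = (\<Otimes>\<^bsub>K\<^esub>i\<in>I - {p}. l i (b i))" if b: "b \<in> B" for b v
    by (rule finprod_cong') (use linear_mapD(1)[OF l] mem[OF b] in auto)
  show ?thesis
    unfolding multilinear_def
  proof (intro ballI conjI)
    fix b assume b: "b \<in> B"
    show "(\<Otimes>\<^bsub>K\<^esub>i\<in>I - {p}. l i (b i)) \<odot>\<^bsub>V p\<^esub> b p \<in> carrier (V p)" using c b mem p by blast
    fix j assume j: "j \<in> I"
    interpret Vj: module K "V j" using V_module j by blast
    note lj = linear_mapD[OF l[OF j], simplified]
    fix v assume v: "v \<in> carrier (V j)"
    show "(\<Otimes>\<^bsub>K\<^esub>i\<in>I - {p}. l i ((b(j := v \<oplus>\<^bsub>V j\<^esub> w)) i)) \<odot>\<^bsub>V p\<^esub> (b(j := v \<oplus>\<^bsub>V j\<^esub> w)) p =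
        (\<Otimes>\<^bsub>K\<^esub>i\<in>I - {p}. l i ((b(j := v)) i)) \<odot>\<^bsub>V p\<^esub> (b(j := v)) p \<oplus>\<^bsub>V p\<^esub>
        (\<Otimes>\<^bsub>K\<^esub>i\<in>I - {p}. l i ((b(j := w)) i)) \<odot>\<^bsub>V p\<^esub> (b(j := w)) p" if w: "w \<in> carrier (V j)" for w
    proof (cases "j = p")
      case True
      then have "v \<in> carrier (V p)" "w \<in> carrier (V p)" using v w by auto
      then show ?thesis unfolding True same[OF b] using c[OF b, of "I - {p}"] by (simp add: Vp.smult_r_distr)
    next
      case False
      then have jp: "j \<in> I - {p}" using j by blast
      have u: "(\<Otimes>\<^bsub>K\<^esub>i\<in>I - {p}. l i ((b(j := x)) i)) = l j x \<otimes>\<^bsub>K\<^esub> (\<Otimes>\<^bsub>K\<^esub>i\<in>I - {p} - {j}. l i (b i))"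
        if "x \<in> carrier (V j)" for x
        by (rule functional_upd[OF fin' Diff_subset l' b jp that])
      have "b p \<in> carrier (V p)" using mem b p by blast
      moreover have "(b(j := x)) p = b p" for x using False by simp
      ultimately show ?thesis
        unfolding u[OF v] u[OF w] u[OF Vj.M.a_closed[OF v w]] lj(2)[OF v w]
        using lj(1)[OF v] lj(1)[OF w] c[OF b, of "I - {p} - {j}"]
        by (simp add: l_distr Vp.smult_l_distr Diff_subset subset_iff)
    qed
  next
    fix b j a v assume b: "b \<in> B" and j: "j \<in> I" and a: "a \<in> carrier K" and v: "v \<in> carrier (V j)"
    interpret Vj: module K "V j" using V_module j by blast
    note lj = linear_mapD[OF l[OF j], simplified]
    show "(\<Otimes>\<^bsub>K\<^esub>i\<in>I - {p}. l i ((b(j := a \<odot>\<^bsub>V j\<^esub> v)) i)) \<odot>\<^bsub>V p\<^esub> (b(j := a \<odot>\<^bsub>V j\<^esub> v)) p =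
        a \<odot>\<^bsub>V p\<^esub> ((\<Otimes>\<^bsub>K\<^esub>i\<in>I - {p}. l i ((b(j := v)) i)) \<odot>\<^bsub>V p\<^esub> (b(j := v)) p)"
    proof (cases "j = p")
      case True
      then have "v \<in> carrier (V p)" using v by auto
      then show ?thesis unfolding True same[OF b] using a c[OF b, of "I - {p}"]
        by (simp add: Vp.smult_assoc1[symmetric] m_comm)
    next
      case False
      then have jp: "j \<in> I - {p}" using j by blast
      have u: "(\<Otimes>\<^bsub>K\<^esub>i\<in>I - {p}. l i ((b(j := x)) i)) = l j x \<otimes>\<^bsub>K\<^esub> (\<Otimes>\<^bsub>K\<^esub>i\<in>I - {p} - {j}. l i (b i))"
        if "x \<in> carrier (V j)" for x
        by (rule functional_upd[OF fin' Diff_subset l' b jp that])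
      have "b p \<in> carrier (V p)" using mem b p by blast
      moreover have "(b(j := x)) p = b p" for x using False by simp
      ultimately show ?thesis
        unfolding u[OF v] u[OF Vj.smult_closed[OF a v]] lj(3)[OF a v]
        using lj(1)[OF v] a c[OF b, of "I - {p} - {j}"]
        by (simp add: m_assoc Vp.smult_assoc1 Diff_subset subset_iff)
    qed
  qed
qed

lemma pure_smult:
  assumes fin: "finite I" and c: "\<And>i. i \<in> I \<Longrightarrow> c i \<in> carrier K" and e: "e \<in> B"
  shows "pure (\<lambda>i\<in>I. c i \<odot>\<^bsub>V i\<^esub> e i) = (\<Otimes>\<^bsub>K\<^esub>i\<in>I. c i) \<odot>\<^bsub>T\<^esub> pure e"
proof -
  interpret T: module K T by (rule tensor_module_module)
  have "J \<subseteq> I \<Longrightarrow> pure (\<lambda>i\<in>I. if i \<in> J then c i \<odot>\<^bsub>V i\<^esub> e i else e i) = (\<Otimes>\<^bsub>K\<^esub>i\<in>J. c i) \<odot>\<^bsub>T\<^esub> pure e"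
    if "finite J" for J
    using that
  proof (induction J)
    case empty
    have "(\<lambda>i\<in>I. e i) = e" using e by (simp add: product_set_def PiE_restrict)
    then show ?case using pure_closed[OF e] by simp
  next
    case (insert j J)
    then have j: "j \<in> I" "J \<subseteq> I" by auto
    let ?b = "\<lambda>i\<in>I. if i \<in> J then c i \<odot>\<^bsub>V i\<^esub> e i else e i"
    have "c i \<odot>\<^bsub>V i\<^esub> e i \<in> carrier (V i)" if "i \<in> I" for i
      using module.smult_closed[OF V_module[OF that] c[OF that]] mem[OF e that] by blast
    then have b: "?b \<in> B" using mem[OF e] unfolding product_set_def by auto
    have upd: "(\<lambda>i\<in>I. if i \<in> insert j J then c i \<odot>\<^bsub>V i\<^esub> e i else e i) = ?b(j := c j \<odot>\<^bsub>V j\<^esub> e j)"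
      using j by (auto simp: fun_eq_iff)
    have upd': "?b(j := e j) = ?b" using j insert.hyps by (auto simp: fun_eq_iff)
    have "pure (?b(j := c j \<odot>\<^bsub>V j\<^esub> e j)) = c j \<odot>\<^bsub>T\<^esub> pure (?b(j := e j))"
      using pure_multilinear b c[OF j(1)] mem[OF e j(1)] j unfolding multilinear_def by blast
    moreover have IH: "pure ?b = (\<Otimes>\<^bsub>K\<^esub>i\<in>J. c i) \<odot>\<^bsub>T\<^esub> pure e" by (rule insert.IH[OF j(2)])
    moreover have "c j \<odot>\<^bsub>T\<^esub> ((\<Otimes>\<^bsub>K\<^esub>i\<in>J. c i) \<odot>\<^bsub>T\<^esub> pure e) = (\<Otimes>\<^bsub>K\<^esub>i\<in>insert j J. c i) \<odot>\<^bsub>T\<^esub> pure e"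
    proof -
      have "(\<Otimes>\<^bsub>K\<^esub>i\<in>J. c i) \<in> carrier K" using c j by (intro finprod_closed) auto
      moreover have "(\<Otimes>\<^bsub>K\<^esub>i\<in>insert j J. c i) = c j \<otimes>\<^bsub>K\<^esub> (\<Otimes>\<^bsub>K\<^esub>i\<in>J. c i)"
        using insert c j by (subst finprod_insert) auto
      ultimately show ?thesis using pure_closed[OF e] c[OF j(1)] by (simp add: T.smult_assoc1)
    qed
    ultimately show ?case unfolding upd upd' by (simp only:)
  qed
  from this[OF fin order_refl] show ?thesis by (simp add: restrict_def cong: if_cong)
qed

lemma rank_one_tensor:
  assumes fin: "finite I" and l: "\<And>i. i \<in> I \<Longrightarrow> linear_map K (V i) (field_module K) (l i)"
    and L: "linear_map K T (field_module K) L" "\<And>b. b \<in> B \<Longrightarrow> L (pure b) = (\<Otimes>\<^bsub>K\<^esub>i\<in>I. l i (b i))"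
    and W: "tensor_product K I W" and w: "w \<in> product_set I W" and t: "t \<in> carrier T"
  shows "tensor_map K I W (\<lambda>i v. l i v \<odot>\<^bsub>W i\<^esub> w i) t = L t \<odot>\<^bsub>tensor_module K I W\<^esub> pure_tensor K I W w"
proof -
  interpret W: tensor_product K I W by fact
  have h: "linear_map K (V i) (W i) (\<lambda>v. l i v \<odot>\<^bsub>W i\<^esub> w i)" if "i \<in> I" for i
    by (rule linear_map_rank_one[OF W.V_module l W.mem[OF w]]) (use that in auto)
  note M = tensor_map[OF tensor_product_axioms W, of "\<lambda>i v. l i v \<odot>\<^bsub>W i\<^esub> w i", OF h]
  show ?thesis
  proof (rule tensor_linear_eqI[OF W.tensor_module_module M(1) linear_map_rank_one[OF W.tensor_module_module L(1) W.pure_closed[OF w]] _ t])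
    fix b assume b: "b \<in> B"
    have "\<And>i. i \<in> I \<Longrightarrow> l i (b i) \<in> carrier K" using linear_mapD(1)[OF l] mem[OF b] by auto
    from W.pure_smult[OF fin this w] M(2)[OF _ b] L(2)[OF b]
    show "tensor_map K I W (\<lambda>i v. l i v \<odot>\<^bsub>W i\<^esub> w i) (pure b) = L (pure b) \<odot>\<^bsub>W.T\<^esub> W.pure w"
      by (simp add: tensor_arg_def)
  qed auto
qed

text \<open>
  Products of functionals separate the points of a finite tensor product of finitely generated
  spaces: the identity of each factor is a sum of maps of rank one, and a tensor product of maps of
  rank one factors through a product of functionals, by \<open>rank_one_tensor\<close>.
\<close>

lemma product_functional_nonzero:
  assumes fin: "finite I"
    and fd: "\<And>i. i \<in> I \<Longrightarrow> \<exists>vs. set vs \<subseteq> carrier (V i) \<and> carrier (V i) = lspan K (V i) vs"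
    and t: "t \<in> carrier T" "t \<noteq> \<zero>\<^bsub>T\<^esub>"
  obtains l L where "\<And>i. i \<in> I \<Longrightarrow> linear_map K (V i) (field_module K) (l i)"
    "linear_map K T (field_module K) L" "\<And>b. b \<in> B \<Longrightarrow> L (pure b) = (\<Otimes>\<^bsub>K\<^esub>i\<in>I. l i (b i))"
    "L t \<noteq> \<zero>\<^bsub>K\<^esub>"
proof (rule ccontr)
  assume none: "\<not> thesis"
  note found = that
  interpret T: module K T by (rule tensor_module_module)
  let ?r1 = "\<lambda>i h. \<exists>l e. linear_map K (V i) (field_module K) l \<and> e \<in> carrier (V i) \<and> h = (\<lambda>v. l v \<odot>\<^bsub>V i\<^esub> e)"
  \<comment> \<open>The maps of rank one are replaced by identities at one index after the other.\<close>
  have kill: "J \<subseteq> I \<Longrightarrow> (\<And>i. i \<in> I - J \<Longrightarrow> ?r1 i (h i)) \<Longrightarrow> (\<And>i. i \<in> J \<Longrightarrow> h i = (\<lambda>v. v)) \<Longrightarrow>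
      tensor_map K I V h t = \<zero>\<^bsub>T\<^esub>" if "finite J" for J h
    using that
  proof (induction J arbitrary: h)
    case empty
    then have "\<forall>i\<in>I. ?r1 i (h i)" by simp
    then obtain l e where le: "\<And>i. i \<in> I \<Longrightarrow> linear_map K (V i) (field_module K) (l i)"
      "\<And>i. i \<in> I \<Longrightarrow> e i \<in> carrier (V i)" "\<And>i. i \<in> I \<Longrightarrow> h i = (\<lambda>v. l i v \<odot>\<^bsub>V i\<^esub> e i)"
      by metis
    obtain L where L: "linear_map K T (field_module K) L" "\<And>b. b \<in> B \<Longrightarrow> L (pure b) = (\<Otimes>\<^bsub>K\<^esub>i\<in>I. l i (b i))"
      using tensor_lift[OF field_module_module[OF cring_axioms] multilinear_functional[OF fin le(1)]] by blast
    have L0: "L t = \<zero>\<^bsub>K\<^esub>" using none found[OF le(1) L] by blast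
    define e' where "e' = restrict e I"
    have e': "e' \<in> B" using le(2) by (auto simp: e'_def product_set_def)
    have lin: "\<And>i. i \<in> I \<Longrightarrow> linear_map K (V i) (V i) (\<lambda>v. l i v \<odot>\<^bsub>V i\<^esub> e' i)"
      by (rule linear_map_rank_one[OF V_module le(1) mem[OF e']]) auto
    have "tensor_map K I V h t = tensor_map K I V (\<lambda>i v. l i v \<odot>\<^bsub>V i\<^esub> e' i) t"
      by (rule tensor_map_cong[OF tensor_product_axioms tensor_product_axioms lin _ t(1)]) (auto simp: le(3) e'_def)
    also have "\<dots> = L t \<odot>\<^bsub>T\<^esub> pure e'"
      by (rule rank_one_tensor[OF fin le(1) L tensor_product_axioms e' t(1)])
    finally show ?case using L0 pure_closed[OF e'] by simp
  next
    case (insert j J)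
    have j: "j \<in> I" "J \<subseteq> I" using insert by auto
    interpret Vj: module K "V j" using V_module j by blast
    interpret Vj: vspace K "V j" by unfold_locales
    have hlin: "linear_map K (V i) (V i) (h i)" if "i \<in> I" "i \<noteq> j" for i
    proof (cases "i \<in> J")
      case True
      then show ?thesis using insert.prems(3)[of i] linear_map_id by simp
    next
      case False
      then have "?r1 i (h i)" using insert.prems(2)[of i] that by simp
      then show ?thesis using linear_map_rank_one[OF V_module[OF that(1)]] by auto
    qed
    have one: "tensor_map K I V (h(j := f)) t = \<zero>\<^bsub>T\<^esub>" if "?r1 j f" for f
      using insert.prems insert.hyps that by (intro insert.IH[OF j(2)]) auto
    obtain D where D: "\<And>l e. (l, e) \<in> set D \<Longrightarrow> linear_map K (V j) (field_module K) l \<and> e \<in> carrier (V j)"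
      "\<And>v. v \<in> carrier (V j) \<Longrightarrow> Vj.sum_rank_one D v = v"
      using Vj.dual_basis fd[OF j(1)] by metis
    have "(\<And>l e. (l, e) \<in> set D' \<Longrightarrow> linear_map K (V j) (field_module K) l \<and> e \<in> carrier (V j)) \<Longrightarrow>
        linear_map K (V j) (V j) (Vj.sum_rank_one D') \<and> tensor_map K I V (h(j := Vj.sum_rank_one D')) t = \<zero>\<^bsub>T\<^esub>" for D'
    proof (induction D')
      case Nil
      have z: "Vj.sum_rank_one [] = (\<lambda>v. \<zero>\<^bsub>K\<^esub> \<odot>\<^bsub>V j\<^esub> \<zero>\<^bsub>V j\<^esub>)" by (simp add: Vj.sum_rank_one_def fun_eq_iff)
      have "linear_map K (V j) (field_module K) (\<lambda>v. \<zero>\<^bsub>K\<^esub>)" by (rule linear_mapI) auto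
      then have "linear_map K (V j) (V j) (\<lambda>v. \<zero>\<^bsub>K\<^esub> \<odot>\<^bsub>V j\<^esub> \<zero>\<^bsub>V j\<^esub>)" "?r1 j (\<lambda>v. \<zero>\<^bsub>K\<^esub> \<odot>\<^bsub>V j\<^esub> \<zero>\<^bsub>V j\<^esub>)"
        using linear_map_rank_one[OF Vj.module_axioms _ Vj.M.zero_closed] by blast+
      then show ?case unfolding z using one by blast
    next
      case (Cons d D')
      obtain l e where d: "d = (l, e)" by force
      then have le: "linear_map K (V j) (field_module K) l" "e \<in> carrier (V j)" using Cons.prems by auto
      have IH: "linear_map K (V j) (V j) (Vj.sum_rank_one D')" "tensor_map K I V (h(j := Vj.sum_rank_one D')) t = \<zero>\<^bsub>T\<^esub>"
        using Cons.IH Cons.prems by (meson list.set_intros(2))+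
      have s: "Vj.sum_rank_one (d # D') = (\<lambda>v. l v \<odot>\<^bsub>V j\<^esub> e \<oplus>\<^bsub>V j\<^esub> Vj.sum_rank_one D' v)"
        by (simp add: Vj.sum_rank_one_def d fun_eq_iff)
      note r = linear_map_rank_one[OF Vj.module_axioms le]
      have "tensor_map K I V (h(j := \<lambda>v. l v \<odot>\<^bsub>V j\<^esub> e)) t = \<zero>\<^bsub>T\<^esub>" using le by (intro one) blast
      then have "tensor_map K I V (h(j := Vj.sum_rank_one (d # D'))) t = \<zero>\<^bsub>T\<^esub>"
        unfolding s using tensor_map_upd_add[OF tensor_product_axioms tensor_product_axioms hlin j(1) r t(1) IH(1)] IH(2) by simp
      then show ?case unfolding s using linear_map_sum[OF Vj.module_axioms r IH(1)] by blast
    qed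
    from this[OF D(1)] have D': "linear_map K (V j) (V j) (Vj.sum_rank_one D)" "tensor_map K I V (h(j := Vj.sum_rank_one D)) t = \<zero>\<^bsub>T\<^esub>"
      by auto
    have "tensor_map K I V h t = tensor_map K I V (h(j := Vj.sum_rank_one D)) t"
    proof (rule tensor_map_cong[OF tensor_product_axioms tensor_product_axioms _ _ t(1)])
      show "linear_map K (V i) (V i) ((h(j := Vj.sum_rank_one D)) i)" if "i \<in> I" for i
        using hlin[OF that] D'(1) by auto
      show "h i v = (h(j := Vj.sum_rank_one D)) i v" if "i \<in> I" "v \<in> carrier (V i)" for i v
        using D(2) that insert.prems(3)[of j] by auto
    qed
    then show ?case using D'(2) by simp
  qed
  have "tensor_map K I V (\<lambda>i v. v) t = \<zero>\<^bsub>T\<^esub>" by (rule kill[OF fin]) auto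
  then show False using tensor_map_id[OF tensor_product_axioms _ t(1), of "\<lambda>i v. v"] t(2) by simp
qed

end

section \<open>Simple functors\<close>

lemma (in preadditive_category) Cmp_zero_right:
  assumes "x \<in> Ob A" "y \<in> Ob A" "z \<in> Ob A" "g \<in> Mor A y z"
  shows "Cmp A x y z g \<one>\<^bsub>Hom A x y\<^esub> = \<one>\<^bsub>Hom A x z\<^esub>"
proof -
  interpret xy: comm_group "Hom A x y" using Hom_comm_group assms by blast
  interpret xz: comm_group "Hom A x z" using Hom_comm_group assms by blast
  have "Cmp A x y z g \<one>\<^bsub>Hom A x y\<^esub> \<otimes>\<^bsub>Hom A x z\<^esub> Cmp A x y z g \<one>\<^bsub>Hom A x y\<^esub> = Cmp A x y z g \<one>\<^bsub>Hom A x y\<^esub>"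
    using Cmp_add_right[of x y z "\<one>\<^bsub>Hom A x y\<^esub>" "\<one>\<^bsub>Hom A x y\<^esub>" g] assms by simp
  then show ?thesis using Cmp_closed[of x y z "\<one>\<^bsub>Hom A x y\<^esub>" g] assms by simp
qed

lemma (in preadditive_category) Cmp_zero_left:
  assumes "x \<in> Ob A" "y \<in> Ob A" "z \<in> Ob A" "f \<in> Mor A x y"
  shows "Cmp A x y z \<one>\<^bsub>Hom A y z\<^esub> f = \<one>\<^bsub>Hom A x z\<^esub>"
proof -
  interpret yz: comm_group "Hom A y z" using Hom_comm_group assms by blast
  interpret xz: comm_group "Hom A x z" using Hom_comm_group assms by blast
  have "Cmp A x y z \<one>\<^bsub>Hom A y z\<^esub> f \<otimes>\<^bsub>Hom A x z\<^esub> Cmp A x y z \<one>\<^bsub>Hom A y z\<^esub> f = Cmp A x y z \<one>\<^bsub>Hom A y z\<^esub> f"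
    using Cmp_add_left[of x y z f "\<one>\<^bsub>Hom A y z\<^esub>" "\<one>\<^bsub>Hom A y z\<^esub>"] assms by simp
  then show ?thesis using Cmp_closed[of x y z f "\<one>\<^bsub>Hom A y z\<^esub>"] assms by simp
qed

text \<open>
  The linear combinations of the maps \<open>farr F x y f\<close>; only the values on the carrier of
  \<open>fobj F x\<close> matter, whence the last rule.
\<close>

inductive_set ops :: "('o, 'm) preadditive_data \<Rightarrow> 'k ring \<Rightarrow> ('o, 'm, 'k, 'v) vect_functor_data
    \<Rightarrow> 'o \<Rightarrow> 'o \<Rightarrow> ('v \<Rightarrow> 'v) set"
  for A K F x y where
  gen: "f \<in> Mor A x y \<Longrightarrow> farr F x y f \<in> ops A K F x y"
| zero: "(\<lambda>v. \<zero>\<^bsub>fobj F y\<^esub>) \<in> ops A K F x y"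
| add: "a \<in> ops A K F x y \<Longrightarrow> b \<in> ops A K F x y \<Longrightarrow> (\<lambda>v. a v \<oplus>\<^bsub>fobj F y\<^esub> b v) \<in> ops A K F x y"
| smult: "c \<in> carrier K \<Longrightarrow> a \<in> ops A K F x y \<Longrightarrow> (\<lambda>v. c \<odot>\<^bsub>fobj F y\<^esub> a v) \<in> ops A K F x y"
| ext: "a \<in> ops A K F x y \<Longrightarrow> (\<And>v. v \<in> carrier (fobj F x) \<Longrightarrow> b v = a v) \<Longrightarrow> b \<in> ops A K F x y"

locale linear_functor = C?: preadditive_category A + vect_functor A K F + K?: field K
  for A :: "('o, 'm) preadditive_data" and K :: "'k ring" and F :: "('o, 'm, 'k, 'v) vect_functor_data"
begin

abbreviation "V x \<equiv> fobj F x"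
abbreviation "Ops \<equiv> ops A K F"

lemma V_vspace: "x \<in> Ob A \<Longrightarrow> vspace K (V x)"
  by (intro vspace.intro K.field_axioms fobj_module)

lemma zero_in: "x \<in> Ob A \<Longrightarrow> \<zero>\<^bsub>V x\<^esub> \<in> carrier (V x)"
proof -
  assume "x \<in> Ob A"
  then interpret module K "V x" by (rule fobj_module)
  show ?thesis by simp
qed

lemma ops_linear:
  assumes "x \<in> Ob A" "y \<in> Ob A" "a \<in> Ops x y"
  shows "linear_map K (V x) (V y) a"
  using assms(3)
proof induction
  case (gen f)
  then show ?case by (rule farr_linear[OF assms(1,2)])
next
  case zero
  interpret module K "V y" using fobj_module assms by blast
  show ?case by (rule linear_mapI) auto
next
  case (add a b)
  show ?case by (rule linear_map_sum[OF fobj_module[OF assms(2)] add.IH])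
next
  case (smult c a)
  show ?case by (rule linear_map_scale[OF fobj_module[OF assms(2)] smult.IH smult.hyps(1)])
next
  case (ext a b)
  interpret module K "V x" using fobj_module assms by blast
  show ?case by (rule linear_mapI) (use ext linear_mapD[OF ext.IH] in auto)
qed

lemma ops_closed: "x \<in> Ob A \<Longrightarrow> y \<in> Ob A \<Longrightarrow> a \<in> Ops x y \<Longrightarrow> v \<in> carrier (V x) \<Longrightarrow> a v \<in> carrier (V y)"
  by (rule linear_mapD(1)[OF ops_linear])

lemma ops_zero: "x \<in> Ob A \<Longrightarrow> y \<in> Ob A \<Longrightarrow> a \<in> Ops x y \<Longrightarrow> a \<zero>\<^bsub>V x\<^esub> = \<zero>\<^bsub>V y\<^esub>"
  by (rule linear_map_zero[OF fobj_module fobj_module ops_linear])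

lemma ops_id: "x \<in> Ob A \<Longrightarrow> (\<lambda>v. v) \<in> Ops x x"
  by (rule ops.ext[OF ops.gen[OF Idn_closed]]) (auto simp: farr_Idn)

lemma ops_comp_gen:
  assumes o: "x \<in> Ob A" "y \<in> Ob A" "z \<in> Ob A" and a: "a \<in> Ops x y" and g: "g \<in> Mor A y z"
  shows "(\<lambda>v. farr F y z g (a v)) \<in> Ops x z"
proof -
  note Fg = farr_linear[OF o(2,3) g]
  note L = linear_mapD[OF Fg]
  show ?thesis
    using a
  proof induction
    case (gen f)
    show ?case by (rule ops.ext[OF ops.gen[OF Cmp_closed[OF o gen g]]]) (use o gen g in \<open>simp add: farr_Cmp\<close>)
  next
    case zero
    have "farr F y z g \<zero>\<^bsub>V y\<^esub> = \<zero>\<^bsub>V z\<^esub>" by (rule linear_map_zero[OF fobj_module fobj_module Fg]) (use o in auto)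
    then show ?case using ops.zero by simp
  next
    case (add a b)
    show ?case by (rule ops.ext[OF ops.add[OF add.IH]]) (use o add ops_closed in \<open>auto simp: L\<close>)
  next
    case (smult c a)
    show ?case by (rule ops.ext[OF ops.smult[OF smult.hyps(1) smult.IH]]) (use o smult ops_closed in \<open>auto simp: L\<close>)
  next
    case (ext a b)
    show ?case by (rule ops.ext[OF ext.IH]) (use ext in auto)
  qed
qed

lemma ops_comp:
  assumes o: "x \<in> Ob A" "y \<in> Ob A" "z \<in> Ob A" and a: "a \<in> Ops x y" and b: "b \<in> Ops y z"
  shows "(\<lambda>v. b (a v)) \<in> Ops x z"
  using b
proof induction
  case (gen f)
  then show ?case using ops_comp_gen o a by blast
next
  case (ext a' b')
  show ?case by (rule ops.ext[OF ext.IH]) (use ext ops_closed o a in auto)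
qed (auto intro: ops.zero ops.add ops.smult)

lemma subfunctorD:
  assumes "is_subfunctor A K N F" "x \<in> Ob A"
  shows "N x \<subseteq> carrier (V x)" "\<zero>\<^bsub>V x\<^esub> \<in> N x"
    "v \<in> N x \<Longrightarrow> w \<in> N x \<Longrightarrow> v \<oplus>\<^bsub>V x\<^esub> w \<in> N x" "c \<in> carrier K \<Longrightarrow> v \<in> N x \<Longrightarrow> c \<odot>\<^bsub>V x\<^esub> v \<in> N x"
    "y \<in> Ob A \<Longrightarrow> f \<in> Mor A x y \<Longrightarrow> v \<in> N x \<Longrightarrow> farr F x y f v \<in> N y"
proof -
  interpret vspace K "V x" using V_vspace assms by blast
  have s: "submodule (N x) K (V x)" using assms unfolding is_subfunctor_def by blast
  show "N x \<subseteq> carrier (V x)" "v \<in> N x \<Longrightarrow> w \<in> N x \<Longrightarrow> v \<oplus>\<^bsub>V x\<^esub> w \<in> N x"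
    "c \<in> carrier K \<Longrightarrow> v \<in> N x \<Longrightarrow> c \<odot>\<^bsub>V x\<^esub> v \<in> N x" "\<zero>\<^bsub>V x\<^esub> \<in> N x"
    using submoduleE[OF s] submodule_zero[OF s] by auto
  show "y \<in> Ob A \<Longrightarrow> f \<in> Mor A x y \<Longrightarrow> v \<in> N x \<Longrightarrow> farr F x y f v \<in> N y"
    using assms unfolding is_subfunctor_def by blast
qed

lemma subfunctorI:
  assumes "\<And>x. x \<in> Ob A \<Longrightarrow> N x \<subseteq> carrier (V x)" "\<And>x. x \<in> Ob A \<Longrightarrow> \<zero>\<^bsub>V x\<^esub> \<in> N x"
    "\<And>x v w. x \<in> Ob A \<Longrightarrow> v \<in> N x \<Longrightarrow> w \<in> N x \<Longrightarrow> v \<oplus>\<^bsub>V x\<^esub> w \<in> N x"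
    "\<And>x c v. x \<in> Ob A \<Longrightarrow> c \<in> carrier K \<Longrightarrow> v \<in> N x \<Longrightarrow> c \<odot>\<^bsub>V x\<^esub> v \<in> N x"
    "\<And>x y f v. x \<in> Ob A \<Longrightarrow> y \<in> Ob A \<Longrightarrow> f \<in> Mor A x y \<Longrightarrow> v \<in> N x \<Longrightarrow> farr F x y f v \<in> N y"
  shows "is_subfunctor A K N F"
  unfolding is_subfunctor_def using assms vspace.submodule_closedI[OF V_vspace] by (simp add: image_subset_iff)

lemma subfunctor_ops:
  assumes N: "is_subfunctor A K N F" and o: "x \<in> Ob A" "y \<in> Ob A" and v: "v \<in> N x" and a: "a \<in> Ops x y"
  shows "a v \<in> N y"
proof -
  have "v \<in> carrier (V x)" using subfunctorD(1)[OF N o(1)] v by blast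
  with a show ?thesis by induction (use subfunctorD[OF N] o v in auto)
qed

text \<open>
  The combinations killing \<open>U\<close> are stable under composition with morphisms on the left. With
  \<open>U = {}\<close> this is the subfunctor generated by \<open>v\<close>.
\<close>

lemma annihilator_orbit_subfunctor:
  assumes x: "x \<in> Ob A" and v: "v \<in> carrier (V x)" and U: "U \<subseteq> carrier (V x)"
  shows "is_subfunctor A K (\<lambda>y. {a v | a. a \<in> Ops x y \<and> (\<forall>u\<in>U. a u = \<zero>\<^bsub>V y\<^esub>)}) F"
proof (rule subfunctorI)
  fix y assume y: "y \<in> Ob A"
  interpret vspace K "V y" using V_vspace y by blast
  let ?N = "{a v | a. a \<in> Ops x y \<and> (\<forall>u\<in>U. a u = \<zero>\<^bsub>V y\<^esub>)}"
  show "?N \<subseteq> carrier (V y)" using ops_closed x y v by auto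
  show "\<zero>\<^bsub>V y\<^esub> \<in> ?N" using ops.zero by fastforce
  show "s \<oplus>\<^bsub>V y\<^esub> t \<in> ?N" if st: "s \<in> ?N" "t \<in> ?N" for s t
  proof -
    obtain a b where "a \<in> Ops x y" "b \<in> Ops x y" "\<forall>u\<in>U. a u = \<zero>\<^bsub>V y\<^esub>" "\<forall>u\<in>U. b u = \<zero>\<^bsub>V y\<^esub>" "s = a v" "t = b v"
      using st by auto
    then show ?thesis using ops.add[of a A K F x y b] by (intro CollectI exI[of _ "\<lambda>v. a v \<oplus>\<^bsub>V y\<^esub> b v"]) auto
  qed
  show "c \<odot>\<^bsub>V y\<^esub> s \<in> ?N" if c: "c \<in> carrier K" and s: "s \<in> ?N" for c s
  proof -
    obtain a where "a \<in> Ops x y" "\<forall>u\<in>U. a u = \<zero>\<^bsub>V y\<^esub>" "s = a v"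
      using s by auto
    then show ?thesis using ops.smult[of c K a A F x y] c by (intro CollectI exI[of _ "\<lambda>v. c \<odot>\<^bsub>V y\<^esub> a v"]) auto
  qed
  fix z f s assume z: "z \<in> Ob A" and f: "f \<in> Mor A y z" and s: "s \<in> ?N"
  obtain a where "a \<in> Ops x y" "\<forall>u\<in>U. a u = \<zero>\<^bsub>V y\<^esub>" "s = a v" using s by auto
  moreover have "farr F y z f \<zero>\<^bsub>V y\<^esub> = \<zero>\<^bsub>V z\<^esub>" by (rule linear_map_zero[OF fobj_module fobj_module farr_linear[OF y z f]]) (use y z in auto)
  ultimately show "farr F y z f s \<in> {a v | a. a \<in> Ops x z \<and> (\<forall>u\<in>U. a u = \<zero>\<^bsub>V z\<^esub>)}"
    using ops_comp_gen[OF x y z _ f] by (intro CollectI exI[of _ "\<lambda>v. farr F y z f (a v)"]) auto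
qed

end

locale simple_vfunctor = linear_functor A K F
  for A :: "('o, 'm) preadditive_data" and K :: "'k ring" and F :: "('o, 'm, 'k, 'v) vect_functor_data" +
  assumes simple: "simple_functor A K F"
    and ac: "algebraically_closed K"
    and fin: "x \<in> Ob A \<Longrightarrow> y \<in> Ob A \<Longrightarrow> finite (Mor A x y)"
begin

lemma nonzero: "\<exists>x\<in>Ob A. \<exists>v\<in>carrier (V x). v \<noteq> \<zero>\<^bsub>V x\<^esub>"
  using simple zero_in unfolding simple_functor_def by blast

lemma subfunctor_full:
  assumes "is_subfunctor A K N F" "x \<in> Ob A" "v \<in> N x" "v \<noteq> \<zero>\<^bsub>V x\<^esub>" "y \<in> Ob A"
  shows "N y = carrier (V y)"
  using simple assms unfolding simple_functor_def by blast

lemma reach_annihilating: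
  assumes x: "x \<in> Ob A" and v: "v \<in> carrier (V x)" and U: "U \<subseteq> carrier (V x)"
    and z: "z \<in> Ob A" and a: "a \<in> Ops x z" "\<And>u. u \<in> U \<Longrightarrow> a u = \<zero>\<^bsub>V z\<^esub>" "a v \<noteq> \<zero>\<^bsub>V z\<^esub>"
    and y: "y \<in> Ob A" and w: "w \<in> carrier (V y)"
  shows "\<exists>a\<in>Ops x y. a v = w \<and> (\<forall>u\<in>U. a u = \<zero>\<^bsub>V y\<^esub>)"
proof -
  have "a v \<in> {a v | a. a \<in> Ops x z \<and> (\<forall>u\<in>U. a u = \<zero>\<^bsub>V z\<^esub>)}" using a by blast
  from subfunctor_full[OF annihilator_orbit_subfunctor[OF x v U] z this a(3) y]
  have "w \<in> {a v | a. a \<in> Ops x y \<and> (\<forall>u\<in>U. a u = \<zero>\<^bsub>V y\<^esub>)}" using w by (simp only:)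
  then show ?thesis by auto
qed

lemma reach:
  assumes "x \<in> Ob A" "v \<in> carrier (V x)" "v \<noteq> \<zero>\<^bsub>V x\<^esub>" "y \<in> Ob A" "w \<in> carrier (V y)"
  shows "\<exists>a\<in>Ops x y. a v = w"
  using reach_annihilating[OF assms(1,2) _ assms(1) ops_id[OF assms(1)] _ assms(3-5), of "{}"] by auto

text \<open>
  A simple functor is generated by any non-zero vector \<open>v\<close>, so its value at \<open>y\<close> is spanned by the
  images of \<open>v\<close> under the finitely many morphisms to \<open>y\<close>.
\<close>

lemma finite_dimensional:
  assumes y: "y \<in> Ob A"
  shows "\<exists>vs. set vs \<subseteq> carrier (V y) \<and> carrier (V y) = lspan K (V y) vs"
proof -
  interpret vspace K "V y" using V_vspace y by blast
  obtain x v where x: "x \<in> Ob A" "v \<in> carrier (V x)" "v \<noteq> \<zero>\<^bsub>V x\<^esub>" using nonzero by blast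
  obtain fs where fs: "set fs = Mor A x y" using fin[OF x(1) y] finite_list by blast
  define vs where "vs = map (\<lambda>f. farr F x y f v) fs"
  have vs: "set vs \<subseteq> carrier (V y)"
    using fs linear_mapD(1)[OF farr_linear[OF x(1) y]] x(2) by (auto simp: vs_def)
  note S = lspan_submodule[OF vs]
  have "a v \<in> lspan K (V y) vs" if "a \<in> Ops x y" for a
    using that
  proof induction
    case (gen f)
    then show ?case using lspan_incl[OF vs] fs by (auto simp: vs_def)
  qed (use submodule_zero[OF S] submoduleE(4,5)[OF S] x in auto)
  then have "carrier (V y) \<subseteq> lspan K (V y) vs" using reach[OF x y] by fastforce
  then show ?thesis using vs lspan_carrier[OF vs] by blast
qed

text \<open>
  An endomorphism \<open>\<phi>\<close> of \<open>F\<close> has an eigenvector at some object; the eigenspaces for its eigenvalue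
  form a non-zero subfunctor, which is \<open>F\<close>.
\<close>

lemma schur:
  assumes lin: "\<And>x. x \<in> Ob A \<Longrightarrow> linear_map K (V x) (V x) (\<phi> x)"
    and nat: "\<And>x y f v. x \<in> Ob A \<Longrightarrow> y \<in> Ob A \<Longrightarrow> f \<in> Mor A x y \<Longrightarrow> v \<in> carrier (V x) \<Longrightarrow>
      \<phi> y (farr F x y f v) = farr F x y f (\<phi> x v)"
  shows "\<exists>c\<in>carrier K. \<forall>x\<in>Ob A. \<forall>v\<in>carrier (V x). \<phi> x v = c \<odot>\<^bsub>V x\<^esub> v"
proof -
  obtain x v where x: "x \<in> Ob A" "v \<in> carrier (V x)" "v \<noteq> \<zero>\<^bsub>V x\<^esub>" using nonzero by blast
  interpret vspace K "V x" using V_vspace x by blast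
  obtain vs where vs: "set vs \<subseteq> carrier (V x)" "carrier (V x) = lspan K (V x) vs"
    using finite_dimensional[OF x(1)] by blast
  obtain c u where c: "c \<in> carrier K" and u: "u \<in> carrier (V x)" "u \<noteq> \<zero>\<^bsub>V x\<^esub>" "\<phi> x u = c \<odot>\<^bsub>V x\<^esub> u"
    using eigenvector[OF ac lin[OF x(1)] vs x(2,3)] by blast
  let ?N = "\<lambda>y. {w \<in> carrier (V y). \<phi> y w = c \<odot>\<^bsub>V y\<^esub> w}"
  have "is_subfunctor A K ?N F"
  proof (rule subfunctorI)
    fix y assume y: "y \<in> Ob A"
    interpret Y: vspace K "V y" using V_vspace y by blast
    note L = linear_mapD[OF lin[OF y]]
    show "\<zero>\<^bsub>V y\<^esub> \<in> ?N y" using linear_map_zero[OF Y.module_axioms Y.module_axioms lin[OF y]] c by simp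
    show "s \<oplus>\<^bsub>V y\<^esub> t \<in> ?N y" if "s \<in> ?N y" "t \<in> ?N y" for s t
      using that c by (auto simp: L Y.smult_r_distr)
    show "d \<odot>\<^bsub>V y\<^esub> s \<in> ?N y" if "d \<in> carrier K" "s \<in> ?N y" for d s
      using that c by (auto simp: L Y.smult_assoc1[symmetric] K.m_comm)
    fix z f s assume z: "z \<in> Ob A" and f: "f \<in> Mor A y z" and s: "s \<in> ?N y"
    then show "farr F y z f s \<in> ?N z" using nat[OF y z f, of s] linear_mapD[OF farr_linear[OF y z f]] c by auto
  qed auto
  then have "?N y = carrier (V y)" if "y \<in> Ob A" for y
    by (rule subfunctor_full[OF _ x(1) _ u(2) that]) (use u in auto)
  then show ?thesis using c by blast
qed

text \<open>
  The density theorem. If every combination killing \<open>u # us\<close> also killed \<open>v\<close>, then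
  \<open>a u \<mapsto> a v\<close>, for \<open>a\<close> killing \<open>us\<close>, would be an endomorphism of \<open>F\<close>, hence a scalar \<open>c\<close>, and the
  induction hypothesis would place \<open>v - c u\<close> in the span of \<open>us\<close>.
\<close>

lemma density:
  assumes y: "y \<in> Ob A"
  shows "set vs \<subseteq> carrier (V y) \<Longrightarrow> v \<in> carrier (V y) \<Longrightarrow> v \<notin> lspan K (V y) vs \<Longrightarrow> z \<in> Ob A \<Longrightarrow> w \<in> carrier (V z) \<Longrightarrow>
    \<exists>a\<in>Ops y z. a v = w \<and> (\<forall>u\<in>set vs. a u = \<zero>\<^bsub>V z\<^esub>)"
proof (induction vs arbitrary: v z w)
  case Nil
  then show ?case using reach[OF y, of v z w] by simp
next
  case (Cons u us)
  interpret Y: vspace K "V y" using V_vspace y by blast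
  have us: "set us \<subseteq> carrier (V y)" and u: "u \<in> carrier (V y)" using Cons.prems by auto
  note S = Y.lspan_submodule[OF us]
  have vn: "v \<notin> lspan K (V y) us" using Cons.prems(1,3) Y.lspan_mono[of us "u # us"] by auto
  show ?case
  proof (cases "\<exists>z'\<in>Ob A. \<exists>a\<in>Ops y z'. (\<forall>x\<in>set (u # us). a x = \<zero>\<^bsub>V z'\<^esub>) \<and> a v \<noteq> \<zero>\<^bsub>V z'\<^esub>")
    case True
    then show ?thesis using reach_annihilating[OF y Cons.prems(2,1) _ _ _ _ Cons.prems(4,5)] by blast
  next
    case False
    then have H: "a v = \<zero>\<^bsub>V z'\<^esub>" if "z' \<in> Ob A" "a \<in> Ops y z'" "\<forall>x\<in>set us. a x = \<zero>\<^bsub>V z'\<^esub>" "a u = \<zero>\<^bsub>V z'\<^esub>" for z' a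
      using that by auto
    have un: "u \<notin> lspan K (V y) us"
    proof
      assume uin: "u \<in> lspan K (V y) us"
      obtain a where a: "a \<in> Ops y y" "a v = v" "\<forall>x\<in>set us. a x = \<zero>\<^bsub>V y\<^esub>"
        using Cons.IH[OF us Cons.prems(2) vn y Cons.prems(2)] by blast
      note La = linear_mapD[OF ops_linear[OF y y a(1)]]
      have "submodule {x \<in> carrier (V y). a x = \<zero>\<^bsub>V y\<^esub>} K (V y)"
        by (rule Y.submodule_closedI) (auto simp: La ops_zero[OF y y a(1)])
      from Y.lspan_least[OF this] us a(3) uin have "a u = \<zero>\<^bsub>V y\<^esub>" by auto
      then have "v = \<zero>\<^bsub>V y\<^esub>" using H[OF y a(1) a(3)] a(2) by simp
      then show False using vn Y.submodule_zero[OF S] by simp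
    qed
    define J where "J z = {a \<in> Ops y z. \<forall>x\<in>set us. a x = \<zero>\<^bsub>V z\<^esub>}" for z
    have ex: "\<exists>a\<in>J z. a u = w" if "z \<in> Ob A" "w \<in> carrier (V z)" for z w
      using Cons.IH[OF us u un that] by (auto simp: J_def)
    have Jadd: "(\<lambda>x. a x \<oplus>\<^bsub>V z\<^esub> b x) \<in> J z" if "a \<in> J z" "b \<in> J z" "z \<in> Ob A" for a b z
    proof -
      interpret Z: vspace K "V z" using V_vspace that by blast
      show ?thesis using that by (auto simp: J_def intro: ops.add)
    qed
    have Jsmult: "(\<lambda>x. c \<odot>\<^bsub>V z\<^esub> a x) \<in> J z" if "a \<in> J z" "c \<in> carrier K" "z \<in> Ob A" for a c z
    proof -
      interpret Z: vspace K "V z" using V_vspace that by blast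
      show ?thesis using that by (auto simp: J_def intro: ops.smult)
    qed
    have J_closed: "a x \<in> carrier (V z)" if "a \<in> J z" "z \<in> Ob A" "x \<in> carrier (V y)" for a z x
      using that ops_closed[OF y] by (auto simp: J_def)
    have wd: "a v = b v" if ab: "a \<in> J z" "b \<in> J z" "a u = b u" "z \<in> Ob A" for a b z
    proof -
      interpret Z: vspace K "V z" using V_vspace that by blast
      let ?d = "\<lambda>x. a x \<oplus>\<^bsub>V z\<^esub> (\<ominus>\<^bsub>K\<^esub> \<one>\<^bsub>K\<^esub>) \<odot>\<^bsub>V z\<^esub> b x"
      have C: "a v \<in> carrier (V z)" "b v \<in> carrier (V z)" "b u \<in> carrier (V z)"
        using J_closed ab Cons.prems(2) u by auto
      have d: "?d \<in> J z" using Jadd[OF ab(1) Jsmult[OF ab(2)]] ab by simp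
      have "?d u = \<zero>\<^bsub>V z\<^esub>" using ab(3) C by (simp add: Z.smult_l_minus Z.M.r_neg)
      then have "?d v = \<zero>\<^bsub>V z\<^esub>" using d H[OF ab(4), of ?d] by (simp add: J_def)
      then have "\<ominus>\<^bsub>V z\<^esub> (\<ominus>\<^bsub>V z\<^esub> b v) = a v" using C by (intro Z.M.minus_equality) (auto simp: Z.smult_l_minus)
      then show ?thesis using C by simp
    qed
    define \<phi> where "\<phi> z w = (SOME w'. \<exists>a\<in>J z. a u = w \<and> a v = w')" for z w
    have \<phi>: "\<phi> z (a u) = a v" if "a \<in> J z" "z \<in> Ob A" for a z
    proof -
      have "\<exists>b\<in>J z. b u = a u \<and> b v = \<phi> z (a u)"
        unfolding \<phi>_def by (rule someI_ex) (use that in blast)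
      then show ?thesis using wd that by metis
    qed
    have "\<exists>c\<in>carrier K. \<forall>x\<in>Ob A. \<forall>w\<in>carrier (V x). \<phi> x w = c \<odot>\<^bsub>V x\<^esub> w"
    proof (rule schur)
      fix z assume z: "z \<in> Ob A"
      interpret Z: vspace K "V z" using V_vspace z by blast
      show "linear_map K (V z) (V z) (\<phi> z)"
      proof (rule linear_mapI)
        fix s assume s: "s \<in> carrier (V z)"
        then obtain a where a: "a \<in> J z" "a u = s" using ex z by blast
        then show "\<phi> z s \<in> carrier (V z)" using \<phi>[OF a(1) z] J_closed[OF a(1) z Cons.prems(2)] by simp
        show "\<phi> z (s \<oplus>\<^bsub>V z\<^esub> t) = \<phi> z s \<oplus>\<^bsub>V z\<^esub> \<phi> z t" if t: "t \<in> carrier (V z)" for t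
        proof -
          obtain b where b: "b \<in> J z" "b u = t" using ex z t by blast
          show ?thesis using \<phi>[OF Jadd[OF a(1) b(1) z] z] \<phi>[OF a(1) z] \<phi>[OF b(1) z] a(2) b(2) by simp
        qed
        show "\<phi> z (c \<odot>\<^bsub>V z\<^esub> s) = c \<odot>\<^bsub>V z\<^esub> \<phi> z s" if c: "c \<in> carrier K" for c
          using \<phi>[OF Jsmult[OF a(1) c z] z] \<phi>[OF a(1) z] a(2) by simp
      qed
      fix z' f s assume z': "z' \<in> Ob A" and f: "f \<in> Mor A z z'" and s: "s \<in> carrier (V z)"
      obtain a where a: "a \<in> J z" "a u = s" using ex z s by blast
      have "farr F z z' f \<zero>\<^bsub>V z\<^esub> = \<zero>\<^bsub>V z'\<^esub>"
        by (rule linear_map_zero[OF fobj_module fobj_module farr_linear[OF z z' f]]) (use z z' in auto)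
      then have "(\<lambda>x. farr F z z' f (a x)) \<in> J z'"
        using a(1) ops_comp_gen[OF y z z' _ f] by (auto simp: J_def)
      from \<phi>[OF this z'] show "\<phi> z' (farr F z z' f s) = farr F z z' f (\<phi> z s)"
        using \<phi>[OF a(1) z] a(2) by simp
    qed
    then obtain c where c: "c \<in> carrier K" "\<And>x w. x \<in> Ob A \<Longrightarrow> w \<in> carrier (V x) \<Longrightarrow> \<phi> x w = c \<odot>\<^bsub>V x\<^esub> w" by blast
    define d where "d = v \<oplus>\<^bsub>V y\<^esub> (\<ominus>\<^bsub>K\<^esub> c) \<odot>\<^bsub>V y\<^esub> u"
    have dC: "d \<in> carrier (V y)" using c u Cons.prems(2) by (simp add: d_def)
    have vd: "v = c \<odot>\<^bsub>V y\<^esub> u \<oplus>\<^bsub>V y\<^esub> d"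
      using c u Cons.prems(2) by (simp add: d_def Y.smult_l_minus Y.M.a_lcomm Y.M.r_neg)
    show ?thesis
    proof (cases "d \<in> lspan K (V y) us")
      case True
      then have "v \<in> lspan K (V y) (u # us)" using vd c(1) by auto
      then show ?thesis using Cons.prems(3) by blast
    next
      case False
      obtain a where a: "a \<in> Ops y y" "a d = d" "\<forall>x\<in>set us. a x = \<zero>\<^bsub>V y\<^esub>"
        using Cons.IH[OF us dC False y dC] by blast
      then have aJ: "a \<in> J y" by (simp add: J_def)
      note La = linear_mapD[OF ops_linear[OF y y a(1)]]
      have au: "a u \<in> carrier (V y)" using La u by blast
      have "a v = c \<odot>\<^bsub>V y\<^esub> a u" using \<phi>[OF aJ y] c(2)[OF y au] by simp
      then have "a d = c \<odot>\<^bsub>V y\<^esub> a u \<oplus>\<^bsub>V y\<^esub> (\<ominus>\<^bsub>K\<^esub> c) \<odot>\<^bsub>V y\<^esub> a u"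
        using c(1) u Cons.prems(2) by (simp add: d_def La)
      then have "d = \<zero>\<^bsub>V y\<^esub>" using a(2) c(1) au by (simp add: Y.smult_l_minus Y.M.r_neg)
      then show ?thesis using False Y.submodule_zero[OF S] by simp
    qed
  qed
qed

text \<open>
  Density applied to a vector \<open>v0\<close> with \<open>l v0 = 1\<close> and to a list spanning the kernel of \<open>l\<close>.
\<close>

lemma burnside:
  assumes y: "y \<in> Ob A" and z: "z \<in> Ob A" and l: "linear_map K (V y) (field_module K) l" and w: "w \<in> carrier (V z)"
  shows "(\<lambda>v. l v \<odot>\<^bsub>V z\<^esub> w) \<in> Ops y z"
proof -
  interpret Y: vspace K "V y" using V_vspace y by blast
  interpret Z: vspace K "V z" using V_vspace z by blast
  note L = linear_mapD[OF l, simplified]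
  have l0: "l \<zero>\<^bsub>V y\<^esub> = \<zero>\<^bsub>K\<^esub>"
    using linear_map_zero[OF Y.module_axioms field_module_module[OF K.cring_axioms] l] by simp
  show ?thesis
  proof (cases "\<forall>v\<in>carrier (V y). l v = \<zero>\<^bsub>K\<^esub>")
    case True
    show ?thesis by (rule ops.ext[OF ops.zero]) (use True w in auto)
  next
    case False
    then obtain v1 where v1: "v1 \<in> carrier (V y)" "l v1 \<noteq> \<zero>\<^bsub>K\<^esub>" by blast
    have i: "inv\<^bsub>K\<^esub> (l v1) \<in> carrier K" "inv\<^bsub>K\<^esub> (l v1) \<otimes>\<^bsub>K\<^esub> l v1 = \<one>\<^bsub>K\<^esub>"
      using Y.inv_nonzero v1 L by auto
    define v0 where "v0 = inv\<^bsub>K\<^esub> (l v1) \<odot>\<^bsub>V y\<^esub> v1"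
    have v0: "v0 \<in> carrier (V y)" "l v0 = \<one>\<^bsub>K\<^esub>" using i v1 by (auto simp: v0_def L)
    obtain ws where ws: "set ws \<subseteq> carrier (V y)" "carrier (V y) = lspan K (V y) ws"
      using finite_dimensional[OF y] by blast
    define us where "us = map (\<lambda>u. u \<oplus>\<^bsub>V y\<^esub> (\<ominus>\<^bsub>K\<^esub> l u) \<odot>\<^bsub>V y\<^esub> v0) ws"
    have us: "set us \<subseteq> carrier (V y)" using ws(1) v0 L by (auto simp: us_def)
    have "submodule {x \<in> carrier (V y). l x = \<zero>\<^bsub>K\<^esub>} K (V y)"
      by (rule Y.submodule_closedI) (auto simp: L l0)
    moreover have "set us \<subseteq> {x \<in> carrier (V y). l x = \<zero>\<^bsub>K\<^esub>}"
      using us ws(1) v0 L(1) by (auto simp: us_def L K.r_neg)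
    ultimately have lus: "l s = \<zero>\<^bsub>K\<^esub>" if "s \<in> lspan K (V y) us" for s using Y.lspan_least that by blast
    have "v0 \<notin> lspan K (V y) us" using lus v0(2) by fastforce
    then obtain a where a: "a \<in> Ops y z" "a v0 = w" "\<forall>u\<in>set us. a u = \<zero>\<^bsub>V z\<^esub>"
      using density[OF y us v0(1) _ z w] by blast
    note La = linear_mapD[OF ops_linear[OF y z a(1)]]
    have "submodule {x \<in> carrier (V y). a x = \<zero>\<^bsub>V z\<^esub>} K (V y)"
      by (rule Y.submodule_closedI) (auto simp: La ops_zero[OF y z a(1)])
    moreover have "set us \<subseteq> {x \<in> carrier (V y). a x = \<zero>\<^bsub>V z\<^esub>}" using us a(3) by auto
    ultimately have aus: "a s = \<zero>\<^bsub>V z\<^esub>" if "s \<in> lspan K (V y) us" for s using Y.lspan_least that by blast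
    have c0: "set (v0 # us) \<subseteq> carrier (V y)" using v0 us by auto
    have "set ws \<subseteq> lspan K (V y) (v0 # us)"
    proof
      fix u assume u: "u \<in> set ws"
      then have uC: "u \<in> carrier (V y)" using ws by auto
      let ?u = "u \<oplus>\<^bsub>V y\<^esub> (\<ominus>\<^bsub>K\<^esub> l u) \<odot>\<^bsub>V y\<^esub> v0"
      have "u = l u \<odot>\<^bsub>V y\<^esub> v0 \<oplus>\<^bsub>V y\<^esub> ?u"
        using uC v0 L by (simp add: Y.smult_l_minus Y.M.a_lcomm Y.M.r_neg)
      moreover have "?u \<in> lspan K (V y) us" using Y.lspan_incl[OF us] u by (auto simp: us_def)
      ultimately show "u \<in> lspan K (V y) (v0 # us)" using L(1)[OF uC] by auto
    qed
    then have full: "carrier (V y) \<subseteq> lspan K (V y) (v0 # us)"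
      using Y.lspan_least[OF Y.lspan_submodule[OF c0]] ws(2) by blast
    show ?thesis
    proof (rule ops.ext[OF a(1)])
      fix v assume "v \<in> carrier (V y)"
      then obtain c s where cs: "c \<in> carrier K" "s \<in> lspan K (V y) us" "v = c \<odot>\<^bsub>V y\<^esub> v0 \<oplus>\<^bsub>V y\<^esub> s"
        using full by auto
      have sC: "s \<in> carrier (V y)" using cs Y.lspan_carrier[OF us] by auto
      show "l v \<odot>\<^bsub>V z\<^esub> w = a v"
        using cs sC v0 lus[OF cs(2)] aus[OF cs(2)] a(2) w by (simp add: L La)
    qed
  qed
qed

end

section \<open>Isomorphisms between simple functors\<close>

text \<open>
  Goursat's lemma: a subfunctor \<open>R\<close> of \<open>F \<times> G\<close> that neither lies in \<open>F\<close> nor contains \<open>G\<close> is the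
  graph of an isomorphism.
\<close>

lemma goursat_iso:
  fixes F :: "('o, 'm, 'k, 'v) vect_functor_data" and G :: "('o, 'm, 'k, 'w) vect_functor_data"
  assumes F: "simple_vfunctor A K F" and G: "simple_vfunctor A K G"
    and R_in: "\<And>x v w. x \<in> Ob A \<Longrightarrow> (v, w) \<in> R x \<Longrightarrow> v \<in> carrier (fobj F x) \<and> w \<in> carrier (fobj G x)"
    and R_zero: "\<And>x. x \<in> Ob A \<Longrightarrow> (\<zero>\<^bsub>fobj F x\<^esub>, \<zero>\<^bsub>fobj G x\<^esub>) \<in> R x"
    and R_add: "\<And>x v w v' w'. x \<in> Ob A \<Longrightarrow> (v, w) \<in> R x \<Longrightarrow> (v', w') \<in> R x \<Longrightarrow>
      (v \<oplus>\<^bsub>fobj F x\<^esub> v', w \<oplus>\<^bsub>fobj G x\<^esub> w') \<in> R x"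
    and R_smult: "\<And>x c v w. x \<in> Ob A \<Longrightarrow> c \<in> carrier K \<Longrightarrow> (v, w) \<in> R x \<Longrightarrow> (c \<odot>\<^bsub>fobj F x\<^esub> v, c \<odot>\<^bsub>fobj G x\<^esub> w) \<in> R x"
    and R_arr: "\<And>x y f v w. x \<in> Ob A \<Longrightarrow> y \<in> Ob A \<Longrightarrow> f \<in> Mor A x y \<Longrightarrow> (v, w) \<in> R x \<Longrightarrow>
      (farr F x y f v, farr G x y f w) \<in> R y"
    and nonzero: "x \<in> Ob A" "(v, w) \<in> R x" "w \<noteq> \<zero>\<^bsub>fobj G x\<^esub>"
    and proper: "y \<in> Ob A" "w' \<in> carrier (fobj G y)" "(\<zero>\<^bsub>fobj F y\<^esub>, w') \<notin> R y"
  shows "functor_iso A K F G"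
proof -
  interpret F: simple_vfunctor A K F by fact
  interpret G: simple_vfunctor A K G by fact
  have Fz: "farr F x y f \<zero>\<^bsub>F.V x\<^esub> = \<zero>\<^bsub>F.V y\<^esub>" if "x \<in> Ob A" "y \<in> Ob A" "f \<in> Mor A x y" for x y f
    by (rule F.ops_zero[OF that(1,2) ops.gen[OF that(3)]])
  have Gz: "farr G x y f \<zero>\<^bsub>G.V x\<^esub> = \<zero>\<^bsub>G.V y\<^esub>" if "x \<in> Ob A" "y \<in> Ob A" "f \<in> Mor A x y" for x y f
    by (rule G.ops_zero[OF that(1,2) ops.gen[OF that(3)]])
  have simps: "\<zero>\<^bsub>F.V z\<^esub> \<oplus>\<^bsub>F.V z\<^esub> \<zero>\<^bsub>F.V z\<^esub> = \<zero>\<^bsub>F.V z\<^esub>" "\<zero>\<^bsub>G.V z\<^esub> \<oplus>\<^bsub>G.V z\<^esub> \<zero>\<^bsub>G.V z\<^esub> = \<zero>\<^bsub>G.V z\<^esub>"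
    "\<And>c. c \<in> carrier K \<Longrightarrow> c \<odot>\<^bsub>F.V z\<^esub> \<zero>\<^bsub>F.V z\<^esub> = \<zero>\<^bsub>F.V z\<^esub>" "\<And>c. c \<in> carrier K \<Longrightarrow> c \<odot>\<^bsub>G.V z\<^esub> \<zero>\<^bsub>G.V z\<^esub> = \<zero>\<^bsub>G.V z\<^esub>"
    if "z \<in> Ob A" for z
  proof -
    interpret Fz: module K "F.V z" by (rule F.fobj_module[OF that])
    interpret Gz: module K "G.V z" by (rule G.fobj_module[OF that])
    show "\<zero>\<^bsub>F.V z\<^esub> \<oplus>\<^bsub>F.V z\<^esub> \<zero>\<^bsub>F.V z\<^esub> = \<zero>\<^bsub>F.V z\<^esub>" "\<zero>\<^bsub>G.V z\<^esub> \<oplus>\<^bsub>G.V z\<^esub> \<zero>\<^bsub>G.V z\<^esub> = \<zero>\<^bsub>G.V z\<^esub>"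
      "\<And>c. c \<in> carrier K \<Longrightarrow> c \<odot>\<^bsub>F.V z\<^esub> \<zero>\<^bsub>F.V z\<^esub> = \<zero>\<^bsub>F.V z\<^esub>" "\<And>c. c \<in> carrier K \<Longrightarrow> c \<odot>\<^bsub>G.V z\<^esub> \<zero>\<^bsub>G.V z\<^esub> = \<zero>\<^bsub>G.V z\<^esub>"
      by simp_all
  qed
  have N1: "is_subfunctor A K (\<lambda>z. {w. (\<zero>\<^bsub>F.V z\<^esub>, w) \<in> R z}) G"
  proof (rule G.subfunctorI)
    fix x w assume x: "x \<in> Ob A" and w: "w \<in> {w. (\<zero>\<^bsub>F.V x\<^esub>, w) \<in> R x}"
    show "w \<oplus>\<^bsub>G.V x\<^esub> w' \<in> {w. (\<zero>\<^bsub>F.V x\<^esub>, w) \<in> R x}" if "w' \<in> {w. (\<zero>\<^bsub>F.V x\<^esub>, w) \<in> R x}" for w'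
      using R_add[OF x, of "\<zero>\<^bsub>F.V x\<^esub>" w "\<zero>\<^bsub>F.V x\<^esub>" w'] w that simps(1)[OF x] by simp
    show "c \<odot>\<^bsub>G.V x\<^esub> w \<in> {w. (\<zero>\<^bsub>F.V x\<^esub>, w) \<in> R x}" if "c \<in> carrier K" for c
      using R_smult[OF x that, of "\<zero>\<^bsub>F.V x\<^esub>" w] w simps(3)[OF x that] by simp
    show "farr G x y f w \<in> {w. (\<zero>\<^bsub>F.V y\<^esub>, w) \<in> R y}" if "y \<in> Ob A" "f \<in> Mor A x y" for y f
      using R_arr[OF x that, of "\<zero>\<^bsub>F.V x\<^esub>" w] w Fz[OF x that] by simp
  qed (use R_in R_zero in blast)+
  have N2: "is_subfunctor A K (\<lambda>z. {v. (v, \<zero>\<^bsub>G.V z\<^esub>) \<in> R z}) F"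
  proof (rule F.subfunctorI)
    fix x v assume x: "x \<in> Ob A" and v: "v \<in> {v. (v, \<zero>\<^bsub>G.V x\<^esub>) \<in> R x}"
    show "v \<oplus>\<^bsub>F.V x\<^esub> v' \<in> {v. (v, \<zero>\<^bsub>G.V x\<^esub>) \<in> R x}" if "v' \<in> {v. (v, \<zero>\<^bsub>G.V x\<^esub>) \<in> R x}" for v'
      using R_add[OF x, of v "\<zero>\<^bsub>G.V x\<^esub>" v' "\<zero>\<^bsub>G.V x\<^esub>"] v that simps(2)[OF x] by simp
    show "c \<odot>\<^bsub>F.V x\<^esub> v \<in> {v. (v, \<zero>\<^bsub>G.V x\<^esub>) \<in> R x}" if "c \<in> carrier K" for c
      using R_smult[OF x that, of v "\<zero>\<^bsub>G.V x\<^esub>"] v simps(4)[OF x that] by simp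
    show "farr F x y f v \<in> {v. (v, \<zero>\<^bsub>G.V y\<^esub>) \<in> R y}" if "y \<in> Ob A" "f \<in> Mor A x y" for y f
      using R_arr[OF x that, of v "\<zero>\<^bsub>G.V x\<^esub>"] v Gz[OF x that] by simp
  qed (use R_in R_zero in blast)+
  have D: "is_subfunctor A K (\<lambda>z. {v. \<exists>w. (v, w) \<in> R z}) F"
  proof (rule F.subfunctorI)
    fix x v assume x: "x \<in> Ob A" and "v \<in> {v. \<exists>w. (v, w) \<in> R x}"
    then obtain w where w: "(v, w) \<in> R x" by blast
    show "v \<oplus>\<^bsub>F.V x\<^esub> v' \<in> {v. \<exists>w. (v, w) \<in> R x}" if "v' \<in> {v. \<exists>w. (v, w) \<in> R x}" for v'
      using that R_add[OF x w] by blast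
    show "c \<odot>\<^bsub>F.V x\<^esub> v \<in> {v. \<exists>w. (v, w) \<in> R x}" if "c \<in> carrier K" for c
      using R_smult[OF x that w] by blast
    show "farr F x y f v \<in> {v. \<exists>w. (v, w) \<in> R y}" if "y \<in> Ob A" "f \<in> Mor A x y" for y f
      using R_arr[OF x that w] by blast
  qed (use R_in R_zero in blast)+
  have E: "is_subfunctor A K (\<lambda>z. {w. \<exists>v. (v, w) \<in> R z}) G"
  proof (rule G.subfunctorI)
    fix x w assume x: "x \<in> Ob A" and "w \<in> {w. \<exists>v. (v, w) \<in> R x}"
    then obtain v where v: "(v, w) \<in> R x" by blast
    show "w \<oplus>\<^bsub>G.V x\<^esub> w' \<in> {w. \<exists>v. (v, w) \<in> R x}" if "w' \<in> {w. \<exists>v. (v, w) \<in> R x}" for w'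
      using that R_add[OF x v] by blast
    show "c \<odot>\<^bsub>G.V x\<^esub> w \<in> {w. \<exists>v. (v, w) \<in> R x}" if "c \<in> carrier K" for c
      using R_smult[OF x that v] by blast
    show "farr G x y f w \<in> {w. \<exists>v. (v, w) \<in> R y}" if "y \<in> Ob A" "f \<in> Mor A x y" for y f
      using R_arr[OF x that v] by blast
  qed (use R_in R_zero in blast)+
  have inj1: "w = \<zero>\<^bsub>G.V z\<^esub>" if "z \<in> Ob A" "(\<zero>\<^bsub>F.V z\<^esub>, w) \<in> R z" for z w
  proof (rule ccontr)
    assume "w \<noteq> \<zero>\<^bsub>G.V z\<^esub>"
    from G.subfunctor_full[OF N1 that(1) _ this proper(1)] that(2) proper show False by blast
  qed
  have v: "v \<noteq> \<zero>\<^bsub>F.V x\<^esub>" using inj1 nonzero by blast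
  have ran: "\<exists>v. (v, w) \<in> R z" if "z \<in> Ob A" "w \<in> carrier (G.V z)" for z w
    using G.subfunctor_full[OF E nonzero(1) _ nonzero(3) that(1)] nonzero(2) that(2) by blast
  have dom: "\<exists>w. (v, w) \<in> R z" if "z \<in> Ob A" "v \<in> carrier (F.V z)" for z v
    using F.subfunctor_full[OF D nonzero(1) _ v that(1)] nonzero(2) that(2) by blast
  have diff: "(v \<ominus>\<^bsub>F.V z\<^esub> v', w \<ominus>\<^bsub>G.V z\<^esub> w') \<in> R z" if z: "z \<in> Ob A" and r: "(v, w) \<in> R z" "(v', w') \<in> R z" for z v w v' w'
  proof -
    interpret Fz: module K "F.V z" by (rule F.fobj_module[OF z])
    interpret Gz: module K "G.V z" by (rule G.fobj_module[OF z])
    have c: "v' \<in> carrier (F.V z)" "w' \<in> carrier (G.V z)" using R_in[OF z r(2)] by auto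
    have "((\<ominus>\<^bsub>K\<^esub> \<one>\<^bsub>K\<^esub>) \<odot>\<^bsub>F.V z\<^esub> v', (\<ominus>\<^bsub>K\<^esub> \<one>\<^bsub>K\<^esub>) \<odot>\<^bsub>G.V z\<^esub> w') \<in> R z" by (rule R_smult[OF z _ r(2)]) simp
    from R_add[OF z r(1) this] show ?thesis
      using c by (simp add: Fz.smult_l_minus Gz.smult_l_minus a_minus_def)
  qed
  have sub_self: "s \<ominus>\<^bsub>F.V z\<^esub> t = \<zero>\<^bsub>F.V z\<^esub> \<longleftrightarrow> s = t" if "z \<in> Ob A" "s \<in> carrier (F.V z)" "t \<in> carrier (F.V z)" for z s t
  proof -
    interpret Fz: module K "F.V z" by (rule F.fobj_module[OF that(1)])
    show ?thesis using that Fz.M.minus_equality[of s "\<ominus>\<^bsub>F.V z\<^esub> t"] by (auto simp: a_minus_def Fz.M.r_neg)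
  qed
  have sub_self': "s \<ominus>\<^bsub>G.V z\<^esub> t = \<zero>\<^bsub>G.V z\<^esub> \<longleftrightarrow> s = t" if "z \<in> Ob A" "s \<in> carrier (G.V z)" "t \<in> carrier (G.V z)" for z s t
  proof -
    interpret Gz: module K "G.V z" by (rule G.fobj_module[OF that(1)])
    show ?thesis using that Gz.M.minus_equality[of s "\<ominus>\<^bsub>G.V z\<^esub> t"] by (auto simp: a_minus_def Gz.M.r_neg)
  qed
  have uniq: "w = w'" if "z \<in> Ob A" "(v, w) \<in> R z" "(v, w') \<in> R z" for z v w w'
  proof -
    have c: "v \<in> carrier (F.V z)" "w \<in> carrier (G.V z)" "w' \<in> carrier (G.V z)" using R_in that by blast+
    have "(v \<ominus>\<^bsub>F.V z\<^esub> v, w \<ominus>\<^bsub>G.V z\<^esub> w') \<in> R z" by (rule diff[OF that])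
    then have "w \<ominus>\<^bsub>G.V z\<^esub> w' = \<zero>\<^bsub>G.V z\<^esub>" using inj1[OF that(1)] sub_self[OF that(1) c(1) c(1)] by simp
    then show ?thesis using sub_self'[OF that(1) c(2,3)] by simp
  qed
  have inj2: "v = \<zero>\<^bsub>F.V z\<^esub>" if "z \<in> Ob A" "(v, \<zero>\<^bsub>G.V z\<^esub>) \<in> R z" for z v
  proof (rule ccontr)
    assume n: "v \<noteq> \<zero>\<^bsub>F.V z\<^esub>"
    have "{v. (v, \<zero>\<^bsub>G.V x\<^esub>) \<in> R x} = carrier (F.V x)"
      by (rule F.subfunctor_full[OF N2 that(1) _ n nonzero(1)]) (simp add: that(2))
    then have "(\<zero>\<^bsub>F.V x\<^esub>, \<zero>\<^bsub>G.V x\<^esub>) \<in> R x" "\<And>s. s \<in> carrier (F.V x) \<Longrightarrow> (s, \<zero>\<^bsub>G.V x\<^esub>) \<in> R x"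
      using R_zero[OF nonzero(1)] by auto
    then show False using uniq[OF nonzero(1,2)] R_in[OF nonzero(1,2)] nonzero(3) by blast
  qed
  have uniq': "v = v'" if "z \<in> Ob A" "(v, w) \<in> R z" "(v', w) \<in> R z" for z v v' w
  proof -
    have c: "w \<in> carrier (G.V z)" "v \<in> carrier (F.V z)" "v' \<in> carrier (F.V z)" using R_in that by blast+
    have "(v \<ominus>\<^bsub>F.V z\<^esub> v', w \<ominus>\<^bsub>G.V z\<^esub> w) \<in> R z" by (rule diff[OF that])
    then have "v \<ominus>\<^bsub>F.V z\<^esub> v' = \<zero>\<^bsub>F.V z\<^esub>" using inj2[OF that(1)] sub_self'[OF that(1) c(1) c(1)] by simp
    then show ?thesis using sub_self[OF that(1) c(2,3)] by simp
  qed
  define \<eta> where "\<eta> z v = (THE w. (v, w) \<in> R z)" for z v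
  have \<eta>_eq: "\<eta> z v = w" if "z \<in> Ob A" "(v, w) \<in> R z" for z v w
    unfolding \<eta>_def by (rule the_equality) (use uniq that in blast)+
  have \<eta>: "(v, \<eta> z v) \<in> R z" if z: "z \<in> Ob A" and v: "v \<in> carrier (F.V z)" for z v
  proof -
    obtain w where "(v, w) \<in> R z" using dom[OF z v] by blast
    then show ?thesis using \<eta>_eq[OF z] by simp
  qed
  show ?thesis
    unfolding functor_iso_def
  proof (intro exI[of _ \<eta>] conjI ballI)
    fix z assume z: "z \<in> Ob A"
    show "linear_map K (F.V z) (G.V z) (\<eta> z)"
    proof (rule linear_mapI)
      fix v assume v: "v \<in> carrier (F.V z)"
      show "\<eta> z v \<in> carrier (G.V z)" using R_in[OF z \<eta>[OF z v]] by blast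
      show "\<eta> z (v \<oplus>\<^bsub>F.V z\<^esub> w) = \<eta> z v \<oplus>\<^bsub>G.V z\<^esub> \<eta> z w" if w: "w \<in> carrier (F.V z)" for w
        by (rule \<eta>_eq[OF z R_add[OF z \<eta>[OF z v] \<eta>[OF z w]]])
      show "\<eta> z (c \<odot>\<^bsub>F.V z\<^esub> v) = c \<odot>\<^bsub>G.V z\<^esub> \<eta> z v" if c: "c \<in> carrier K" for c
        by (rule \<eta>_eq[OF z R_smult[OF z c \<eta>[OF z v]]])
    qed
    show "bij_betw (\<eta> z) (carrier (F.V z)) (carrier (G.V z))"
      unfolding bij_betw_def
    proof
      show "inj_on (\<eta> z) (carrier (F.V z))"
      proof (rule inj_onI)
        fix v v' assume v: "v \<in> carrier (F.V z)" "v' \<in> carrier (F.V z)" and eq: "\<eta> z v = \<eta> z v'"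
        show "v = v'" by (rule uniq'[OF z \<eta>[OF z v(1)]]) (simp add: eq \<eta>[OF z v(2)])
      qed
      show "\<eta> z ` carrier (F.V z) = carrier (G.V z)"
      proof (intro equalityI subsetI)
        fix w assume "w \<in> carrier (G.V z)"
        then obtain v where "(v, w) \<in> R z" using ran[OF z] by blast
        then show "w \<in> \<eta> z ` carrier (F.V z)" using \<eta>_eq[OF z] R_in[OF z] by blast
      qed (use R_in[OF z \<eta>[OF z]] in blast)
    qed
    fix y f v assume y: "y \<in> Ob A" and f: "f \<in> Mor A z y" and v: "v \<in> carrier (F.V z)"
    show "\<eta> y (farr F z y f v) = farr G z y f (\<eta> z v)"
      by (rule \<eta>_eq[OF y R_arr[OF z y f \<eta>[OF z v]]])
  qed
qed

text \<open>
  A simple functor on which some zero morphism acts non-trivially is constant: the images of a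
  vector \<open>u = F 0 v\<close> under the zero morphisms span a non-zero subfunctor.
\<close>

lemma (in simple_vfunctor) zero_acts_imp_const:
  assumes x: "x \<in> Ob A" and v: "v \<in> carrier (V x)" and nz: "farr F x x \<one>\<^bsub>Hom A x x\<^esub> v \<noteq> \<zero>\<^bsub>V x\<^esub>"
  shows "functor_iso A K F (const_functor K)"
proof -
  have one: "\<one>\<^bsub>Hom A y z\<^esub> \<in> Mor A y z" if "y \<in> Ob A" "z \<in> Ob A" for y z
  proof -
    interpret comm_group "Hom A y z" by (rule Hom_comm_group[OF that])
    show ?thesis by simp
  qed
  define e where "e y = farr F x y \<one>\<^bsub>Hom A x y\<^esub> v" for y
  have e: "e y \<in> carrier (V y)" if "y \<in> Ob A" for y
    unfolding e_def by (rule linear_mapD(1)[OF farr_linear[OF x that one[OF x that]] v])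
  have arr: "farr F y z f (e y) = e z" if y: "y \<in> Ob A" and z: "z \<in> Ob A" and f: "f \<in> Mor A y z" for y z f
    unfolding e_def using farr_Cmp[OF x y z one[OF x y] f v] Cmp_zero_right[OF x y z f] by simp
  let ?N = "\<lambda>y. {c \<odot>\<^bsub>V y\<^esub> e y | c. c \<in> carrier K}"
  have N: "is_subfunctor A K ?N F"
  proof (rule subfunctorI)
    fix y assume y: "y \<in> Ob A"
    interpret Y: module K "V y" by (rule fobj_module[OF y])
    show "?N y \<subseteq> carrier (V y)" using e[OF y] by auto
    have "\<zero>\<^bsub>V y\<^esub> = \<zero>\<^bsub>K\<^esub> \<odot>\<^bsub>V y\<^esub> e y" using e[OF y] by simp
    then show "\<zero>\<^bsub>V y\<^esub> \<in> ?N y" by blast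
    fix s assume "s \<in> ?N y"
    then obtain c where c: "c \<in> carrier K" "s = c \<odot>\<^bsub>V y\<^esub> e y" by blast
    show "s \<oplus>\<^bsub>V y\<^esub> t \<in> ?N y" if t: "t \<in> ?N y" for t
    proof -
      obtain d where d: "d \<in> carrier K" "t = d \<odot>\<^bsub>V y\<^esub> e y" using t by blast
      have "s \<oplus>\<^bsub>V y\<^esub> t = (c \<oplus>\<^bsub>K\<^esub> d) \<odot>\<^bsub>V y\<^esub> e y" using c d e[OF y] by (simp add: Y.smult_l_distr)
      then show ?thesis using c d by blast
    qed
    show "d \<odot>\<^bsub>V y\<^esub> s \<in> ?N y" if d: "d \<in> carrier K" for d
    proof -
      have "d \<odot>\<^bsub>V y\<^esub> s = (d \<otimes>\<^bsub>K\<^esub> c) \<odot>\<^bsub>V y\<^esub> e y" using c d e[OF y] by (simp add: Y.smult_assoc1)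
      then show ?thesis using c d by blast
    qed
    show "farr F y z f s \<in> ?N z" if z: "z \<in> Ob A" and f: "f \<in> Mor A y z" for z f
      using linear_mapD(3)[OF farr_linear[OF y z f] c(1) e[OF y]] arr[OF y z f] c by auto
  qed
  have ex: "e x \<noteq> \<zero>\<^bsub>V x\<^esub>" using nz by (simp add: e_def)
  interpret X: vspace K "V x" by (rule V_vspace[OF x])
  have "e x = \<one>\<^bsub>K\<^esub> \<odot>\<^bsub>V x\<^esub> e x" using e[OF x] by simp
  then have "e x \<in> ?N x" by blast
  from subfunctor_full[OF N x this ex] have full: "\<exists>c\<in>carrier K. w = c \<odot>\<^bsub>V y\<^esub> e y" if "y \<in> Ob A" "w \<in> carrier (V y)" for y w
    using that by blast
  have en: "e y \<noteq> \<zero>\<^bsub>V y\<^esub>" if y: "y \<in> Ob A" for y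
    using arr[OF y x one[OF y x]] ex ops_zero[OF y x ops.gen[OF one[OF y x]]] by metis
  have inj: "c = d" if y: "y \<in> Ob A" and cd: "c \<in> carrier K" "d \<in> carrier K" "c \<odot>\<^bsub>V y\<^esub> e y = d \<odot>\<^bsub>V y\<^esub> e y" for y c d
  proof -
    interpret Y: vspace K "V y" by (rule V_vspace[OF y])
    have "(c \<ominus>\<^bsub>K\<^esub> d) \<odot>\<^bsub>V y\<^esub> e y = \<zero>\<^bsub>V y\<^esub>"
      using cd e[OF y] by (simp add: a_minus_def Y.smult_l_distr Y.smult_l_minus Y.M.r_neg)
    then show ?thesis using Y.smult_eq_zero[of "c \<ominus>\<^bsub>K\<^esub> d" "e y"] e[OF y] en[OF y] cd by simp
  qed
  define \<eta> where "\<eta> y w = (THE c. c \<in> carrier K \<and> w = c \<odot>\<^bsub>V y\<^esub> e y)" for y w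
  have \<eta>_eq: "\<eta> y (c \<odot>\<^bsub>V y\<^esub> e y) = c" if "y \<in> Ob A" "c \<in> carrier K" for y c
    unfolding \<eta>_def by (rule the_equality) (use that inj in auto)
  have \<eta>: "\<eta> y w \<in> carrier K" "\<eta> y w \<odot>\<^bsub>V y\<^esub> e y = w" if "y \<in> Ob A" "w \<in> carrier (V y)" for y w
    using full[OF that] \<eta>_eq[OF that(1)] by auto
  show ?thesis
    unfolding functor_iso_def
  proof (intro exI[of _ \<eta>] conjI ballI)
    fix y assume y: "y \<in> Ob A"
    interpret Y: module K "V y" by (rule fobj_module[OF y])
    have c: "fobj (const_functor K) y = field_module K" by (simp add: const_functor_def)
    show "linear_map K (V y) (fobj (const_functor K) y) (\<eta> y)"
      unfolding c
    proof (rule linear_mapI)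
      fix v assume v: "v \<in> carrier (V y)"
      note v' = \<eta>[OF y v]
      show "\<eta> y v \<in> carrier (field_module K)" using v' by simp
      show "\<eta> y (v \<oplus>\<^bsub>V y\<^esub> w) = \<eta> y v \<oplus>\<^bsub>field_module K\<^esub> \<eta> y w" if w: "w \<in> carrier (V y)" for w
      proof -
        note w' = \<eta>[OF y w]
        have "v \<oplus>\<^bsub>V y\<^esub> w = (\<eta> y v \<oplus>\<^bsub>K\<^esub> \<eta> y w) \<odot>\<^bsub>V y\<^esub> e y"
          using v' w' e[OF y] by (simp add: Y.smult_l_distr)
        then show ?thesis using \<eta>_eq[OF y, of "\<eta> y v \<oplus>\<^bsub>K\<^esub> \<eta> y w"] v' w' by simp
      qed
      show "\<eta> y (d \<odot>\<^bsub>V y\<^esub> v) = d \<odot>\<^bsub>field_module K\<^esub> \<eta> y v" if d: "d \<in> carrier K" for d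
      proof -
        have "d \<odot>\<^bsub>V y\<^esub> v = (d \<otimes>\<^bsub>K\<^esub> \<eta> y v) \<odot>\<^bsub>V y\<^esub> e y"
          using v' d e[OF y] by (simp add: Y.smult_assoc1)
        then show ?thesis using \<eta>_eq[OF y, of "d \<otimes>\<^bsub>K\<^esub> \<eta> y v"] v' d by simp
      qed
    qed
    show "bij_betw (\<eta> y) (carrier (V y)) (carrier (fobj (const_functor K) y))"
      unfolding c by (rule bij_betw_byWitness[where f' = "\<lambda>c. c \<odot>\<^bsub>V y\<^esub> e y"]) (use \<eta>[OF y] \<eta>_eq[OF y] e[OF y] in auto)
    fix z f w assume z: "z \<in> Ob A" and f: "f \<in> Mor A y z" and w: "w \<in> carrier (V y)"
    have "farr F y z f (\<eta> y w \<odot>\<^bsub>V y\<^esub> e y) = \<eta> y w \<odot>\<^bsub>V z\<^esub> e z"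
      using linear_mapD(3)[OF farr_linear[OF y z f] \<eta>(1)[OF y w] e[OF y]] arr[OF y z f] by simp
    then show "\<eta> z (farr F y z f w) = farr (const_functor K) y z f (\<eta> y w)"
      using \<eta>[OF y w] \<eta>_eq[OF z] by (simp add: const_functor_def)
  qed
qed

lemma (in linear_functor) iso_const_endomorphism:
  assumes iso: "functor_iso A K F (const_functor K)" and x: "x \<in> Ob A" and f: "f \<in> Mor A x x" and v: "v \<in> carrier (V x)"
  shows "farr F x x f v = v"
proof -
  obtain \<eta> where \<eta>: "bij_betw (\<eta> x) (carrier (V x)) (carrier K)" "\<eta> x (farr F x x f v) = \<eta> x v"
    using iso x f v unfolding functor_iso_def const_functor_def by auto
  show ?thesis
    by (rule inj_onD[OF bij_betw_imp_inj_on[OF \<eta>(1)] \<eta>(2) linear_mapD(1)[OF farr_linear[OF x x f] v] v])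
qed

lemma functor_iso_sym:
  assumes iso: "functor_iso A K F G" and F: "vect_functor A K F"
  shows "functor_iso A K G F"
proof -
  interpret F: vect_functor A K F by fact
  obtain \<eta> where \<eta>: "\<And>x. x \<in> Ob A \<Longrightarrow> linear_map K (fobj F x) (fobj G x) (\<eta> x)"
    "\<And>x. x \<in> Ob A \<Longrightarrow> bij_betw (\<eta> x) (carrier (fobj F x)) (carrier (fobj G x))"
    "\<And>x y f v. x \<in> Ob A \<Longrightarrow> y \<in> Ob A \<Longrightarrow> f \<in> Mor A x y \<Longrightarrow> v \<in> carrier (fobj F x) \<Longrightarrow> \<eta> y (farr F x y f v) = farr G x y f (\<eta> x v)"
    using iso unfolding functor_iso_def by blast
  define \<theta> where "\<theta> x = inv_into (carrier (fobj F x)) (\<eta> x)" for x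
  have l: "\<theta> x (\<eta> x v) = v" if "x \<in> Ob A" "v \<in> carrier (fobj F x)" for x v
    unfolding \<theta>_def by (rule bij_betw_inv_into_left[OF \<eta>(2)[OF that(1)] that(2)])
  have r: "\<eta> x (\<theta> x w) = w" "\<theta> x w \<in> carrier (fobj F x)" if "x \<in> Ob A" "w \<in> carrier (fobj G x)" for x w
    unfolding \<theta>_def using bij_betw_inv_into_right[OF \<eta>(2)[OF that(1)] that(2)] \<eta>(2)[OF that(1)] that(2)
    by (auto simp: bij_betw_def inv_into_into)
  show ?thesis
    unfolding functor_iso_def
  proof (intro exI[of _ \<theta>] conjI ballI)
    fix x assume x: "x \<in> Ob A"
    interpret X: module K "fobj F x" by (rule F.fobj_module[OF x])
    note L = linear_mapD[OF \<eta>(1)[OF x]]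
    show "linear_map K (fobj G x) (fobj F x) (\<theta> x)"
    proof (rule linear_mapI)
      fix v assume v: "v \<in> carrier (fobj G x)"
      show "\<theta> x v \<in> carrier (fobj F x)" using r[OF x v] by simp
      show "\<theta> x (v \<oplus>\<^bsub>fobj G x\<^esub> w) = \<theta> x v \<oplus>\<^bsub>fobj F x\<^esub> \<theta> x w" if w: "w \<in> carrier (fobj G x)" for w
        using L(2)[OF r(2)[OF x v] r(2)[OF x w]] r[OF x v] r[OF x w] l[OF x, of "\<theta> x v \<oplus>\<^bsub>fobj F x\<^esub> \<theta> x w"] by simp
      show "\<theta> x (c \<odot>\<^bsub>fobj G x\<^esub> v) = c \<odot>\<^bsub>fobj F x\<^esub> \<theta> x v" if c: "c \<in> carrier K" for c
        using L(3)[OF c r(2)[OF x v]] r[OF x v] l[OF x, of "c \<odot>\<^bsub>fobj F x\<^esub> \<theta> x v"] c by simp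
    qed
    show "bij_betw (\<theta> x) (carrier (fobj G x)) (carrier (fobj F x))"
      unfolding \<theta>_def by (rule bij_betw_inv_into[OF \<eta>(2)[OF x]])
    fix y f w assume y: "y \<in> Ob A" and f: "f \<in> Mor A x y" and w: "w \<in> carrier (fobj G x)"
    have "farr F x y f (\<theta> x w) \<in> carrier (fobj F y)"
      by (rule linear_mapD(1)[OF F.farr_linear[OF x y f] r(2)[OF x w]])
    then show "\<theta> y (farr G x y f w) = farr F x y f (\<theta> x w)"
      using \<eta>(3)[OF x y f r(2)[OF x w]] r(1)[OF x w] l[OF y, of "farr F x y f (\<theta> x w)"] by simp
  qed
qed

lemma functor_iso_trans:
  assumes FG: "functor_iso A K F G" and GH: "functor_iso A K G H"
  shows "functor_iso A K F H"
proof -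
  obtain \<eta> where \<eta>: "\<And>x. x \<in> Ob A \<Longrightarrow> linear_map K (fobj F x) (fobj G x) (\<eta> x)"
    "\<And>x. x \<in> Ob A \<Longrightarrow> bij_betw (\<eta> x) (carrier (fobj F x)) (carrier (fobj G x))"
    "\<And>x y f v. x \<in> Ob A \<Longrightarrow> y \<in> Ob A \<Longrightarrow> f \<in> Mor A x y \<Longrightarrow> v \<in> carrier (fobj F x) \<Longrightarrow> \<eta> y (farr F x y f v) = farr G x y f (\<eta> x v)"
    using FG unfolding functor_iso_def by blast
  obtain \<theta> where \<theta>: "\<And>x. x \<in> Ob A \<Longrightarrow> linear_map K (fobj G x) (fobj H x) (\<theta> x)"
    "\<And>x. x \<in> Ob A \<Longrightarrow> bij_betw (\<theta> x) (carrier (fobj G x)) (carrier (fobj H x))"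
    "\<And>x y f v. x \<in> Ob A \<Longrightarrow> y \<in> Ob A \<Longrightarrow> f \<in> Mor A x y \<Longrightarrow> v \<in> carrier (fobj G x) \<Longrightarrow> \<theta> y (farr G x y f v) = farr H x y f (\<theta> x v)"
    using GH unfolding functor_iso_def by blast
  show ?thesis
    unfolding functor_iso_def
  proof (intro exI[of _ "\<lambda>x v. \<theta> x (\<eta> x v)"] conjI ballI)
    fix x assume x: "x \<in> Ob A"
    show "linear_map K (fobj F x) (fobj H x) (\<lambda>v. \<theta> x (\<eta> x v))" by (rule linear_map_comp[OF \<eta>(1)[OF x] \<theta>(1)[OF x]])
    show "bij_betw (\<lambda>v. \<theta> x (\<eta> x v)) (carrier (fobj F x)) (carrier (fobj H x))"
      using bij_betw_trans[OF \<eta>(2)[OF x] \<theta>(2)[OF x]] by (simp add: o_def)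
    fix y f v assume "y \<in> Ob A" "f \<in> Mor A x y" "v \<in> carrier (fobj F x)"
    then show "\<theta> y (\<eta> y (farr F x y f v)) = farr H x y f (\<theta> x (\<eta> x v))"
      using \<eta>(3)[OF x] \<theta>(3)[OF x] linear_mapD(1)[OF \<eta>(1)[OF x]] by simp
  qed
qed

lemma simple_functor_iso:
  assumes F: "vect_functor A K F" and K: "field K" and C: "preadditive_category A"
    and iso: "functor_iso A K F G" and G: "simple_functor A K G"
  shows "simple_functor A K F"
proof -
  have Gf: "vect_functor A K G" using G unfolding simple_functor_def by blast
  interpret F: linear_functor A K F by (intro linear_functor.intro F K C)
  interpret G: linear_functor A K G by (intro linear_functor.intro Gf K C)
  obtain \<eta> where \<eta>: "\<And>x. x \<in> Ob A \<Longrightarrow> linear_map K (fobj F x) (fobj G x) (\<eta> x)"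
    "\<And>x. x \<in> Ob A \<Longrightarrow> bij_betw (\<eta> x) (carrier (fobj F x)) (carrier (fobj G x))"
    "\<And>x y f v. x \<in> Ob A \<Longrightarrow> y \<in> Ob A \<Longrightarrow> f \<in> Mor A x y \<Longrightarrow> v \<in> carrier (fobj F x) \<Longrightarrow> \<eta> y (farr F x y f v) = farr G x y f (\<eta> x v)"
    using iso unfolding functor_iso_def by blast
  have z: "\<eta> x \<zero>\<^bsub>F.V x\<^esub> = \<zero>\<^bsub>G.V x\<^esub>" if "x \<in> Ob A" for x
    by (rule linear_map_zero[OF F.fobj_module[OF that] G.fobj_module[OF that] \<eta>(1)[OF that]])
  have inj: "inj_on (\<eta> x) (carrier (F.V x))" and surj: "\<eta> x ` carrier (F.V x) = carrier (G.V x)" if "x \<in> Ob A" for x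
    using \<eta>(2)[OF that] by (auto simp: bij_betw_def)
  obtain x where x: "x \<in> Ob A" "carrier (G.V x) \<noteq> {\<zero>\<^bsub>G.V x\<^esub>}" using G unfolding simple_functor_def by blast
  have "carrier (F.V x) \<noteq> {\<zero>\<^bsub>F.V x\<^esub>}" using surj[OF x(1)] z[OF x(1)] x(2) by auto
  moreover have "(\<forall>x\<in>Ob A. N x = {\<zero>\<^bsub>F.V x\<^esub>}) \<or> (\<forall>x\<in>Ob A. N x = carrier (F.V x))" if N: "is_subfunctor A K N F" for N
  proof -
    note ND = F.subfunctorD[OF N]
    have "is_subfunctor A K (\<lambda>x. \<eta> x ` N x) G"
    proof (rule G.subfunctorI)
      fix x assume x: "x \<in> Ob A"
      note L = linear_mapD[OF \<eta>(1)[OF x]] and Nx = ND[OF x]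
      show "\<eta> x ` N x \<subseteq> carrier (G.V x)" using Nx(1) L(1) by auto
      show "\<zero>\<^bsub>G.V x\<^esub> \<in> \<eta> x ` N x" using Nx(2) z[OF x] by force
      fix s assume s: "s \<in> \<eta> x ` N x"
      then obtain s' where s': "s' \<in> N x" "s = \<eta> x s'" by blast
      have s'C: "s' \<in> carrier (F.V x)" using s' Nx(1) by blast
      show "s \<oplus>\<^bsub>G.V x\<^esub> t \<in> \<eta> x ` N x" if t: "t \<in> \<eta> x ` N x" for t
      proof -
        obtain t' where t': "t' \<in> N x" "t = \<eta> x t'" using t by blast
        then have "t' \<in> carrier (F.V x)" using Nx(1) by blast
        then have "s \<oplus>\<^bsub>G.V x\<^esub> t = \<eta> x (s' \<oplus>\<^bsub>F.V x\<^esub> t')" using L(2) s' t' s'C by simp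
        then show ?thesis using Nx(3)[OF s'(1) t'(1)] by blast
      qed
      show "c \<odot>\<^bsub>G.V x\<^esub> s \<in> \<eta> x ` N x" if "c \<in> carrier K" for c
        using L(3)[OF that s'C] Nx(4)[OF that s'(1)] s' by (metis imageI)
      show "farr G x y f s \<in> \<eta> y ` N y" if "y \<in> Ob A" "f \<in> Mor A x y" for y f
        using \<eta>(3)[OF x that s'C] Nx(5)[OF that s'(1)] s' by (metis imageI)
    qed
    then consider "\<forall>x\<in>Ob A. \<eta> x ` N x = {\<zero>\<^bsub>G.V x\<^esub>}" | "\<forall>x\<in>Ob A. \<eta> x ` N x = carrier (G.V x)"
      using G unfolding simple_functor_def by blast
    then show ?thesis
    proof cases
      case 1
      have "N x = {\<zero>\<^bsub>F.V x\<^esub>}" if x: "x \<in> Ob A" for x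
      proof -
        have "s = \<zero>\<^bsub>F.V x\<^esub>" if "s \<in> N x" for s
          by (rule inj_onD[OF inj[OF x]]) (use 1 x that z[OF x] ND(1,2)[OF x] in auto)
        then show ?thesis using ND(2)[OF x] by blast
      qed
      then show ?thesis by blast
    next
      case 2
      have "N x = carrier (F.V x)" if x: "x \<in> Ob A" for x
        by (rule inj_on_image_eq_iff[OF inj[OF x] ND(1)[OF x] order_refl, THEN iffD1]) (use 2 x surj[OF x] in simp)
      then show ?thesis by blast
    qed
  qed
  ultimately show ?thesis unfolding simple_functor_def using F x(1) by blast
qed

section \<open>Primary components\<close>

text \<open>
  On an abelian group of exponent dividing \<open>L\<close>, the projection to the \<open>p\<close>-primary part is the power
  map with any exponent that is \<open>1\<close> modulo the \<open>p\<close>-part of \<open>L\<close> and \<open>0\<close> modulo the rest. That one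
  exponent serves for several groups at once makes the projections compatible with composition.
\<close>

definition primary_exponent :: "nat \<Rightarrow> nat \<Rightarrow> nat" where
  "primary_exponent p L = (SOME N. [N = 1] (mod p ^ multiplicity p L) \<and> (L div p ^ multiplicity p L) dvd N)"

lemma primary_exponent:
  assumes p: "Factorial_Ring.prime p" and L: "L > 0"
  shows "[primary_exponent p L = 1] (mod p ^ multiplicity p L)" "(L div p ^ multiplicity p L) dvd primary_exponent p L"
    and "coprime p (L div p ^ multiplicity p L)"
proof -
  let ?m = "L div p ^ multiplicity p L"
  show cop: "coprime p ?m"
  proof (rule prime_imp_coprime[OF p])
    show "\<not> p dvd ?m" using multiplicity_decompose[of L p] prime_gt_1_nat[OF p] L by auto
  qed
  then have "coprime ?m (p ^ multiplicity p L)" by (simp add: coprime_commute)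
  from cong_solve_coprime_nat[OF this] obtain x where "[?m * x = 1] (mod p ^ multiplicity p L)" by auto
  then have "\<exists>N. [N = 1] (mod p ^ multiplicity p L) \<and> ?m dvd N" by (intro exI[of _ "?m * x"]) simp
  from someI_ex[OF this] show "[primary_exponent p L = 1] (mod p ^ multiplicity p L)" "?m dvd primary_exponent p L"
    unfolding primary_exponent_def by auto
qed

locale plain_comm_group = comm_group G for G :: "'a monoid" (structure)
begin

lemma pow_cong_eq:
  assumes x: "x \<in> carrier G" and d: "x [^] d = \<one>" and c: "[m = n] (mod d)"
  shows "x [^] m = x [^] (n::nat)"
proof -
  have "ord x dvd d" using x d by (simp add: pow_eq_id)
  then have "[m = n] (mod ord x)" using c cong_dvd_modulus_nat by blast
  then have "int (ord x) dvd int n - int m" by (metis cong_int_iff cong_iff_dvd_diff cong_sym)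
  then have "x [^] int m = x [^] int n" using int_pow_eq[OF x] by simp
  then show ?thesis by (simp add: int_pow_int)
qed

lemma primary_power:
  assumes p: "Factorial_Ring.prime p" and L: "L > 0" "x \<in> carrier G" "x [^] L = \<one>"
  shows "(x [^] primary_exponent p L) [^] (p ^ multiplicity p L) = \<one>"
proof -
  let ?N = "primary_exponent p L" and ?a = "p ^ multiplicity p L"
  have "?a * (L div ?a) = L" by (simp add: multiplicity_dvd)
  moreover have "?a * (L div ?a) dvd ?N * ?a" using primary_exponent(2)[OF p L(1)] by (metis dvd_refl mult.commute mult_dvd_mono)
  ultimately have "L dvd ?N * ?a" by simp
  then show ?thesis using L by (simp add: nat_pow_pow pow_eq_id dvd_trans)
qed

lemma primary_power_id:
  assumes p: "Factorial_Ring.prime p" and L: "L > 0" "x \<in> primary_part p G" "x [^] L = \<one>"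
  shows "x [^] primary_exponent p L = x"
proof -
  obtain n where x: "x \<in> carrier G" "x [^] (p ^ n) = \<one>" using L by (auto simp: primary_part_def)
  have "ord x dvd p ^ n" "ord x dvd L" using x L by (simp_all add: pow_eq_id)
  then obtain k where k: "ord x = p ^ k" using p divides_primepow_nat by blast
  then have "p ^ k dvd p ^ multiplicity p L" using \<open>ord x dvd L\<close> p L(1)
    by (metis le_imp_power_dvd not_prime_unit multiplicity_geI power_dvd_iff_le_multiplicity gr_implies_not0)
  then have "x [^] (p ^ multiplicity p L) = \<one>" using x k by (simp add: pow_eq_id)
  from pow_cong_eq[OF x(1) this primary_exponent(1)[OF p L(1)]] show ?thesis using x by simp
qed

lemma primary_power_other:
  assumes p: "Factorial_Ring.prime p" and q: "Factorial_Ring.prime q" "q \<noteq> p"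
    and L: "L > 0" "x \<in> primary_part q G" "x [^] L = \<one>"
  shows "x [^] primary_exponent p L = \<one>"
proof -
  obtain n where x: "x \<in> carrier G" "x [^] (q ^ n) = \<one>" using L by (auto simp: primary_part_def)
  have o: "ord x dvd q ^ n" "ord x dvd L" using x L by (simp_all add: pow_eq_id)
  have "coprime (q ^ n) (p ^ multiplicity p L)" using p q primes_coprime by auto
  then have "coprime (ord x) (p ^ multiplicity p L)" using o(1) coprime_divisors dvd_refl by blast
  moreover have "L = p ^ multiplicity p L * (L div p ^ multiplicity p L)" by (simp add: multiplicity_dvd)
  ultimately have "ord x dvd L div p ^ multiplicity p L" using o(2) coprime_dvd_mult_right_iff by metis
  then have "ord x dvd primary_exponent p L" using primary_exponent(2)[OF p L(1)] dvd_trans by blast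
  then show ?thesis using x by (simp add: pow_eq_id)
qed

lemma primary_part_subset: "primary_part p G \<subseteq> carrier G"
  by (auto simp: primary_part_def)

text \<open>
  Splitting off the part of \<open>n\<close> at one prime, Bezout's identity writes \<open>x\<close> as the product of a
  primary element and an element of smaller exponent.
\<close>

lemma in_generated_by_primary_parts:
  assumes "n > 0" "x \<in> carrier G" "x [^] n = \<one>" "coprime p n"
  shows "x \<in> generate G (\<Union>q\<in>{q. Factorial_Ring.prime q \<and> q \<noteq> p}. primary_part q G)"
  using assms
proof (induction n arbitrary: x rule: less_induct)
  case (less n)
  let ?U = "\<Union>q\<in>{q. Factorial_Ring.prime q \<and> q \<noteq> p}. primary_part q G"
  show ?case
  proof (cases "n = 1")
    case True
    then show ?thesis using less.prems generate.one by simp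
  next
    case False
    then obtain q where q: "Factorial_Ring.prime q" "q dvd n" using prime_factor_nat by blast
    define a where "a = q ^ multiplicity q n"
    define m where "m = n div a"
    have nam: "n = a * m" by (simp add: a_def m_def multiplicity_dvd)
    have "multiplicity q n \<noteq> 0" using q less.prems(1) by (simp add: prime_multiplicity_gt_zero_iff)
    then have a: "a > 1" using one_less_power[OF prime_gt_1_nat[OF q(1)]] by (simp add: a_def)
    have qm: "coprime q m" using primary_exponent(3)[OF q(1) less.prems(1)] by (simp add: m_def a_def)
    then have cop: "coprime a m" by (simp add: a_def)
    have m: "m > 0" "m < n" using nam a less.prems(1) by (auto intro: Nat.gr0I)
    have qp: "q \<noteq> p" using q less.prems(4) by (metis coprime_absorb_left not_prime_unit)
    have x: "x \<in> carrier G" by (rule less.prems(2))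
    have "(x [^] m) [^] a = \<one>" using less.prems(3) x by (simp add: nat_pow_pow nam mult.commute)
    then have "x [^] m \<in> primary_part q G" using x unfolding primary_part_def a_def by auto
    then have 1: "x [^] m \<in> generate G ?U" using q qp by (intro generate.incl) blast
    have "(x [^] a) [^] m = \<one>" using less.prems(3) x by (simp add: nat_pow_pow nam)
    moreover have "coprime p m" using less.prems(4) nam by simp
    ultimately have 2: "x [^] a \<in> generate G ?U" using less.IH[OF m(2,1)] x by simp
    have U: "?U \<subseteq> carrier G" using primary_part_subset by blast
    note sub = generate_is_subgroup[OF U]
    obtain s t where st: "s * int m + t * int a = 1"
      using cop bezout_int[of "int m" "int a"] by (metis coprime_commute coprime_imp_gcd_eq_1 gcd_int_int_eq of_nat_1)
    have "(x [^] m) [^] s \<otimes> (x [^] a) [^] t = x [^] (s * int m + t * int a)"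
      using x by (simp add: int_pow_int[symmetric] int_pow_pow int_pow_mult mult.commute)
    then have eq: "(x [^] m) [^] s \<otimes> (x [^] a) [^] t = x" unfolding st using x by simp
    have "(x [^] m) [^] s \<otimes> (x [^] a) [^] t \<in> generate G ?U"
      by (intro subgroup.m_closed[OF sub] subgroup_int_pow_closed[OF sub] 1 2)
    then show ?thesis unfolding eq .
  qed
qed

lemma primary_component_eq:
  assumes p: "Factorial_Ring.prime p" and L: "L > 0" "\<And>x. x \<in> carrier G \<Longrightarrow> x [^] L = \<one>" and v: "v \<in> carrier G"
  shows "primary_component p G v = v [^] primary_exponent p L"
proof -
  let ?N = "primary_exponent p L" and ?U = "\<Union>q\<in>{q. Factorial_Ring.prime q \<and> q \<noteq> p}. primary_part q G"
  have U: "?U \<subseteq> carrier G" using primary_part_subset by blast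
  have kill: "w [^] ?N = \<one> \<and> w \<in> carrier G" if "w \<in> generate G ?U" for w
    using that
  proof induction
    case one
    then show ?case by simp
  next
    case (incl h)
    then show ?case using primary_power_other[OF p] L U by blast
  next
    case (inv h)
    then have "h \<in> carrier G" "h [^] ?N = \<one>" using primary_power_other[OF p] L U by blast+
    then show ?case by (simp add: nat_pow_inv)
  next
    case (eng h1 h2)
    then show ?case by (simp add: nat_pow_distrib)
  qed
  show ?thesis
    unfolding primary_component_def
  proof (rule the_equality)
    let ?w = "v \<otimes> inv (v [^] ?N)"
    have c: "v [^] ?N \<in> carrier G" using v by simp
    have Npow: "(v [^] ?N) [^] (p ^ multiplicity p L) = \<one>" by (rule primary_power[OF p L(1) v L(2)[OF v]])
    then have pp: "v [^] ?N \<in> primary_part p G" using c by (auto simp: primary_part_def)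
    have wC: "?w \<in> carrier G" using v by simp
    have "?w [^] (L div p ^ multiplicity p L) = \<one>"
    proof -
      let ?m = "L div p ^ multiplicity p L"
      have "ord ?w dvd L" using L(2)[OF wC] wC by (simp add: pow_eq_id)
      moreover have "?w [^] ?N = \<one>"
        using v primary_power_id[OF p L(1) pp L(2)[OF c]] by (simp add: nat_pow_distrib nat_pow_inv)
      then have "ord ?w dvd ?N" using wC by (simp add: pow_eq_id)
      moreover have "coprime ?N (p ^ multiplicity p L)"
        using primary_exponent(1)[OF p L(1)] by (metis cong_imp_coprime cong_sym coprime_1_left)
      ultimately have "coprime (ord ?w) (p ^ multiplicity p L)" using coprime_divisors dvd_refl by blast
      moreover have "L = p ^ multiplicity p L * ?m" by (simp add: multiplicity_dvd)
      ultimately have "ord ?w dvd ?m" using \<open>ord ?w dvd L\<close> coprime_dvd_mult_right_iff by metis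
      then show ?thesis using wC by (simp add: pow_eq_id)
    qed
    moreover have "L div p ^ multiplicity p L > 0" using L(1)
      by (metis dvd_div_eq_0_iff multiplicity_dvd gr_zeroI less_numeral_extra(3))
    ultimately have "?w \<in> generate G ?U"
      using in_generated_by_primary_parts[OF _ wC] primary_exponent(3)[OF p L(1)] by blast
    moreover have "v = v [^] ?N \<otimes> ?w" using v c by (simp add: m_comm m_lcomm)
    ultimately show "v [^] ?N \<in> primary_part p G \<and> (\<exists>w\<in>generate G ?U. v = v [^] ?N \<otimes> w)" using pp by blast
    fix u assume "u \<in> primary_part p G \<and> (\<exists>w\<in>generate G ?U. v = u \<otimes> w)"
    then obtain w where u: "u \<in> primary_part p G" and w: "w \<in> generate G ?U" "v = u \<otimes> w" by blast
    have uC: "u \<in> carrier G" using u primary_part_subset by blast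
    have "u [^] ?N = u" using primary_power_id[OF p L(1) u L(2)[OF uC]] .
    then show "u = v [^] ?N" using w kill[OF w(1)] uC by (simp add: nat_pow_distrib)
  qed
qed

end

locale finite_comm_group = plain_comm_group G for G :: "'a monoid" (structure) +
  assumes finite_carrier: "finite (carrier G)"
begin

lemma order_pos: "order G > 0"
  using finite_carrier by (simp add: order_gt_0_iff_finite)

lemma component_eq: "Factorial_Ring.prime p \<Longrightarrow> v \<in> carrier G \<Longrightarrow> primary_component p G v = v [^] primary_exponent p (order G)"
  by (rule primary_component_eq) (use order_pos pow_order_eq_1 in auto)

lemma component_closed: "Factorial_Ring.prime p \<Longrightarrow> v \<in> carrier G \<Longrightarrow> primary_component p G v \<in> carrier G"
  by (simp add: component_eq)

lemma component_mem: "Factorial_Ring.prime p \<Longrightarrow> v \<in> carrier G \<Longrightarrow> primary_component p G v \<in> primary_part p G"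
  using primary_power[of p "order G" v] order_pos pow_order_eq_1[of v] by (auto simp: component_eq primary_part_def)

lemma component_mult: "Factorial_Ring.prime p \<Longrightarrow> v \<in> carrier G \<Longrightarrow> w \<in> carrier G \<Longrightarrow>
    primary_component p G (v \<otimes> w) = primary_component p G v \<otimes> primary_component p G w"
  by (simp add: component_eq nat_pow_distrib)

lemma component_one: "Factorial_Ring.prime p \<Longrightarrow> primary_component p G \<one> = \<one>"
  by (simp add: component_eq)

lemma component_id: "Factorial_Ring.prime p \<Longrightarrow> v \<in> primary_part p G \<Longrightarrow> primary_component p G v = v"
  using primary_part_subset order_pos pow_order_eq_1 by (subst component_eq) (auto intro: primary_power_id)

lemma component_other: "Factorial_Ring.prime p \<Longrightarrow> Factorial_Ring.prime q \<Longrightarrow> q \<noteq> p \<Longrightarrow> v \<in> primary_part q G \<Longrightarrow>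
    primary_component p G v = \<one>"
  using primary_part_subset order_pos pow_order_eq_1 by (subst component_eq) (auto intro: primary_power_other)

lemma primary_part_subgroup:
  assumes "Factorial_Ring.prime p"
  shows "subgroup (primary_part p G) G"
proof
  show "primary_part p G \<subseteq> carrier G" by (rule primary_part_subset)
  show "\<one> \<in> primary_part p G" using component_mem[OF assms one_closed] component_one[OF assms] by simp
  show "x \<otimes> y \<in> primary_part p G" if xy: "x \<in> primary_part p G" "y \<in> primary_part p G" for x y
  proof -
    have c: "x \<in> carrier G" "y \<in> carrier G" using xy primary_part_subset by auto
    show ?thesis using component_mem[OF assms m_closed[OF c]] component_mult[OF assms c] component_id[OF assms] xy by simp
  qed
  show "inv x \<in> primary_part p G" if "x \<in> primary_part p G" for x
    using that by (auto simp: primary_part_def nat_pow_inv)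
qed

text \<open>
  The exponents of all the projections kill the quotient of two elements with the same components.
  The exponent at \<open>p\<close> is prime to \<open>p\<close>, so no prime divisor of the order of the group divides them all.
\<close>

lemma component_ext:
  assumes u: "u \<in> carrier G" and v: "v \<in> carrier G"
    and eq: "\<And>p. Factorial_Ring.prime p \<Longrightarrow> primary_component p G u = primary_component p G v"
  shows "u = v"
proof -
  define h where "h = u \<otimes> inv v"
  have h: "h \<in> carrier G" using u v by (simp add: h_def)
  have N: "h [^] primary_exponent p (order G) = \<one>" if p: "Factorial_Ring.prime p" for p
    using eq[OF p] u v by (simp add: h_def component_eq p nat_pow_distrib nat_pow_inv)
  have "ord h = 1"
  proof (rule ccontr)
    assume "ord h \<noteq> 1"
    then obtain p where p: "Factorial_Ring.prime p" "p dvd ord h" using prime_factor_nat by blast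
    have "ord h dvd order G" using ord_dvd_group_order[OF h] .
    then have "p dvd order G" using p(2) dvd_trans by blast
    then have "multiplicity p (order G) \<noteq> 0" using order_pos p(1) by (simp add: prime_multiplicity_gt_zero_iff)
    then have "p dvd p ^ multiplicity p (order G)" by simp
    then have "[primary_exponent p (order G) = 1] (mod p)"
      using primary_exponent(1)[OF p(1) order_pos] cong_dvd_modulus_nat by blast
    moreover have "p dvd primary_exponent p (order G)" using N[OF p(1)] h p(2) by (simp add: pow_eq_id dvd_trans)
    ultimately have "p dvd 1" by (metis cong_dvd_iff)
    then show False using p(1) by simp
  qed
  then have "h = \<one>" using h ord_eq_1 by simp
  then have "inv (inv v) = u" using u v unfolding h_def by (intro inv_equality) auto
  then show ?thesis using v by simp
qed

lemma ex_components:
  assumes fin: "finite J" and J: "\<And>p. p \<in> J \<Longrightarrow> Factorial_Ring.prime p \<and> f p \<in> primary_part p G"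
  shows "\<exists>v\<in>carrier G. (\<forall>p\<in>J. primary_component p G v = f p) \<and>
    (\<forall>q. Factorial_Ring.prime q \<and> q \<notin> J \<longrightarrow> primary_component q G v = \<one>)"
  using fin J
proof induction
  case empty
  show ?case by (rule bexI[of _ \<one>]) (auto simp: component_one)
next
  case (insert p J)
  then obtain v where v: "v \<in> carrier G" "\<forall>p\<in>J. primary_component p G v = f p"
    "\<forall>q. Factorial_Ring.prime q \<and> q \<notin> J \<longrightarrow> primary_component q G v = \<one>" by auto
  have p: "Factorial_Ring.prime p" "f p \<in> primary_part p G" using insert by auto
  have fC: "f p \<in> carrier G" using p primary_part_subset by auto
  have "primary_component q G (v \<otimes> f p) = f q" if "q \<in> insert p J" for q
  proof (cases "q = p")
    case True
    then show ?thesis using component_mult[OF p(1) v(1) fC] v(3) insert.hyps(2) p component_id[OF p] fC by simp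
  next
    case False
    then have q: "q \<in> J" "Factorial_Ring.prime q" "f q \<in> carrier G" using that insert.prems primary_part_subset by auto
    then show ?thesis using component_mult[OF q(2) v(1) fC] v(2) component_other[OF q(2) p(1) _ p(2)] False by auto
  qed
  moreover have "primary_component q G (v \<otimes> f p) = \<one>" if q: "Factorial_Ring.prime q" "q \<notin> insert p J" for q
    using component_mult[OF q(1) v(1) fC] v(3) component_other[OF q(1) p(1) _ p(2)] q by auto
  ultimately show ?case using v(1) fC by (intro bexI[of _ "v \<otimes> f p"]) auto
qed

lemma primary_part_trivial:
  assumes p: "Factorial_Ring.prime p" "\<not> p dvd order G" and v: "v \<in> primary_part p G"
  shows "v = \<one>"
proof -
  obtain n where x: "v \<in> carrier G" "v [^] (p ^ n) = \<one>" using v by (auto simp: primary_part_def)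
  then have "ord v dvd p ^ n" by (simp add: pow_eq_id)
  moreover have "ord v dvd order G" by (rule ord_dvd_group_order[OF x(1)])
  moreover have "coprime (p ^ n) (order G)" using p by (simp add: prime_imp_coprime)
  ultimately have "ord v = 1" by (metis coprime_common_divisor_nat)
  then show ?thesis using x ord_eq_1 by simp
qed

end

locale finite_preadditive = preadditive_category A for A :: "('o, 'm) preadditive_data" +
  assumes fin: "x \<in> Ob A \<Longrightarrow> y \<in> Ob A \<Longrightarrow> finite (Mor A x y)"
begin

abbreviation "pc p x y \<equiv> primary_component p (Hom A x y)"
abbreviation "PMor p x y \<equiv> primary_part p (Hom A x y)"

lemma Hom_finite_comm_group: "x \<in> Ob A \<Longrightarrow> y \<in> Ob A \<Longrightarrow> finite_comm_group (Hom A x y)"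
  by (intro finite_comm_group.intro plain_comm_group.intro finite_comm_group_axioms.intro Hom_comm_group fin)

lemma PMor_Mor: "f \<in> PMor p x y \<Longrightarrow> f \<in> Mor A x y"
  by (simp add: primary_part_def)

lemma Cmp_pow_left:
  assumes o: "x \<in> Ob A" "y \<in> Ob A" "z \<in> Ob A" and f: "f \<in> Mor A x y" and g: "g \<in> Mor A y z"
  shows "Cmp A x y z (g [^]\<^bsub>Hom A y z\<^esub> (n::nat)) f = Cmp A x y z g f [^]\<^bsub>Hom A x z\<^esub> n"
proof -
  interpret yz: comm_group "Hom A y z" using Hom_comm_group o by blast
  show ?thesis by (induction n) (use Cmp_zero_left[OF o f] Cmp_add_left[OF o f] g in auto)
qed

lemma Cmp_pow_right:
  assumes o: "x \<in> Ob A" "y \<in> Ob A" "z \<in> Ob A" and f: "f \<in> Mor A x y" and g: "g \<in> Mor A y z"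
  shows "Cmp A x y z g (f [^]\<^bsub>Hom A x y\<^esub> (n::nat)) = Cmp A x y z g f [^]\<^bsub>Hom A x z\<^esub> n"
proof -
  interpret xy: comm_group "Hom A x y" using Hom_comm_group o by blast
  show ?thesis by (induction n) (use Cmp_zero_right[OF o g] Cmp_add_right[OF o _ _ g] f in auto)
qed

lemma pc_common:
  assumes p: "Factorial_Ring.prime p" and L: "order (Hom A x y) dvd L" "L > 0" and o: "x \<in> Ob A" "y \<in> Ob A" and f: "f \<in> Mor A x y"
  shows "pc p x y f = f [^]\<^bsub>Hom A x y\<^esub> primary_exponent p L"
proof -
  interpret xy: finite_comm_group "Hom A x y" by (rule Hom_finite_comm_group[OF o])
  have "g [^]\<^bsub>Hom A x y\<^esub> L = \<one>\<^bsub>Hom A x y\<^esub>" if "g \<in> Mor A x y" for g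
    using xy.pow_order_eq_1[OF that] L that xy.pow_eq_id dvd_trans by metis
  then show ?thesis by (intro xy.primary_component_eq[OF p L(2) _ f])
qed

lemma ex_common_exponent:
  assumes "x \<in> Ob A" "y \<in> Ob A" "z \<in> Ob A"
  obtains L where "order (Hom A x y) dvd L" "order (Hom A y z) dvd L" "order (Hom A x z) dvd L" "L > 0"
proof
  let ?L = "order (Hom A x y) * order (Hom A y z) * order (Hom A x z)"
  show "order (Hom A x y) dvd ?L" "order (Hom A y z) dvd ?L" "order (Hom A x z) dvd ?L" by simp_all
  show "?L > 0" using assms finite_comm_group.order_pos[OF Hom_finite_comm_group] by simp
qed

text \<open>
  By \<open>pc_common\<close> the projections on the groups involved are power maps with the same exponent, and
  composition is bilinear.
\<close>

lemma pc_Cmp_left: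
  assumes p: "Factorial_Ring.prime p" and o: "x \<in> Ob A" "y \<in> Ob A" "z \<in> Ob A" and f: "f \<in> Mor A x y" and g: "g \<in> Mor A y z"
  shows "Cmp A x y z (pc p y z g) f = pc p x z (Cmp A x y z g f)"
proof -
  obtain L where L: "order (Hom A x y) dvd L" "order (Hom A y z) dvd L" "order (Hom A x z) dvd L" "L > 0"
    using ex_common_exponent[OF o] .
  show ?thesis using pc_common[OF p L(2,4) o(2,3) g] pc_common[OF p L(3,4) o(1,3) Cmp_closed[OF o f g]] Cmp_pow_left[OF o f g] by simp
qed

lemma pc_Cmp_right:
  assumes p: "Factorial_Ring.prime p" and o: "x \<in> Ob A" "y \<in> Ob A" "z \<in> Ob A" and f: "f \<in> Mor A x y" and g: "g \<in> Mor A y z"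
  shows "Cmp A x y z g (pc p x y f) = pc p x z (Cmp A x y z g f)"
proof -
  obtain L where L: "order (Hom A x y) dvd L" "order (Hom A y z) dvd L" "order (Hom A x z) dvd L" "L > 0"
    using ex_common_exponent[OF o] .
  show ?thesis using pc_common[OF p L(1,4) o(1,2) f] pc_common[OF p L(3,4) o(1,3) Cmp_closed[OF o f g]] Cmp_pow_right[OF o f g] by simp
qed

lemma pc_mem: "Factorial_Ring.prime p \<Longrightarrow> x \<in> Ob A \<Longrightarrow> y \<in> Ob A \<Longrightarrow> f \<in> Mor A x y \<Longrightarrow> pc p x y f \<in> PMor p x y"
  using finite_comm_group.component_mem[OF Hom_finite_comm_group] by blast

lemma pc_id: "Factorial_Ring.prime p \<Longrightarrow> x \<in> Ob A \<Longrightarrow> y \<in> Ob A \<Longrightarrow> f \<in> PMor p x y \<Longrightarrow> pc p x y f = f"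
  using finite_comm_group.component_id[OF Hom_finite_comm_group] by blast

lemma pc_other: "Factorial_Ring.prime p \<Longrightarrow> Factorial_Ring.prime q \<Longrightarrow> q \<noteq> p \<Longrightarrow> x \<in> Ob A \<Longrightarrow> y \<in> Ob A \<Longrightarrow> f \<in> PMor q x y \<Longrightarrow>
    pc p x y f = \<one>\<^bsub>Hom A x y\<^esub>"
  using finite_comm_group.component_other[OF Hom_finite_comm_group] by blast

lemma pc_mult: "Factorial_Ring.prime p \<Longrightarrow> x \<in> Ob A \<Longrightarrow> y \<in> Ob A \<Longrightarrow> f \<in> Mor A x y \<Longrightarrow> g \<in> Mor A x y \<Longrightarrow>
    pc p x y (f \<otimes>\<^bsub>Hom A x y\<^esub> g) = pc p x y f \<otimes>\<^bsub>Hom A x y\<^esub> pc p x y g"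
  using finite_comm_group.component_mult[OF Hom_finite_comm_group] by blast

lemma pc_Cmp:
  assumes p: "Factorial_Ring.prime p" and o: "x \<in> Ob A" "y \<in> Ob A" "z \<in> Ob A" and f: "f \<in> Mor A x y" and g: "g \<in> Mor A y z"
  shows "pc p x z (Cmp A x y z g f) = Cmp A x y z (pc p y z g) (pc p x y f)"
proof -
  have c: "Cmp A x y z g f \<in> Mor A x z" by (rule Cmp_closed[OF o f g])
  have "Cmp A x y z (pc p y z g) (pc p x y f) = pc p x z (pc p x z (Cmp A x y z g f))"
    using pc_Cmp_left[OF p o PMor_Mor[OF pc_mem[OF p o(1,2) f]] g] pc_Cmp_right[OF p o f g] by simp
  then show ?thesis using pc_id[OF p o(1,3) pc_mem[OF p o(1,3) c]] by simp
qed

lemma PMor_Cmp: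
  assumes p: "Factorial_Ring.prime p" and o: "x \<in> Ob A" "y \<in> Ob A" "z \<in> Ob A" and f: "f \<in> Mor A x y" and g: "g \<in> Mor A y z"
    and fg: "f \<in> PMor p x y \<or> g \<in> PMor p y z"
  shows "Cmp A x y z g f \<in> PMor p x z"
proof -
  have "Cmp A x y z g f = pc p x z (Cmp A x y z g f)"
    using fg pc_Cmp_left[OF p o f g] pc_Cmp_right[OF p o f g] pc_id[OF p o(1,2)] pc_id[OF p o(2,3)] by metis
  then show ?thesis using pc_mem[OF p o(1,3) Cmp_closed[OF o f g]] by simp
qed

lemma Idn_component_left:
  assumes p: "Factorial_Ring.prime p" and o: "x \<in> Ob A" "y \<in> Ob A" and f: "f \<in> Mor A x y"
  shows "Cmp A x y y (pc p y y (Idn A y)) f = pc p x y f"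
  using pc_Cmp_left[OF p o(1,2,2) f Idn_closed[OF o(2)]] Cmp_Idn_left o f by simp

lemma Idn_component_right:
  assumes p: "Factorial_Ring.prime p" and o: "x \<in> Ob A" "y \<in> Ob A" and f: "f \<in> Mor A x y"
  shows "Cmp A x x y f (pc p x x (Idn A x)) = pc p x y f"
  using pc_Cmp_right[OF p o(1,1,2) Idn_closed[OF o(1)] f] Cmp_Idn_right o f by simp

lemma primary_category_simps [simp]:
  "Ob (primary_category p A) = Ob A" "Mor (primary_category p A) x y = PMor p x y"
  "Cmp (primary_category p A) = Cmp A" "Idn (primary_category p A) x = pc p x x (Idn A x)"
  "\<one>\<^bsub>Hom (primary_category p A) x y\<^esub> = \<one>\<^bsub>Hom A x y\<^esub>"
  "f \<otimes>\<^bsub>Hom (primary_category p A) x y\<^esub> g = f \<otimes>\<^bsub>Hom A x y\<^esub> g"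
  by (simp_all add: primary_category_def)

lemma primary_category_finite_preadditive:
  assumes p: "Factorial_Ring.prime p"
  shows "finite_preadditive (primary_category p A)"
proof (intro finite_preadditive.intro finite_preadditive_axioms.intro preadditive_category.intro, unfold primary_category_simps)
  fix x y assume o: "x \<in> Ob A" "y \<in> Ob A"
  interpret xy: finite_comm_group "Hom A x y" by (rule Hom_finite_comm_group[OF o])
  show "comm_group (Hom (primary_category p A) x y)"
    unfolding primary_category_def
    using group.group_comm_groupI[OF xy.subgroup_imp_group[OF xy.primary_part_subgroup[OF p]]] xy.m_comm PMor_Mor by simp
  show "finite (PMor p x y)" using fin[OF o] xy.primary_part_subset finite_subset by blast
qed (use p in \<open>auto simp: PMor_Cmp PMor_Mor pc_mem Idn_closed Idn_component_left Idn_component_right pc_id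
      Cmp_add_left Cmp_add_right Cmp_assoc\<close>)

end

section \<open>Tensor products of simple functors on the primary categories\<close>

lemma (in vspace) ex_nonzero_functional:
  assumes fd: "set vs \<subseteq> carrier V" "carrier V = lspan K V vs" and v: "v \<in> carrier V" "v \<noteq> \<zero>\<^bsub>V\<^esub>"
  shows "\<exists>l. linear_map K V (field_module K) l \<and> l v \<noteq> \<zero>\<^bsub>K\<^esub>"
proof (rule ccontr)
  assume none: "\<not> ?thesis"
  obtain D where D: "\<And>l e. (l, e) \<in> set D \<Longrightarrow> linear_map K V (field_module K) l \<and> e \<in> carrier V"
    "\<And>v. v \<in> carrier V \<Longrightarrow> sum_rank_one D v = v" using dual_basis[OF fd] by blast
  have "(\<And>l e. (l, e) \<in> set D' \<Longrightarrow> l v = \<zero>\<^bsub>K\<^esub> \<and> e \<in> carrier V) \<Longrightarrow> sum_rank_one D' v = \<zero>\<^bsub>V\<^esub>" for D'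
  proof (induction D')
    case Nil
    then show ?case by (simp add: sum_rank_one_def)
  next
    case (Cons d D')
    obtain l e where d: "d = (l, e)" by force
    have "l v = \<zero>\<^bsub>K\<^esub>" "e \<in> carrier V" using Cons.prems[of l e] d by auto
    moreover have "sum_rank_one D' v = \<zero>\<^bsub>V\<^esub>" using Cons.IH Cons.prems by (meson list.set_intros(2))
    ultimately show ?case by (simp add: sum_rank_one_def d)
  qed
  from this[of D] have "sum_rank_one D v = \<zero>\<^bsub>V\<^esub>" using D(1) none by blast
  then show False using D(2) v by simp
qed

lemma (in vspace) ex_unit_functional:
  assumes fd: "\<exists>vs. set vs \<subseteq> carrier V \<and> carrier V = lspan K V vs" and v: "v \<in> carrier V" "v \<noteq> \<zero>\<^bsub>V\<^esub>"
  shows "\<exists>l. linear_map K V (field_module K) l \<and> l v = \<one>\<^bsub>K\<^esub>"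
proof -
  obtain l where l: "linear_map K V (field_module K) l" "l v \<noteq> \<zero>\<^bsub>K\<^esub>"
    using fd ex_nonzero_functional[OF _ _ v] by blast
  have lv: "l v \<in> carrier K" using linear_mapD(1)[OF l(1) v(1)] by simp
  have "linear_map K V (field_module K) (\<lambda>w. inv\<^bsub>K\<^esub> l v \<odot>\<^bsub>field_module K\<^esub> l w)"
    by (rule linear_map_scale[OF field_module_module[OF K.cring_axioms] l(1) inv_nonzero(1)[OF lv l(2)]])
  then show ?thesis using inv_nonzero(2)[OF lv l(2)] by (intro exI) auto
qed

lemma (in tensor_product) pure_nonzero:
  assumes fin: "finite I"
    and fd: "\<And>i. i \<in> I \<Longrightarrow> \<exists>vs. set vs \<subseteq> carrier (V i) \<and> carrier (V i) = lspan K (V i) vs"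
    and b: "b \<in> B" "\<And>i. i \<in> I \<Longrightarrow> b i \<noteq> \<zero>\<^bsub>V i\<^esub>"
  obtains l L where "\<And>i. i \<in> I \<Longrightarrow> linear_map K (V i) (field_module K) (l i)"
    "linear_map K T (field_module K) L" "\<And>b. b \<in> B \<Longrightarrow> L (pure b) = (\<Otimes>\<^bsub>K\<^esub>i\<in>I. l i (b i))"
    "\<And>i. i \<in> I \<Longrightarrow> l i (b i) = \<one>\<^bsub>K\<^esub>" "L (pure b) = \<one>\<^bsub>K\<^esub>" "pure b \<noteq> \<zero>\<^bsub>T\<^esub>"
proof -
  have "\<exists>l. linear_map K (V i) (field_module K) l \<and> l (b i) = \<one>\<^bsub>K\<^esub>" if i: "i \<in> I" for i
  proof -
    interpret Vi: vspace K "V i" by (intro vspace.intro field_axioms V_module[OF i])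
    show ?thesis by (rule Vi.ex_unit_functional[OF fd[OF i] mem[OF b(1) i] b(2)[OF i]])
  qed
  then obtain l where l: "\<And>i. i \<in> I \<Longrightarrow> linear_map K (V i) (field_module K) (l i)" "\<And>i. i \<in> I \<Longrightarrow> l i (b i) = \<one>\<^bsub>K\<^esub>"
    by metis
  obtain L where L: "linear_map K T (field_module K) L" "\<And>b. b \<in> B \<Longrightarrow> L (pure b) = (\<Otimes>\<^bsub>K\<^esub>i\<in>I. l i (b i))"
    using tensor_lift[OF field_module_module[OF cring_axioms] multilinear_functional[OF fin l(1)]] by blast
  have one: "L (pure b) = \<one>\<^bsub>K\<^esub>" using L(2)[OF b(1)] l(2) by (simp add: finprod_one_eqI)
  have "L \<zero>\<^bsub>T\<^esub> = \<zero>\<^bsub>K\<^esub>"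
    using linear_map_zero[OF tensor_module_module field_module_module[OF cring_axioms] L(1)] by simp
  then have "pure b \<noteq> \<zero>\<^bsub>T\<^esub>" using one by auto
  then show ?thesis using that l L one by blast
qed

locale primary_tensor = finite_preadditive A + K?: algebraically_closed K
  for A :: "('o, 'm) preadditive_data" and K :: "'k ring" +
  fixes I :: "nat set" and S :: "nat \<Rightarrow> ('o, 'm, 'k, 'v) vect_functor_data"
  assumes finite_I: "finite I"
    and prime_I: "p \<in> I \<Longrightarrow> Factorial_Ring.prime p"
    and simple_S: "p \<in> I \<Longrightarrow> simple_functor (primary_category p A) K (S p)"
begin

abbreviation "W x \<equiv> \<lambda>p. fobj (S p) x"
abbreviation "T \<equiv> tensor_functor K I (\<lambda>p. precompose (primary_projection p A) (S p))"

lemma S_simple: "p \<in> I \<Longrightarrow> simple_vfunctor (primary_category p A) K (S p)"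
proof -
  assume p: "p \<in> I"
  interpret P: finite_preadditive "primary_category p A" by (rule primary_category_finite_preadditive[OF prime_I[OF p]])
  show ?thesis
    using simple_S[OF p] P.fin
    by (intro simple_vfunctor.intro simple_vfunctor_axioms.intro linear_functor.intro P.preadditive_category_axioms K.field_axioms K.algebraically_closed_axioms)
      (auto simp: simple_functor_def)
qed

lemma S_module: "p \<in> I \<Longrightarrow> x \<in> Ob A \<Longrightarrow> module K (W x p)"
proof -
  assume p: "p \<in> I" and x: "x \<in> Ob A"
  interpret S: simple_vfunctor "primary_category p A" K "S p" by (rule S_simple[OF p])
  show ?thesis using S.fobj_module x by simp
qed

lemma W_tensor: "x \<in> Ob A \<Longrightarrow> tensor_product K I (W x)"
  by (intro tensor_product.intro tensor_product_axioms.intro K.field_axioms S_module)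

lemma W_fd: "x \<in> Ob A \<Longrightarrow> p \<in> I \<Longrightarrow> \<exists>vs. set vs \<subseteq> carrier (W x p) \<and> carrier (W x p) = lspan K (W x p) vs"
  using simple_vfunctor.finite_dimensional[OF S_simple] by simp

lemma T_simps:
  "fobj T x = tensor_module K I (W x)"
  "farr T x y f = tensor_map K I (W y) (\<lambda>p. farr (S p) x y (pc p x y f))"
  by (simp_all add: tensor_functor_def precompose_def primary_projection_def)

lemma arr_linear:
  assumes "p \<in> I" "x \<in> Ob A" "y \<in> Ob A" "f \<in> Mor A x y"
  shows "linear_map K (W x p) (W y p) (farr (S p) x y (pc p x y f))"
proof -
  interpret S: simple_vfunctor "primary_category p A" K "S p" by (rule S_simple[OF assms(1)])
  show ?thesis using S.farr_linear[of x y "pc p x y f"] assms pc_mem prime_I by simp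
qed

lemma T_functor: "vect_functor A K T"
proof (rule vect_functor.intro)
  fix x assume x: "x \<in> Ob A"
  interpret X: tensor_product K I "W x" by (rule W_tensor[OF x])
  show "module K (fobj T x)" using X.tensor_module_module by (simp add: T_simps)
  show "farr T x x (Idn A x) v = v" if v: "v \<in> carrier (fobj T x)" for v
    unfolding T_simps
  proof (rule tensor_map_id[OF X.tensor_product_axioms])
    show "v \<in> carrier X.T" using v by (simp add: T_simps)
    fix p w assume p: "p \<in> I" and w: "w \<in> carrier (W x p)"
    interpret S: simple_vfunctor "primary_category p A" K "S p" by (rule S_simple[OF p])
    show "farr (S p) x x (pc p x x (Idn A x)) w = w" using S.farr_Idn[of x w] x w by simp
  qed
  fix y f assume y: "y \<in> Ob A" and f: "f \<in> Mor A x y"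
  interpret Y: tensor_product K I "W y" by (rule W_tensor[OF y])
  show "linear_map K (fobj T x) (fobj T y) (farr T x y f)"
    unfolding T_simps by (rule tensor_map(1)[OF X.tensor_product_axioms Y.tensor_product_axioms]) (rule arr_linear[OF _ x y f])
  fix z g v assume z: "z \<in> Ob A" and g: "g \<in> Mor A y z" and v: "v \<in> carrier (fobj T x)"
  interpret Z: tensor_product K I "W z" by (rule W_tensor[OF z])
  have v': "v \<in> carrier X.T" using v by (simp add: T_simps)
  have gf: "linear_map K (W x p) (W z p) (\<lambda>v. farr (S p) y z (pc p y z g) (farr (S p) x y (pc p x y f) v))" if "p \<in> I" for p
    using linear_map_comp[OF arr_linear[OF that x y f] arr_linear[OF that y z g]] .
  have "farr T x z (Cmp A x y z g f) v =
      tensor_map K I (W z) (\<lambda>p v. farr (S p) y z (pc p y z g) (farr (S p) x y (pc p x y f) v)) v"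
    unfolding T_simps
  proof (rule tensor_map_cong[OF X.tensor_product_axioms Z.tensor_product_axioms gf _ v'])
    fix p w assume p: "p \<in> I" and w: "w \<in> carrier (W x p)"
    interpret S: simple_vfunctor "primary_category p A" K "S p" by (rule S_simple[OF p])
    show "farr (S p) x z (pc p x z (Cmp A x y z g f)) w = farr (S p) y z (pc p y z g) (farr (S p) x y (pc p x y f) w)"
      using S.farr_Cmp[of x y z "pc p x y f" "pc p y z g" w] x y z w pc_mem f g prime_I[OF p] pc_Cmp[OF prime_I[OF p] x y z f g] by simp
  qed
  also have "\<dots> = farr T y z g (farr T x y f v)"
    unfolding T_simps
    by (rule tensor_map_comp[OF X.tensor_product_axioms Y.tensor_product_axioms Z.tensor_product_axioms arr_linear[OF _ x y f] arr_linear[OF _ y z g] v'])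
  finally show "farr T x z (Cmp A x y z g f) v = farr T y z g (farr T x y f v)" .
qed

lemma T_linear_functor: "linear_functor A K T"
  by (intro linear_functor.intro preadditive_category_axioms T_functor K.field_axioms)

text \<open>
  A morphism of \<open>A\<close> may have arbitrary components at the primes in \<open>I\<close>, so by multilinearity a
  subfunctor of \<open>T\<close> is stable under all tensor products of linear combinations of the maps
  \<open>farr (S p) x y f\<close>.
\<close>

lemma subfunctor_tensor_ops:
  assumes N: "is_subfunctor A K N T" and x: "x \<in> Ob A" and y: "y \<in> Ob A" and t: "t \<in> N x"
    and a: "\<And>p. p \<in> I \<Longrightarrow> a p \<in> ops (primary_category p A) K (S p) x y"
  shows "tensor_map K I (W y) a t \<in> N y"
proof -
  interpret T: linear_functor A K T by (rule T_linear_functor)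
  interpret X: tensor_product K I "W x" by (rule W_tensor[OF x])
  interpret Y: tensor_product K I "W y" by (rule W_tensor[OF y])
  note XY = X.tensor_product_axioms Y.tensor_product_axioms
  have t': "t \<in> carrier X.T" using T.subfunctorD(1)[OF N x] t by (auto simp: T_simps)
  note Ny = T.subfunctorD[OF N y, unfolded T_simps]
  interpret YT: module K Y.T by (rule Y.tensor_module_module)
  have lin: "linear_map K (W x p) (W y p) b" if "p \<in> I" "b \<in> ops (primary_category p A) K (S p) x y" for p b
  proof -
    interpret S: simple_vfunctor "primary_category p A" K "S p" by (rule S_simple[OF that(1)])
    show ?thesis using S.ops_linear[OF _ _ that(2)] x y by simp
  qed
  have "J \<subseteq> I \<Longrightarrow> (\<And>p. p \<in> I \<Longrightarrow> a p \<in> ops (primary_category p A) K (S p) x y) \<Longrightarrow>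
      (\<And>p. p \<in> I - J \<Longrightarrow> \<exists>f\<in>PMor p x y. a p = farr (S p) x y f) \<Longrightarrow> tensor_map K I (W y) a t \<in> N y" if "finite J" for J a
    using that
  proof (induction J arbitrary: a)
    case empty
    then have "\<forall>p\<in>I. \<exists>f\<in>PMor p x y. a p = farr (S p) x y f" by simp
    then obtain f where f: "\<And>p. p \<in> I \<Longrightarrow> f p \<in> PMor p x y" "\<And>p. p \<in> I \<Longrightarrow> a p = farr (S p) x y (f p)" by metis
    interpret xy: finite_comm_group "Hom A x y" by (rule Hom_finite_comm_group[OF x y])
    obtain F where F: "F \<in> Mor A x y" "\<And>p. p \<in> I \<Longrightarrow> pc p x y F = f p"
      using xy.ex_components[OF finite_I, of f] f(1) prime_I by blast
    have "tensor_map K I (W y) a t = tensor_map K I (W y) (\<lambda>p. farr (S p) x y (pc p x y F)) t"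
      by (rule tensor_map_cong[OF XY arr_linear[OF _ x y F(1)] _ t']) (simp_all add: f(2) F(2))
    then show ?case using T.subfunctorD(5)[OF N x y F(1) t] by (simp add: T_simps)
  next
    case (insert j J)
    have j: "j \<in> I" "J \<subseteq> I" using insert by auto
    interpret Vj: module K "W y j" by (rule S_module[OF j(1) y])
    have alin: "linear_map K (W x p) (W y p) (a p)" if "p \<in> I" "p \<noteq> j" for p
      using lin insert.prems(2) that by blast
    have "tensor_map K I (W y) (a(j := b)) t \<in> N y" if "b \<in> ops (primary_category j A) K (S j) x y" for b
      using that
    proof induction
      case (gen f)
      then have f: "f \<in> PMor j x y" by simp
      show ?case using insert.prems insert.hyps(2) f ops.gen[OF gen] by (intro insert.IH[OF j(2)]) auto
    next
      case zero
      have z: "linear_map K (W x j) (W y j) (\<lambda>v. \<zero>\<^bsub>W y j\<^esub>)" by (rule lin[OF j(1) ops.zero])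
      have "tensor_map K I (W y) (a(j := \<lambda>v. \<zero>\<^bsub>K\<^esub> \<odot>\<^bsub>W y j\<^esub> \<zero>\<^bsub>W y j\<^esub>)) t = \<zero>\<^bsub>Y.T\<^esub>"
        using tensor_map_upd_smult[OF XY alin j(1) z t' K.zero_closed] tensor_map_upd_closed[OF XY alin j(1) z t'] by simp
      then have eq: "tensor_map K I (W y) (a(j := \<lambda>v. \<zero>\<^bsub>W y j\<^esub>)) t = \<zero>\<^bsub>Y.T\<^esub>" by simp
      show ?case unfolding eq by (rule Ny(2))
    next
      case (add b c)
      have eq: "tensor_map K I (W y) (a(j := \<lambda>v. b v \<oplus>\<^bsub>W y j\<^esub> c v)) t =
          tensor_map K I (W y) (a(j := b)) t \<oplus>\<^bsub>Y.T\<^esub> tensor_map K I (W y) (a(j := c)) t"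
        by (rule tensor_map_upd_add[OF XY alin j(1) lin[OF j(1) add.hyps(1)] t' lin[OF j(1) add.hyps(2)]])
      show ?case unfolding eq by (rule Ny(3)[OF add.IH])
    next
      case (smult c b)
      have eq: "tensor_map K I (W y) (a(j := \<lambda>v. c \<odot>\<^bsub>W y j\<^esub> b v)) t =
          c \<odot>\<^bsub>Y.T\<^esub> tensor_map K I (W y) (a(j := b)) t"
        by (rule tensor_map_upd_smult[OF XY alin j(1) lin[OF j(1) smult.hyps(2)] t' smult.hyps(1)])
      show ?case unfolding eq by (rule Ny(4)[OF smult.hyps(1) smult.IH])
    next
      case (ext b c)
      have "tensor_map K I (W y) (a(j := c)) t = tensor_map K I (W y) (a(j := b)) t"
        by (rule tensor_map_cong[OF XY _ _ t']) (use alin lin[OF j(1) ext.hyps(1)] ext.hyps(2) in auto)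
      then show ?case using ext.IH by (simp only:)
    qed
    from this[OF insert.prems(2)[OF j(1)]] show ?case unfolding fun_upd_triv .
  qed
  from this[OF finite_I order_refl a] show ?thesis by blast
qed

text \<open>
  Given \<open>t \<noteq> 0\<close> in a subfunctor and a product of functionals that is non-zero on \<open>t\<close>, Burnside's
  theorem for each \<open>S p\<close> provides operators of rank one with these functionals and arbitrary images, so
  the subfunctor contains all pure tensors.
\<close>

lemma T_simple:
  assumes x: "x \<in> Ob A" and nz: "\<And>p. p \<in> I \<Longrightarrow> \<exists>v\<in>carrier (W x p). v \<noteq> \<zero>\<^bsub>W x p\<^esub>"
  shows "simple_functor A K T"
  unfolding simple_functor_def
proof (intro conjI allI impI)
  interpret T: linear_functor A K T by (rule T_linear_functor)
  show "vect_functor A K T" by (rule T_functor)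
  obtain v where v: "\<And>p. p \<in> I \<Longrightarrow> v p \<in> carrier (W x p)" "\<And>p. p \<in> I \<Longrightarrow> v p \<noteq> \<zero>\<^bsub>W x p\<^esub>" using nz by metis
  interpret X: tensor_product K I "W x" by (rule W_tensor[OF x])
  have vB: "restrict v I \<in> X.B" using v by (auto simp: product_set_def)
  obtain "X.pure (restrict v I) \<noteq> \<zero>\<^bsub>X.T\<^esub>"
    using X.pure_nonzero[OF finite_I W_fd[OF x] vB] v by auto
  then show "\<exists>x\<in>Ob A. carrier (fobj T x) \<noteq> {\<zero>\<^bsub>fobj T x\<^esub>}"
    using X.pure_closed[OF vB] x by (intro bexI[of _ x]) (auto simp: T_simps)
  fix N assume N: "is_subfunctor A K N T"
  show "(\<forall>x\<in>Ob A. N x = {\<zero>\<^bsub>fobj T x\<^esub>}) \<or> (\<forall>x\<in>Ob A. N x = carrier (fobj T x))"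
  proof (cases "\<forall>x\<in>Ob A. N x \<subseteq> {\<zero>\<^bsub>fobj T x\<^esub>}")
    case True
    then have "\<forall>x\<in>Ob A. N x = {\<zero>\<^bsub>fobj T x\<^esub>}" using T.subfunctorD(2)[OF N] by blast
    then show ?thesis by blast
  next
    case False
    then obtain z t where z: "z \<in> Ob A" "t \<in> N z" "t \<noteq> \<zero>\<^bsub>fobj T z\<^esub>" by blast
    interpret Z: tensor_product K I "W z" by (rule W_tensor[OF z(1)])
    have t: "t \<in> carrier Z.T" "t \<noteq> \<zero>\<^bsub>Z.T\<^esub>" using T.subfunctorD(1)[OF N z(1)] z by (auto simp: T_simps)
    have "\<exists>l L. (\<forall>i\<in>I. linear_map K (W z i) (field_module K) (l i)) \<and> linear_map K Z.T (field_module K) L \<and>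
        (\<forall>b\<in>Z.B. L (Z.pure b) = (\<Otimes>\<^bsub>K\<^esub>i\<in>I. l i (b i))) \<and> L t \<noteq> \<zero>\<^bsub>K\<^esub>"
    proof (rule Z.product_functional_nonzero[OF finite_I W_fd[OF z(1)] t])
      fix l L assume a: "\<And>i. i \<in> I \<Longrightarrow> linear_map K (W z i) (field_module K) (l i)" "linear_map K Z.T (field_module K) L"
        "\<And>b. b \<in> Z.B \<Longrightarrow> L (Z.pure b) = (\<Otimes>\<^bsub>K\<^esub>i\<in>I. l i (b i))" "L t \<noteq> \<zero>\<^bsub>K\<^esub>"
      show ?thesis by (rule exI[of _ l], rule exI[of _ L]) (use a in simp)
    qed
    then obtain l L where l: "\<And>i. i \<in> I \<Longrightarrow> linear_map K (W z i) (field_module K) (l i)"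
      and L: "linear_map K Z.T (field_module K) L" "\<And>b. b \<in> Z.B \<Longrightarrow> L (Z.pure b) = (\<Otimes>\<^bsub>K\<^esub>i\<in>I. l i (b i))" "L t \<noteq> \<zero>\<^bsub>K\<^esub>"
      by blast
    have Lt: "L t \<in> carrier K" using linear_mapD(1)[OF L(1) t(1)] by simp
    have "N y = carrier (fobj T y)" if y: "y \<in> Ob A" for y
    proof -
      interpret Y: tensor_product K I "W y" by (rule W_tensor[OF y])
      interpret YT: vspace K Y.T by (intro vspace.intro K.field_axioms Y.tensor_module_module)
      have Ny: "submodule (N y) K Y.T" using N y unfolding is_subfunctor_def by (simp add: T_simps)
      have "Y.pure w \<in> N y" if w: "w \<in> Y.B" for w
      proof -
        have "(\<lambda>v. l p v \<odot>\<^bsub>W y p\<^esub> w p) \<in> ops (primary_category p A) K (S p) z y" if p: "p \<in> I" for p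
        proof -
          interpret S: simple_vfunctor "primary_category p A" K "S p" by (rule S_simple[OF p])
          show ?thesis using S.burnside[OF _ _ l[OF p] Y.mem[OF w p]] z y by simp
        qed
        from subfunctor_tensor_ops[OF N z(1) y z(2), of "\<lambda>p v. l p v \<odot>\<^bsub>W y p\<^esub> w p", OF this]
        have "L t \<odot>\<^bsub>Y.T\<^esub> Y.pure w \<in> N y"
          using Z.rank_one_tensor[OF finite_I l L(1,2) Y.tensor_product_axioms w t(1)] by simp
        then have "inv\<^bsub>K\<^esub> (L t) \<odot>\<^bsub>Y.T\<^esub> (L t \<odot>\<^bsub>Y.T\<^esub> Y.pure w) \<in> N y"
          using YT.submoduleE(4)[OF Ny] YT.inv_nonzero(1)[OF Lt L(3)] by blast
        then show ?thesis using YT.smult_cancel[OF Lt L(3) Y.pure_closed[OF w]] by simp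
      qed
      from Y.tensor_submodule_all[OF Ny this] show ?thesis by (simp add: T_simps)
    qed
    then show ?thesis by blast
  qed
qed

lemma retract_nonzero:
  assumes q: "q \<in> I" and o: "x \<in> Ob A" "s \<in> Ob A" and ip: "i \<in> Mor A x s" "p \<in> Mor A s x" "Cmp A x s x p i = Idn A x"
    and v: "v \<in> carrier (W x q)" "v \<noteq> \<zero>\<^bsub>W x q\<^esub>"
  shows "\<exists>w\<in>carrier (W s q). w \<noteq> \<zero>\<^bsub>W s q\<^esub>"
proof -
  interpret S: simple_vfunctor "primary_category q A" K "S q" by (rule S_simple[OF q])
  note pr = prime_I[OF q]
  let ?w = "farr (S q) x s (pc q x s i) v"
  have m: "pc q x s i \<in> PMor q x s" "pc q s x p \<in> PMor q s x" using pc_mem pr o ip by auto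
  have "farr (S q) s x (pc q s x p) ?w = v"
    using S.farr_Cmp[of x s x "pc q x s i" "pc q s x p" v] S.farr_Idn[of x v] o m v pc_Cmp[OF pr o(1,2,1) ip(1,2)] ip(3) by simp
  moreover have "farr (S q) s x (pc q s x p) \<zero>\<^bsub>W s q\<^esub> = \<zero>\<^bsub>W x q\<^esub>"
    using S.ops_zero[of s x] ops.gen[of "pc q s x p" "primary_category q A" s x "S q" K] o m by simp
  moreover have "?w \<in> carrier (W s q)" using linear_mapD(1)[OF arr_linear[OF q o ip(1)] v(1)] .
  ultimately show ?thesis using v(2) by (intro bexI[of _ ?w]) auto
qed

text \<open>
  Non-vanishing of a functor at \<open>x\<close> passes to every object that has \<open>x\<close> as a retract, so sums of
  objects at which the single functors are non-zero will do.
\<close>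

lemma ex_common_support:
  assumes "additive_category A"
  shows "\<exists>x\<in>Ob A. \<forall>p\<in>I. \<exists>v\<in>carrier (W x p). v \<noteq> \<zero>\<^bsub>W x p\<^esub>"
proof -
  interpret additive_category A by fact
  have "J \<subseteq> I \<Longrightarrow> \<exists>x\<in>Ob A. \<forall>p\<in>J. \<exists>v\<in>carrier (W x p). v \<noteq> \<zero>\<^bsub>W x p\<^esub>" if "finite J" for J
    using that
  proof induction
    case empty
    show ?case using ex_zero_object by (auto simp: is_zero_object_def)
  next
    case (insert q J)
    then obtain x where x: "x \<in> Ob A" "\<forall>p\<in>J. \<exists>v\<in>carrier (W x p). v \<noteq> \<zero>\<^bsub>W x p\<^esub>" by auto
    have q: "q \<in> I" using insert by auto
    interpret S: simple_vfunctor "primary_category q A" K "S q" by (rule S_simple[OF q])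
    obtain y v where y: "y \<in> Ob A" "v \<in> carrier (W y q)" "v \<noteq> \<zero>\<^bsub>W y q\<^esub>" using S.nonzero by auto
    obtain s i j p r where "is_biproduct A x y s i j p r" using ex_biproduct[OF x(1) y(1)] by blast
    then have s: "s \<in> Ob A" "i \<in> Mor A x s" "p \<in> Mor A s x" "Cmp A x s x p i = Idn A x"
      "j \<in> Mor A y s" "r \<in> Mor A s y" "Cmp A y s y r j = Idn A y"
      by (auto simp: is_biproduct_def)
    have "\<exists>w\<in>carrier (W s p'). w \<noteq> \<zero>\<^bsub>W s p'\<^esub>" if "p' \<in> insert q J" for p'
    proof (cases "p' = q")
      case True
      then show ?thesis using retract_nonzero[OF q y(1) s(1,5-7) y(2,3)] by simp
    next
      case False
      then have p': "p' \<in> J" "p' \<in> I" using that insert.prems by auto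
      then obtain v where "v \<in> carrier (W x p')" "v \<noteq> \<zero>\<^bsub>W x p'\<^esub>" using x(2) by blast
      then show ?thesis using retract_nonzero[OF p'(2) x(1) s(1-4)] by blast
    qed
    then show ?case using s(1) by blast
  qed
  then show ?thesis using finite_I by blast
qed

end

section \<open>Uniqueness of the factors\<close>

inductive pair_span :: "('o, 'm) preadditive_data \<Rightarrow> 'k ring \<Rightarrow> ('o, 'm, 'k, 'v) vect_functor_data
    \<Rightarrow> ('o, 'm, 'k, 'w) vect_functor_data \<Rightarrow> 'o \<Rightarrow> 'v \<Rightarrow> 'w \<Rightarrow> 'o \<Rightarrow> 'v \<Rightarrow> 'w \<Rightarrow> bool"
  for A K F G x v w where
  base: "pair_span A K F G x v w x v w"
| zero: "y \<in> Ob A \<Longrightarrow> pair_span A K F G x v w y \<zero>\<^bsub>fobj F y\<^esub> \<zero>\<^bsub>fobj G y\<^esub>"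
| add: "y \<in> Ob A \<Longrightarrow> pair_span A K F G x v w y a b \<Longrightarrow> pair_span A K F G x v w y a' b' \<Longrightarrow>
    pair_span A K F G x v w y (a \<oplus>\<^bsub>fobj F y\<^esub> a') (b \<oplus>\<^bsub>fobj G y\<^esub> b')"
| smult: "y \<in> Ob A \<Longrightarrow> c \<in> carrier K \<Longrightarrow> pair_span A K F G x v w y a b \<Longrightarrow>
    pair_span A K F G x v w y (c \<odot>\<^bsub>fobj F y\<^esub> a) (c \<odot>\<^bsub>fobj G y\<^esub> b)"
| arr: "y \<in> Ob A \<Longrightarrow> z \<in> Ob A \<Longrightarrow> f \<in> Mor A y z \<Longrightarrow> pair_span A K F G x v w y a b \<Longrightarrow>
    pair_span A K F G x v w z (farr F y z f a) (farr G y z f b)"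

text \<open>
  Two simple functors are isomorphic as soon as some linear condition \<open>Q\<close> on pairs of vectors at a
  single object \<open>x\<close> holds on the \<open>End x\<close>-orbit of \<open>(v, w)\<close> and fails at some \<open>(0, w')\<close>: then the
  subfunctor of \<open>F \<times> G\<close> generated by \<open>(v, w)\<close> is proper.
\<close>

lemma simple_iso_of_generators:
  assumes F: "simple_vfunctor A K F" and G: "simple_vfunctor A K G"
    and x: "x \<in> Ob A" and v: "v \<in> carrier (fobj F x)" and w: "w \<in> carrier (fobj G x)" "w \<noteq> \<zero>\<^bsub>fobj G x\<^esub>"
    and w': "w' \<in> carrier (fobj G x)"
    and Q_zero: "Q \<zero>\<^bsub>fobj F x\<^esub> \<zero>\<^bsub>fobj G x\<^esub>"
    and Q_add: "\<And>a b a' b'. a \<in> carrier (fobj F x) \<Longrightarrow> b \<in> carrier (fobj G x) \<Longrightarrow> a' \<in> carrier (fobj F x) \<Longrightarrow>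
      b' \<in> carrier (fobj G x) \<Longrightarrow> Q a b \<Longrightarrow> Q a' b' \<Longrightarrow> Q (a \<oplus>\<^bsub>fobj F x\<^esub> a') (b \<oplus>\<^bsub>fobj G x\<^esub> b')"
    and Q_smult: "\<And>c a b. c \<in> carrier K \<Longrightarrow> a \<in> carrier (fobj F x) \<Longrightarrow> b \<in> carrier (fobj G x) \<Longrightarrow> Q a b \<Longrightarrow>
      Q (c \<odot>\<^bsub>fobj F x\<^esub> a) (c \<odot>\<^bsub>fobj G x\<^esub> b)"
    and Q_gen: "\<And>f. f \<in> Mor A x x \<Longrightarrow> Q (farr F x x f v) (farr G x x f w)"
    and Q_proper: "\<not> Q \<zero>\<^bsub>fobj F x\<^esub> w'"
  shows "functor_iso A K F G"
proof -
  interpret F: simple_vfunctor A K F by fact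
  interpret G: simple_vfunctor A K G by fact
  let ?R = "pair_span A K F G x v w"
  have R_in: "y \<in> Ob A \<and> a \<in> carrier (F.V y) \<and> b \<in> carrier (G.V y)" if "?R y a b" for y a b
    using that
  proof induction
    case base
    then show ?case using x v w by simp
  next
    case (zero y)
    then show ?case using F.zero_in G.zero_in by simp
  next
    case (add y a b a' b')
    interpret Fy: module K "F.V y" by (rule F.fobj_module[OF add.hyps(1)])
    interpret Gy: module K "G.V y" by (rule G.fobj_module[OF add.hyps(1)])
    show ?case using add by simp
  next
    case (smult y c a b)
    interpret Fy: module K "F.V y" by (rule F.fobj_module[OF smult.hyps(1)])
    interpret Gy: module K "G.V y" by (rule G.fobj_module[OF smult.hyps(1)])
    show ?case using smult by simp
  next
    case (arr y z f a b)
    then show ?case using linear_mapD(1)[OF F.farr_linear] linear_mapD(1)[OF G.farr_linear] by blast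
  qed
  have inv: "\<forall>g\<in>Mor A y x. Q (farr F y x g a) (farr G y x g b)" if "?R y a b" for y a b
    using that
  proof induction
    case base
    then show ?case using Q_gen by blast
  next
    case (zero y)
    show ?case
      using F.ops_zero[OF zero x ops.gen] G.ops_zero[OF zero x ops.gen] Q_zero by simp
  next
    case (add y a b a' b')
    show ?case
    proof
      fix g assume g: "g \<in> Mor A y x"
      note Fg = linear_mapD[OF F.farr_linear[OF add.hyps(1) x g]] and Gg = linear_mapD[OF G.farr_linear[OF add.hyps(1) x g]]
      have c: "a \<in> carrier (F.V y)" "a' \<in> carrier (F.V y)" "b \<in> carrier (G.V y)" "b' \<in> carrier (G.V y)"
        using R_in add.hyps by blast+
      show "Q (farr F y x g (a \<oplus>\<^bsub>F.V y\<^esub> a')) (farr G y x g (b \<oplus>\<^bsub>G.V y\<^esub> b'))"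
        unfolding Fg(2)[OF c(1,2)] Gg(2)[OF c(3,4)]
        by (rule Q_add) (use Fg(1) Gg(1) c add.IH g in auto)
    qed
  next
    case (smult y c a b)
    show ?case
    proof
      fix g assume g: "g \<in> Mor A y x"
      note Fg = linear_mapD[OF F.farr_linear[OF smult.hyps(1) x g]] and Gg = linear_mapD[OF G.farr_linear[OF smult.hyps(1) x g]]
      have c: "a \<in> carrier (F.V y)" "b \<in> carrier (G.V y)" using R_in smult.hyps by blast+
      show "Q (farr F y x g (c \<odot>\<^bsub>F.V y\<^esub> a)) (farr G y x g (c \<odot>\<^bsub>G.V y\<^esub> b))"
        unfolding Fg(3)[OF smult.hyps(2) c(1)] Gg(3)[OF smult.hyps(2) c(2)]
        by (rule Q_smult) (use Fg(1) Gg(1) c smult g in auto)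
    qed
  next
    case (arr y z f a b)
    show ?case
    proof
      fix g assume g: "g \<in> Mor A z x"
      have c: "a \<in> carrier (F.V y)" "b \<in> carrier (G.V y)" using R_in arr.hyps by blast+
      have "Cmp A y z x g f \<in> Mor A y x" by (rule F.Cmp_closed[OF arr.hyps(1,2) x arr.hyps(3) g])
      then have "Q (farr F y x (Cmp A y z x g f) a) (farr G y x (Cmp A y z x g f) b)" using arr.IH by blast
      then show "Q (farr F z x g (farr F y z f a)) (farr G z x g (farr G y z f b))"
        unfolding F.farr_Cmp[OF arr.hyps(1,2) x arr.hyps(3) g c(1)] G.farr_Cmp[OF arr.hyps(1,2) x arr.hyps(3) g c(2)] .
    qed
  qed
  show ?thesis
  proof (rule goursat_iso[OF F G, where R = "\<lambda>y. {(a, b). ?R y a b}" and x = x and v = v and w = w and y = x and w' = w'])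
    show "(\<zero>\<^bsub>F.V x\<^esub>, w') \<notin> {(a, b). ?R x a b}"
    proof
      assume "(\<zero>\<^bsub>F.V x\<^esub>, w') \<in> {(a, b). ?R x a b}"
      then have "Q (farr F x x (Idn A x) \<zero>\<^bsub>F.V x\<^esub>) (farr G x x (Idn A x) w')" using inv F.Idn_closed[OF x] by blast
      then show False using Q_proper F.farr_Idn[OF x F.zero_in[OF x]] G.farr_Idn[OF x w'] by simp
    qed
  qed (auto simp: x w w' intro: pair_span.intros dest: R_in)
qed

lemma (in tensor_product) pure_zero:
  assumes b: "b \<in> B" and i: "i \<in> I" "b i = \<zero>\<^bsub>V i\<^esub>"
  shows "pure b = \<zero>\<^bsub>T\<^esub>"
proof -
  interpret Vi: module K "V i" by (rule V_module[OF i(1)])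
  interpret T: module K T by (rule tensor_module_module)
  have "pure (b(i := \<zero>\<^bsub>K\<^esub> \<odot>\<^bsub>V i\<^esub> b i)) = \<zero>\<^bsub>K\<^esub> \<odot>\<^bsub>T\<^esub> pure (b(i := b i))"
    using pure_multilinear b i(1) mem[OF b i(1)] unfolding multilinear_def by blast
  moreover have "b(i := \<zero>\<^bsub>K\<^esub> \<odot>\<^bsub>V i\<^esub> b i) = b" using i(2) by auto
  ultimately show ?thesis using pure_closed[OF b] by simp
qed

lemma (in tensor_product) ex_pure_nonzero:
  assumes "t \<in> carrier T" "t \<noteq> \<zero>\<^bsub>T\<^esub>"
  shows "\<exists>b\<in>B. pure b \<noteq> \<zero>\<^bsub>T\<^esub>"
proof (rule ccontr)
  assume none: "\<not> ?thesis"
  interpret T: vspace K T by (intro vspace.intro field_axioms tensor_module_module)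
  have "submodule {\<zero>\<^bsub>T\<^esub>} K T" by (rule T.submodule_closedI) auto
  from tensor_submodule_all[OF this] show False using none assms by auto
qed

lemma (in finite_preadditive) ex_replace_component:
  assumes p: "Factorial_Ring.prime p" and o: "x \<in> Ob A" "y \<in> Ob A" and v: "v \<in> Mor A x y" and a: "a \<in> PMor p x y"
  shows "\<exists>w\<in>Mor A x y. pc p x y w = a \<and> (\<forall>q. Factorial_Ring.prime q \<and> q \<noteq> p \<longrightarrow> pc q x y w = pc q x y v)"
proof -
  interpret xy: finite_comm_group "Hom A x y" by (rule Hom_finite_comm_group[OF o])
  have aC: "a \<in> Mor A x y" by (rule PMor_Mor[OF a])
  define n where "n = inv\<^bsub>Hom A x y\<^esub> (pc p x y v)"
  have pm: "pc p x y v \<in> PMor p x y" by (rule pc_mem[OF p o v])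
  have n: "n \<in> PMor p x y" unfolding n_def by (rule subgroup.m_inv_closed[OF xy.primary_part_subgroup[OF p] pm])
  have nC: "n \<in> Mor A x y" by (rule PMor_Mor[OF n])
  have pC: "pc p x y v \<in> Mor A x y" by (rule PMor_Mor[OF pm])
  let ?w = "v \<otimes>\<^bsub>Hom A x y\<^esub> (n \<otimes>\<^bsub>Hom A x y\<^esub> a)"
  have "pc p x y ?w = pc p x y v \<otimes>\<^bsub>Hom A x y\<^esub> (n \<otimes>\<^bsub>Hom A x y\<^esub> a)"
    using pc_mult[OF p o] v nC aC pc_id[OF p o n] pc_id[OF p o a] by simp
  also have "\<dots> = a" unfolding n_def using pC aC by (simp add: xy.m_assoc[symmetric])
  finally have "pc p x y ?w = a" .
  moreover have "pc q x y ?w = pc q x y v" if q: "Factorial_Ring.prime q" "q \<noteq> p" for q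
    using pc_mult[OF q(1) o] v nC aC pc_other[OF q(1) p _ o n] pc_other[OF q(1) p _ o a] q(2) xy.component_closed[OF q(1) v] by simp
  ultimately show ?thesis using v nC aC by (intro bexI[of _ ?w]) auto
qed

context primary_tensor
begin

lemma arr_pure:
  assumes x: "x \<in> Ob A" "y \<in> Ob A" and f: "f \<in> Mor A x y" and b: "b \<in> product_set I (W x)"
  shows "farr T x y f (pure_tensor K I (W x) b) = pure_tensor K I (W y) (tensor_arg I (\<lambda>p. farr (S p) x y (pc p x y f)) b)"
  unfolding T_simps
  by (rule tensor_map(2)[OF W_tensor[OF x(1)] W_tensor[OF x(2)] arr_linear[OF _ x f] b])

lemma arr_eq_id:
  assumes x: "x \<in> Ob A" and f: "\<And>q. q \<in> I \<Longrightarrow> pc q x x f = pc q x x (Idn A x)" and t: "t \<in> carrier (fobj T x)"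
  shows "farr T x x f t = t"
  unfolding T_simps
proof (rule tensor_map_id[OF W_tensor[OF x]])
  show "t \<in> carrier (tensor_module K I (W x))" using t by (simp add: T_simps)
  fix q v assume q: "q \<in> I" and v: "v \<in> carrier (W x q)"
  interpret S: simple_vfunctor "primary_category q A" K "S q" by (rule S_simple[OF q])
  show "farr (S q) x x (pc q x x f) v = v" using S.farr_Idn[of x v] x v by (simp add: f[OF q])
qed

lemma arr_eq_zero:
  assumes x: "x \<in> Ob A" and f: "f \<in> Mor A x x" and p: "p \<in> I" "pc p x x f = \<one>\<^bsub>Hom A x x\<^esub>"
    and nc: "\<not> functor_iso (primary_category p A) K (S p) (const_functor K)" and t: "t \<in> carrier (fobj T x)"
  shows "farr T x x f t = \<zero>\<^bsub>fobj T x\<^esub>"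
proof -
  interpret T: linear_functor A K T by (rule T_linear_functor)
  interpret X: tensor_product K I "W x" by (rule W_tensor[OF x])
  interpret XT: module K X.T by (rule X.tensor_module_module)
  interpret S: simple_vfunctor "primary_category p A" K "S p" by (rule S_simple[OF p(1)])
  have lin: "linear_map K X.T X.T (farr T x x f)" using T.farr_linear[OF x x f] by (simp add: T_simps)
  have z: "linear_map K X.T X.T (\<lambda>t. \<zero>\<^bsub>X.T\<^esub>)" by (rule linear_mapI) auto
  have "farr T x x f t = \<zero>\<^bsub>X.T\<^esub>"
  proof (rule X.tensor_linear_eqI[OF X.tensor_module_module lin z])
    show "t \<in> carrier X.T" using t by (simp add: T_simps)
    fix b assume b: "b \<in> X.B"
    let ?b = "tensor_arg I (\<lambda>p. farr (S p) x x (pc p x x f)) b"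
    have "?b \<in> X.B" by (rule tensor_map(3)[OF X.tensor_product_axioms X.tensor_product_axioms arr_linear[OF _ x x f] b])
    moreover have "?b p = \<zero>\<^bsub>W x p\<^esub>"
      using S.zero_acts_imp_const[of x "b p"] nc x X.mem[OF b p(1)] p by (auto simp: tensor_arg_def)
    ultimately show "farr T x x f (X.pure b) = \<zero>\<^bsub>X.T\<^esub>"
      using arr_pure[OF x x f b] X.pure_zero[OF _ p(1)] by simp
  qed
  then show ?thesis by (simp add: T_simps)
qed

end

text \<open>
  The endomorphism of \<open>x\<close> that is zero at \<open>p\<close> and the identity at all other primes acts as zero on a tensor
  product with a non-constant factor at \<open>p\<close>, and as the identity on one without a factor at \<open>p\<close>.
\<close>

lemma nonconstant_subset:
  assumes P: "primary_tensor A K I S" and P': "primary_tensor A K I' S'"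
    and nc: "\<And>p. p \<in> I \<Longrightarrow> \<not> functor_iso (primary_category p A) K (S p) (const_functor K)"
    and F: "linear_functor A K F" and x: "x \<in> Ob A" "v \<in> carrier (fobj F x)" "v \<noteq> \<zero>\<^bsub>fobj F x\<^esub>"
    and iso: "functor_iso A K F (tensor_functor K I (\<lambda>p. precompose (primary_projection p A) (S p)))"
    and iso': "functor_iso A K F (tensor_functor K I' (\<lambda>p. precompose (primary_projection p A) (S' p)))"
  shows "I \<subseteq> I'"
proof (rule subsetI, rule ccontr)
  fix p assume p: "p \<in> I" "p \<notin> I'"
  interpret P: primary_tensor A K I S by fact
  interpret P': primary_tensor A K I' S' by fact
  interpret F: linear_functor A K F by fact
  interpret T: linear_functor A K P.T by (rule P.T_linear_functor)
  note pr = P.prime_I[OF p(1)]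
  interpret xx: finite_comm_group "Hom A x x" by (rule P.Hom_finite_comm_group[OF x(1,1)])
  have "\<one>\<^bsub>Hom A x x\<^esub> \<in> P.PMor p x x" using subgroup.one_closed[OF xx.primary_part_subgroup[OF pr]] .
  then obtain f where f: "f \<in> Mor A x x" "P.pc p x x f = \<one>\<^bsub>Hom A x x\<^esub>"
    "\<And>q. Factorial_Ring.prime q \<Longrightarrow> q \<noteq> p \<Longrightarrow> P.pc q x x f = P.pc q x x (Idn A x)"
    using P.ex_replace_component[OF pr x(1,1) P.Idn_closed[OF x(1)]] by blast
  obtain \<eta> where \<eta>: "linear_map K (fobj F x) (fobj P.T x) (\<eta> x)" "bij_betw (\<eta> x) (carrier (fobj F x)) (carrier (fobj P.T x))"
    "\<eta> x (farr F x x f v) = farr P.T x x f (\<eta> x v)"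
    using iso x f(1) unfolding functor_iso_def by blast
  obtain \<theta> where \<theta>: "linear_map K (fobj F x) (fobj P'.T x) (\<theta> x)" "bij_betw (\<theta> x) (carrier (fobj F x)) (carrier (fobj P'.T x))"
    "\<theta> x (farr F x x f v) = farr P'.T x x f (\<theta> x v)"
    using iso' x f(1) unfolding functor_iso_def by blast
  have Fv: "farr F x x f v \<in> carrier (fobj F x)" by (rule linear_mapD(1)[OF F.farr_linear[OF x(1,1) f(1)] x(2)])
  have "farr P.T x x f (\<eta> x v) = \<zero>\<^bsub>fobj P.T x\<^esub>"
    by (rule P.arr_eq_zero[OF x(1) f(1) p(1) f(2) nc[OF p(1)] linear_mapD(1)[OF \<eta>(1) x(2)]])
  also have "\<dots> = \<eta> x \<zero>\<^bsub>fobj F x\<^esub>"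
    by (rule linear_map_zero[OF F.fobj_module[OF x(1)] T.fobj_module[OF x(1)] \<eta>(1), symmetric])
  finally have "farr F x x f v = \<zero>\<^bsub>fobj F x\<^esub>"
    using \<eta>(3) inj_onD[OF bij_betw_imp_inj_on[OF \<eta>(2)] _ Fv F.zero_in[OF x(1)]] by simp
  moreover have "farr P'.T x x f (\<theta> x v) = \<theta> x v"
    by (rule P'.arr_eq_id[OF x(1) _ linear_mapD(1)[OF \<theta>(1) x(2)]]) (use f(3) P'.prime_I p(2) in blast)
  then have "farr F x x f v = v"
    using \<theta>(3) inj_onD[OF bij_betw_imp_inj_on[OF \<theta>(2)] _ Fv x(2)] by simp
  ultimately show False using x(3) by simp
qed

text \<open>
  Fixing pure vectors at the primes other than \<open>p\<close> embeds \<open>S p\<close> into the tensor product, and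
  contracting with functionals at these primes maps the tensor product to \<open>S' p\<close>; both are
  compatible with endomorphisms that are the identity away from \<open>p\<close>. The functionals are chosen so
  that the composite is non-zero.
\<close>

lemma factor_iso:
  assumes P: "primary_tensor A K I S" and P': "primary_tensor A K I S'"
    and F: "linear_functor A K F" and x: "x \<in> Ob A" "v0 \<in> carrier (fobj F x)" "v0 \<noteq> \<zero>\<^bsub>fobj F x\<^esub>"
    and iso: "functor_iso A K F (tensor_functor K I (\<lambda>p. precompose (primary_projection p A) (S p)))"
    and iso': "functor_iso A K F (tensor_functor K I (\<lambda>p. precompose (primary_projection p A) (S' p)))"
    and p: "p \<in> I"
  shows "functor_iso (primary_category p A) K (S p) (S' p)"
proof -
  interpret P: primary_tensor A K I S by fact
  interpret P': primary_tensor A K I S' by fact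
  interpret F: linear_functor A K F by fact
  interpret T: linear_functor A K P.T by (rule P.T_linear_functor)
  interpret T': linear_functor A K P'.T by (rule P'.T_linear_functor)
  interpret X: tensor_product K I "P.W x" by (rule P.W_tensor[OF x(1)])
  interpret X': tensor_product K I "P'.W x" by (rule P'.W_tensor[OF x(1)])
  interpret Sp: simple_vfunctor "primary_category p A" K "S p" by (rule P.S_simple[OF p])
  interpret Sp': simple_vfunctor "primary_category p A" K "S' p" by (rule P'.S_simple[OF p])
  note pr = P.prime_I[OF p]
  have "functor_iso A K P.T P'.T"
    by (rule functor_iso_trans[OF functor_iso_sym[OF iso F.vect_functor_axioms] iso'])
  then obtain \<theta> where \<theta>: "linear_map K (fobj P.T x) (fobj P'.T x) \<theta>" "bij_betw \<theta> (carrier (fobj P.T x)) (carrier (fobj P'.T x))"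
    "\<And>f t. f \<in> Mor A x x \<Longrightarrow> t \<in> carrier (fobj P.T x) \<Longrightarrow> \<theta> (farr P.T x x f t) = farr P'.T x x f (\<theta> t)"
    using x(1) unfolding functor_iso_def by blast
  note \<theta>' = \<theta>[unfolded P.T_simps(1) P'.T_simps(1)]
  obtain \<eta> where \<eta>: "linear_map K (fobj F x) (fobj P.T x) \<eta>" "bij_betw \<eta> (carrier (fobj F x)) (carrier (fobj P.T x))"
    using iso x(1) unfolding functor_iso_def by blast
  have "\<eta> v0 \<noteq> \<eta> \<zero>\<^bsub>fobj F x\<^esub>"
    using inj_onD[OF bij_betw_imp_inj_on[OF \<eta>(2)] _ x(2) F.zero_in[OF x(1)]] x(3) by blast
  then have "\<eta> v0 \<noteq> \<zero>\<^bsub>X.T\<^esub>" "\<eta> v0 \<in> carrier X.T"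
    using linear_map_zero[OF F.fobj_module[OF x(1)] T.fobj_module[OF x(1)] \<eta>(1)] linear_mapD(1)[OF \<eta>(1) x(2)]
    by (simp_all add: P.T_simps)
  then obtain u where u: "u \<in> X.B" "X.pure u \<noteq> \<zero>\<^bsub>X.T\<^esub>" using X.ex_pure_nonzero by blast
  define t' where "t' = \<theta> (X.pure u)"
  have uC: "X.pure u \<in> carrier X.T" by (rule X.pure_closed[OF u(1)])
  interpret XT: module K X.T by (rule X.tensor_module_module)
  have "\<theta> (X.pure u) \<noteq> \<theta> \<zero>\<^bsub>X.T\<^esub>"
    using inj_onD[OF bij_betw_imp_inj_on[OF \<theta>'(2)] _ uC XT.M.zero_closed] u(2) by blast
  then have t': "t' \<noteq> \<zero>\<^bsub>X'.T\<^esub>" "t' \<in> carrier X'.T"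
    using linear_map_zero[OF X.tensor_module_module X'.tensor_module_module \<theta>'(1)] linear_mapD(1)[OF \<theta>'(1) uC]
    by (simp_all add: t'_def)
  have "\<exists>l L. (\<forall>i\<in>I. linear_map K (P'.W x i) (field_module K) (l i)) \<and> linear_map K X'.T (field_module K) L \<and>
      (\<forall>b\<in>X'.B. L (X'.pure b) = (\<Otimes>\<^bsub>K\<^esub>i\<in>I. l i (b i))) \<and> L t' \<noteq> \<zero>\<^bsub>K\<^esub>"
  proof (rule X'.product_functional_nonzero[OF P.finite_I P'.W_fd[OF x(1)] t'(2,1)])
    fix l L assume a: "\<And>i. i \<in> I \<Longrightarrow> linear_map K (P'.W x i) (field_module K) (l i)" "linear_map K X'.T (field_module K) L"
      "\<And>b. b \<in> X'.B \<Longrightarrow> L (X'.pure b) = (\<Otimes>\<^bsub>K\<^esub>i\<in>I. l i (b i))" "L t' \<noteq> \<zero>\<^bsub>K\<^esub>"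
    show ?thesis by (rule exI[of _ l], rule exI[of _ L]) (use a in simp)
  qed
  then obtain l L where l: "\<And>i. i \<in> I \<Longrightarrow> linear_map K (P'.W x i) (field_module K) (l i)"
    and L: "linear_map K X'.T (field_module K) L" "\<And>b. b \<in> X'.B \<Longrightarrow> L (X'.pure b) = (\<Otimes>\<^bsub>K\<^esub>i\<in>I. l i (b i))" "L t' \<noteq> \<zero>\<^bsub>K\<^esub>"
    by blast
  obtain C where C: "linear_map K X'.T (P'.W x p) C"
    "\<And>b. b \<in> X'.B \<Longrightarrow> C (X'.pure b) = (\<Otimes>\<^bsub>K\<^esub>i\<in>I - {p}. l i (b i)) \<odot>\<^bsub>P'.W x p\<^esub> b p"
    using X'.tensor_lift[OF P'.S_module[OF p x(1)] X'.multilinear_contraction[OF P.finite_I l p]] by blast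
  note lp = linear_mapD[OF l[OF p], simplified]
  have lC: "l p (C t) = L t" if t: "t \<in> carrier X'.T" for t
  proof (rule X'.tensor_linear_eqI[OF field_module_module[OF P.K.cring_axioms] linear_map_comp[OF C(1) l[OF p]] L(1) _ t])
    fix b assume b: "b \<in> X'.B"
    have bp: "b p \<in> carrier (P'.W x p)" by (rule X'.mem[OF b p])
    have k: "(\<Otimes>\<^bsub>K\<^esub>i\<in>I - {p}. l i (b i)) \<in> carrier K" by (rule X'.functional_closed[OF Diff_subset _ b]) (use l in blast)
    have "L (X'.pure b) = l p (b p) \<otimes>\<^bsub>K\<^esub> (\<Otimes>\<^bsub>K\<^esub>i\<in>I - {p}. l i (b i))"
      using L(2)[OF b] X'.functional_upd[OF P.finite_I order_refl l b p bp] by simp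
    then show "l p (C (X'.pure b)) = L (X'.pure b)"
      using C(2)[OF b] lp(3)[OF k bp] lp(1)[OF bp] k by (simp add: P.K.m_comm)
  qed
  define w where "w = C t'"
  have wC: "w \<in> carrier (P'.W x p)" using linear_mapD(1)[OF C(1) t'(2)] by (simp add: w_def)
  have "l p \<zero>\<^bsub>P'.W x p\<^esub> = \<zero>\<^bsub>K\<^esub>"
    using linear_map_zero[OF P'.S_module[OF p x(1)] field_module_module[OF P.K.cring_axioms] l[OF p]] by simp
  then have wn: "w \<noteq> \<zero>\<^bsub>P'.W x p\<^esub>" using lC[OF t'(2)] L(3) by (auto simp: w_def)

  define \<psi> where "\<psi> v = C (\<theta> (X.pure (u(p := v))))" for v
  have pl: "linear_map K (P.W x p) X.T (\<lambda>v. X.pure (u(p := v)))"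
    by (rule linear_mapI) (use X.pure_multilinear u(1) p X.pure_closed X.upd_mem[OF u(1) p] in \<open>auto simp: multilinear_def\<close>)
  have \<psi>lin: "linear_map K (P.W x p) (P'.W x p) \<psi>"
    unfolding \<psi>_def by (rule linear_map_comp[OF linear_map_comp[OF pl \<theta>'(1)] C(1)])
  have \<psi>u: "\<psi> (u p) = w" by (simp add: \<psi>_def w_def t'_def)
  have \<psi>nat: "\<psi> (farr (S p) x x f v) = farr (S' p) x x f (\<psi> v)" if f: "f \<in> P.PMor p x x" and v: "v \<in> carrier (P.W x p)" for f v
  proof -
    obtain h where h: "h \<in> Mor A x x" "P.pc p x x h = f"
      "\<And>q. Factorial_Ring.prime q \<Longrightarrow> q \<noteq> p \<Longrightarrow> P.pc q x x h = P.pc q x x (Idn A x)"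
      using P.ex_replace_component[OF pr x(1,1) P.Idn_closed[OF x(1)] f] by blast
    have idS: "farr (S q) x x (P.pc q x x h) s = s" if "q \<in> I" "q \<noteq> p" "s \<in> carrier (P.W x q)" for q s
    proof -
      interpret Sq: simple_vfunctor "primary_category q A" K "S q" by (rule P.S_simple[OF that(1)])
      show ?thesis using Sq.farr_Idn[of x s] x(1) that h(3)[OF P.prime_I[OF that(1)] that(2)] by simp
    qed
    have idS': "farr (S' q) x x (P.pc q x x h) s = s" if "q \<in> I" "q \<noteq> p" "s \<in> carrier (P'.W x q)" for q s
    proof -
      interpret Sq: simple_vfunctor "primary_category q A" K "S' q" by (rule P'.S_simple[OF that(1)])
      show ?thesis using Sq.farr_Idn[of x s] x(1) that h(3)[OF P.prime_I[OF that(1)] that(2)] by simp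
    qed
    have ext: "b i = undefined" if "b \<in> X.B" "i \<notin> I" for b i using that by (auto simp: product_set_def PiE_def extensional_def)
    have ext': "b i = undefined" if "b \<in> X'.B" "i \<notin> I" for b i using that by (auto simp: product_set_def PiE_def extensional_def)
    have uv: "u(p := v) \<in> X.B" by (rule X.upd_mem[OF u(1) p v])
    have "tensor_arg I (\<lambda>q. farr (S q) x x (P.pc q x x h)) (u(p := v)) = u(p := farr (S p) x x f v)"
    proof
      fix q show "tensor_arg I (\<lambda>q. farr (S q) x x (P.pc q x x h)) (u(p := v)) q = (u(p := farr (S p) x x f v)) q"
        using h(2) idS X.mem[OF u(1)] ext[OF u(1)] p by (auto simp: tensor_arg_def)
    qed
    then have 1: "farr P.T x x h (X.pure (u(p := v))) = X.pure (u(p := farr (S p) x x f v))"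
      using P.arr_pure[OF x(1,1) h(1) uv] by simp
    have f': "farr (S' p) x x f s \<in> carrier (P'.W x p)" if "s \<in> carrier (P'.W x p)" for s
      using linear_mapD(1)[OF P'.arr_linear[OF p x(1,1) h(1)] that] h(2) by simp
    have 2: "C (farr P'.T x x h t) = farr (S' p) x x f (C t)" if t: "t \<in> carrier X'.T" for t
    proof (rule X'.tensor_linear_eqI[OF P'.S_module[OF p x(1)] _ _ _ t])
      show "linear_map K X'.T (P'.W x p) (\<lambda>t. C (farr P'.T x x h t))"
        using linear_map_comp[OF _ C(1)] T'.farr_linear[OF x(1,1) h(1)] by (simp add: P'.T_simps)
      have "linear_map K (P'.W x p) (P'.W x p) (farr (S' p) x x f)" using P'.arr_linear[OF p x(1,1) h(1)] h(2) by simp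
      from linear_map_comp[OF C(1) this] show "linear_map K X'.T (P'.W x p) (\<lambda>t. farr (S' p) x x f (C t))" .
      fix b assume b: "b \<in> X'.B"
      have bp: "b p \<in> carrier (P'.W x p)" by (rule X'.mem[OF b p])
      have arg: "tensor_arg I (\<lambda>q. farr (S' q) x x (P.pc q x x h)) b = b(p := farr (S' p) x x f (b p))"
      proof
        fix q show "tensor_arg I (\<lambda>q. farr (S' q) x x (P.pc q x x h)) b q = (b(p := farr (S' p) x x f (b p))) q"
          using h(2) idS' X'.mem[OF b] ext'[OF b] p by (auto simp: tensor_arg_def)
      qed
      have b': "b(p := farr (S' p) x x f (b p)) \<in> X'.B" by (rule X'.upd_mem[OF b p f'[OF bp]])
      have k: "(\<Otimes>\<^bsub>K\<^esub>i\<in>I - {p}. l i (b i)) \<in> carrier K" by (rule X'.functional_closed[OF Diff_subset _ b]) (use l in blast)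
      have same: "(\<Otimes>\<^bsub>K\<^esub>i\<in>I - {p}. l i ((b(p := farr (S' p) x x f (b p))) i)) = (\<Otimes>\<^bsub>K\<^esub>i\<in>I - {p}. l i (b i))"
        by (rule P.K.finprod_cong') (use linear_mapD(1)[OF l] X'.mem[OF b] in auto)
      have "C (farr P'.T x x h (X'.pure b)) = (\<Otimes>\<^bsub>K\<^esub>i\<in>I - {p}. l i (b i)) \<odot>\<^bsub>P'.W x p\<^esub> farr (S' p) x x f (b p)"
        using P'.arr_pure[OF x(1,1) h(1) b] arg C(2)[OF b'] same by simp
      also have "\<dots> = farr (S' p) x x f (C (X'.pure b))"
        using linear_mapD(3)[OF P'.arr_linear[OF p x(1,1) h(1)] k bp] C(2)[OF b] h(2) by simp
      finally show "C (farr P'.T x x h (X'.pure b)) = farr (S' p) x x f (C (X'.pure b))" .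
    qed
    have uvC: "X.pure (u(p := v)) \<in> carrier X.T" by (rule X.pure_closed[OF uv])
    have "\<psi> (farr (S p) x x f v) = C (farr P'.T x x h (\<theta> (X.pure (u(p := v)))))"
      using \<theta>'(3)[OF h(1) uvC] 1 by (simp add: \<psi>_def)
    also have "\<dots> = farr (S' p) x x f (\<psi> v)"
      unfolding \<psi>_def by (rule 2[OF linear_mapD(1)[OF \<theta>'(1) uvC]])
    finally show ?thesis .
  qed
  have up: "u p \<in> carrier (P.W x p)" by (rule X.mem[OF u(1) p])
  have \<psi>0: "\<psi> \<zero>\<^bsub>P.W x p\<^esub> = \<zero>\<^bsub>P'.W x p\<^esub>"
    by (rule linear_map_zero[OF P.S_module[OF p x(1)] P'.S_module[OF p x(1)] \<psi>lin])
  show ?thesis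
  proof (rule simple_iso_of_generators[OF Sp.simple_vfunctor_axioms Sp'.simple_vfunctor_axioms _ up wC wn wC, where Q = "\<lambda>a b. b = \<psi> a"])
    show "farr (S' p) x x f w = \<psi> (farr (S p) x x f (u p))" if "f \<in> Mor (primary_category p A) x x" for f
      using \<psi>nat[OF _ up] \<psi>u that by simp
    show "\<not> w = \<psi> \<zero>\<^bsub>P.W x p\<^esub>" using \<psi>0 wn by simp
  qed (use x(1) \<psi>0 linear_mapD[OF \<psi>lin] in auto)
qed

section \<open>Replacing a primary component\<close>

context finite_preadditive
begin

text \<open>
  The morphism with component \<open>f\<close> at \<open>p\<close> and the components of \<open>g\<close> elsewhere. It is unique by
  \<open>Mor_eqI\<close>. In effect \<open>A\<close> embeds into the product of its primary categories, and \<open>rep\<close>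
  is how morphisms are given componentwise.
\<close>

definition rep :: "nat \<Rightarrow> 'o \<Rightarrow> 'o \<Rightarrow> 'm \<Rightarrow> 'm \<Rightarrow> 'm" where
  "rep p x y g f = (SOME w. w \<in> Mor A x y \<and> pc p x y w = f \<and>
     (\<forall>q. Factorial_Ring.prime q \<and> q \<noteq> p \<longrightarrow> pc q x y w = pc q x y g))"

lemma rep:
  assumes p: "Factorial_Ring.prime p" and o: "x \<in> Ob A" "y \<in> Ob A" and g: "g \<in> Mor A x y" and f: "f \<in> PMor p x y"
  shows rep_closed: "rep p x y g f \<in> Mor A x y" and pc_rep: "pc p x y (rep p x y g f) = f"
    and pc_rep_other: "\<And>q. Factorial_Ring.prime q \<Longrightarrow> q \<noteq> p \<Longrightarrow> pc q x y (rep p x y g f) = pc q x y g"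
proof -
  have "rep p x y g f \<in> Mor A x y \<and> pc p x y (rep p x y g f) = f \<and>
     (\<forall>q. Factorial_Ring.prime q \<and> q \<noteq> p \<longrightarrow> pc q x y (rep p x y g f) = pc q x y g)"
    unfolding rep_def by (rule someI_ex) (use ex_replace_component[OF p o g f] in blast)
  then show "rep p x y g f \<in> Mor A x y" "pc p x y (rep p x y g f) = f"
    "\<And>q. Factorial_Ring.prime q \<Longrightarrow> q \<noteq> p \<Longrightarrow> pc q x y (rep p x y g f) = pc q x y g" by auto
qed

lemma Mor_eqI:
  assumes "x \<in> Ob A" "y \<in> Ob A" "g \<in> Mor A x y" "h \<in> Mor A x y"
    "\<And>q. Factorial_Ring.prime q \<Longrightarrow> pc q x y g = pc q x y h"
  shows "g = h"
  using finite_comm_group.component_ext[OF Hom_finite_comm_group] assms by blast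

lemma rep_eqI:
  assumes p: "Factorial_Ring.prime p" and o: "x \<in> Ob A" "y \<in> Ob A" and g: "g \<in> Mor A x y" and f: "f \<in> PMor p x y"
    and w: "w \<in> Mor A x y" "pc p x y w = f" "\<And>q. Factorial_Ring.prime q \<Longrightarrow> q \<noteq> p \<Longrightarrow> pc q x y w = pc q x y g"
  shows "rep p x y g f = w"
  by (rule Mor_eqI[OF o rep_closed[OF p o g f] w(1)]) (use w(2,3) pc_rep[OF p o g f] pc_rep_other[OF p o g f] in metis)

lemma rep_self: "Factorial_Ring.prime p \<Longrightarrow> x \<in> Ob A \<Longrightarrow> y \<in> Ob A \<Longrightarrow> g \<in> Mor A x y \<Longrightarrow> rep p x y g (pc p x y g) = g"
  by (rule rep_eqI) (auto simp: pc_mem)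

lemma rep_Cmp:
  assumes p: "Factorial_Ring.prime p" and o: "x \<in> Ob A" "y \<in> Ob A" "z \<in> Ob A"
    and g: "g \<in> Mor A x y" "f \<in> PMor p x y" and h: "h \<in> Mor A y z" "k \<in> PMor p y z"
  shows "Cmp A x y z (rep p y z h k) (rep p x y g f) = rep p x z (Cmp A x y z h g) (Cmp A x y z k f)"
proof (rule rep_eqI[OF p o(1,3), symmetric])
  note G = rep_closed[OF p o(1,2) g] and H = rep_closed[OF p o(2,3) h]
  show "Cmp A x y z h g \<in> Mor A x z" by (rule Cmp_closed[OF o g(1) h(1)])
  show "Cmp A x y z k f \<in> PMor p x z" by (rule PMor_Cmp[OF p o PMor_Mor[OF g(2)] PMor_Mor[OF h(2)]]) (use g in blast)
  show "Cmp A x y z (rep p y z h k) (rep p x y g f) \<in> Mor A x z" by (rule Cmp_closed[OF o G H])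
  show "pc p x z (Cmp A x y z (rep p y z h k) (rep p x y g f)) = Cmp A x y z k f"
    using pc_Cmp[OF p o G H] pc_rep[OF p o(1,2) g] pc_rep[OF p o(2,3) h] by simp
  show "pc q x z (Cmp A x y z (rep p y z h k) (rep p x y g f)) = pc q x z (Cmp A x y z h g)" if q: "Factorial_Ring.prime q" "q \<noteq> p" for q
    using pc_Cmp[OF q(1) o G H] pc_Cmp[OF q(1) o g(1) h(1)] pc_rep_other[OF p o(1,2) g q] pc_rep_other[OF p o(2,3) h q] by simp
qed

end

section \<open>Vectors generating simple modules over all primary endomorphism rings\<close>

text \<open>
  The orbit of \<open>u\<close> under the linear combinations of endomorphisms of \<open>x\<close> is a simple module (or
  \<open>u = 0\<close>).
\<close>

definition irreducible_at :: "('o, 'm) preadditive_data \<Rightarrow> 'k ring \<Rightarrow> ('o, 'm, 'k, 'v) vect_functor_data \<Rightarrow> 'o \<Rightarrow> 'v \<Rightarrow> bool" where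
  "irreducible_at A K F x u \<longleftrightarrow> (\<forall>b\<in>ops A K F x x. b u \<noteq> \<zero>\<^bsub>fobj F x\<^esub> \<longrightarrow> (\<exists>c\<in>ops A K F x x. c (b u) = u))"

text \<open>
  An orbit of minimal dimension is simple. If there were none, repeatedly passing to a smaller orbit
  would give a strictly descending chain of orbits; the exchange lemma applied to the generators of
  this chain in reverse order forbids that.
\<close>

lemma (in linear_functor) ex_irreducible_at:
  assumes x: "x \<in> Ob A" and fd: "set vs \<subseteq> carrier (V x)" "carrier (V x) = lspan K (V x) vs"
    and u: "u \<in> carrier (V x)" "u \<noteq> \<zero>\<^bsub>V x\<^esub>"
  shows "\<exists>a\<in>Ops x x. a u \<noteq> \<zero>\<^bsub>V x\<^esub> \<and> irreducible_at A K F x (a u)"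
proof (rule ccontr)
  assume none: "\<not> ?thesis"
  interpret X: vspace K "V x" by (rule V_vspace[OF x])
  define P where "P v \<longleftrightarrow> v \<noteq> \<zero>\<^bsub>V x\<^esub> \<and> (\<exists>a\<in>Ops x x. v = a u)" for v
  have step: "\<exists>b\<in>Ops x x. P (b v) \<and> (\<forall>c\<in>Ops x x. c (b v) \<noteq> v)" if v: "P v" for v
  proof -
    obtain a where a: "a \<in> Ops x x" "v = a u" "a u \<noteq> \<zero>\<^bsub>V x\<^esub>" using v by (auto simp: P_def)
    then obtain b where b: "b \<in> Ops x x" "b (a u) \<noteq> \<zero>\<^bsub>V x\<^esub>" "\<forall>c\<in>Ops x x. c (b (a u)) \<noteq> a u"
      using none unfolding irreducible_at_def by blast
    have "P (b v)" unfolding P_def a(2) using b(2) ops_comp[OF x x x a(1) b(1)]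
      by (intro conjI bexI[of _ "\<lambda>v. b (a v)"]) auto
    then show ?thesis using b(1,3) unfolding a(2) by (intro bexI[of _ b]) auto
  qed
  then obtain b where b: "\<And>v. P v \<Longrightarrow> b v \<in> Ops x x" "\<And>v. P v \<Longrightarrow> P (b v v)" "\<And>v c. P v \<Longrightarrow> c \<in> Ops x x \<Longrightarrow> c (b v v) \<noteq> v"
    by metis
  define w where "w n = ((\<lambda>v. b v v) ^^ n) u" for n
  have wS: "w (Suc n) = b (w n) (w n)" for n by (simp add: w_def)
  have "P u" unfolding P_def using u ops_id[OF x] by (intro conjI bexI[of _ "\<lambda>v. v"]) auto
  then have wP: "P (w n)" for n by (induction n) (auto simp: w_def b(2))
  have wC: "w n \<in> carrier (V x)" for n using wP[of n] ops_closed[OF x x _ u(1)] by (auto simp: P_def)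
  have later: "\<exists>c\<in>Ops x x. w (k + n) = c (w k)" for k n
  proof (induction n)
    case 0
    show ?case using ops_id[OF x] by (intro bexI[of _ "\<lambda>v. v"]) auto
  next
    case (Suc n)
    then obtain c where c: "c \<in> Ops x x" "w (k + n) = c (w k)" by blast
    have "w (k + Suc n) = b (w (k + n)) (c (w k))" using wS[of "k + n"] c(2) by simp
    then show ?case using ops_comp[OF x x x c(1) b(1)[OF wP[of "k + n"]]]
      by (intro bexI[of _ "\<lambda>v. b (w (k + n)) (c v)"])
  qed
  let ?N = "length vs"
  obtain n where n: "n \<le> ?N" "w (?N - n) \<in> lspan K (V x) (map (\<lambda>i. w (?N - i)) [0..<n])"
    using X.exchange[OF fd(1), of "\<lambda>i. w (?N - i)"] wC fd(2) by auto
  define k where "k = ?N - n"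
  let ?O = "{a (w (Suc k)) | a. a \<in> Ops x x \<and> (\<forall>u\<in>{}. a u = \<zero>\<^bsub>V x\<^esub>)}"
  have sub: "submodule ?O K (V x)"
    using annihilator_orbit_subfunctor[OF x wC, of "{}" "Suc k"] x unfolding is_subfunctor_def by blast
  have "w (?N - i) \<in> ?O" if "i < n" for i
  proof -
    have "?N - i = Suc k + (n - Suc i)" using that n(1) by (simp add: k_def)
    then show ?thesis using later[of "Suc k" "n - Suc i"] by auto
  qed
  then have "lspan K (V x) (map (\<lambda>i. w (?N - i)) [0..<n]) \<subseteq> ?O" by (intro X.lspan_least[OF sub]) auto
  then have "w k \<in> ?O" using n(2) unfolding k_def by blast
  then obtain c where "c \<in> Ops x x" "w k = c (w (Suc k))" by blast
  then show False using b(3)[OF wP[of k]] wS[of k] by metis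
qed

lemma preadditive_restrict:
  assumes "preadditive_category C" "Z \<subseteq> Ob C"
  shows "preadditive_category (C\<lparr>Ob := Z\<rparr>)"
proof -
  interpret preadditive_category C by fact
  show ?thesis
    by (rule preadditive_category.intro) (use assms(2) in \<open>auto simp: subset_iff Hom_comm_group Cmp_closed Cmp_assoc Idn_closed Cmp_Idn_left Cmp_Idn_right Cmp_add_left Cmp_add_right\<close>)
qed

locale simple_at_object = finite_preadditive A + S: simple_vfunctor A K S
  for A :: "('o, 'm) preadditive_data" and K :: "'k ring" and S :: "('o, 'm, 'k, 'v) vect_functor_data" +
  fixes x :: 'o
  assumes x: "x \<in> Ob A"
begin

abbreviation "Vx \<equiv> fobj S x"
abbreviation "e p \<equiv> pc p x x (Idn A x)"

text \<open>The embedding of \<open>p\<close>-primary endomorphisms of \<open>x\<close> by the identity at the other primes.\<close>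

definition rho :: "nat \<Rightarrow> 'm \<Rightarrow> 'm" where "rho p f = rep p x x (Idn A x) f"

text \<open>\<open>S x\<close> as a functor on the one-object category of \<open>p\<close>-primary endomorphisms of \<open>x\<close>.\<close>

definition EC :: "nat \<Rightarrow> ('o, 'm) preadditive_data" where "EC p = (primary_category p A)\<lparr>Ob := {x}\<rparr>"
definition LF :: "nat \<Rightarrow> ('o, 'm, 'k, 'v) vect_functor_data" where
  "LF p = \<lparr>fobj = fobj S, farr = (\<lambda>a b f. farr S x x (rho p f))\<rparr>"

lemma EC_simps [simp]: "Ob (EC p) = {x}" "Mor (EC p) a b = PMor p a b" "Cmp (EC p) = Cmp A" "Idn (EC p) x = e p"
  by (simp_all add: EC_def primary_category_def)

lemma LF_simps [simp]: "fobj (LF p) = fobj S" "farr (LF p) a b f = farr S x x (rho p f)"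
  by (simp_all add: LF_def)

lemma Idx: "Idn A x \<in> Mor A x x" by (rule Idn_closed[OF x])
lemma e_mem: "Factorial_Ring.prime p \<Longrightarrow> e p \<in> PMor p x x" using pc_mem[OF _ x x Idx] .

lemma rho_closed: "Factorial_Ring.prime p \<Longrightarrow> f \<in> PMor p x x \<Longrightarrow> rho p f \<in> Mor A x x"
  unfolding rho_def by (rule rep_closed[OF _ x x Idx])

lemma rho_e: "Factorial_Ring.prime p \<Longrightarrow> rho p (e p) = Idn A x"
  unfolding rho_def by (rule rep_self[OF _ x x Idx])

lemma Cmp_e_left: "Factorial_Ring.prime p \<Longrightarrow> y \<in> Ob A \<Longrightarrow> f \<in> PMor p y x \<Longrightarrow> Cmp A y x x (e p) f = f"
  using Idn_component_left[OF _ _ x] PMor_Mor pc_id[OF _ _ x] by metis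

lemma Cmp_e_right: "Factorial_Ring.prime p \<Longrightarrow> y \<in> Ob A \<Longrightarrow> f \<in> PMor p x y \<Longrightarrow> Cmp A x x y f (e p) = f"
  using Idn_component_right[OF _ x] PMor_Mor pc_id[OF _ x] by metis

lemma rho_Cmp: "Factorial_Ring.prime p \<Longrightarrow> f \<in> PMor p x x \<Longrightarrow> g \<in> PMor p x x \<Longrightarrow> Cmp A x x x (rho p g) (rho p f) = rho p (Cmp A x x x g f)"
  unfolding rho_def using rep_Cmp[OF _ x x x Idx _ Idx] Cmp_Idn_left[OF x x Idx] by simp

lemma rho_commute:
  assumes p: "Factorial_Ring.prime p" and f: "f \<in> PMor p x x" and g: "g \<in> Mor A x x" "pc p x x g = e p"
  shows "Cmp A x x x (rho p f) g = Cmp A x x x g (rho p f)"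
proof -
  have "g = rep p x x g (e p)" using rep_self[OF p x x g(1)] g(2) by simp
  then show ?thesis
    using rep_Cmp[OF p x x x g(1) e_mem[OF p] Idx f] rep_Cmp[OF p x x x Idx f g(1) e_mem[OF p]]
      Cmp_Idn_left[OF x x g(1)] Cmp_Idn_right[OF x x g(1)] Cmp_e_left[OF p x f] Cmp_e_right[OF p x f]
    unfolding rho_def by metis
qed

lemma LF_linear: assumes p: "Factorial_Ring.prime p" shows "linear_functor (EC p) K (LF p)"
proof (rule linear_functor.intro)
  interpret P: finite_preadditive "primary_category p A" by (rule primary_category_finite_preadditive[OF p])
  show "preadditive_category (EC p)" unfolding EC_def
    by (rule preadditive_restrict[OF P.preadditive_category_axioms]) (simp add: x)
  show "vect_functor (EC p) K (LF p)"
  proof (rule vect_functor.intro)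
    fix a b c assume a: "a \<in> Ob (EC p)"
    then have [simp]: "a = x" by simp
    show "module K (fobj (LF p) a)" using S.fobj_module[OF x] by simp
    show "farr (LF p) a a (Idn (EC p) a) v = v" if "v \<in> carrier (fobj (LF p) a)" for v
      using that rho_e[OF p] S.farr_Idn[OF x] by simp
    fix f assume b: "b \<in> Ob (EC p)" and f: "f \<in> Mor (EC p) a b"
    then have [simp]: "b = x" by simp
    show "linear_map K (fobj (LF p) a) (fobj (LF p) b) (farr (LF p) a b f)"
      using S.farr_linear[OF x x rho_closed[OF p]] f by simp
    fix g v assume c: "c \<in> Ob (EC p)" and g: "g \<in> Mor (EC p) b c" and v: "v \<in> carrier (fobj (LF p) a)"
    then have [simp]: "c = x" by simp
    show "farr (LF p) a c (Cmp (EC p) a b c g f) v = farr (LF p) b c g (farr (LF p) a b f v)"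
      using S.farr_Cmp[OF x x x rho_closed[OF p] rho_closed[OF p], of f g v] f g v rho_Cmp[OF p, of f g] by simp
  qed
  show "field K" by (rule S.K.field_axioms)
qed

abbreviation "Ops_at p \<equiv> ops (EC p) K (LF p) x x"

lemma Ops_at_linear: "Factorial_Ring.prime p \<Longrightarrow> a \<in> Ops_at p \<Longrightarrow> linear_map K Vx Vx a"
  using linear_functor.ops_linear[OF LF_linear, of p x x a] by simp

lemma Ops_at_commute_arr:
  assumes p: "Factorial_Ring.prime p" and a: "a \<in> Ops_at p" and g: "g \<in> Mor A x x" "pc p x x g = e p" and v: "v \<in> carrier Vx"
  shows "a (farr S x x g v) = farr S x x g (a v)"
proof -
  note L = linear_mapD[OF S.farr_linear[OF x x g(1)]]
  note gv = L(1)[OF v]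
  show ?thesis
    using a
  proof induction
    case (gen f)
    then have f: "f \<in> PMor p x x" by simp
    show ?case
      using S.farr_Cmp[OF x x x g(1) rho_closed[OF p f] v] S.farr_Cmp[OF x x x rho_closed[OF p f] g(1) v] rho_commute[OF p f g] by simp
  next
    case zero
    show ?case using S.ops_zero[OF x x ops.gen[OF g(1)]] by simp
  next
    case (add a b)
    then show ?case using L(2) linear_mapD(1)[OF Ops_at_linear[OF p]] v by simp
  next
    case (smult c a)
    then show ?case using L(3) linear_mapD(1)[OF Ops_at_linear[OF p]] v by simp
  next
    case (ext a b)
    then show ?case using gv v by simp
  qed
qed

lemma Ops_at_commute:
  assumes p: "Factorial_Ring.prime p" and q: "Factorial_Ring.prime q" "q \<noteq> p"
    and a: "a \<in> Ops_at p" and b: "b \<in> Ops_at q" and v: "v \<in> carrier Vx"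
  shows "a (b v) = b (a v)"
proof -
  note La = linear_mapD[OF Ops_at_linear[OF p a]]
  show ?thesis
    using b
  proof induction
    case (gen f)
    then have f: "f \<in> PMor q x x" by simp
    have "pc p x x (rho q f) = e p" unfolding rho_def by (rule pc_rep_other[OF q(1) x x Idx f p]) (use q in blast)
    then show ?case using Ops_at_commute_arr[OF p a rho_closed[OF q(1) f] _ v] by simp
  next
    case zero
    interpret X: module K Vx by (rule S.fobj_module[OF x])
    show ?case using linear_map_zero[OF X.module_axioms X.module_axioms Ops_at_linear[OF p a]] by simp
  next
    case (add b c)
    then show ?case using La(2) linear_mapD(1)[OF Ops_at_linear[OF q(1)]] v by simp
  next
    case (smult c b)
    then show ?case using La(3) linear_mapD(1)[OF Ops_at_linear[OF q(1)]] v by simp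
  next
    case (ext b c)
    then show ?case using La(1)[OF v] v by simp
  qed
qed

lemma Ops_at_scalar:
  assumes p: "Factorial_Ring.prime p" "\<not> p dvd order (Hom A x x)" and a: "a \<in> Ops_at p"
  shows "\<exists>c\<in>carrier K. \<forall>v\<in>carrier Vx. a v = c \<odot>\<^bsub>Vx\<^esub> v"
proof -
  interpret xx: finite_comm_group "Hom A x x" by (rule Hom_finite_comm_group[OF x x])
  interpret X: vspace K Vx by (rule S.V_vspace[OF x])
  show ?thesis
    using a
  proof induction
    case (gen f)
    then have f: "f \<in> PMor p x x" by simp
    have "f = e p" using xx.primary_part_trivial[OF p f] xx.primary_part_trivial[OF p e_mem[OF p(1)]] by simp
    then show ?case using rho_e[OF p(1)] S.farr_Idn[OF x] by (intro bexI[of _ "\<one>\<^bsub>K\<^esub>"]) auto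
  next
    case zero
    show ?case by (intro bexI[of _ "\<zero>\<^bsub>K\<^esub>"]) auto
  next
    case (add a b)
    then obtain c d where "c \<in> carrier K" "d \<in> carrier K" "\<forall>v\<in>carrier Vx. a v = c \<odot>\<^bsub>Vx\<^esub> v" "\<forall>v\<in>carrier Vx. b v = d \<odot>\<^bsub>Vx\<^esub> v" by blast
    then show ?case by (intro bexI[of _ "c \<oplus>\<^bsub>K\<^esub> d"]) (auto simp: X.smult_l_distr)
  next
    case (smult d a)
    then obtain c where "c \<in> carrier K" "\<forall>v\<in>carrier Vx. a v = c \<odot>\<^bsub>Vx\<^esub> v" by blast
    then show ?case using smult(1) by (intro bexI[of _ "d \<otimes>\<^bsub>K\<^esub> c"]) (auto simp: X.smult_assoc1)
  next
    case (ext a b)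
    then show ?case by auto
  qed
qed

text \<open>
  Primes that do not divide the order of \<open>End x\<close> contribute scalars only. The finitely many others
  are treated one after the other, replacing \<open>u\<close> by some \<open>a u\<close>: since \<open>a\<close> commutes with the
  operators for the other primes, what has been achieved there is not lost.
\<close>

lemma ex_irreducible_vector:
  assumes nz: "\<exists>v\<in>carrier Vx. v \<noteq> \<zero>\<^bsub>Vx\<^esub>"
  shows "\<exists>u\<in>carrier Vx. u \<noteq> \<zero>\<^bsub>Vx\<^esub> \<and> (\<forall>p. Factorial_Ring.prime p \<longrightarrow> irreducible_at (EC p) K (LF p) x u)"
proof -
  interpret X: vspace K Vx by (rule S.V_vspace[OF x])
  interpret xx: finite_comm_group "Hom A x x" by (rule Hom_finite_comm_group[OF x x])
  obtain vs where vs: "set vs \<subseteq> carrier Vx" "carrier Vx = lspan K Vx vs" using S.finite_dimensional[OF x] by blast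
  have step: "(\<And>p. p \<in> J \<Longrightarrow> Factorial_Ring.prime p) \<Longrightarrow>
    \<exists>u\<in>carrier Vx. u \<noteq> \<zero>\<^bsub>Vx\<^esub> \<and> (\<forall>p\<in>J. irreducible_at (EC p) K (LF p) x u)" if "finite J" for J
    using that
  proof induction
    case empty
    then show ?case using nz by blast
  next
    case (insert p J)
    then obtain u where u: "u \<in> carrier Vx" "u \<noteq> \<zero>\<^bsub>Vx\<^esub>" "\<forall>p\<in>J. irreducible_at (EC p) K (LF p) x u" by auto
    have p: "Factorial_Ring.prime p" using insert by auto
    obtain a where a: "a \<in> Ops_at p" "a u \<noteq> \<zero>\<^bsub>Vx\<^esub>" "irreducible_at (EC p) K (LF p) x (a u)"
      using linear_functor.ex_irreducible_at[OF LF_linear[OF p], of x vs u] vs u by auto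
    note La = linear_mapD[OF Ops_at_linear[OF p a(1)]]
    have a0: "a \<zero>\<^bsub>Vx\<^esub> = \<zero>\<^bsub>Vx\<^esub>" by (rule linear_map_zero[OF X.module_axioms X.module_axioms Ops_at_linear[OF p a(1)]])
    have "irreducible_at (EC q) K (LF q) x (a u)" if q: "q \<in> J" for q
      unfolding irreducible_at_def
    proof (intro ballI impI)
      have qp: "Factorial_Ring.prime q" "q \<noteq> p" using insert q by auto
      fix b assume b: "b \<in> Ops_at q" "b (a u) \<noteq> \<zero>\<^bsub>fobj (LF q) x\<^esub>"
      have bC: "b u \<in> carrier Vx" using linear_mapD(1)[OF Ops_at_linear[OF qp(1) b(1)] u(1)] .
      have ab: "b (a u) = a (b u)" using Ops_at_commute[OF p qp a(1) b(1) u(1)] by simp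
      then have "b u \<noteq> \<zero>\<^bsub>Vx\<^esub>" using b(2) a0 by auto
      then obtain c where c: "c \<in> Ops_at q" "c (b u) = u" using u(3) q b(1) unfolding irreducible_at_def by auto
      have "c (b (a u)) = a u" unfolding ab using Ops_at_commute[OF p qp a(1) c(1) bC] c(2) by simp
      then show "\<exists>c\<in>Ops_at q. c (b (a u)) = a u" using c(1) by blast
    qed
    then show ?case using a La(1)[OF u(1)] by (intro bexI[of _ "a u"]) auto
  qed
  let ?J = "{p. Factorial_Ring.prime p \<and> p dvd order (Hom A x x)}"
  have fin_J: "finite ?J" by (rule finite_subset[OF _ finite_divisors_nat[OF xx.order_pos]]) auto
  have "\<exists>u\<in>carrier Vx. u \<noteq> \<zero>\<^bsub>Vx\<^esub> \<and> (\<forall>p\<in>?J. irreducible_at (EC p) K (LF p) x u)"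
    by (rule step[OF fin_J]) simp
  then obtain u where u: "u \<in> carrier Vx" "u \<noteq> \<zero>\<^bsub>Vx\<^esub>" "\<forall>p\<in>?J. irreducible_at (EC p) K (LF p) x u"
    by blast
  have "irreducible_at (EC p) K (LF p) x u" if p: "Factorial_Ring.prime p" for p
  proof (cases "p dvd order (Hom A x x)")
    case True
    then show ?thesis using u(3) p by blast
  next
    case False
    show ?thesis
      unfolding irreducible_at_def
    proof (intro ballI impI)
      fix b assume b: "b \<in> Ops_at p" "b u \<noteq> \<zero>\<^bsub>fobj (LF p) x\<^esub>"
      obtain c where c: "c \<in> carrier K" "b u = c \<odot>\<^bsub>Vx\<^esub> u" using Ops_at_scalar[OF p False b(1)] u(1) by blast
      have cn: "c \<noteq> \<zero>\<^bsub>K\<^esub>" using b(2) c u(1) by auto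
      have "(\<lambda>v. inv\<^bsub>K\<^esub> c \<odot>\<^bsub>fobj (LF p) x\<^esub> v) \<in> Ops_at p"
        by (rule ops.smult[OF X.inv_nonzero(1)[OF c(1) cn] linear_functor.ops_id[OF LF_linear[OF p]]]) simp
      moreover have "inv\<^bsub>K\<^esub> c \<odot>\<^bsub>Vx\<^esub> (b u) = u" unfolding c(2) by (rule X.smult_cancel[OF c(1) cn u(1)])
      ultimately show "\<exists>c\<in>Ops_at p. c (b u) = u" by (intro bexI) auto
    qed
  qed
  then show ?thesis using u by blast
qed

end

section \<open>Construction of the factors\<close>

inductive_set mspan :: "'k ring \<Rightarrow> ('k, 'v) module \<Rightarrow> 'v set \<Rightarrow> 'v set" for K M Z where
  incl: "v \<in> Z \<Longrightarrow> v \<in> mspan K M Z"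
| zero: "\<zero>\<^bsub>M\<^esub> \<in> mspan K M Z"
| add: "v \<in> mspan K M Z \<Longrightarrow> w \<in> mspan K M Z \<Longrightarrow> v \<oplus>\<^bsub>M\<^esub> w \<in> mspan K M Z"
| smult: "c \<in> carrier K \<Longrightarrow> v \<in> mspan K M Z \<Longrightarrow> c \<odot>\<^bsub>M\<^esub> v \<in> mspan K M Z"

lemma (in vspace) mspan_carrier:
  assumes "Z \<subseteq> carrier V" "v \<in> mspan K V Z"
  shows "v \<in> carrier V"
  using assms(2) by induction (use assms(1) in auto)

lemma (in vspace) mspan_submodule: "Z \<subseteq> carrier V \<Longrightarrow> submodule (mspan K V Z) K V"
  by (rule submodule_closedI) (auto intro: mspan_carrier mspan.intros)

lemma (in vspace) mspan_linear_eq: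
  assumes W: "module K W" and Z: "Z \<subseteq> carrier V" and h: "linear_map K V W h" and g: "linear_map K V W g"
    and eq: "\<And>v. v \<in> Z \<Longrightarrow> h v = g v" and v: "v \<in> mspan K V Z"
  shows "h v = g v"
  using v
proof induction
  case zero
  show ?case using linear_map_zero[OF module_axioms W h] linear_map_zero[OF module_axioms W g] by simp
qed (use eq linear_mapD[OF h] linear_mapD[OF g] mspan_carrier[OF Z] in auto)

text \<open>
  The object \<open>s y\<close> with the morphisms \<open>i y\<close>, \<open>j y\<close>, \<open>r y\<close>, \<open>q y\<close> contains both \<open>y\<close> and \<open>x\<close> as
  retracts. If idempotents split, it contains the sum of the \<open>p\<close>-primary part of \<open>y\<close> and the
  prime-to-\<open>p\<close> part of \<open>x\<close> as a summand; call it \<open>Z y\<close>. For \<open>y = x\<close> this is \<open>x\<close> itself. The factor of \<open>S\<close> at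
  \<open>p\<close> is the subfunctor of \<open>y \<mapsto> S (Z y)\<close>, on the \<open>p\<close>-primary category, that is generated by \<open>u\<close>. Its values
  are realised as subspaces of the spaces \<open>S (s y)\<close>, so they have elements of the same type as those
  of \<open>S\<close>.
\<close>

locale primary_factor = simple_at_object A K S x
  for A :: "('o, 'm) preadditive_data" and K :: "'k ring" and S :: "('o, 'm, 'k, 'v) vect_functor_data" and x :: 'o +
  fixes p :: nat and u :: 'v and s :: "'o \<Rightarrow> 'o" and i j r q :: "'o \<Rightarrow> 'm"
  assumes p: "Factorial_Ring.prime p"
    and u: "u \<in> carrier (fobj S x)" "u \<noteq> \<zero>\<^bsub>fobj S x\<^esub>"
    and irr: "irreducible_at (EC p) K (LF p) x u"
    and s: "y \<in> Ob A \<Longrightarrow> s y \<in> Ob A"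
    and i: "y \<in> Ob A \<Longrightarrow> i y \<in> Mor A y (s y)"
    and j: "y \<in> Ob A \<Longrightarrow> j y \<in> Mor A x (s y)"
    and r: "y \<in> Ob A \<Longrightarrow> r y \<in> Mor A (s y) y"
    and q: "y \<in> Ob A \<Longrightarrow> q y \<in> Mor A (s y) x"
    and ri: "y \<in> Ob A \<Longrightarrow> Cmp A y (s y) y (r y) (i y) = Idn A y"
    and qj: "y \<in> Ob A \<Longrightarrow> Cmp A x (s y) x (q y) (j y) = Idn A x"
begin

text \<open>
  On prime-to-\<open>p\<close> components the following three morphisms are the identity of \<open>x\<close>, seen through the
  retractions; on \<open>p\<close>-primary components they are \<open>f\<close>, \<open>h\<close> and the identity of \<open>x\<close>. So \<open>mat\<close>
  describes the action of the \<open>p\<close>-primary category, \<open>col\<close> yields the generators, and \<open>pr\<close> identifies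
  \<open>Z x\<close> with \<open>x\<close>.
\<close>

definition col :: "'o \<Rightarrow> 'm \<Rightarrow> 'm" where
  "col y f = rep p x (s y) (j y) (Cmp A x y (s y) (i y) f)"
definition mat :: "'o \<Rightarrow> 'o \<Rightarrow> 'm \<Rightarrow> 'm" where
  "mat y z h = rep p (s y) (s z) (Cmp A (s y) x (s z) (j z) (q y)) (Cmp A (s y) z (s z) (i z) (Cmp A (s y) y z h (r y)))"
definition pr :: 'm where
  "pr = rep p (s x) x (q x) (pc p (s x) x (r x))"

lemma ri_Cmp: "y \<in> Ob A \<Longrightarrow> z \<in> Ob A \<Longrightarrow> f \<in> Mor A z y \<Longrightarrow> Cmp A z (s y) y (r y) (Cmp A z y (s y) (i y) f) = f"
  using Cmp_assoc[of z y "s y" y f "i y" "r y"] s i r ri Cmp_Idn_left by simp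

lemma qj_Cmp: "y \<in> Ob A \<Longrightarrow> z \<in> Ob A \<Longrightarrow> f \<in> Mor A z x \<Longrightarrow> Cmp A z (s y) x (q y) (Cmp A z x (s y) (j y) f) = f"
  using Cmp_assoc[of z x "s y" x f "j y" "q y"] s j q qj x Cmp_Idn_left by simp

lemma col_args:
  assumes "y \<in> Ob A" "f \<in> PMor p x y"
  shows "j y \<in> Mor A x (s y)" "Cmp A x y (s y) (i y) f \<in> PMor p x (s y)"
  using assms PMor_Cmp[OF p x assms(1) s[OF assms(1)] PMor_Mor[OF assms(2)] i[OF assms(1)]] j by auto

lemma mat_args:
  assumes "y \<in> Ob A" "z \<in> Ob A" "h \<in> PMor p y z"
  shows "Cmp A (s y) x (s z) (j z) (q y) \<in> Mor A (s y) (s z)"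
    "Cmp A (s y) z (s z) (i z) (Cmp A (s y) y z h (r y)) \<in> PMor p (s y) (s z)"
proof -
  show "Cmp A (s y) x (s z) (j z) (q y) \<in> Mor A (s y) (s z)" using Cmp_closed assms x s j q by blast
  have h: "Cmp A (s y) y z h (r y) \<in> PMor p (s y) z"
    using PMor_Cmp[OF p s[OF assms(1)] assms(1,2) r[OF assms(1)] PMor_Mor[OF assms(3)]] assms(3) by blast
  have *: "Cmp A (s y) z (s z) (i z) (Cmp A (s y) y z h (r y)) \<in> PMor p (s y) (s z)"
    using PMor_Cmp[OF p s[OF assms(1)] assms(2) s[OF assms(2)] PMor_Mor[OF h] i[OF assms(2)]] h by blast
  then show "Cmp A (s y) z (s z) (i z) (Cmp A (s y) y z h (r y)) \<in> PMor p (s y) (s z)" .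
qed

lemma pr_args: "q x \<in> Mor A (s x) x" "pc p (s x) x (r x) \<in> PMor p (s x) x"
  using q r s x pc_mem[OF p] by auto

lemma col_closed: "y \<in> Ob A \<Longrightarrow> f \<in> PMor p x y \<Longrightarrow> col y f \<in> Mor A x (s y)"
  unfolding col_def by (rule rep_closed[OF p x s col_args])

lemma mat_closed: "y \<in> Ob A \<Longrightarrow> z \<in> Ob A \<Longrightarrow> h \<in> PMor p y z \<Longrightarrow> mat y z h \<in> Mor A (s y) (s z)"
  unfolding mat_def by (rule rep_closed[OF p s s mat_args])

lemma pr_closed: "pr \<in> Mor A (s x) x"
  unfolding pr_def by (rule rep_closed[OF p s[OF x] x pr_args])

lemma PMor_Cmp': "y \<in> Ob A \<Longrightarrow> z \<in> Ob A \<Longrightarrow> w \<in> Ob A \<Longrightarrow> f \<in> PMor p y z \<Longrightarrow> h \<in> PMor p z w \<Longrightarrow> Cmp A y z w h f \<in> PMor p y w"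
  using PMor_Cmp[OF p] PMor_Mor by blast

lemma mat_col:
  assumes y: "y \<in> Ob A" and z: "z \<in> Ob A" and f: "f \<in> PMor p x y" and h: "h \<in> PMor p y z"
  shows "Cmp A x (s y) (s z) (mat y z h) (col y f) = col z (Cmp A x y z h f)"
proof -
  note m = x y z s[OF y] s[OF z] i[OF y] i[OF z] j[OF y] j[OF z] r[OF y] q[OF y] PMor_Mor[OF f] PMor_Mor[OF h]
  have 1: "Cmp A x (s y) (s z) (Cmp A (s y) x (s z) (j z) (q y)) (j y) = j z"
    using m qj[OF y] Cmp_Idn_right[of x "s z" "j z"] by (simp add: Cmp_assoc)
  have 2: "Cmp A x (s y) (s z) (Cmp A (s y) z (s z) (i z) (Cmp A (s y) y z h (r y))) (Cmp A x y (s y) (i y) f)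
      = Cmp A x z (s z) (i z) (Cmp A x y z h f)"
    using m ri_Cmp[OF y x, of f] by (simp add: Cmp_assoc Cmp_closed)
  show ?thesis
    unfolding mat_def col_def rep_Cmp[OF p x s[OF y] s[OF z] col_args[OF y f] mat_args[OF y z h]] 1 2 ..
qed

lemma mat_mat:
  assumes y: "y \<in> Ob A" and z: "z \<in> Ob A" and w: "w \<in> Ob A" and h: "h \<in> PMor p y z" and k: "k \<in> PMor p z w"
  shows "Cmp A (s y) (s z) (s w) (mat z w k) (mat y z h) = mat y w (Cmp A y z w k h)"
proof -
  note m = x y z w s[OF y] s[OF z] s[OF w] i[OF y] i[OF z] i[OF w] j[OF y] j[OF z] j[OF w] r[OF y] r[OF z] q[OF y] q[OF z] PMor_Mor[OF h] PMor_Mor[OF k]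
  have 1: "Cmp A (s y) (s z) (s w) (Cmp A (s z) x (s w) (j w) (q z)) (Cmp A (s y) x (s z) (j z) (q y)) = Cmp A (s y) x (s w) (j w) (q y)"
    using m qj_Cmp[OF z s[OF y] q[OF y]] by (simp add: Cmp_assoc Cmp_closed)
  have 2: "Cmp A (s y) (s z) (s w) (Cmp A (s z) w (s w) (i w) (Cmp A (s z) z w k (r z))) (Cmp A (s y) z (s z) (i z) (Cmp A (s y) y z h (r y)))
      = Cmp A (s y) w (s w) (i w) (Cmp A (s y) y w (Cmp A y z w k h) (r y))"
    using m ri_Cmp[OF z s[OF y], of "Cmp A (s y) y z h (r y)"] by (simp add: Cmp_assoc Cmp_closed)
  show ?thesis
    unfolding mat_def rep_Cmp[OF p s[OF y] s[OF z] s[OF w] mat_args[OF y z h] mat_args[OF z w k]] 1 2 ..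
qed

lemma pr_col:
  assumes f: "f \<in> PMor p x x"
  shows "Cmp A x (s x) x pr (col x f) = rho p f"
proof -
  note m = x s[OF x] i[OF x] j[OF x] r[OF x] q[OF x] PMor_Mor[OF f]
  have "Cmp A x (s x) x (pc p (s x) x (r x)) (Cmp A x x (s x) (i x) f) = f"
    using pc_Cmp_left[OF p x s[OF x] x, of "Cmp A x x (s x) (i x) f" "r x"] m ri_Cmp[OF x x, of f] pc_id[OF p x x f] by (simp add: Cmp_closed)
  then show ?thesis
    unfolding pr_def col_def rho_def using rep_Cmp[OF p x s[OF x] x col_args[OF x f] pr_args] qj[OF x] by simp
qed

lemma col_rho:
  assumes f: "f \<in> PMor p x x"
  shows "Cmp A x x (s x) (col x (e p)) (rho p f) = col x f"
proof -
  note m = x s[OF x] i[OF x] j[OF x] PMor_Mor[OF f] PMor_Mor[OF e_mem[OF p]]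
  have "Cmp A x x (s x) (Cmp A x x (s x) (i x) (e p)) f = Cmp A x x (s x) (i x) f"
    using m Cmp_e_left[OF p x f] by (simp add: Cmp_assoc)
  then show ?thesis
    unfolding col_def rho_def using rep_Cmp[OF p x x s[OF x] Idx f col_args[OF x e_mem[OF p]]] Cmp_Idn_right[OF x s[OF x] j[OF x]] by simp
qed

lemma Cmp_col:
  assumes y: "y \<in> Ob A" and g: "g \<in> Mor A (s y) x" and f: "f \<in> PMor p x y"
  defines "k \<equiv> Cmp A y (s y) x (pc p (s y) x g) (i y)"
  shows "k \<in> PMor p y x"
    and "Cmp A x (s y) x g (col y f) = Cmp A x x x (rep p x x (Cmp A x (s y) x g (j y)) (e p)) (rho p (Cmp A x y x k f))"
proof -
  have gp: "pc p (s y) x g \<in> PMor p (s y) x" by (rule pc_mem[OF p s[OF y] x g])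
  note m = x y s[OF y] i[OF y] j[OF y] PMor_Mor[OF f] g PMor_Mor[OF gp]
  show k: "k \<in> PMor p y x" unfolding k_def using PMor_Cmp[OF p y s[OF y] x i[OF y] PMor_Mor[OF gp]] gp by blast
  have kf: "Cmp A x y x k f \<in> PMor p x x" by (rule PMor_Cmp'[OF x y x f k])
  have gj: "Cmp A x (s y) x g (j y) \<in> Mor A x x" by (rule Cmp_closed[OF x s[OF y] x j[OF y] g])
  have assoc: "Cmp A x (s y) x (pc p (s y) x g) (Cmp A x y (s y) (i y) f) = Cmp A x y x k f"
    unfolding k_def using m by (simp add: Cmp_assoc)
  have "Cmp A x (s y) x g (col y f) = rep p x x (Cmp A x (s y) x g (j y)) (Cmp A x y x k f)"
    using rep_Cmp[OF p x s[OF y] x col_args[OF y f] g gp] rep_self[OF p s[OF y] x g] assoc by (simp add: col_def)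
  also have "\<dots> = Cmp A x x x (rep p x x (Cmp A x (s y) x g (j y)) (e p)) (rho p (Cmp A x y x k f))"
    using rep_Cmp[OF p x x x Idx kf gj e_mem[OF p]] Cmp_Idn_right[OF x x gj] Cmp_e_left[OF p x kf] by (simp add: rho_def)
  finally show "Cmp A x (s y) x g (col y f) = \<dots>" .
qed

definition gen :: "'o \<Rightarrow> 'm \<Rightarrow> 'v" where "gen y f = farr S x (s y) (col y f) u"

abbreviation "gens y \<equiv> gen y ` PMor p x y"

definition factor :: "('o, 'm, 'k, 'v) vect_functor_data" where
  "factor = \<lparr>fobj = (\<lambda>y. (fobj S (s y))\<lparr>carrier := mspan K (fobj S (s y)) (gens y)\<rparr>),
     farr = (\<lambda>y z h. farr S (s y) (s z) (mat y z h))\<rparr>"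

lemma factor_simps [simp]:
  "carrier (fobj factor y) = mspan K (fobj S (s y)) (gens y)" "\<zero>\<^bsub>fobj factor y\<^esub> = \<zero>\<^bsub>fobj S (s y)\<^esub>"
  "a \<oplus>\<^bsub>fobj factor y\<^esub> b = a \<oplus>\<^bsub>fobj S (s y)\<^esub> b" "c \<odot>\<^bsub>fobj factor y\<^esub> a = c \<odot>\<^bsub>fobj S (s y)\<^esub> a"
  "farr factor y z h = farr S (s y) (s z) (mat y z h)"
  by (simp_all add: factor_def)

lemma gens_carrier: "y \<in> Ob A \<Longrightarrow> gens y \<subseteq> carrier (fobj S (s y))"
  using linear_mapD(1)[OF S.farr_linear[OF x s col_closed] u(1)] by (auto simp: gen_def)

lemma span_carrier: "y \<in> Ob A \<Longrightarrow> v \<in> mspan K (fobj S (s y)) (gens y) \<Longrightarrow> v \<in> carrier (fobj S (s y))"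
  using vspace.mspan_carrier[OF S.V_vspace[OF s] gens_carrier] by blast

lemma mat_gen:
  assumes y: "y \<in> Ob A" and z: "z \<in> Ob A" and f: "f \<in> PMor p x y" and h: "h \<in> PMor p y z"
  shows "farr S (s y) (s z) (mat y z h) (gen y f) = gen z (Cmp A x y z h f)"
  unfolding gen_def using S.farr_Cmp[OF x s[OF y] s[OF z] col_closed[OF y f] mat_closed[OF y z h] u(1)] mat_col[OF y z f h] by simp

lemma span_linear_eq:
  assumes "y \<in> Ob A" "module K W" "linear_map K (fobj S (s y)) W h" "linear_map K (fobj S (s y)) W g"
    "\<And>f. f \<in> PMor p x y \<Longrightarrow> h (gen y f) = g (gen y f)" "v \<in> mspan K (fobj S (s y)) (gens y)"
  shows "h v = g v"
  by (rule vspace.mspan_linear_eq[OF S.V_vspace[OF s[OF assms(1)]] assms(2) gens_carrier[OF assms(1)] assms(3,4) _ assms(6)])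
    (use assms(5) in auto)

lemma mat_span:
  assumes y: "y \<in> Ob A" and z: "z \<in> Ob A" and h: "h \<in> PMor p y z" and v: "v \<in> mspan K (fobj S (s y)) (gens y)"
  shows "farr S (s y) (s z) (mat y z h) v \<in> mspan K (fobj S (s z)) (gens z)"
proof -
  note Lin = S.farr_linear[OF s[OF y] s[OF z] mat_closed[OF y z h]]
  note L = linear_mapD[OF Lin]
  show ?thesis
    using v
  proof induction
    case (incl v)
    then obtain f where f: "f \<in> PMor p x y" "v = gen y f" by blast
    show ?case unfolding f(2) mat_gen[OF y z f(1) h] using PMor_Cmp'[OF x y z f(1) h] by (intro mspan.incl) blast
  next
    case zero
    show ?case using linear_map_zero[OF S.fobj_module[OF s[OF y]] S.fobj_module[OF s[OF z]] Lin] mspan.zero by simp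
  next
    case (add v w)
    then show ?case using L(2)[OF span_carrier[OF y] span_carrier[OF y]] mspan.add by simp
  next
    case (smult c v)
    then show ?case using L(3)[OF _ span_carrier[OF y]] mspan.smult by simp
  qed
qed

lemma factor_functor: "vect_functor (primary_category p A) K factor"
proof (rule vect_functor.intro)
  fix y assume "y \<in> Ob (primary_category p A)"
  then have y: "y \<in> Ob A" by simp
  interpret Y: vspace K "fobj S (s y)" by (rule S.V_vspace[OF s[OF y]])
  show "module K (fobj factor y)"
    unfolding factor_def using submodule.submodule_is_module[OF Y.mspan_submodule[OF gens_carrier[OF y]] Y.module_axioms] by simp
  have ey: "pc p y y (Idn A y) \<in> PMor p y y" by (rule pc_mem[OF p y y Idn_closed[OF y]])
  show "farr factor y y (Idn (primary_category p A) y) v = v" if v: "v \<in> carrier (fobj factor y)" for v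
  proof -
    have "farr S (s y) (s y) (mat y y (pc p y y (Idn A y))) v = v"
    proof (rule span_linear_eq[OF y Y.module_axioms S.farr_linear[OF s[OF y] s[OF y] mat_closed[OF y y ey]] linear_map_id])
      show "farr S (s y) (s y) (mat y y (pc p y y (Idn A y))) (gen y f) = gen y f" if f: "f \<in> PMor p x y" for f
        using mat_gen[OF y y f ey] Idn_component_left[OF p x y PMor_Mor[OF f]] pc_id[OF p x y f] by simp
      show "v \<in> mspan K (fobj S (s y)) (gens y)" using v by simp
    qed
    then show ?thesis by simp
  qed
  fix z h assume "z \<in> Ob (primary_category p A)" and "h \<in> Mor (primary_category p A) y z"
  then have z: "z \<in> Ob A" and h: "h \<in> PMor p y z" by simp_all
  note L = linear_mapD[OF S.farr_linear[OF s[OF y] s[OF z] mat_closed[OF y z h]]]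
  show "linear_map K (fobj factor y) (fobj factor z) (farr factor y z h)"
    by (rule linear_mapI) (use mat_span[OF y z h] L span_carrier[OF y] in auto)
  fix w k v assume "w \<in> Ob (primary_category p A)" "k \<in> Mor (primary_category p A) z w" "v \<in> carrier (fobj factor y)"
  then have w: "w \<in> Ob A" and k: "k \<in> PMor p z w" and v: "v \<in> carrier (fobj S (s y))" using span_carrier[OF y] by auto
  show "farr factor y w (Cmp (primary_category p A) y z w k h) v = farr factor z w k (farr factor y z h v)"
    using S.farr_Cmp[OF s[OF y] s[OF z] s[OF w] mat_closed[OF y z h] mat_closed[OF z w k] v] mat_mat[OF y z w h k] by simp
qed

lemma factor_linear_functor: "linear_functor (primary_category p A) K factor"
proof -
  interpret P: finite_preadditive "primary_category p A" by (rule primary_category_finite_preadditive[OF p])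
  show ?thesis by (intro linear_functor.intro P.preadditive_category_axioms factor_functor S.K.field_axioms)
qed

sublocale Fac: linear_functor "primary_category p A" K factor by (rule factor_linear_functor)

definition P :: "'v \<Rightarrow> 'v" where "P v = farr S (s x) x pr v"

lemma P_linear: "linear_map K (fobj S (s x)) Vx P"
  unfolding P_def using S.farr_linear[OF s[OF x] x pr_closed] .

lemma P_gen: "f \<in> PMor p x x \<Longrightarrow> P (gen x f) = farr S x x (rho p f) u"
  unfolding P_def gen_def using S.farr_Cmp[OF x s[OF x] x col_closed[OF x] pr_closed u(1)] pr_col by simp

lemma P_inverse:
  assumes v: "v \<in> carrier (fobj factor x)"
  shows "farr S x (s x) (col x (e p)) (P v) = v"
proof -
  note c = col_closed[OF x e_mem[OF p]]
  interpret sx: module K "fobj S (s x)" by (rule S.fobj_module[OF s[OF x]])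
  show ?thesis
  proof (rule span_linear_eq[OF x sx.module_axioms linear_map_comp[OF P_linear S.farr_linear[OF x s[OF x] c]] linear_map_id])
    show "farr S x (s x) (col x (e p)) (P (gen x f)) = gen x f" if f: "f \<in> PMor p x x" for f
      using S.farr_Cmp[OF x x s[OF x] rho_closed[OF p f] c u(1)] col_rho[OF f] P_gen[OF f] by (simp add: gen_def)
    show "v \<in> mspan K (fobj S (s x)) (gens x)" using v by simp
  qed
qed

definition base :: 'v where "base = gen x (e p)"

lemma base_closed: "base \<in> carrier (fobj factor x)"
  unfolding base_def using e_mem[OF p] by (auto intro: mspan.incl)

lemma P_base: "P base = u"
  unfolding base_def using P_gen[OF e_mem[OF p]] rho_e[OF p] S.farr_Idn[OF x u(1)] by simp

lemma base_nonzero: "base \<noteq> \<zero>\<^bsub>fobj factor x\<^esub>"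
  using P_base u(2) linear_map_zero[OF S.fobj_module[OF s[OF x]] S.fobj_module[OF x] P_linear] by auto

lemma arr_base: "y \<in> Ob A \<Longrightarrow> f \<in> PMor p x y \<Longrightarrow> farr factor x y f base = gen y f"
  unfolding base_def using mat_gen[OF x _ e_mem[OF p], of y f] Cmp_e_right[OF p, of y f] by simp

text \<open>Under \<open>P\<close> the action on \<open>factor x\<close> becomes the action of the \<open>p\<close>-primary endomorphisms on \<open>S x\<close>.\<close>

lemma P_arr:
  assumes f: "f \<in> PMor p x x" and v: "v \<in> carrier (fobj factor x)"
  shows "P (farr factor x x f v) = farr S x x (rho p f) (P v)"
proof -
  have "P (farr S (s x) (s x) (mat x x f) v) = farr S x x (rho p f) (P v)"
  proof (rule span_linear_eq[OF x S.fobj_module[OF x], where h = "\<lambda>v. P (farr S (s x) (s x) (mat x x f) v)"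
        and g = "\<lambda>v. farr S x x (rho p f) (P v)"])
    show "linear_map K (fobj S (s x)) Vx (\<lambda>v. P (farr S (s x) (s x) (mat x x f) v))"
      by (rule linear_map_comp[OF S.farr_linear[OF s[OF x] s[OF x] mat_closed[OF x x f]] P_linear])
    show "linear_map K (fobj S (s x)) Vx (\<lambda>v. farr S x x (rho p f) (P v))"
      by (rule linear_map_comp[OF P_linear S.farr_linear[OF x x rho_closed[OF p f]]])
    show "P (farr S (s x) (s x) (mat x x f) (gen x g)) = farr S x x (rho p f) (P (gen x g))" if g: "g \<in> PMor p x x" for g
      using mat_gen[OF x x g f] P_gen[OF g] P_gen[OF PMor_Cmp'[OF x x x g f]]
        S.farr_Cmp[OF x x x rho_closed[OF p g] rho_closed[OF p f] u(1)] rho_Cmp[OF p g f] by simp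
    show "v \<in> mspan K (fobj S (s x)) (gens x)" using v by simp
  qed
  then show ?thesis by simp
qed

abbreviation "Fac_ops \<equiv> ops (primary_category p A) K factor x x"

text \<open>
  Hence operators on \<open>factor x\<close> and linear combinations of \<open>p\<close>-primary endomorphisms on \<open>S x\<close>
  correspond to each other.
\<close>

lemma ops_transfer:
  assumes "b \<in> Fac_ops"
  shows "\<exists>b'\<in>Ops_at p. \<forall>v\<in>carrier (fobj factor x). b' (P v) = P (b v)"
  using assms
proof induction
  case (gen f)
  then have f: "f \<in> Mor (EC p) x x" by simp
  show ?case using ops.gen[OF f, of "LF p" K] P_arr f by (intro bexI[of _ "farr (LF p) x x f"]) auto
next
  case zero
  show ?case using ops.zero[of "LF p" x "EC p" K x] linear_map_zero[OF S.fobj_module[OF s[OF x]] S.fobj_module[OF x] P_linear]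
    by (intro bexI[of _ "\<lambda>v. \<zero>\<^bsub>fobj (LF p) x\<^esub>"]) auto
next
  case (add a b)
  then obtain a' b' where ab: "a' \<in> Ops_at p" "b' \<in> Ops_at p" "\<forall>v\<in>carrier (fobj factor x). a' (P v) = P (a v)"
    "\<forall>v\<in>carrier (fobj factor x). b' (P v) = P (b v)" by blast
  have "P (a v \<oplus>\<^bsub>fobj factor x\<^esub> b v) = P (a v) \<oplus>\<^bsub>Vx\<^esub> P (b v)" if "v \<in> carrier (fobj factor x)" for v
    using linear_mapD(2)[OF P_linear] Fac.ops_closed[of x x] add.hyps that x span_carrier[OF x] by simp
  then show ?case using ops.add[OF ab(1,2)] ab(3,4) by (intro bexI[of _ "\<lambda>v. a' v \<oplus>\<^bsub>fobj (LF p) x\<^esub> b' v"]) auto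
next
  case (smult c b)
  then obtain b' where b: "b' \<in> Ops_at p" "\<forall>v\<in>carrier (fobj factor x). b' (P v) = P (b v)" by blast
  have "P (c \<odot>\<^bsub>fobj factor x\<^esub> b v) = c \<odot>\<^bsub>Vx\<^esub> P (b v)" if "v \<in> carrier (fobj factor x)" for v
    using linear_mapD(3)[OF P_linear smult.hyps(1)] Fac.ops_closed[of x x] smult.hyps that x span_carrier[OF x] by simp
  then show ?case using ops.smult[OF smult.hyps(1) b(1)] b(2) by (intro bexI[of _ "\<lambda>v. c \<odot>\<^bsub>fobj (LF p) x\<^esub> b' v"]) auto
next
  case (ext a b)
  then show ?case by auto
qed

lemma ops_transfer':
  assumes "b \<in> Ops_at p"
  shows "\<exists>b'\<in>Fac_ops. \<forall>v\<in>carrier (fobj factor x). P (b' v) = b (P v)"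
  using assms
proof induction
  case (gen f)
  then have f: "f \<in> Mor (primary_category p A) x x" by simp
  show ?case using ops.gen[OF f, of factor K] P_arr f by (intro bexI[of _ "farr factor x x f"]) auto
next
  case zero
  show ?case using ops.zero[of factor x "primary_category p A" K x] linear_map_zero[OF S.fobj_module[OF s[OF x]] S.fobj_module[OF x] P_linear]
    by (intro bexI[of _ "\<lambda>v. \<zero>\<^bsub>fobj factor x\<^esub>"]) auto
next
  case (add a b)
  then obtain a' b' where ab: "a' \<in> Fac_ops" "b' \<in> Fac_ops" "\<forall>v\<in>carrier (fobj factor x). P (a' v) = a (P v)"
    "\<forall>v\<in>carrier (fobj factor x). P (b' v) = b (P v)" by blast
  have "P (a' v \<oplus>\<^bsub>fobj factor x\<^esub> b' v) = P (a' v) \<oplus>\<^bsub>Vx\<^esub> P (b' v)" if "v \<in> carrier (fobj factor x)" for v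
    using linear_mapD(2)[OF P_linear] Fac.ops_closed[of x x] ab that x span_carrier[OF x] by simp
  then show ?case using ops.add[OF ab(1,2)] ab(3,4) by (intro bexI[of _ "\<lambda>v. a' v \<oplus>\<^bsub>fobj factor x\<^esub> b' v"]) auto
next
  case (smult c b)
  then obtain b' where b: "b' \<in> Fac_ops" "\<forall>v\<in>carrier (fobj factor x). P (b' v) = b (P v)" by blast
  have "P (c \<odot>\<^bsub>fobj factor x\<^esub> b' v) = c \<odot>\<^bsub>Vx\<^esub> P (b' v)" if "v \<in> carrier (fobj factor x)" for v
    using linear_mapD(3)[OF P_linear smult.hyps(1)] Fac.ops_closed[of x x] b that x span_carrier[OF x] by simp
  then show ?case using ops.smult[OF smult.hyps(1) b(1)] b(2) by (intro bexI[of _ "\<lambda>v. c \<odot>\<^bsub>fobj factor x\<^esub> b' v"]) auto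
next
  case (ext a b)
  then obtain b' where b: "b' \<in> Fac_ops" "\<forall>v\<in>carrier (fobj factor x). P (b' v) = a (P v)" by blast
  have "P v \<in> carrier Vx" if "v \<in> carrier (fobj factor x)" for v
    using linear_mapD(1)[OF P_linear] span_carrier[OF x] that by simp
  then show ?case using b ext.hyps(2) by (intro bexI[of _ b']) auto
qed

lemma P_orbit:
  assumes "v \<in> carrier (fobj factor x)"
  shows "\<exists>b\<in>Ops_at p. P v = b u"
proof -
  have "v \<in> mspan K (fobj S (s x)) (gens x)" using assms by simp
  then show ?thesis
  proof induction
    case (incl v)
    then obtain f where f: "f \<in> PMor p x x" "v = gen x f" by blast
    then have "f \<in> Mor (EC p) x x" by simp
    then show ?case using ops.gen[of f "EC p" x x "LF p" K] P_gen[OF f(1)] f(2) by (intro bexI[of _ "farr (LF p) x x f"]) auto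
  next
    case zero
    show ?case using ops.zero[of "LF p" x "EC p" K x] linear_map_zero[OF S.fobj_module[OF s[OF x]] S.fobj_module[OF x] P_linear]
      by (intro bexI[of _ "\<lambda>v. \<zero>\<^bsub>fobj (LF p) x\<^esub>"]) auto
  next
    case (add v w)
    then obtain a b where ab: "a \<in> Ops_at p" "b \<in> Ops_at p" "P v = a u" "P w = b u" by blast
    then show ?case using ops.add[OF ab(1,2)] linear_mapD(2)[OF P_linear span_carrier[OF x] span_carrier[OF x]] add.hyps
      by (intro bexI[of _ "\<lambda>v. a v \<oplus>\<^bsub>fobj (LF p) x\<^esub> b v"]) auto
  next
    case (smult c v)
    then obtain b where b: "b \<in> Ops_at p" "P v = b u" by blast
    then show ?case using ops.smult[OF smult.hyps(1) b(1)] linear_mapD(3)[OF P_linear smult.hyps(1) span_carrier[OF x]] smult.hyps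
      by (intro bexI[of _ "\<lambda>v. c \<odot>\<^bsub>fobj (LF p) x\<^esub> b v"]) auto
  qed
qed

text \<open>
  Since \<open>S\<close> is simple, some \<open>g : s y \<rightarrow> x\<close> does not kill \<open>w\<close>. Its prime-to-\<open>p\<close> part acts after its
  \<open>p\<close>-primary part, so the latter does not kill \<open>w\<close> either.
\<close>

lemma arr_nonzero:
  assumes y: "y \<in> Ob A" and w: "w \<in> carrier (fobj factor y)" "w \<noteq> \<zero>\<^bsub>fobj factor y\<^esub>"
  shows "\<exists>k\<in>PMor p y x. P (farr factor y x k w) \<noteq> \<zero>\<^bsub>Vx\<^esub>"
proof -
  have wC: "w \<in> carrier (fobj S (s y))" using span_carrier[OF y] w(1) by simp
  interpret X: vspace K Vx by (rule S.V_vspace[OF x])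
  have "\<exists>g\<in>Mor A (s y) x. farr S (s y) x g w \<noteq> \<zero>\<^bsub>Vx\<^esub>"
  proof (rule ccontr)
    assume none: "\<not> ?thesis"
    have "a w = \<zero>\<^bsub>Vx\<^esub>" if "a \<in> ops A K S (s y) x" for a
      using that by induction (use none wC in auto)
    moreover obtain a where "a \<in> ops A K S (s y) x" "a w = u" using S.reach[OF s[OF y] wC _ x u(1)] w(2) by auto
    ultimately show False using u(2) by simp
  qed
  then obtain g where g: "g \<in> Mor A (s y) x" "farr S (s y) x g w \<noteq> \<zero>\<^bsub>Vx\<^esub>" by blast
  define k where "k = Cmp A y (s y) x (pc p (s y) x g) (i y)"
  define g' where "g' = rep p x x (Cmp A x (s y) x g (j y)) (e p)"
  have gp: "pc p (s y) x g \<in> PMor p (s y) x" by (rule pc_mem[OF p s[OF y] x g(1)])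
  have k: "k \<in> PMor p y x" unfolding k_def using PMor_Cmp[OF p y s[OF y] x i[OF y] PMor_Mor[OF gp]] gp by blast
  have g': "g' \<in> Mor A x x"
    unfolding g'_def by (rule rep_closed[OF p x x Cmp_closed[OF x s[OF y] x j[OF y] g(1)] e_mem[OF p]])
  have "farr S (s y) x g w = farr S x x g' (P (farr S (s y) (s x) (mat y x k) w))"
  proof (rule span_linear_eq[OF y S.fobj_module[OF x] S.farr_linear[OF s[OF y] x g(1)]])
    show "linear_map K (fobj S (s y)) Vx (\<lambda>w. farr S x x g' (P (farr S (s y) (s x) (mat y x k) w)))"
      by (rule linear_map_comp[OF linear_map_comp[OF S.farr_linear[OF s[OF y] s[OF x] mat_closed[OF y x k]] P_linear] S.farr_linear[OF x x g']])
    show "w \<in> mspan K (fobj S (s y)) (gens y)" using w(1) by simp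
    fix f assume f: "f \<in> PMor p x y"
    have kf: "Cmp A x y x k f \<in> PMor p x x" by (rule PMor_Cmp'[OF x y x f k])
    have "farr S (s y) x g (gen y f) = farr S x x (Cmp A x (s y) x g (col y f)) u"
      unfolding gen_def using S.farr_Cmp[OF x s[OF y] x col_closed[OF y f] g(1) u(1)] by simp
    also have "\<dots> = farr S x x g' (farr S x x (rho p (Cmp A x y x k f)) u)"
      using Cmp_col(2)[OF y g(1) f] S.farr_Cmp[OF x x x rho_closed[OF p kf] g' u(1)] by (simp add: k_def g'_def)
    also have "\<dots> = farr S x x g' (P (farr S (s y) (s x) (mat y x k) (gen y f)))"
      using mat_gen[OF y x f k] P_gen[OF kf] by simp
    finally show "farr S (s y) x g (gen y f) = farr S x x g' (P (farr S (s y) (s x) (mat y x k) (gen y f)))" .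
  qed
  then have "P (farr S (s y) (s x) (mat y x k) w) \<noteq> \<zero>\<^bsub>Vx\<^esub>" using g(2) S.ops_zero[OF x x ops.gen[OF g']] by auto
  then show ?thesis using k by auto
qed

text \<open>
  A non-zero subfunctor is non-zero at \<open>x\<close> by \<open>arr_nonzero\<close>; as the orbit of \<open>u\<close> is a simple module
  isomorphic to \<open>factor x\<close>, it then contains the generator.
\<close>

lemma factor_simple: "simple_functor (primary_category p A) K factor"
  unfolding simple_functor_def
proof (intro conjI allI impI)
  show "vect_functor (primary_category p A) K factor" by (rule factor_functor)
  show "\<exists>y\<in>Ob (primary_category p A). carrier (fobj factor y) \<noteq> {\<zero>\<^bsub>fobj factor y\<^esub>}"
    using base_closed base_nonzero x by (intro bexI[of _ x]) auto
  fix N assume N: "is_subfunctor (primary_category p A) K N factor"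
  note D = Fac.subfunctorD[OF N, unfolded primary_category_simps]
  show "(\<forall>y\<in>Ob (primary_category p A). N y = {\<zero>\<^bsub>fobj factor y\<^esub>}) \<or> (\<forall>y\<in>Ob (primary_category p A). N y = carrier (fobj factor y))"
  proof (cases "\<forall>y\<in>Ob A. N y \<subseteq> {\<zero>\<^bsub>fobj factor y\<^esub>}")
    case True
    then have "\<forall>y\<in>Ob A. N y = {\<zero>\<^bsub>fobj factor y\<^esub>}" using D(2) by blast
    then show ?thesis by simp
  next
    case False
    then obtain y w where y: "y \<in> Ob A" and w: "w \<in> N y" "w \<noteq> \<zero>\<^bsub>fobj factor y\<^esub>" by blast
    have wC: "w \<in> carrier (fobj factor y)" using D(1)[OF y] w(1) by blast
    obtain k where k: "k \<in> PMor p y x" "P (farr factor y x k w) \<noteq> \<zero>\<^bsub>Vx\<^esub>" using arr_nonzero[OF y wC w(2)] by blast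
    define w1 where "w1 = farr factor y x k w"
    have w1: "w1 \<in> N x" unfolding w1_def by (rule D(5)[OF y x k(1) w(1)])
    have w1C: "w1 \<in> carrier (fobj factor x)" using D(1)[OF x] w1 by blast
    obtain b where b: "b \<in> Ops_at p" "P w1 = b u" using P_orbit[OF w1C] by blast
    obtain c where c: "c \<in> Ops_at p" "c (b u) = u" using irr b k(2) unfolding irreducible_at_def w1_def by auto
    obtain c' where c': "c' \<in> Fac_ops" "\<forall>v\<in>carrier (fobj factor x). P (c' v) = c (P v)" using ops_transfer'[OF c(1)] by blast
    have N1: "c' w1 \<in> N x" using Fac.subfunctor_ops[OF N _ _ w1 c'(1)] x by simp
    then have "c' w1 \<in> carrier (fobj factor x)" using D(1)[OF x] by blast
    from P_inverse[OF this] have "c' w1 = base" using P_inverse[OF base_closed] c'(2) w1C b(2) c(2) P_base by simp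
    then have baseN: "base \<in> N x" using N1 by simp
    have "N z = carrier (fobj factor z)" if z: "z \<in> Ob A" for z
    proof
      show "N z \<subseteq> carrier (fobj factor z)" by (rule D(1)[OF z])
      have "v \<in> N z" if "v \<in> mspan K (fobj S (s z)) (gens z)" for v
        using that
      proof induction
        case (incl v)
        then obtain f where f: "f \<in> PMor p x z" "v = gen z f" by blast
        then show ?case using D(5)[OF x z f(1) baseN] arr_base[OF z f(1)] by simp
      qed (use D(2-4)[OF z] in auto)
      then show "carrier (fobj factor z) \<subseteq> N z" by auto
    qed
    then show ?thesis by simp
  qed
qed

end

section \<open>The decomposition\<close>

locale all_factors = simple_at_object A K S x
  for A :: "('o, 'm) preadditive_data" and K :: "'k ring" and S :: "('o, 'm, 'k, 'v) vect_functor_data" and x :: 'o +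
  fixes u :: 'v and s :: "'o \<Rightarrow> 'o" and i j r q :: "'o \<Rightarrow> 'm"
  assumes factors: "Factorial_Ring.prime p \<Longrightarrow> primary_factor A K S x p u s i j r q"
begin

definition Sp :: "nat \<Rightarrow> ('o, 'm, 'k, 'v) vect_functor_data" where
  "Sp p = primary_factor.factor A K S x p u s i j r q"
definition generator :: "nat \<Rightarrow> 'v" where "generator p = primary_factor.base A S x p u s i j"
abbreviation "I \<equiv> nonconstant_primes A K Sp"
abbreviation "J \<equiv> {p. Factorial_Ring.prime p \<and> p dvd order (Hom A x x)}"

lemma u: "u \<in> carrier Vx" "u \<noteq> \<zero>\<^bsub>Vx\<^esub>"
  using primary_factor.u[OF factors[OF two_is_prime_nat]] .

lemma Sp_simple: "Factorial_Ring.prime p \<Longrightarrow> simple_functor (primary_category p A) K (Sp p)"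
  unfolding Sp_def by (rule primary_factor.factor_simple[OF factors])

lemma generator_closed: "Factorial_Ring.prime p \<Longrightarrow> generator p \<in> carrier (fobj (Sp p) x)"
  unfolding generator_def Sp_def by (rule primary_factor.base_closed[OF factors])

lemma generator_nonzero: "Factorial_Ring.prime p \<Longrightarrow> generator p \<noteq> \<zero>\<^bsub>fobj (Sp p) x\<^esub>"
  unfolding generator_def Sp_def by (rule primary_factor.base_nonzero[OF factors])

lemma Sp_vfunctor: "Factorial_Ring.prime p \<Longrightarrow> simple_vfunctor (primary_category p A) K (Sp p)"
proof -
  assume p: "Factorial_Ring.prime p"
  interpret P: finite_preadditive "primary_category p A" by (rule primary_category_finite_preadditive[OF p])
  show ?thesis
    using Sp_simple[OF p] P.fin S.ac
    by (intro simple_vfunctor.intro simple_vfunctor_axioms.intro linear_functor.intro P.preadditive_category_axioms S.K.field_axioms)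
      (auto simp: simple_functor_def)
qed

lemma finite_J: "finite J"
proof -
  interpret xx: finite_comm_group "Hom A x x" by (rule Hom_finite_comm_group[OF x x])
  show ?thesis by (rule finite_subset[OF _ finite_divisors_nat[OF xx.order_pos]]) auto
qed

lemma I_subset: "I \<subseteq> J"
proof
  fix p assume "p \<in> I"
  then have p: "Factorial_Ring.prime p" and nc: "\<not> functor_iso (primary_category p A) K (Sp p) (const_functor K)"
    by (auto simp: nonconstant_primes_def)
  interpret xx: finite_comm_group "Hom A x x" by (rule Hom_finite_comm_group[OF x x])
  interpret Sp: simple_vfunctor "primary_category p A" K "Sp p" by (rule Sp_vfunctor[OF p])
  have "p dvd order (Hom A x x)"
  proof (rule ccontr)
    assume "\<not> p dvd order (Hom A x x)"
    then have "\<one>\<^bsub>Hom A x x\<^esub> = e p" using xx.primary_part_trivial[OF p _ e_mem[OF p]] by simp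
    then have "farr (Sp p) x x \<one>\<^bsub>Hom (primary_category p A) x x\<^esub> (generator p) = generator p"
      using Sp.farr_Idn[of x "generator p"] x generator_closed[OF p] by simp
    then show False using Sp.zero_acts_imp_const[of x "generator p"] nc x generator_closed[OF p] generator_nonzero[OF p] by simp
  qed
  then show "p \<in> J" using p by simp
qed

lemma tensor: "primary_tensor A K I Sp"
proof -
  interpret ac: algebraically_closed K by (rule S.ac)
  show ?thesis
    by (intro primary_tensor.intro primary_tensor_axioms.intro finite_preadditive_axioms ac.algebraically_closed_axioms)
      (use finite_subset[OF I_subset finite_J] Sp_simple in \<open>auto simp: nonconstant_primes_def\<close>)
qed

sublocale T: primary_tensor A K I Sp by (rule tensor)

definition l :: "nat \<Rightarrow> 'v \<Rightarrow> 'k" where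
  "l p = (SOME l. linear_map K (fobj (Sp p) x) (field_module K) l \<and> l (generator p) = \<one>\<^bsub>K\<^esub>)"

lemma l:
  assumes p: "Factorial_Ring.prime p"
  shows "linear_map K (fobj (Sp p) x) (field_module K) (l p)" "l p (generator p) = \<one>\<^bsub>K\<^esub>"
proof -
  interpret Sp: simple_vfunctor "primary_category p A" K "Sp p" by (rule Sp_vfunctor[OF p])
  interpret V: vspace K "fobj (Sp p) x" by (rule Sp.V_vspace) (simp add: x)
  have "\<exists>l. linear_map K (fobj (Sp p) x) (field_module K) l \<and> l (generator p) = \<one>\<^bsub>K\<^esub>"
    by (rule V.ex_unit_functional[OF Sp.finite_dimensional generator_closed[OF p] generator_nonzero[OF p]]) (simp add: x)
  from someI_ex[OF this] show "linear_map K (fobj (Sp p) x) (field_module K) (l p)" "l p (generator p) = \<one>\<^bsub>K\<^esub>"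
    unfolding l_def by auto
qed

definition matrix_coeff :: "nat \<Rightarrow> 'm \<Rightarrow> 'k" where "matrix_coeff p f = l p (farr (Sp p) x x f (generator p))"

lemma arr_generator_closed: "Factorial_Ring.prime p \<Longrightarrow> f \<in> PMor p x x \<Longrightarrow> farr (Sp p) x x f (generator p) \<in> carrier (fobj (Sp p) x)"
proof -
  assume p: "Factorial_Ring.prime p" and f: "f \<in> PMor p x x"
  interpret Sp: simple_vfunctor "primary_category p A" K "Sp p" by (rule Sp_vfunctor[OF p])
  show ?thesis using linear_mapD(1)[OF Sp.farr_linear[of x x f] generator_closed[OF p]] x f by simp
qed

lemma matrix_coeff_closed: "Factorial_Ring.prime p \<Longrightarrow> f \<in> PMor p x x \<Longrightarrow> matrix_coeff p f \<in> carrier K"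
  unfolding matrix_coeff_def using linear_mapD(1)[OF l(1) arr_generator_closed] by simp

lemma matrix_coeff_const:
  assumes p: "Factorial_Ring.prime p" "p \<notin> I" and f: "f \<in> PMor p x x"
  shows "matrix_coeff p f = \<one>\<^bsub>K\<^esub>"
proof -
  interpret Sp: simple_vfunctor "primary_category p A" K "Sp p" by (rule Sp_vfunctor[OF p(1)])
  have "functor_iso (primary_category p A) K (Sp p) (const_functor K)" using p by (simp add: nonconstant_primes_def)
  from Sp.iso_const_endomorphism[OF this, of x f "generator p"] show ?thesis
    using x f generator_closed[OF p(1)] l(2)[OF p(1)] by (simp add: matrix_coeff_def)
qed

text \<open>
  By Burnside's theorem on \<open>Sp p\<close>, some linear combination of the operators of \<open>p\<close>-primary
  endomorphisms projects the orbit of \<open>u\<close> under them to the line through \<open>u\<close>.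
\<close>

lemma ex_projection:
  assumes p: "Factorial_Ring.prime p"
  shows "\<exists>b\<in>Ops_at p. \<forall>f\<in>PMor p x x. b (farr S x x (rho p f) u) = matrix_coeff p f \<odot>\<^bsub>Vx\<^esub> u"
proof -
  interpret F: primary_factor A K S x p u s i j r q by (rule factors[OF p])
  interpret Sp: simple_vfunctor "primary_category p A" K "Sp p" by (rule Sp_vfunctor[OF p])
  have Sp_eq: "Sp p = F.factor" "generator p = F.base" by (simp_all add: Sp_def generator_def)
  have "(\<lambda>v. l p v \<odot>\<^bsub>fobj (Sp p) x\<^esub> generator p) \<in> ops (primary_category p A) K (Sp p) x x"
    using Sp.burnside[OF _ _ l(1)[OF p] generator_closed[OF p]] x by simp
  then obtain b where b: "b \<in> Ops_at p" "\<And>v. v \<in> carrier (fobj (Sp p) x) \<Longrightarrow> b (F.P v) = F.P (l p v \<odot>\<^bsub>fobj (Sp p) x\<^esub> generator p)"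
    using F.ops_transfer unfolding Sp_eq by blast
  have "b (farr S x x (rho p f) u) = matrix_coeff p f \<odot>\<^bsub>Vx\<^esub> u" if f: "f \<in> PMor p x x" for f
  proof -
    have "farr S x x (rho p f) u = F.P (farr (Sp p) x x f (generator p))"
      using F.P_gen[OF f] F.arr_base[OF x f] by (simp add: Sp_eq)
    then have "b (farr S x x (rho p f) u) = F.P (matrix_coeff p f \<odot>\<^bsub>fobj (Sp p) x\<^esub> generator p)"
      using b(2)[OF arr_generator_closed[OF p f]] by (simp add: matrix_coeff_def)
    also have "\<dots> = matrix_coeff p f \<odot>\<^bsub>Vx\<^esub> F.P (generator p)"
      using linear_mapD(3)[OF F.P_linear matrix_coeff_closed[OF p f]] F.span_carrier[OF x] generator_closed[OF p] by (simp add: Sp_eq)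
    finally show ?thesis using F.P_base by (simp add: Sp_eq)
  qed
  then show ?thesis using b(1) by blast
qed

text \<open>
  Applying these projections for all \<open>p\<close> in turn strips an endomorphism of its components one by
  one, each time at the cost of a matrix coefficient.
\<close>

lemma ex_strip:
  assumes "finite X'" "\<And>p. p \<in> X' \<Longrightarrow> Factorial_Ring.prime p"
  shows "\<exists>B. linear_map K Vx Vx B \<and> (\<forall>F\<in>Mor A x x. \<forall>F'\<in>Mor A x x. (\<forall>p\<in>X'. pc p x x F' = e p) \<longrightarrow>
      (\<forall>p. Factorial_Ring.prime p \<and> p \<notin> X' \<longrightarrow> pc p x x F' = pc p x x F) \<longrightarrow>
      B (farr S x x F u) = (\<Otimes>\<^bsub>K\<^esub>p\<in>X'. matrix_coeff p (pc p x x F)) \<odot>\<^bsub>Vx\<^esub> farr S x x F' u)"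
  using assms
proof induction
  case empty
  interpret X: vspace K Vx by (rule S.V_vspace[OF x])
  show ?case
  proof (intro exI[of _ "\<lambda>v. v"] conjI ballI impI linear_map_id)
    fix F F' assume F: "F \<in> Mor A x x" "F' \<in> Mor A x x"
      "\<forall>p. Factorial_Ring.prime p \<and> p \<notin> {} \<longrightarrow> pc p x x F' = pc p x x F"
    then have "F' = F" using Mor_eqI[OF x x] by blast
    then show "farr S x x F u = (\<Otimes>\<^bsub>K\<^esub>p\<in>{}. matrix_coeff p (pc p x x F)) \<odot>\<^bsub>Vx\<^esub> farr S x x F' u"
      using linear_mapD(1)[OF S.farr_linear[OF x x F(1)] u(1)] by simp
  qed
next
  case (insert p X')
  interpret X: vspace K Vx by (rule S.V_vspace[OF x])
  have p: "Factorial_Ring.prime p" using insert by auto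
  obtain B where B: "linear_map K Vx Vx B" "\<And>F F'. F \<in> Mor A x x \<Longrightarrow> F' \<in> Mor A x x \<Longrightarrow> (\<forall>p\<in>X'. pc p x x F' = e p) \<Longrightarrow>
      (\<forall>p. Factorial_Ring.prime p \<and> p \<notin> X' \<longrightarrow> pc p x x F' = pc p x x F) \<Longrightarrow>
      B (farr S x x F u) = (\<Otimes>\<^bsub>K\<^esub>p\<in>X'. matrix_coeff p (pc p x x F)) \<odot>\<^bsub>Vx\<^esub> farr S x x F' u"
    using insert by auto
  obtain b where b: "b \<in> Ops_at p" "\<And>f. f \<in> PMor p x x \<Longrightarrow> b (farr S x x (rho p f) u) = matrix_coeff p f \<odot>\<^bsub>Vx\<^esub> u"
    using ex_projection[OF p] by blast
  note bl = Ops_at_linear[OF p b(1)]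
  show ?case
  proof (intro exI[of _ "\<lambda>v. b (B v)"] conjI ballI impI)
    show "linear_map K Vx Vx (\<lambda>v. b (B v))" by (rule linear_map_comp[OF B(1) bl])
    fix F F' assume F: "F \<in> Mor A x x" and F': "F' \<in> Mor A x x" "\<forall>p\<in>insert p X'. pc p x x F' = e p"
      "\<forall>q. Factorial_Ring.prime q \<and> q \<notin> insert p X' \<longrightarrow> pc q x x F' = pc q x x F"
    have f: "pc p x x F \<in> PMor p x x" by (rule pc_mem[OF p x x F])
    define F1 where "F1 = rep p x x F' (pc p x x F)"
    note R = rep_closed[OF p x x F'(1) f] pc_rep[OF p x x F'(1) f] pc_rep_other[OF p x x F'(1) f]
    have F1: "F1 \<in> Mor A x x" unfolding F1_def by (rule R(1))
    have "pc q x x F1 = e q" if q: "q \<in> X'" for q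
    proof -
      have "q \<noteq> p" "Factorial_Ring.prime q" using insert q by auto
      then show ?thesis using R(3)[of q] F'(2) q by (simp add: F1_def)
    qed
    moreover have "pc q x x F1 = pc q x x F" if q: "Factorial_Ring.prime q" "q \<notin> X'" for q
      by (cases "q = p") (use R(2,3) F'(3) q in \<open>auto simp: F1_def\<close>)
    ultimately have 1: "B (farr S x x F u) = (\<Otimes>\<^bsub>K\<^esub>p\<in>X'. matrix_coeff p (pc p x x F)) \<odot>\<^bsub>Vx\<^esub> farr S x x F1 u"
      by (intro B(2)[OF F F1]) auto
    have F1_eq: "F1 = Cmp A x x x F' (rho p (pc p x x F))"
    proof -
      have "F' = rep p x x F' (e p)" using rep_self[OF p x x F'(1)] F'(2) by simp
      then have "Cmp A x x x F' (rho p (pc p x x F)) = Cmp A x x x (rep p x x F' (e p)) (rep p x x (Idn A x) (pc p x x F))"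
        by (simp add: rho_def)
      also have "\<dots> = F1"
        unfolding F1_def using rep_Cmp[OF p x x x Idx f F'(1) e_mem[OF p]] Cmp_Idn_right[OF x x F'(1)] Cmp_e_left[OF p x f] by simp
      finally show ?thesis ..
    qed
    have k: "matrix_coeff p (pc p x x F) \<in> carrier K" by (rule matrix_coeff_closed[OF p f])
    have kX: "(\<Otimes>\<^bsub>K\<^esub>p\<in>X'. matrix_coeff p (pc p x x F)) \<in> carrier K"
      by (rule S.K.finprod_closed) (use insert.prems matrix_coeff_closed pc_mem[OF _ x x F] in auto)
    note L = linear_mapD[OF S.farr_linear[OF x x F'(1)]]
    have "b (farr S x x F1 u) = b (farr S x x F' (farr S x x (rho p (pc p x x F)) u))"
      unfolding F1_eq using S.farr_Cmp[OF x x x rho_closed[OF p f] F'(1) u(1)] by simp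
    also have "\<dots> = farr S x x F' (b (farr S x x (rho p (pc p x x F)) u))"
      by (rule Ops_at_commute_arr[OF p b(1) F'(1)]) (use F'(2) linear_mapD(1)[OF S.farr_linear[OF x x rho_closed[OF p f]] u(1)] in auto)
    also have "\<dots> = matrix_coeff p (pc p x x F) \<odot>\<^bsub>Vx\<^esub> farr S x x F' u"
      using b(2)[OF f] L(3)[OF k u(1)] by simp
    finally have 2: "b (farr S x x F1 u) = matrix_coeff p (pc p x x F) \<odot>\<^bsub>Vx\<^esub> farr S x x F' u" .
    have "b (B (farr S x x F u)) = (\<Otimes>\<^bsub>K\<^esub>p\<in>X'. matrix_coeff p (pc p x x F)) \<odot>\<^bsub>Vx\<^esub> b (farr S x x F1 u)"
      unfolding 1 by (rule linear_mapD(3)[OF bl kX linear_mapD(1)[OF S.farr_linear[OF x x F1] u(1)]])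
    also have "\<dots> = (\<Otimes>\<^bsub>K\<^esub>p\<in>insert p X'. matrix_coeff p (pc p x x F)) \<odot>\<^bsub>Vx\<^esub> farr S x x F' u"
    proof -
      have "(\<Otimes>\<^bsub>K\<^esub>p\<in>insert p X'. matrix_coeff p (pc p x x F)) = matrix_coeff p (pc p x x F) \<otimes>\<^bsub>K\<^esub> (\<Otimes>\<^bsub>K\<^esub>p\<in>X'. matrix_coeff p (pc p x x F))"
        by (rule S.K.finprod_insert) (use insert.hyps insert.prems matrix_coeff_closed pc_mem[OF _ x x F] in auto)
      then show ?thesis unfolding 2 using k kX L(1)[OF u(1)] by (simp add: X.smult_assoc1[symmetric] S.K.m_comm)
    qed
    finally show "b (B (farr S x x F u)) = (\<Otimes>\<^bsub>K\<^esub>p\<in>insert p X'. matrix_coeff p (pc p x x F)) \<odot>\<^bsub>Vx\<^esub> farr S x x F' u" .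
  qed
qed

lemma ex_projection_all:
  "\<exists>B. linear_map K Vx Vx B \<and> (\<forall>F\<in>Mor A x x. B (farr S x x F u) = (\<Otimes>\<^bsub>K\<^esub>p\<in>I. matrix_coeff p (pc p x x F)) \<odot>\<^bsub>Vx\<^esub> u)"
proof -
  interpret xx: finite_comm_group "Hom A x x" by (rule Hom_finite_comm_group[OF x x])
  obtain B where B: "linear_map K Vx Vx B" "\<And>F F'. F \<in> Mor A x x \<Longrightarrow> F' \<in> Mor A x x \<Longrightarrow> (\<forall>p\<in>J. pc p x x F' = e p) \<Longrightarrow>
      (\<forall>p. Factorial_Ring.prime p \<and> p \<notin> J \<longrightarrow> pc p x x F' = pc p x x F) \<Longrightarrow>
      B (farr S x x F u) = (\<Otimes>\<^bsub>K\<^esub>p\<in>J. matrix_coeff p (pc p x x F)) \<odot>\<^bsub>Vx\<^esub> farr S x x F' u"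
    using ex_strip[OF finite_J] by blast
  have "B (farr S x x F u) = (\<Otimes>\<^bsub>K\<^esub>p\<in>I. matrix_coeff p (pc p x x F)) \<odot>\<^bsub>Vx\<^esub> u" if F: "F \<in> Mor A x x" for F
  proof -
    have "pc p x x (Idn A x) = pc p x x F" if "Factorial_Ring.prime p" "\<not> p dvd order (Hom A x x)" for p
      using xx.primary_part_trivial[OF that pc_mem[OF that(1) x x F]] xx.primary_part_trivial[OF that e_mem[OF that(1)]] by simp
    then have "B (farr S x x F u) = (\<Otimes>\<^bsub>K\<^esub>p\<in>J. matrix_coeff p (pc p x x F)) \<odot>\<^bsub>Vx\<^esub> farr S x x (Idn A x) u"
      by (intro B(2)[OF F Idx]) auto
    moreover have "(\<Otimes>\<^bsub>K\<^esub>p\<in>J. matrix_coeff p (pc p x x F)) = (\<Otimes>\<^bsub>K\<^esub>p\<in>I. matrix_coeff p (pc p x x F))"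
      by (rule S.K.finprod_mono_neutral_cong_right[OF finite_J I_subset])
        (use matrix_coeff_const matrix_coeff_closed pc_mem[OF _ x x F] in auto)
    ultimately show ?thesis using S.farr_Idn[OF x u(1)] by simp
  qed
  then show ?thesis using B(1) by blast
qed

text \<open>
  The matrix coefficient of \<open>S\<close> at \<open>u\<close> is the product of those of the factors, i.e. that of the
  tensor product at the pure tensor of the generators.
\<close>

lemma iso: "functor_iso A K S T.T"
proof -
  interpret X: vspace K Vx by (rule S.V_vspace[OF x])
  interpret W: tensor_product K I "T.W x" by (rule T.W_tensor[OF x])
  interpret TF: linear_functor A K T.T by (rule T.T_linear_functor)
  interpret WT: module K W.T by (rule W.tensor_module_module)
  have lI: "\<And>p. p \<in> I \<Longrightarrow> linear_map K (T.W x p) (field_module K) (l p)" using l(1) T.prime_I by blast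
  define t where "t = restrict generator I"
  have tB: "t \<in> W.B" using generator_closed T.prime_I by (auto simp: t_def product_set_def)
  obtain L where L: "linear_map K W.T (field_module K) L" "\<And>b. b \<in> W.B \<Longrightarrow> L (W.pure b) = (\<Otimes>\<^bsub>K\<^esub>i\<in>I. l i (b i))"
    using W.tensor_lift[OF field_module_module[OF S.K.cring_axioms] W.multilinear_functional[OF T.finite_I lI]] by blast
  have Lt: "L (W.pure t) = \<one>\<^bsub>K\<^esub>"
    unfolding L(2)[OF tB] by (rule S.K.finprod_one_eqI) (use l(2) T.prime_I in \<open>auto simp: t_def\<close>)
  have L0: "L \<zero>\<^bsub>W.T\<^esub> = \<zero>\<^bsub>K\<^esub>"
    using linear_map_zero[OF W.tensor_module_module field_module_module[OF S.K.cring_axioms] L(1)] by simp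
  have pn: "W.pure t \<noteq> \<zero>\<^bsub>W.T\<^esub>" using Lt L0 by auto
  have T_simple: "simple_functor A K T.T"
    by (rule T.T_simple[OF x]) (use generator_closed generator_nonzero T.prime_I in blast)
  have SV: "simple_vfunctor A K T.T"
    by (intro simple_vfunctor.intro simple_vfunctor_axioms.intro T.T_linear_functor T_simple S.ac fin)
  obtain B where B: "linear_map K Vx Vx B" "\<And>F. F \<in> Mor A x x \<Longrightarrow> B (farr S x x F u) = (\<Otimes>\<^bsub>K\<^esub>p\<in>I. matrix_coeff p (pc p x x F)) \<odot>\<^bsub>Vx\<^esub> u"
    using ex_projection_all by blast
  note BL = linear_mapD[OF B(1)] and LL = linear_mapD[OF L(1), simplified]
  have B0: "B \<zero>\<^bsub>Vx\<^esub> = \<zero>\<^bsub>Vx\<^esub>" by (rule linear_map_zero[OF X.module_axioms X.module_axioms B(1)])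
  show ?thesis
  proof (rule simple_iso_of_generators[OF S.simple_vfunctor_axioms SV x u(1), where w = "W.pure t" and w' = "W.pure t"
        and Q = "\<lambda>a b. B a = L b \<odot>\<^bsub>Vx\<^esub> u"], unfold T.T_simps(1))
    show "W.pure t \<in> carrier W.T" "W.pure t \<in> carrier W.T" by (rule W.pure_closed[OF tB])+
    show "W.pure t \<noteq> \<zero>\<^bsub>W.T\<^esub>" by (rule pn)
    show "B \<zero>\<^bsub>Vx\<^esub> = L \<zero>\<^bsub>W.T\<^esub> \<odot>\<^bsub>Vx\<^esub> u" using B0 L0 u(1) by simp
    show "\<not> B \<zero>\<^bsub>Vx\<^esub> = L (W.pure t) \<odot>\<^bsub>Vx\<^esub> u" using B0 Lt u by simp
    show "B (a \<oplus>\<^bsub>Vx\<^esub> a') = L (b \<oplus>\<^bsub>W.T\<^esub> b') \<odot>\<^bsub>Vx\<^esub> u"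
      if "a \<in> carrier Vx" "b \<in> carrier W.T" "a' \<in> carrier Vx" "b' \<in> carrier W.T" "B a = L b \<odot>\<^bsub>Vx\<^esub> u" "B a' = L b' \<odot>\<^bsub>Vx\<^esub> u" for a b a' b'
      using BL(2)[OF that(1,3)] LL(2)[OF that(2,4)] LL(1)[OF that(2)] LL(1)[OF that(4)] that(5,6) u(1) by (simp add: X.smult_l_distr)
    show "B (c \<odot>\<^bsub>Vx\<^esub> a) = L (c \<odot>\<^bsub>W.T\<^esub> b) \<odot>\<^bsub>Vx\<^esub> u"
      if "c \<in> carrier K" "a \<in> carrier Vx" "b \<in> carrier W.T" "B a = L b \<odot>\<^bsub>Vx\<^esub> u" for c a b
      using BL(3)[OF that(1,2)] LL(3)[OF that(1,3)] LL(1)[OF that(3)] that u(1) by (simp add: X.smult_assoc1)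
    fix F assume F: "F \<in> Mor A x x"
    let ?b = "tensor_arg I (\<lambda>p. farr (Sp p) x x (pc p x x F)) t"
    have b: "?b \<in> W.B" by (rule tensor_map(3)[OF W.tensor_product_axioms W.tensor_product_axioms T.arr_linear[OF _ x x F] tB])
    have "L (farr T.T x x F (W.pure t)) = (\<Otimes>\<^bsub>K\<^esub>p\<in>I. l p (?b p))"
      unfolding T.arr_pure[OF x x F tB] by (rule L(2)[OF b])
    also have "\<dots> = (\<Otimes>\<^bsub>K\<^esub>p\<in>I. matrix_coeff p (pc p x x F))"
      by (rule S.K.finprod_cong') (use matrix_coeff_closed T.prime_I pc_mem[OF _ x x F] in \<open>auto simp: tensor_arg_def t_def matrix_coeff_def\<close>)
    finally show "B (farr S x x F u) = L (farr T.T x x F (W.pure t)) \<odot>\<^bsub>Vx\<^esub> u" using B(2)[OF F] by simp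
  qed
qed

lemma decomposition: "primary_tensor_decomposition A K S Sp"
  unfolding primary_tensor_decomposition_def prime_tensor_def using Sp_simple T.finite_I iso by blast

end

theorem proposition6:
  fixes A :: "('o, 'm) preadditive_data"
    and K :: "'k ring"
    and S :: "('o, 'm, 'k, 'v) vect_functor_data"
  assumes "additive_category A"
    and "algebraically_closed K"
    and "vect_functor A K S"
    and "\<And>x y. x \<in> Ob A \<Longrightarrow> y \<in> Ob A \<Longrightarrow> finite (Mor A x y)"
  shows "(simple_functor A K S \<longleftrightarrow>
            (\<exists>Sp :: nat \<Rightarrow> ('o, 'm, 'k, 'v) vect_functor_data.
               primary_tensor_decomposition A K S Sp)) \<and>
         (\<forall>(Sp :: nat \<Rightarrow> ('o, 'm, 'k, 'v) vect_functor_data)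
            (Sp' :: nat \<Rightarrow> ('o, 'm, 'k, 'v) vect_functor_data).
            primary_tensor_decomposition A K S Sp \<and> primary_tensor_decomposition A K S Sp' \<longrightarrow>
            (\<forall>p. Factorial_Ring.prime p \<longrightarrow>
               functor_iso (primary_category p A) K (Sp p) (Sp' p)))"
proof -
  interpret additive_category A by fact
  interpret K: algebraically_closed K by fact
  have FP: "finite_preadditive A"
    by (intro finite_preadditive.intro finite_preadditive_axioms.intro preadditive_category_axioms assms(4))
  have LS: "linear_functor A K S" by (intro linear_functor.intro preadditive_category_axioms assms(3) K.field_axioms)
  have PT: "primary_tensor A K (nonconstant_primes A K Sp) Sp" if "primary_tensor_decomposition A K S Sp"
    for Sp :: "nat \<Rightarrow> ('o, 'm, 'k, 'v) vect_functor_data"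
    using that
    by (intro primary_tensor.intro primary_tensor_axioms.intro FP K.algebraically_closed_axioms)
      (auto simp: primary_tensor_decomposition_def nonconstant_primes_def)
  have simple: "simple_functor A K S" if D: "primary_tensor_decomposition A K S Sp"
    for Sp :: "nat \<Rightarrow> ('o, 'm, 'k, 'v) vect_functor_data"
  proof -
    interpret T: primary_tensor A K "nonconstant_primes A K Sp" Sp by (rule PT[OF D])
    obtain x where x: "x \<in> Ob A" "\<And>p. p \<in> nonconstant_primes A K Sp \<Longrightarrow> \<exists>v\<in>carrier (T.W x p). v \<noteq> \<zero>\<^bsub>T.W x p\<^esub>"
      using T.ex_common_support[OF assms(1)] by blast
    have "functor_iso A K S T.T" using D unfolding primary_tensor_decomposition_def prime_tensor_def by blast
    then show ?thesis
      by (rule simple_functor_iso[OF assms(3) K.field_axioms preadditive_category_axioms _ T.T_simple[OF x]])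
  qed
  have exists: "\<exists>Sp :: nat \<Rightarrow> ('o, 'm, 'k, 'v) vect_functor_data. primary_tensor_decomposition A K S Sp" if simp: "simple_functor A K S"
  proof -
    interpret S: simple_vfunctor A K S
      by (intro simple_vfunctor.intro simple_vfunctor_axioms.intro LS simp assms(2,4))
    obtain x where x: "x \<in> Ob A" "\<exists>v\<in>carrier (fobj S x). v \<noteq> \<zero>\<^bsub>fobj S x\<^esub>" using S.nonzero by blast
    interpret X: simple_at_object A K S x
      by (intro simple_at_object.intro simple_at_object_axioms.intro FP S.simple_vfunctor_axioms x(1))
    obtain u where u: "u \<in> carrier (fobj S x)" "u \<noteq> \<zero>\<^bsub>fobj S x\<^esub>"
      "\<And>p. Factorial_Ring.prime p \<Longrightarrow> irreducible_at (X.EC p) K (X.LF p) x u" using X.ex_irreducible_vector[OF x(2)] by blast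
    have "\<forall>y\<in>Ob A. \<exists>s i j r q. is_biproduct A y x s i j r q" using ex_biproduct[OF _ x(1)] by blast
    then obtain s i j r q where b: "\<And>y. y \<in> Ob A \<Longrightarrow> is_biproduct A y x (s y) (i y) (j y) (r y) (q y)" by metis
    interpret D: all_factors A K S x u s i j r q
      by (intro all_factors.intro all_factors_axioms.intro primary_factor.intro primary_factor_axioms.intro X.simple_at_object_axioms u)
        (use b in \<open>auto simp: is_biproduct_def\<close>)
    show ?thesis using D.decomposition by blast
  qed
  have unique: "functor_iso (primary_category p A) K (Sp p) (Sp' p)"
    if D: "primary_tensor_decomposition A K S Sp" and D': "primary_tensor_decomposition A K S Sp'" and p: "Factorial_Ring.prime p"
    for Sp Sp' :: "nat \<Rightarrow> ('o, 'm, 'k, 'v) vect_functor_data" and p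
  proof -
    let ?I = "nonconstant_primes A K Sp" and ?I' = "nonconstant_primes A K Sp'"
    obtain x v where x: "x \<in> Ob A" "v \<in> carrier (fobj S x)" "v \<noteq> \<zero>\<^bsub>fobj S x\<^esub>"
    proof -
      interpret S: simple_vfunctor A K S
        by (intro simple_vfunctor.intro simple_vfunctor_axioms.intro LS simple[OF D] assms(2,4))
      show ?thesis using S.nonzero that by blast
    qed
    have iso: "functor_iso A K S (tensor_functor K ?I (\<lambda>p. precompose (primary_projection p A) (Sp p)))"
      "functor_iso A K S (tensor_functor K ?I' (\<lambda>p. precompose (primary_projection p A) (Sp' p)))"
      using D D' unfolding primary_tensor_decomposition_def prime_tensor_def by blast+
    have "?I \<subseteq> ?I'"
      by (rule nonconstant_subset[OF PT[OF D] PT[OF D'] _ LS x iso]) (simp add: nonconstant_primes_def)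
    moreover have "?I' \<subseteq> ?I"
      by (rule nonconstant_subset[OF PT[OF D'] PT[OF D] _ LS x iso(2,1)]) (simp add: nonconstant_primes_def)
    ultimately have eq: "?I' = ?I" by blast
    show ?thesis
    proof (cases "p \<in> ?I")
      case True
      have P': "primary_tensor A K ?I Sp'" using PT[OF D'] unfolding eq .
      show ?thesis by (rule factor_iso[OF PT[OF D] P' LS x iso(1) _ True]) (use iso(2) in \<open>simp only: eq\<close>)
    next
      case False
      then have c: "functor_iso (primary_category p A) K (Sp p) (const_functor K)"
        "functor_iso (primary_category p A) K (Sp' p) (const_functor K)"
        using p eq by (auto simp: nonconstant_primes_def)
      have "vect_functor (primary_category p A) K (Sp' p)"
        using D' p unfolding primary_tensor_decomposition_def simple_functor_def by blast
      then show ?thesis by (rule functor_iso_trans[OF c(1) functor_iso_sym[OF c(2)]])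
    qed
  qed
  show ?thesis using simple exists unique by blast
qed

end
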